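(* Let $F$ be an $A$-algebra, $n$ a positive integer, and $x=(x_1,\dots,x_n)$ a sequence of elements of $F$. Let $\mathcal E=\bigoplus_{i=1}^nR(x)[x_i]$ be the free $R(x)$-module of rank $n$ with basis $[x_1],\dots,[x_n]$, and for $y\in F$ let $$[y]=\sum_{i=1}^n\frac{\delta(x,x^i_y)}{\delta(x,x)}[x_i]\in\mathcal E .$$ Then the $R(x)$-bilinear map $\mathcal E\times\mathcal E\to\mathcal E$ determined by $[x_i][x_j]:=[x_ix_j]$ for $i,j\in\{1,\dots,n\}$ defines a (commutative) $R(x)$-algebra structure on $\mathcal E$, and the $R(x)$-linear map $F\otimes_AR(x)\to\mathcal E$ induced by $y\mapsto[y]$ is a surjective $R(x)$-algebra homomorphism.
   Context: All rings are commutative with unit. Divided powers. For a ring $A$ and an $A$-module $M$, $\Gamma_AM=\bigoplus_{m\ge 0}\Gamma^m_AM$ is the divided power algebra: the $A$-algebra generated by symbols $\gamma^m(x)$ ($m\ge 0$, $x\in M$, degree $m$) subject to $\gamma^0(x)=1$, $\gamma^m(\lambda x)=\lambda^m\gamma^m(x)$ for $\lambda\in A$, $\gamma^m(x+y)=\sum_{j=0}^m\gamma^j(x)\gamma^{m-j}(y)$, $\gamma^m(x)\gamma^l(x)=\binom{m+l}{m}\gamma^{m+l}(x)$. Its product is written $*$. One has $\Gamma^n_A(M)\otimes_AB=\Gamma^n_B(M\otimes_AB)$ for every $A$-algebra $B$. If $F$ is an $A$-algebra, each $\Gamma^n_AF$ has a second product making it an $A$-algebra, characterised by $\gamma^n(x)\gamma^n(y)=\gamma^n(xy)$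 after every base change $A\to B$. For $x=(x_1,\dots,x_n)$, $y=(y_1,\dots,y_n)$ in $F$ put $\delta(x,y)=\sum_{\sigma\in\mathfrak S_n}(-1)^{|\sigma|}\gamma^1(x_1y_{\sigma(1)})*\cdots*\gamma^1(x_ny_{\sigma(n)})\in\Gamma^n_AF$. The ideal of norms $I_F\subseteq\Gamma^n_AF$ is the ideal generated by all $\delta(x,y)$ with all $x_i,y_i\in F$. $R=\bigoplus_{m\ge0}I_F^m$ is the Rees algebra, and $R(x)=R_{(\delta(x,x))}$ is the degree-zero part of the localization of $R$ at $\delta(x,x)\in I_F$ regarded as an element of degree $1$. For $y\in F$ and $1\le i\le n$, $x^i_y$ is the sequence $x_1,\dots,x_{i-1},y,x_{i+1},\dots,x_n$. The fractions $\delta(x,x^i_y)/\delta(x,x)$ (numerator of degree $1$) are elements of $R(x)$; for $y=x_i$ the element $[y]$ is the basis element $[x_i]$, and $y\mapsto[y]$ is $A$-linear. *)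

theory Defs
  imports "HOL-Combinatorics.Permutations" "HOL-Library.Multiset" "HOL-Algebra.Algebra"
begin

(* All rings are HOL-Algebra structures with explicit carriers, because "cring", unlike the class
   comm_ring_1, admits the zero ring: R(x) below may well be zero.  An A-algebra F is a record
   with "algebra A F". *)

section \<open>Algebraic constructions\<close>

definition supp :: "('r, 'x) ring_scheme \<Rightarrow> ('m \<Rightarrow> 'r) \<Rightarrow> 'm set"
  where "supp R f = {m. f m \<noteq> \<zero>\<^bsub>R\<^esub>}"

definition single :: "('r, 'x) ring_scheme \<Rightarrow> 'm \<Rightarrow> 'r \<Rightarrow> 'm \<Rightarrow> 'r"
  where "single R m c = (\<lambda>k. if k = m then c else \<zero>\<^bsub>R\<^esub>)"

text \<open>The monoid ring \<open>R[M]\<close>: finitely supported functions with convolution.\<close>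

definition monoid_ring :: "('r, 'x) ring_scheme \<Rightarrow> ('m, 'y) monoid_scheme \<Rightarrow> ('m \<Rightarrow> 'r) ring"
  where "monoid_ring R M =
    \<lparr>carrier = {f. range f \<subseteq> carrier R \<and> finite (supp R f) \<and> supp R f \<subseteq> carrier M},
     monoid.mult = (\<lambda>f g m. finsum R (\<lambda>(a, b). f a \<otimes>\<^bsub>R\<^esub> g b)
               {(a, b). a \<in> supp R f \<and> b \<in> supp R g \<and> a \<otimes>\<^bsub>M\<^esub> b = m}),
     one = single R \<one>\<^bsub>M\<^esub> \<one>\<^bsub>R\<^esub>,
     ring.zero = (\<lambda>m. \<zero>\<^bsub>R\<^esub>),
     add = (\<lambda>f g m. f m \<oplus>\<^bsub>R\<^esub> g m)\<rparr>"

text \<open>The free commutative monoid on \<open>S\<close>; its monoid ring is the polynomial ring \<open>R[S]\<close>,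
  a monomial being a finite multiset of variables.\<close>

definition free_comm_monoid :: "'s set \<Rightarrow> 's multiset monoid"
  where "free_comm_monoid S =
    \<lparr>carrier = {w. set_mset w \<subseteq> S}, monoid.mult = (\<lambda>w w'. w + w'), one = {#}\<rparr>"

text \<open>A ring \<open>S\<close> viewed as an algebra through a ring homomorphism \<open>\<phi>\<close> into it.\<close>

definition algebra_via :: "('b, 'x) ring_scheme \<Rightarrow> ('a \<Rightarrow> 'b) \<Rightarrow> ('a, 'b) module"
  where "algebra_via S \<phi> =
    \<lparr>carrier = carrier S, monoid.mult = monoid.mult S, one = one S, ring.zero = ring.zero S, add = add S,
     smult = (\<lambda>a s. \<phi> a \<otimes>\<^bsub>S\<^esub> s)\<rparr>"

definition linear_maps ::
  "('a, 'x) ring_scheme \<Rightarrow> ('a, 'm, 'y) module_scheme \<Rightarrow> ('a, 'p, 'z) module_scheme \<Rightarrow> ('m \<Rightarrow> 'p) set"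
  where "linear_maps R M N = {h. h \<in> carrier M \<rightarrow> carrier N
      \<and> (\<forall>u\<in>carrier M. \<forall>v\<in>carrier M. h (u \<oplus>\<^bsub>M\<^esub> v) = h u \<oplus>\<^bsub>N\<^esub> h v)
      \<and> (\<forall>a\<in>carrier R. \<forall>u\<in>carrier M. h (a \<odot>\<^bsub>M\<^esub> u) = a \<odot>\<^bsub>N\<^esub> h u)}"


subsection \<open>Tensor product of algebras\<close>

text \<open>\<open>F \<otimes>\<^sub>A C\<close> is the free abelian group on the pairs \<open>(y, c)\<close> modulo the bilinearity
  relations.  The free abelian group is the monoid ring over the integers of the
  multiplicative monoid \<open>F \<times> C\<close>, so that \<open>(y \<otimes> c)(y' \<otimes> c') = yy' \<otimes> cc'\<close>; the set of
  relations is stable under multiplication by pairs, hence the ideal it generates is just the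
  subgroup it generates.\<close>

type_synonym ('f, 'c) tens = "('f \<times> 'c \<Rightarrow> int) set"

definition pair_ring ::
  "('a, 'f, 'y) module_scheme \<Rightarrow> ('a, 'c, 'z) module_scheme \<Rightarrow> ('f \<times> 'c \<Rightarrow> int) ring"
  where "pair_ring F C = monoid_ring \<Z> (F \<times>\<times> C)"

definition tensor_ideal ::
  "('a, 'x) ring_scheme \<Rightarrow> ('a, 'f, 'y) module_scheme \<Rightarrow> ('a, 'c, 'z) module_scheme
    \<Rightarrow> ('f \<times> 'c \<Rightarrow> int) set"
  where "tensor_ideal A F C = (let P = pair_ring F C; s = (\<lambda>y c. single \<Z> (y, c) 1) in
    genideal P
     ({s (y \<oplus>\<^bsub>F\<^esub> y') c \<ominus>\<^bsub>P\<^esub> (s y c \<oplus>\<^bsub>P\<^esub> s y' c) | y y' c.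
         y \<in> carrier F \<and> y' \<in> carrier F \<and> c \<in> carrier C}
      \<union> {s y (c \<oplus>\<^bsub>C\<^esub> c') \<ominus>\<^bsub>P\<^esub> (s y c \<oplus>\<^bsub>P\<^esub> s y c') | y c c'.
         y \<in> carrier F \<and> c \<in> carrier C \<and> c' \<in> carrier C}
      \<union> {s (a \<odot>\<^bsub>F\<^esub> y) c \<ominus>\<^bsub>P\<^esub> s y (a \<odot>\<^bsub>C\<^esub> c) | a y c.
         a \<in> carrier A \<and> y \<in> carrier F \<and> c \<in> carrier C}))"

definition tensor ::
  "('a, 'x) ring_scheme \<Rightarrow> ('a, 'f, 'y) module_scheme \<Rightarrow> ('a, 'c, 'z) module_scheme
    \<Rightarrow> 'f \<Rightarrow> 'c \<Rightarrow> ('f, 'c) tens"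
  where "tensor A F C y c = tensor_ideal A F C +>\<^bsub>pair_ring F C\<^esub> single \<Z> (y, c) 1"

text \<open>\<open>F \<otimes>\<^sub>A C\<close> as a \<open>C\<close>-algebra.\<close>

definition tensor_algebra ::
  "('a, 'x) ring_scheme \<Rightarrow> ('a, 'f, 'y) module_scheme \<Rightarrow> ('a, 'c, 'z) module_scheme
    \<Rightarrow> ('c, ('f, 'c) tens) module"
  where "tensor_algebra A F C =
    algebra_via (pair_ring F C Quot tensor_ideal A F C) (tensor A F C \<one>\<^bsub>F\<^esub>)"


subsection \<open>Localization\<close>

definition loc_rel :: "('r, 'x) ring_scheme \<Rightarrow> 'r set \<Rightarrow> (('r \<times> 'r) \<times> ('r \<times> 'r)) set"
  where "loc_rel R S = {((r, s), (r', s')). r \<in> carrier R \<and> s \<in> S \<and> r' \<in> carrier R \<and> s' \<in> S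
      \<and> (\<exists>u\<in>S. u \<otimes>\<^bsub>R\<^esub> (r \<otimes>\<^bsub>R\<^esub> s') = u \<otimes>\<^bsub>R\<^esub> (r' \<otimes>\<^bsub>R\<^esub> s))}"

definition loc_frac :: "('r, 'x) ring_scheme \<Rightarrow> 'r set \<Rightarrow> 'r \<Rightarrow> 'r \<Rightarrow> ('r \<times> 'r) set"
  where "loc_frac R S r s = loc_rel R S `` {(r, s)}"

definition localization :: "('r, 'x) ring_scheme \<Rightarrow> 'r set \<Rightarrow> ('r \<times> 'r) set ring"
  where "localization R S =
    \<lparr>carrier = (carrier R \<times> S) // loc_rel R S,
     monoid.mult = (\<lambda>U V. \<Union>(r, s)\<in>U. \<Union>(r', s')\<in>V. loc_frac R S (r \<otimes>\<^bsub>R\<^esub> r') (s \<otimes>\<^bsub>R\<^esub> s')),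
     one = loc_frac R S \<one>\<^bsub>R\<^esub> \<one>\<^bsub>R\<^esub>,
     ring.zero = loc_frac R S \<zero>\<^bsub>R\<^esub> \<one>\<^bsub>R\<^esub>,
     add = (\<lambda>U V. \<Union>(r, s)\<in>U. \<Union>(r', s')\<in>V.
              loc_frac R S (r \<otimes>\<^bsub>R\<^esub> s' \<oplus>\<^bsub>R\<^esub> r' \<otimes>\<^bsub>R\<^esub> s) (s \<otimes>\<^bsub>R\<^esub> s'))\<rparr>"


subsection \<open>Rees algebra\<close>

primrec ideal_pow :: "('r, 'x) ring_scheme \<Rightarrow> 'r set \<Rightarrow> nat \<Rightarrow> 'r set"
  where
    "ideal_pow R I 0 = carrier R"
  | "ideal_pow R I (Suc m) = ideal_prod R I (ideal_pow R I m)"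

text \<open>\<open>\<Oplus>\<^sub>m I\<^sup>m\<close>, realised as the subring of the polynomials over \<open>R\<close> whose \<open>m\<close>-th
  coefficient lies in \<open>I\<^sup>m\<close>.\<close>

definition rees_algebra :: "('r, 'x) ring_scheme \<Rightarrow> 'r set \<Rightarrow> ('r, nat \<Rightarrow> 'r) up_ring"
  where "rees_algebra R I = (UP R)\<lparr>carrier :=
    {p \<in> carrier (UP R). \<forall>m. coeff (UP R) p m \<in> ideal_pow R I m}\<rparr>"

text \<open>The element \<open>c \<in> I\<^sup>m\<close> placed in degree \<open>m\<close>.\<close>

definition in_deg :: "('r, 'x) ring_scheme \<Rightarrow> nat \<Rightarrow> 'r \<Rightarrow> nat \<Rightarrow> 'r"
  where "in_deg R m c = up_ring.monom (UP R) c m"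


section \<open>Divided powers\<close>

text \<open>The variable \<open>(m, x)\<close> stands for the symbol \<open>\<gamma>\<^sup>m(x)\<close>.\<close>

type_synonym ('a, 'm) dpoly = "(nat \<times> 'm) multiset \<Rightarrow> 'a"
type_synonym ('a, 'm) dpow = "('a, 'm) dpoly set"

definition dp_poly ::
  "('a, 'x) ring_scheme \<Rightarrow> ('a, 'm, 'y) module_scheme \<Rightarrow> ('a, 'm) dpoly ring"
  where "dp_poly A M = monoid_ring A (free_comm_monoid (UNIV \<times> carrier M))"

definition dp_var :: "('a, 'x) ring_scheme \<Rightarrow> nat \<Rightarrow> 'm \<Rightarrow> ('a, 'm) dpoly"
  where "dp_var A m x = single A {#(m, x)#} \<one>\<^bsub>A\<^esub>"

definition dp_const :: "('a, 'x) ring_scheme \<Rightarrow> 'a \<Rightarrow> ('a, 'm) dpoly"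
  where "dp_const A a = single A {#} a"

definition dp_ideal ::
  "('a, 'x) ring_scheme \<Rightarrow> ('a, 'm, 'y) module_scheme \<Rightarrow> ('a, 'm) dpoly set"
  where "dp_ideal A M = (let P = dp_poly A M; g = dp_var A in
    genideal P
     ({g 0 x \<ominus>\<^bsub>P\<^esub> \<one>\<^bsub>P\<^esub> | x. x \<in> carrier M}
      \<union> {g m (c \<odot>\<^bsub>M\<^esub> x) \<ominus>\<^bsub>P\<^esub> dp_const A (c [^]\<^bsub>A\<^esub> m) \<otimes>\<^bsub>P\<^esub> g m x | m c x.
          c \<in> carrier A \<and> x \<in> carrier M}
      \<union> {g m (x \<oplus>\<^bsub>M\<^esub> y) \<ominus>\<^bsub>P\<^esub> (\<Oplus>\<^bsub>P\<^esub>j\<in>{0..m}. g j x \<otimes>\<^bsub>P\<^esub> g (m - j) y) | m x y.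
          x \<in> carrier M \<and> y \<in> carrier M}
      \<union> {g m x \<otimes>\<^bsub>P\<^esub> g l x \<ominus>\<^bsub>P\<^esub> add_pow P ((m + l) choose m) (g (m + l) x) | m l x.
          x \<in> carrier M}))"

text \<open>\<open>\<Gamma>\<^sub>A M\<close> as an \<open>A\<close>-algebra; its multiplication is the product written \<open>*\<close>.\<close>

definition dp_algebra ::
  "('a, 'x) ring_scheme \<Rightarrow> ('a, 'm, 'y) module_scheme \<Rightarrow> ('a, ('a, 'm) dpow) module"
  where "dp_algebra A M = algebra_via (dp_poly A M Quot dp_ideal A M)
    (\<lambda>a. dp_ideal A M +>\<^bsub>dp_poly A M\<^esub> dp_const A a)"

definition gam ::
  "('a, 'x) ring_scheme \<Rightarrow> ('a, 'm, 'y) module_scheme \<Rightarrow> nat \<Rightarrow> 'm \<Rightarrow> ('a, 'm) dpow"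
  where "gam A M m x = dp_ideal A M +>\<^bsub>dp_poly A M\<^esub> dp_var A m x"

text \<open>The homogeneous part \<open>\<Gamma>\<^sup>n\<^sub>A M\<close>: classes of polynomials all of whose monomials
  \<open>\<gamma>\<^bsup>m\<^esup>(x) * \<gamma>\<^bsup>l\<^esup>(y) * \<dots>\<close> satisfy \<open>m + l + \<dots> = n\<close>.\<close>

definition dp_part ::
  "('a, 'x) ring_scheme \<Rightarrow> ('a, 'm, 'y) module_scheme \<Rightarrow> nat \<Rightarrow> ('a, 'm) dpow set"
  where "dp_part A M n = {dp_ideal A M +>\<^bsub>dp_poly A M\<^esub> p | p.
    p \<in> carrier (dp_poly A M) \<and> (\<forall>w\<in>supp A p. sum_mset (image_mset fst w) = n)}"


subsection \<open>The second product\<close>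

text \<open>\<open>\<Gamma>\<^sup>n\<^sub>A F\<close> with a candidate \<open>\<mu>\<close> for the second product.\<close>

definition dp_part_with ::
  "('a, 'x) ring_scheme \<Rightarrow> ('a, 'f, 'y) module_scheme \<Rightarrow> nat
    \<Rightarrow> (('a, 'f) dpow \<Rightarrow> ('a, 'f) dpow \<Rightarrow> ('a, 'f) dpow) \<Rightarrow> ('a, ('a, 'f) dpow) module"
  where "dp_part_with A F n \<mu> = (dp_algebra A F)
    \<lparr>carrier := dp_part A F n, monoid.mult := \<mu>, one := gam A F n \<one>\<^bsub>F\<^esub>\<rparr>"

text \<open>The canonical map \<open>\<Gamma>\<^sub>A F \<rightarrow> \<Gamma>\<^sub>B(F \<otimes>\<^sub>A B)\<close>, inducing
  \<open>\<Gamma>\<^sup>n\<^sub>A F \<otimes>\<^sub>A B = \<Gamma>\<^sup>n\<^sub>B(F \<otimes>\<^sub>A B)\<close>; these conditions determine it on the carrier.\<close>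

definition is_base_change_map ::
  "('a, 'x) ring_scheme \<Rightarrow> ('a, 'f, 'y) module_scheme \<Rightarrow> ('a, 'b, 'z) module_scheme
    \<Rightarrow> (('a, 'f) dpow \<Rightarrow> ('b, ('f, 'b) tens) dpow) \<Rightarrow> bool"
  where "is_base_change_map A F B \<kappa> \<longleftrightarrow>
    (let FB = tensor_algebra A F B; G = dp_algebra A F; GB = dp_algebra B FB in
      \<kappa> \<in> ring_hom G GB
      \<and> (\<forall>a\<in>carrier A. \<forall>u\<in>carrier G. \<kappa> (a \<odot>\<^bsub>G\<^esub> u) = (a \<odot>\<^bsub>B\<^esub> \<one>\<^bsub>B\<^esub>) \<odot>\<^bsub>GB\<^esub> \<kappa> u)
      \<and> (\<forall>m. \<forall>y\<in>carrier F. \<kappa> (gam A F m y) = gam B FB m (tensor A F B y \<one>\<^bsub>B\<^esub>)))"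

text \<open>\<open>\<mu>\<close> makes \<open>\<Gamma>\<^sup>n\<^sub>A F\<close> an \<open>A\<close>-algebra, and for every \<open>A\<close>-algebra \<open>B\<close> the \<open>B\<close>-algebra
  structure \<open>\<nu>\<close> that it induces on \<open>\<Gamma>\<^sup>n\<^sub>A F \<otimes>\<^sub>A B = \<Gamma>\<^sup>n\<^sub>B(F \<otimes>\<^sub>A B)\<close> satisfies
  \<open>\<gamma>\<^sup>n(x)\<gamma>\<^sup>n(y) = \<gamma>\<^sup>n(xy)\<close>.

  A quantified variable has a fixed type, so \<open>B\<close> ranges over the algebras carried by subsets
  of one type, namely that of the polynomials over \<open>A\<close> in countably many variables.
  Every countably generated \<open>A\<close>-algebra has an isomorphic copy there, being no larger than
  this polynomial ring.  This is no restriction: two elements of \<open>F \<otimes>\<^sub>A B\<close> come from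
  \<open>F \<otimes>\<^sub>A B'\<close> for a finitely generated subalgebra \<open>B'\<close> of \<open>B\<close>.\<close>

definition is_second_product ::
  "('a, 'x) ring_scheme \<Rightarrow> ('a, 'f, 'y) module_scheme \<Rightarrow> nat
    \<Rightarrow> (('a, 'f) dpow \<Rightarrow> ('a, 'f) dpow \<Rightarrow> ('a, 'f) dpow) \<Rightarrow> bool"
  where "is_second_product A F n \<mu> \<longleftrightarrow>
    algebra A (dp_part_with A F n \<mu>)
    \<and> (\<forall>B :: ('a, nat multiset \<Rightarrow> 'a) module. algebra A B \<longrightarrow>
        (let FB = tensor_algebra A F B in
          \<exists>\<kappa> \<nu>. is_base_change_map A F B \<kappa>
            \<and> algebra B (dp_part_with B FB n \<nu>)
            \<and> (\<forall>u\<in>dp_part A F n. \<forall>v\<in>dp_part A F n. \<nu> (\<kappa> u) (\<kappa> v) = \<kappa> (\<mu> u v))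
            \<and> (\<forall>x\<in>carrier FB. \<forall>y\<in>carrier FB.
                 \<nu> (gam B FB n x) (gam B FB n y) = gam B FB n (x \<otimes>\<^bsub>FB\<^esub> y))))"

text \<open>The choice is immaterial on \<open>\<Gamma>\<^sup>n\<^sub>A F\<close>, where the second product is unique.\<close>

definition dp_n ::
  "('a, 'x) ring_scheme \<Rightarrow> ('a, 'f, 'y) module_scheme \<Rightarrow> nat \<Rightarrow> ('a, ('a, 'f) dpow) module"
  where "dp_n A F n = dp_part_with A F n (SOME \<mu>. is_second_product A F n \<mu>)"


section \<open>The ideal of norms and the ring \<open>R(x)\<close>\<close>

text \<open>Sequences \<open>x\<^sub>1, \<dots>, x\<^sub>n\<close> are functions on \<open>nat\<close> of which only the values on \<open>{1..n}\<close>
  are used; \<open>x\<^sup>i\<^sub>y\<close> is \<open>x(i := y)\<close>.\<close>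

definition norm_delta ::
  "('a, 'x) ring_scheme \<Rightarrow> ('a, 'f, 'y) module_scheme \<Rightarrow> nat \<Rightarrow> (nat \<Rightarrow> 'f) \<Rightarrow> (nat \<Rightarrow> 'f)
    \<Rightarrow> ('a, 'f) dpow"
  where "norm_delta A F n x y = (let G = dp_algebra A F in
    \<Oplus>\<^bsub>G\<^esub>\<sigma>\<in>{\<sigma>. \<sigma> permutes {1..n}}.
      add_pow G (sign \<sigma>) (\<Otimes>\<^bsub>G\<^esub>i\<in>{1..n}. gam A F 1 (x i \<otimes>\<^bsub>F\<^esub> y (\<sigma> i))))"

definition norm_ideal ::
  "('a, 'x) ring_scheme \<Rightarrow> ('a, 'f, 'y) module_scheme \<Rightarrow> nat \<Rightarrow> ('a, 'f) dpow set"
  where "norm_ideal A F n = genideal (dp_n A F n)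
    {norm_delta A F n x y | x y. x \<in> {1..n} \<rightarrow> carrier F \<and> y \<in> {1..n} \<rightarrow> carrier F}"

definition norm_rees ::
  "('a, 'x) ring_scheme \<Rightarrow> ('a, 'f, 'y) module_scheme \<Rightarrow> nat
    \<Rightarrow> (('a, 'f) dpow, nat \<Rightarrow> ('a, 'f) dpow) up_ring"
  where "norm_rees A F n = rees_algebra (dp_n A F n) (norm_ideal A F n)"

type_synonym ('a, 'f) rx = "((nat \<Rightarrow> ('a, 'f) dpow) \<times> (nat \<Rightarrow> ('a, 'f) dpow)) set"

text \<open>\<open>\<delta>(x, y)\<close> as an element of degree 1 of the Rees algebra.\<close>

definition delta1 ::
  "('a, 'x) ring_scheme \<Rightarrow> ('a, 'f, 'y) module_scheme \<Rightarrow> nat \<Rightarrow> (nat \<Rightarrow> 'f) \<Rightarrow> (nat \<Rightarrow> 'f)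
    \<Rightarrow> nat \<Rightarrow> ('a, 'f) dpow"
  where "delta1 A F n x y = in_deg (dp_n A F n) 1 (norm_delta A F n x y)"

definition delta_powers ::
  "('a, 'x) ring_scheme \<Rightarrow> ('a, 'f, 'y) module_scheme \<Rightarrow> nat \<Rightarrow> (nat \<Rightarrow> 'f)
    \<Rightarrow> (nat \<Rightarrow> ('a, 'f) dpow) set"
  where "delta_powers A F n x = {delta1 A F n x x [^]\<^bsub>norm_rees A F n\<^esub> k | k :: nat. True}"

definition rx_frac ::
  "('a, 'x) ring_scheme \<Rightarrow> ('a, 'f, 'y) module_scheme \<Rightarrow> nat \<Rightarrow> (nat \<Rightarrow> 'f)
    \<Rightarrow> (nat \<Rightarrow> ('a, 'f) dpow) \<Rightarrow> (nat \<Rightarrow> ('a, 'f) dpow) \<Rightarrow> ('a, 'f) rx"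
  where "rx_frac A F n x = loc_frac (norm_rees A F n) (delta_powers A F n x)"

text \<open>\<open>R(x)\<close> is the subring of the localization consisting of the \<open>c / \<delta>(x, x)\<^sup>k\<close> with \<open>c\<close> of
  degree \<open>k\<close>; it is an \<open>A\<close>-algebra through \<open>A \<rightarrow> \<Gamma>\<^sup>n\<^sub>A F = R\<^sub>0\<close>.\<close>

definition rx ::
  "('a, 'x) ring_scheme \<Rightarrow> ('a, 'f, 'y) module_scheme \<Rightarrow> nat \<Rightarrow> (nat \<Rightarrow> 'f)
    \<Rightarrow> ('a, ('a, 'f) rx) module"
  where "rx A F n x = (let G = dp_n A F n; R = norm_rees A F n in
    algebra_via
      ((localization R (delta_powers A F n x))
        \<lparr>carrier := {rx_frac A F n x (in_deg G k c) (delta1 A F n x x [^]\<^bsub>R\<^esub> k) | k c.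
                      c \<in> ideal_pow G (norm_ideal A F n) k}\<rparr>)
      (\<lambda>a. rx_frac A F n x (in_deg G 0 (a \<odot>\<^bsub>G\<^esub> \<one>\<^bsub>G\<^esub>)) \<one>\<^bsub>R\<^esub>))"


section \<open>The module \<open>\<E>\<close>\<close>

text \<open>Elements of the free module \<open>\<E>\<close> are given by their coordinates with respect to the
  basis \<open>[x\<^sub>1], \<dots>, [x\<^sub>n]\<close>, as functions on \<open>{1..n}\<close>.\<close>

definition brk ::
  "('a, 'x) ring_scheme \<Rightarrow> ('a, 'f, 'y) module_scheme \<Rightarrow> nat \<Rightarrow> (nat \<Rightarrow> 'f) \<Rightarrow> 'f
    \<Rightarrow> nat \<Rightarrow> ('a, 'f) rx"
  where "brk A F n x y =
    (\<lambda>i\<in>{1..n}. rx_frac A F n x (delta1 A F n x (x(i := y))) (delta1 A F n x x))"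

text \<open>The multiplication is the bilinear extension of \<open>[x\<^sub>i][x\<^sub>j] := [x\<^sub>i x\<^sub>j]\<close>; the unit,
  which this does not specify in advance, is a parameter.\<close>

definition mod_E ::
  "('a, 'x) ring_scheme \<Rightarrow> ('a, 'f, 'y) module_scheme \<Rightarrow> nat \<Rightarrow> (nat \<Rightarrow> 'f)
    \<Rightarrow> (nat \<Rightarrow> ('a, 'f) rx) \<Rightarrow> (('a, 'f) rx, nat \<Rightarrow> ('a, 'f) rx) module"
  where "mod_E A F n x e = (let Rx = rx A F n x in
    \<lparr>carrier = {1..n} \<rightarrow>\<^sub>E carrier Rx,
     monoid.mult = (\<lambda>u v. \<lambda>k\<in>{1..n}. \<Oplus>\<^bsub>Rx\<^esub>i\<in>{1..n}. \<Oplus>\<^bsub>Rx\<^esub>j\<in>{1..n}.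
               (u i \<otimes>\<^bsub>Rx\<^esub> v j) \<otimes>\<^bsub>Rx\<^esub> brk A F n x (x i \<otimes>\<^bsub>F\<^esub> x j) k),
     one = e,
     ring.zero = (\<lambda>k\<in>{1..n}. \<zero>\<^bsub>Rx\<^esub>),
     add = (\<lambda>u v. \<lambda>k\<in>{1..n}. u k \<oplus>\<^bsub>Rx\<^esub> v k),
     smult = (\<lambda>c u. \<lambda>k\<in>{1..n}. c \<otimes>\<^bsub>Rx\<^esub> u k)\<rparr>)"

text \<open>\<open>h : F \<otimes>\<^sub>A R(x) \<rightarrow> \<E>\<close> is the \<open>R(x)\<close>-linear map induced by \<open>y \<mapsto> [y]\<close>.\<close>

definition is_induced_map ::
  "('a, 'x) ring_scheme \<Rightarrow> ('a, 'f, 'y) module_scheme \<Rightarrow> nat \<Rightarrow> (nat \<Rightarrow> 'f)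
    \<Rightarrow> (nat \<Rightarrow> ('a, 'f) rx) \<Rightarrow> (('f, ('a, 'f) rx) tens \<Rightarrow> nat \<Rightarrow> ('a, 'f) rx) \<Rightarrow> bool"
  where "is_induced_map A F n x e h \<longleftrightarrow> (let Rx = rx A F n x in
    h \<in> linear_maps Rx (tensor_algebra A F Rx) (mod_E A F n x e)
    \<and> (\<forall>y\<in>carrier F. h (tensor A F Rx y \<one>\<^bsub>Rx\<^esub>) = brk A F n x y))"

end

theory Submission
  imports Defs
begin

text \<open>Put \<open>c\<^sub>i(y) = \<delta>(x, x\<^sup>i\<^sub>y) / \<delta>(x, x)\<close>. If \<open>c\<^sub>k(x\<^sub>i)\<close> is the Kronecker symbol and
  \<open>\<Sum>\<^sub>i c\<^sub>i(y) c\<^sub>k(x\<^sub>i w) = c\<^sub>k(y w)\<close>, then the \<open>R(x)\<close>-linear map \<open>F \<otimes>\<^sub>A R(x) \<rightarrow> \<E>\<close> is surjective and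
  multiplicative, and \<open>\<E>\<close> inherits all ring axioms from \<open>F \<otimes>\<^sub>A R(x)\<close>. After clearing
  denominators the second identity reads
  \<open>\<Sum>\<^sub>i \<delta>(x, x\<^sup>i\<^sub>y) \<delta>(x, x\<^sup>k\<^sub>z) = \<delta>(x, x) \<delta>(x, x\<^sup>k\<^sub>y\<^sub>w)\<close> with \<open>z = x\<^sub>i w\<close>, which is Cramer's rule:
  writing \<open>a\<^sup>(\<^sup>j\<^sup>)\<close> for \<open>a\<close> in the \<open>j\<close>-th factor of \<open>F\<^bsup>\<otimes>n\<^esup>\<close>, the element \<open>\<delta>(x, y)\<close> is the image of
  \<open>x\<^sub>1\<^sup>(\<^sup>1\<^sup>) \<cdots> x\<^sub>n\<^sup>(\<^sup>n\<^sup>) det(y\<^sub>i\<^sup>(\<^sup>j\<^sup>))\<close> under \<open>a\<^sub>1 \<otimes> \<cdots> \<otimes> a\<^sub>n \<mapsto> \<gamma>\<^sup>1(a\<^sub>1) * \<cdots> * \<gamma>\<^sup>1(a\<^sub>n)\<close>, and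
  \<open>\<delta>(x, y) \<delta>(z, w)\<close> is that of \<open>x\<^sub>1\<^sup>(\<^sup>1\<^sup>) \<cdots> x\<^sub>n\<^sup>(\<^sup>n\<^sup>) det(y\<^sub>i\<^sup>(\<^sup>j\<^sup>)) det(z\<^sub>i\<^sup>(\<^sup>j\<^sup>)) det(w\<^sub>i\<^sup>(\<^sup>j\<^sup>))\<close>.

  This needs the second product on \<open>\<Gamma>\<^sup>n\<^sub>A F\<close>. For finitely many \<open>x\<^sub>i\<close>, multiplication by
  \<open>\<Sum>\<^sub>i T\<^sub>i x\<^sub>i\<close> on \<open>F[T]\<close> induces a map \<open>\<Gamma>(F) \<rightarrow> \<Gamma>(F)[T]\<close>, whose coefficient at \<open>\<Prod>\<^sub>i T\<^sub>i\<^bsup>m(i)\<^esup>\<close> is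
  multiplication by \<open>\<gamma>\<^bsup>m(1)\<^esup>(x\<^sub>1) * \<gamma>\<^bsup>m(2)\<^esup>(x\<^sub>2) * \<cdots>\<close>; conversely the base change to a polynomial ring
  \<open>A[T]\<close> determines the product by comparing coefficients.\<close>


section \<open>Additive maps\<close>

text \<open>Everything rests on one description of maps out of \<Gamma>(F). Sequences in a ring S
  that obey the product rule of divided powers form a module \<open>edp S\<close>, and by
  \<open>dp_lift\<close> a linear map from F to \<open>edp S\<close> extends to a ring homomorphism
  from \<Gamma>(F) to S. \<open>Phi\<close>, the base change map and its left inverse
  \<open>\<sigma>\<close> are all obtained so, and the four families of relations are treated only
  once. The second product cannot be obtained so: it is bilinear but not multiplicative for the
  first product. Taking it as a coefficient of \<open>Phi\<close> makes it respect the relations in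
  one argument, and \<open>Phi_sym\<close> carries this over to the other. Associativity has to be
  shown on products of divided powers, where a direct computation would involve sums over matrices
  of exponents. Over A[T] such products are the coefficients of \<gamma>^n of a generic linear
  combination, and the claim becomes associativity in F[T]; disjoint sets of variables keep the
  coefficients of the factors apart. The tensor power of F is replaced by a polynomial ring over the
  integers, where the determinant identities hold, followed by a map that is only additive.\<close>

definition add_hom :: "('a, 'x) ring_scheme \<Rightarrow> ('b, 'y) ring_scheme \<Rightarrow> ('a \<Rightarrow> 'b) set"
  where "add_hom M N = {h \<in> carrier M \<rightarrow> carrier N.
    \<forall>u\<in>carrier M. \<forall>v\<in>carrier M. h (u \<oplus>\<^bsub>M\<^esub> v) = h u \<oplus>\<^bsub>N\<^esub> h v}"

lemma add_homI:
  assumes "\<And>u. u \<in> carrier M \<Longrightarrow> h u \<in> carrier N"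
    and "\<And>u v. u \<in> carrier M \<Longrightarrow> v \<in> carrier M \<Longrightarrow> h (u \<oplus>\<^bsub>M\<^esub> v) = h u \<oplus>\<^bsub>N\<^esub> h v"
  shows "h \<in> add_hom M N"
  using assms unfolding add_hom_def by auto

lemma add_hom_closed: "h \<in> add_hom M N \<Longrightarrow> u \<in> carrier M \<Longrightarrow> h u \<in> carrier N"
  unfolding add_hom_def by auto

lemma add_hom_add:
  "h \<in> add_hom M N \<Longrightarrow> u \<in> carrier M \<Longrightarrow> v \<in> carrier M \<Longrightarrow> h (u \<oplus>\<^bsub>M\<^esub> v) = h u \<oplus>\<^bsub>N\<^esub> h v"
  unfolding add_hom_def by auto

lemma add_hom_comp:
  assumes "h \<in> add_hom M N" "k \<in> add_hom N L" shows "(\<lambda>u. k (h u)) \<in> add_hom M L"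
  by (rule add_homI) (simp_all add: assms add_hom_closed[OF assms(1)] add_hom_closed[OF assms(2)] add_hom_add[OF assms(1)] add_hom_add[OF assms(2)])

lemma ring_hom_add_hom: "h \<in> ring_hom M N \<Longrightarrow> h \<in> add_hom M N"
  by (auto intro!: add_homI simp: ring_hom_closed ring_hom_add)

lemma ring_hom_comp: "h \<in> ring_hom M N \<Longrightarrow> k \<in> ring_hom N L \<Longrightarrow> (\<lambda>u. k (h u)) \<in> ring_hom M L"
  by (rule ring_hom_memI) (auto simp: ring_hom_closed ring_hom_add ring_hom_mult ring_hom_one)

lemma add_hom_group:
  assumes "abelian_group M" "abelian_group N" "h \<in> add_hom M N"
  shows "abelian_group_hom M N h"
  using assms
  by (auto intro!: abelian_group_homI abelian_group.a_group group_hom.intro group_hom_axioms.intro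
      simp: hom_def add_hom_def)

lemma add_hom_zero:
  "abelian_group M \<Longrightarrow> abelian_group N \<Longrightarrow> h \<in> add_hom M N \<Longrightarrow> h \<zero>\<^bsub>M\<^esub> = \<zero>\<^bsub>N\<^esub>"
  by (intro abelian_group_hom.hom_zero add_hom_group)

lemma add_hom_a_inv:
  "abelian_group M \<Longrightarrow> abelian_group N \<Longrightarrow> h \<in> add_hom M N \<Longrightarrow> u \<in> carrier M
    \<Longrightarrow> h (\<ominus>\<^bsub>M\<^esub> u) = \<ominus>\<^bsub>N\<^esub> h u"
  by (intro abelian_group_hom.hom_a_inv add_hom_group)

lemma add_hom_minus:
  assumes "abelian_group M" "abelian_group N" "h \<in> add_hom M N" "u \<in> carrier M" "v \<in> carrier M"
  shows "h (u \<ominus>\<^bsub>M\<^esub> v) = h u \<ominus>\<^bsub>N\<^esub> h v"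
  using assms
  by (simp add: a_minus_def add_hom_add add_hom_a_inv abelian_group.a_inv_closed)

lemma add_hom_finsum:
  assumes "abelian_group M" "abelian_group N" "h \<in> add_hom M N" "f \<in> A \<rightarrow> carrier M"
  shows "h (finsum M f A) = finsum N (\<lambda>i. h (f i)) A"
proof -
  interpret M: abelian_group M by fact
  interpret N: abelian_group N by fact
  show ?thesis using assms(4)
  proof (induct A rule: infinite_finite_induct)
    case (insert i A)
    then have "f i \<in> carrier M" "f \<in> A \<rightarrow> carrier M" by auto
    moreover have "(\<lambda>i. h (f i)) \<in> A \<rightarrow> carrier N" "h (f i) \<in> carrier N"
      using insert by (auto intro: add_hom_closed[OF assms(3)])
    ultimately show ?case using insert assms(3)
      by (simp add: M.finsum_insert N.finsum_insert add_hom_add M.finsum_closed)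
  qed (use assms add_hom_zero in auto)
qed

lemma add_hom_int_pow:
  assumes "abelian_group M" "abelian_group N" "h \<in> add_hom M N" "u \<in> carrier M"
  shows "h (add_pow M (k::int) u) = add_pow N k (h u)"
proof -
  interpret M: abelian_group M by fact
  interpret N: abelian_group N by fact
  interpret group_hom "add_monoid M" "add_monoid N" h
    using assms by (intro group_hom.intro M.a_group N.a_group group_hom_axioms.intro)
      (auto simp: hom_def add_hom_def)
  show ?thesis using hom_int_pow[of u k] assms(4) by (simp add: add_pow_def)
qed

lemma add_hom_nat_pow:
  assumes "abelian_group M" "abelian_group N" "h \<in> add_hom M N" "u \<in> carrier M"
  shows "h (add_pow M (k::nat) u) = add_pow N k (h u)"
  using add_hom_int_pow[OF assms, of "int k"] by (simp add: add_pow_int_ge)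

lemma (in abelian_group) add_pow_int_hom:
  assumes "u \<in> carrier G" shows "(\<lambda>k::int. add_pow G k u) \<in> add_hom \<Z> G"
  using assms by (auto intro!: add_homI simp: add.int_pow_mult)

lemma (in abelian_group) finsum_in_set:
  assumes "\<zero> \<in> Q" "Q \<subseteq> carrier G" "\<And>u v. u \<in> Q \<Longrightarrow> v \<in> Q \<Longrightarrow> u \<oplus> v \<in> Q" "\<And>i. i \<in> A \<Longrightarrow> f i \<in> Q"
  shows "finsum G f A \<in> Q"
  using assms(4)
proof (induct A rule: infinite_finite_induct)
  case (insert i A)
  then have "f i \<in> carrier G" "f \<in> A \<rightarrow> carrier G" using assms(2) by auto
  then show ?case using insert assms by (simp add: finsum_insert)
qed (use assms in auto)

section \<open>Finite products and sums\<close>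

lemma (in comm_monoid) finprod_bij:
  assumes "bij_betw h A B" "f \<in> B \<rightarrow> carrier G"
  shows "finprod G (\<lambda>x. f (h x)) A = finprod G f B"
  using assms finprod_reindex[of f h A] by (simp add: bij_betw_def)

text \<open>Multiplicative form on purpose: in the additive monoid of a ring the same lemma, as
  \<open>add.finprod_Sigma\<close>, rearranges iterated sums.\<close>

lemma (in comm_monoid) finprod_Sigma:
  assumes "finite A" "\<And>a. a \<in> A \<Longrightarrow> finite (B a)"
    and "\<And>a b. a \<in> A \<Longrightarrow> b \<in> B a \<Longrightarrow> f a b \<in> carrier G"
  shows "finprod G (\<lambda>a. finprod G (f a) (B a)) A = finprod G (\<lambda>p. f (fst p) (snd p)) (Sigma A B)"
proof -
  have "Sigma A B = (\<Union>a\<in>A. Pair a ` B a)" by auto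
  then have "finprod G (\<lambda>p. f (fst p) (snd p)) (Sigma A B)
      = finprod G (\<lambda>a. finprod G (\<lambda>p. f (fst p) (snd p)) (Pair a ` B a)) A"
    using assms by (simp only:) (intro finprod_UN_disjoint, auto simp: pairwise_def disjnt_def)
  also have "\<dots> = finprod G (\<lambda>a. finprod G (f a) (B a)) A"
  proof (rule finprod_cong')
    fix a assume a: "a \<in> A"
    have "finprod G (\<lambda>p. f (fst p) (snd p)) (Pair a ` B a) = finprod G (\<lambda>b. f a b) (B a)"
      by (rule trans[OF finprod_reindex]) (use a assms(3) in \<open>auto simp: inj_on_def\<close>)
    then show "finprod G (\<lambda>p. f (fst p) (snd p)) (Pair a ` B a) = finprod G (f a) (B a)" by simp
  qed (use assms in auto)
  finally show ?thesis ..
qed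

lemma (in comm_monoid) finprod_group:
  assumes "finite A" "finite C" "\<And>a. a \<in> A \<Longrightarrow> g a \<in> C" "f \<in> A \<rightarrow> carrier G"
  shows "finprod G f A = finprod G (\<lambda>c. finprod G f {a\<in>A. g a = c}) C"
proof -
  have "A = (\<Union>c\<in>C. {a\<in>A. g a = c})" using assms by auto
  then have "finprod G f A = finprod G f (\<Union>c\<in>C. {a\<in>A. g a = c})" by simp
  also have "\<dots> = finprod G (\<lambda>c. finprod G f {a\<in>A. g a = c}) C"
    using assms by (intro finprod_UN_disjoint) (auto simp: pairwise_def disjnt_def)
  finally show ?thesis .
qed

lemma (in abelian_monoid) finsum_add_pow:
  assumes "finite A" "u \<in> carrier G"
  shows "(\<Oplus>i\<in>A. add_pow G (k i :: nat) u) = add_pow G (\<Sum>i\<in>A. k i) u"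
  using assms by (induct A rule: finite_induct) (auto simp: add.nat_pow_mult)

lemma (in cring) finsum_mult_finsum:
  assumes "finite A" "finite B" "f \<in> A \<rightarrow> carrier R" "g \<in> B \<rightarrow> carrier R"
  shows "finsum R f A \<otimes> finsum R g B = (\<Oplus>p\<in>A \<times> B. f (fst p) \<otimes> g (snd p))"
proof -
  have "finsum R f A \<otimes> finsum R g B = (\<Oplus>a\<in>A. f a \<otimes> finsum R g B)"
    using assms by (intro finsum_ldistr) auto
  also have "\<dots> = (\<Oplus>a\<in>A. \<Oplus>b\<in>B. f a \<otimes> g b)"
    using assms by (intro finsum_cong') (auto simp: Pi_iff intro!: finsum_rdistr)
  also have "\<dots> = (\<Oplus>p\<in>A \<times> B. f (fst p) \<otimes> g (snd p))"
    using assms by (intro add.finprod_Sigma) auto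
  finally show ?thesis .
qed

lemma (in cring) binomial_theorem:
  assumes ab: "a \<in> carrier R" "b \<in> carrier R"
  shows "(a \<oplus> b) [^] (m::nat) = (\<Oplus>j\<in>{..m}. add_pow R (m choose j) (a [^] j \<otimes> b [^] (m - j)))"
proof (induct m)
  case (Suc m)
  let ?t = "\<lambda>m j. add_pow R (m choose j) (a [^] j \<otimes> b [^] (m - j))"
  let ?s = "\<lambda>j. add_pow R (m choose j) (a [^] j \<otimes> b [^] (Suc m - j))"
  have "(a \<oplus> b) [^] Suc m = a \<otimes> finsum R (?t m) {..m} \<oplus> b \<otimes> finsum R (?t m) {..m}"
    using Suc ab by (simp add: m_comm l_distr)
  also have "a \<otimes> finsum R (?t m) {..m} = (\<Oplus>j\<in>{..m}. add_pow R (m choose j) (a [^] Suc j \<otimes> b [^] (m - j)))"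
    using ab by (subst finsum_rdistr) (auto intro!: finsum_cong' simp: add_pow_rdistr m_ac)
  also have "b \<otimes> finsum R (?t m) {..m} = finsum R ?s {..m}"
    using ab by (subst finsum_rdistr) (auto intro!: finsum_cong' simp: add_pow_rdistr m_ac Suc_diff_le)
  \<comment> \<open>The added term vanishes because \<open>m choose Suc m\<close> is 0. After
    splitting off j = 0 the remaining sum runs over \<open>{..m}\<close> again, and Pascal's rule
    applies termwise.\<close>
  also have "finsum R ?s {..m} = finsum R ?s {..Suc m}"
    using ab by (simp add: binomial_eq_0 del: binomial_eq_0_iff)
  also have "\<dots> = (\<Oplus>j\<in>{..m}. add_pow R (m choose Suc j) (a [^] Suc j \<otimes> b [^] (m - j))) \<oplus> b [^] Suc m"
    using ab by (subst finsum_Suc2) auto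
  also have "(\<Oplus>j\<in>{..m}. add_pow R (m choose j) (a [^] Suc j \<otimes> b [^] (m - j))) \<oplus>
      ((\<Oplus>j\<in>{..m}. add_pow R (m choose Suc j) (a [^] Suc j \<otimes> b [^] (m - j))) \<oplus> b [^] Suc m)
    = (\<Oplus>j\<in>{..m}. add_pow R (m choose j) (a [^] Suc j \<otimes> b [^] (m - j))
        \<oplus> add_pow R (m choose Suc j) (a [^] Suc j \<otimes> b [^] (m - j))) \<oplus> b [^] Suc m"
    using ab by (subst finsum_addf) (auto simp: a_assoc simp del: nat_pow_Suc)
  also have "\<dots> = (\<Oplus>j\<in>{..m}. ?t (Suc m) (Suc j)) \<oplus> ?t (Suc m) 0"
    using ab by (simp add: add.nat_pow_mult)
  also have "\<dots> = finsum R (?t (Suc m)) {..Suc m}" using ab by (subst finsum_Suc2) auto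
  finally show ?case .
qed (use ab in simp)

section \<open>Monoid rings\<close>

locale monring = R?: cring R + M?: comm_monoid M for R (structure) and M (structure)
begin

abbreviation P where "P \<equiv> monoid_ring R M"

lemma mr_carrier:
  "f \<in> carrier P \<longleftrightarrow> (\<forall>m. f m \<in> carrier R) \<and> finite (supp R f) \<and> supp R f \<subseteq> carrier M"
  by (auto simp: monoid_ring_def)

lemma mr_simps: "\<zero>\<^bsub>P\<^esub> = (\<lambda>m. \<zero>\<^bsub>R\<^esub>)" "f \<oplus>\<^bsub>P\<^esub> g = (\<lambda>m. f m \<oplus>\<^bsub>R\<^esub> g m)"
  "\<one>\<^bsub>P\<^esub> = single R \<one>\<^bsub>M\<^esub> \<one>\<^bsub>R\<^esub>"
  by (simp_all add: monoid_ring_def)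

lemma mr_abelian: "abelian_group P"
proof (rule abelian_groupI)
  fix f g assume fg: "f \<in> carrier P" "g \<in> carrier P"
  have "supp R (f \<oplus>\<^bsub>P\<^esub> g) \<subseteq> supp R f \<union> supp R g"
    by (auto simp: supp_def mr_simps)
  then show "f \<oplus>\<^bsub>P\<^esub> g \<in> carrier P" using fg
    by (auto simp: mr_carrier mr_simps intro: finite_subset)
next
  fix f assume f: "f \<in> carrier P"
  have "supp R (\<lambda>m. \<ominus>\<^bsub>R\<^esub> f m) \<subseteq> supp R f" using f by (auto simp: supp_def)
  then have "(\<lambda>m. \<ominus>\<^bsub>R\<^esub> f m) \<in> carrier P" using f
    by (auto simp: mr_carrier intro: finite_subset)
  moreover have "(\<lambda>m. \<ominus>\<^bsub>R\<^esub> f m) \<oplus>\<^bsub>P\<^esub> f = \<zero>\<^bsub>P\<^esub>"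
    using f by (auto simp: mr_simps mr_carrier R.l_neg)
  ultimately show "\<exists>g\<in>carrier P. g \<oplus>\<^bsub>P\<^esub> f = \<zero>\<^bsub>P\<^esub>" by blast
qed (auto simp: mr_carrier mr_simps supp_def R.a_ac)

lemma single_closed: "m \<in> carrier M \<Longrightarrow> r \<in> carrier R \<Longrightarrow> single R m r \<in> carrier P"
  by (auto simp: mr_carrier single_def supp_def)

lemma single_add_hom: "m \<in> carrier M \<Longrightarrow> single R m \<in> add_hom R P"
  by (rule add_homI) (simp add: single_closed, simp add: mr_simps single_def fun_eq_iff)

lemma coeff_add_hom: "(\<lambda>f. f m) \<in> add_hom P R"
  by (rule add_homI) (auto simp: mr_carrier mr_simps)

lemma coeff_finsum: "F \<in> A \<rightarrow> carrier P \<Longrightarrow> finsum P F A m = (\<Oplus>\<^bsub>R\<^esub>i\<in>A. F i m)"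
  by (rule add_hom_finsum[OF mr_abelian R.abelian_group_axioms coeff_add_hom])

text \<open>A convolution may be summed over any finite sets containing the supports, as the extra
  products vanish. Products with different supports can then be compared term by term.\<close>

lemma mult_eq:
  assumes f: "f \<in> carrier P" "g \<in> carrier P" and UV: "finite U" "finite V" "supp R f \<subseteq> U" "supp R g \<subseteq> V"
  shows "(f \<otimes>\<^bsub>P\<^esub> g) m = (\<Oplus>\<^bsub>R\<^esub>p\<in>{p\<in>U \<times> V. fst p \<otimes>\<^bsub>M\<^esub> snd p = m}. f (fst p) \<otimes>\<^bsub>R\<^esub> g (snd p))"
proof -
  have "(f \<otimes>\<^bsub>P\<^esub> g) m = (\<Oplus>\<^bsub>R\<^esub>p\<in>{(a, b). a \<in> supp R f \<and> b \<in> supp R g \<and> a \<otimes>\<^bsub>M\<^esub> b = m}. f (fst p) \<otimes>\<^bsub>R\<^esub> g (snd p))"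
    by (simp add: monoid_ring_def case_prod_beta')
  also have "\<dots> = (\<Oplus>\<^bsub>R\<^esub>p\<in>{p\<in>U \<times> V. fst p \<otimes>\<^bsub>M\<^esub> snd p = m}. f (fst p) \<otimes>\<^bsub>R\<^esub> g (snd p))"
    using UV f by (intro R.add.finprod_mono_neutral_cong_left) (auto simp: mr_carrier supp_def)
  finally show ?thesis .
qed

lemma supp_mult:
  assumes f: "f \<in> carrier P" "g \<in> carrier P"
  shows "supp R (f \<otimes>\<^bsub>P\<^esub> g) \<subseteq> (\<lambda>(a,b). a \<otimes>\<^bsub>M\<^esub> b) ` (supp R f \<times> supp R g)"
proof
  fix m assume m: "m \<in> supp R (f \<otimes>\<^bsub>P\<^esub> g)"
  show "m \<in> (\<lambda>(a,b). a \<otimes>\<^bsub>M\<^esub> b) ` (supp R f \<times> supp R g)"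
  proof (rule ccontr)
    assume "\<not> ?thesis"
    then have e: "{p\<in>supp R f \<times> supp R g. fst p \<otimes>\<^bsub>M\<^esub> snd p = m} = {}" by force
    have "finite (supp R f)" "finite (supp R g)" using f by (auto simp: mr_carrier)
    then have "(f \<otimes>\<^bsub>P\<^esub> g) m = \<zero>\<^bsub>R\<^esub>"
      using mult_eq[OF f, of "supp R f" "supp R g" m] unfolding e by simp
    with m show False by (simp add: supp_def)
  qed
qed

lemma mult_closed: assumes f: "f \<in> carrier P" "g \<in> carrier P" shows "f \<otimes>\<^bsub>P\<^esub> g \<in> carrier P"
proof -
  note supp_mult[OF f]
  moreover have "finite ((\<lambda>(a,b). a \<otimes>\<^bsub>M\<^esub> b) ` (supp R f \<times> supp R g))"
    "(\<lambda>(a,b). a \<otimes>\<^bsub>M\<^esub> b) ` (supp R f \<times> supp R g) \<subseteq> carrier M"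
    using f by (auto simp: mr_carrier)
  moreover have "(f \<otimes>\<^bsub>P\<^esub> g) m \<in> carrier R" for m
    using f mult_eq[OF f, of "supp R f" "supp R g" m] by (simp add: mr_carrier)
  ultimately show ?thesis unfolding mr_carrier by (meson finite_subset order_trans)
qed

lemma mult_add_left:
  assumes f: "f \<in> carrier P" "f' \<in> carrier P" "g \<in> carrier P"
  shows "(f \<oplus>\<^bsub>P\<^esub> f') \<otimes>\<^bsub>P\<^esub> g = f \<otimes>\<^bsub>P\<^esub> g \<oplus>\<^bsub>P\<^esub> f' \<otimes>\<^bsub>P\<^esub> g"
proof
  fix m
  let ?U = "supp R f \<union> supp R f'" let ?V = "supp R g"
  have fin: "finite ?U" "finite ?V" using f by (auto simp: mr_carrier)
  have s: "supp R (f \<oplus>\<^bsub>P\<^esub> f') \<subseteq> ?U" by (auto simp: supp_def mr_simps)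
  have c: "f \<oplus>\<^bsub>P\<^esub> f' \<in> carrier P" using f mr_abelian by (simp add: abelian_groupE(1))
  have r: "f m \<in> carrier R" "f' m \<in> carrier R" "g m \<in> carrier R" for m using f by (auto simp: mr_carrier)
  have "((f \<oplus>\<^bsub>P\<^esub> f') \<otimes>\<^bsub>P\<^esub> g) m =
     (\<Oplus>\<^bsub>R\<^esub>p\<in>{p\<in>?U \<times> ?V. fst p \<otimes>\<^bsub>M\<^esub> snd p = m}. (f \<oplus>\<^bsub>P\<^esub> f') (fst p) \<otimes>\<^bsub>R\<^esub> g (snd p))"
    by (rule mult_eq) (use c f fin s in auto)
  also have "\<dots> = (f \<otimes>\<^bsub>P\<^esub> g) m \<oplus>\<^bsub>R\<^esub> (f' \<otimes>\<^bsub>P\<^esub> g) m"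
    using fin f r by (simp add: mult_eq[of _ _ ?U ?V] mr_simps R.l_distr R.finsum_addf)
  finally show "((f \<oplus>\<^bsub>P\<^esub> f') \<otimes>\<^bsub>P\<^esub> g) m = (f \<otimes>\<^bsub>P\<^esub> g \<oplus>\<^bsub>P\<^esub> f' \<otimes>\<^bsub>P\<^esub> g) m"
    by (simp add: mr_simps)
qed

lemma mult_comm:
  assumes f: "f \<in> carrier P" "g \<in> carrier P"
  shows "f \<otimes>\<^bsub>P\<^esub> g = g \<otimes>\<^bsub>P\<^esub> f"
proof
  fix m
  let ?U = "supp R f" let ?V = "supp R g"
  have fin: "finite ?U" "finite ?V" "?U \<subseteq> carrier M" "?V \<subseteq> carrier M" using f by (auto simp: mr_carrier)
  have r: "f m \<in> carrier R" "g m \<in> carrier R" for m using f by (auto simp: mr_carrier)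
  let ?A = "{p\<in>?U \<times> ?V. fst p \<otimes>\<^bsub>M\<^esub> snd p = m}"
  have eq: "{p\<in>?V \<times> ?U. fst p \<otimes>\<^bsub>M\<^esub> snd p = m} = prod.swap ` ?A"
    using fin by (auto simp: M.m_comm subset_iff image_def)
  have "(g \<otimes>\<^bsub>P\<^esub> f) m = (\<Oplus>\<^bsub>R\<^esub>p\<in>prod.swap ` ?A. g (fst p) \<otimes>\<^bsub>R\<^esub> f (snd p))"
    using mult_eq[OF f(2,1) fin(2,1) order_refl order_refl, of m] eq by simp
  also have "\<dots> = (\<Oplus>\<^bsub>R\<^esub>p\<in>?A. g (snd p) \<otimes>\<^bsub>R\<^esub> f (fst p))"
    using r by (subst R.finsum_reindex) (auto)
  also have "\<dots> = (f \<otimes>\<^bsub>P\<^esub> g) m"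
    using mult_eq[OF f fin(1,2) order_refl order_refl, of m] r by (simp add: R.m_comm)
  finally show "(f \<otimes>\<^bsub>P\<^esub> g) m = (g \<otimes>\<^bsub>P\<^esub> f) m" by simp
qed

lemma single_mult:
  assumes "a \<in> carrier M" "b \<in> carrier M" "r \<in> carrier R" "s \<in> carrier R"
  shows "single R a r \<otimes>\<^bsub>P\<^esub> single R b s = single R (a \<otimes>\<^bsub>M\<^esub> b) (r \<otimes>\<^bsub>R\<^esub> s)"
proof
  fix m
  have "(single R a r \<otimes>\<^bsub>P\<^esub> single R b s) m = (\<Oplus>\<^bsub>R\<^esub>p\<in>{p\<in>{a} \<times> {b}. fst p \<otimes>\<^bsub>M\<^esub> snd p = m}. single R a r (fst p) \<otimes>\<^bsub>R\<^esub> single R b s (snd p))"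
    by (rule mult_eq) (use assms single_closed in \<open>auto simp: supp_def single_def\<close>)
  moreover have "{p\<in>{a} \<times> {b}. fst p \<otimes>\<^bsub>M\<^esub> snd p = m} = (if a \<otimes>\<^bsub>M\<^esub> b = m then {(a,b)} else {})" by auto
  ultimately show "(single R a r \<otimes>\<^bsub>P\<^esub> single R b s) m = single R (a \<otimes>\<^bsub>M\<^esub> b) (r \<otimes>\<^bsub>R\<^esub> s) m"
    using assms by (auto simp: single_def)
qed

lemma mr_decomp:
  assumes "f \<in> carrier P" shows "f = (\<Oplus>\<^bsub>P\<^esub>m\<in>supp R f. single R m (f m))"
proof
  fix k
  have f: "f m \<in> carrier R" "finite (supp R f)" "supp R f \<subseteq> carrier M" for m using assms by (auto simp: mr_carrier)
  have "(\<Oplus>\<^bsub>P\<^esub>m\<in>supp R f. single R m (f m)) k = (\<Oplus>\<^bsub>R\<^esub>m\<in>supp R f. single R m (f m) k)"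
    using f by (intro coeff_finsum) (auto intro!: single_closed)
  also have "\<dots> = (\<Oplus>\<^bsub>R\<^esub>m\<in>supp R f. if k = m then f m else \<zero>\<^bsub>R\<^esub>)" by (simp add: single_def)
  also have "\<dots> = f k"
  proof (cases "k \<in> supp R f")
    case True then show ?thesis using f by (intro R.finsum_singleton) auto
  next
    case False
    then have "(\<Oplus>\<^bsub>R\<^esub>m\<in>supp R f. if k = m then f m else \<zero>\<^bsub>R\<^esub>) = (\<Oplus>\<^bsub>R\<^esub>m\<in>supp R f. \<zero>\<^bsub>R\<^esub>)"
      by (intro R.finsum_cong') auto
    then show ?thesis using False by (simp add: supp_def)
  qed
  finally show "f k = (\<Oplus>\<^bsub>P\<^esub>m\<in>supp R f. single R m (f m)) k" ..
qed

text \<open>Only the monomials that occur in f, with their own coefficients, are offered to the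
  induction. This matters for homogeneous elements, whose defining condition restricts the
  support.\<close>

lemma mr_supp_induct:
  assumes f: "f \<in> carrier P" and z: "Q \<zero>\<^bsub>P\<^esub>"
    and s: "\<And>m. m \<in> supp R f \<Longrightarrow> m \<in> carrier M \<Longrightarrow> Q (single R m (f m))"
    and a: "\<And>f g. f \<in> carrier P \<Longrightarrow> g \<in> carrier P \<Longrightarrow> Q f \<Longrightarrow> Q g \<Longrightarrow> Q (f \<oplus>\<^bsub>P\<^esub> g)"
  shows "Q f"
proof -
  interpret P: abelian_group P by (rule mr_abelian)
  have "(\<Oplus>\<^bsub>P\<^esub>m\<in>supp R f. single R m (f m)) \<in> {g\<in>carrier P. Q g}"
  proof (rule P.finsum_in_set)
    fix m assume "m \<in> supp R f"
    then show "single R m (f m) \<in> {g\<in>carrier P. Q g}"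
      using f s by (auto simp: mr_carrier[of f] intro!: single_closed)
  qed (auto simp: z a)
  then show ?thesis using mr_decomp[OF f] by simp
qed

lemma mr_induct [consumes 1, case_names single add]:
  assumes f: "f \<in> carrier P"
    and s: "\<And>m r. m \<in> carrier M \<Longrightarrow> r \<in> carrier R \<Longrightarrow> Q (single R m r)"
    and a: "\<And>f g. f \<in> carrier P \<Longrightarrow> g \<in> carrier P \<Longrightarrow> Q f \<Longrightarrow> Q g \<Longrightarrow> Q (f \<oplus>\<^bsub>P\<^esub> g)"
  shows "Q f"
proof (rule mr_supp_induct[of f Q])
  \<comment> \<open>Zero counts as a monomial with zero coefficient, so the monomial case covers
    it.\<close>
  have "single R \<one>\<^bsub>M\<^esub> \<zero>\<^bsub>R\<^esub> = \<zero>\<^bsub>P\<^esub>" by (auto simp: single_def mr_simps)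
  then show "Q \<zero>\<^bsub>P\<^esub>" using s[of "\<one>\<^bsub>M\<^esub>" "\<zero>\<^bsub>R\<^esub>"] by simp
qed (use f s a in \<open>auto simp: mr_carrier\<close>)

lemma mult_add_right:
  assumes "f \<in> carrier P" "g \<in> carrier P" "h \<in> carrier P"
  shows "f \<otimes>\<^bsub>P\<^esub> (g \<oplus>\<^bsub>P\<^esub> h) = f \<otimes>\<^bsub>P\<^esub> g \<oplus>\<^bsub>P\<^esub> f \<otimes>\<^bsub>P\<^esub> h"
  using assms mult_add_left[of g h f] abelian_groupE(1)[OF mr_abelian]
  by (simp add: mult_comm[of f])

text \<open>Both sides are additive in each of the three arguments, so monomials decide.\<close>

lemma mult_assoc:
  assumes f: "f \<in> carrier P" and g: "g \<in> carrier P" and h: "h \<in> carrier P"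
  shows "(f \<otimes>\<^bsub>P\<^esub> g) \<otimes>\<^bsub>P\<^esub> h = f \<otimes>\<^bsub>P\<^esub> (g \<otimes>\<^bsub>P\<^esub> h)"
  using f
proof (induct f rule: mr_induct)
  case (single m r)
  note 1 = single
  show ?case using g
  proof (induct g rule: mr_induct)
    case (single m' r')
    note 2 = single
    show ?case using h
    proof (induct h rule: mr_induct)
      case (single m'' r'')
      then show ?case using 1 2 by (simp add: single_mult M.m_assoc R.m_assoc)
    next
      case (add f' g')
      then show ?case using 1 2 by (simp add: mult_add_right mult_closed single_closed)
    qed
  next
    case (add f' g')
    then show ?case using 1 h by (simp add: mult_add_right mult_add_left mult_closed single_closed)
  qed
next
  case (add f' g')
  then show ?case using g h by (simp add: mult_add_left mult_closed)
qed

lemma mult_one: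
  assumes f: "f \<in> carrier P" shows "\<one>\<^bsub>P\<^esub> \<otimes>\<^bsub>P\<^esub> f = f"
  using f
proof (induct f rule: mr_induct)
  case (single m r)
  then show ?case by (simp add: single_mult mr_simps)
next
  case (add f' g')
  moreover have "\<one>\<^bsub>P\<^esub> \<in> carrier P" by (simp add: mr_simps single_closed)
  ultimately show ?case by (simp add: mult_add_right)
qed

lemma mr_cring: "cring P"
proof (rule cringI[OF mr_abelian])
  show "comm_monoid P"
  proof (rule comm_monoidI)
    show "\<one>\<^bsub>P\<^esub> \<in> carrier P" by (simp add: mr_simps single_closed)
  qed (fact mult_closed mult_assoc mult_one mult_comm)+
qed (auto simp: mult_add_left)

text \<open>As an additive group the monoid ring is the direct sum of copies of R indexed by M. The
  extension is a sum over the support; \<open>ext\<close> enlarges the index set so that f, g and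
  their sum are summed over the same set.\<close>

lemma mr_lift:
  assumes N: "abelian_group N" and \<phi>: "\<And>m. m \<in> carrier M \<Longrightarrow> \<phi> m \<in> add_hom R N"
  obtains h where "h \<in> add_hom P N"
    "\<And>m r. m \<in> carrier M \<Longrightarrow> r \<in> carrier R \<Longrightarrow> h (single R m r) = \<phi> m r"
proof
  interpret N: abelian_group N by fact
  define h where "h f = (\<Oplus>\<^bsub>N\<^esub>m\<in>supp R f. \<phi> m (f m))" for f
  note z = add_hom_zero[OF R.abelian_group_axioms N \<phi>]
  have ext: "h f = (\<Oplus>\<^bsub>N\<^esub>m\<in>U. \<phi> m (f m))"
    if "f \<in> carrier P" "finite U" "U \<subseteq> carrier M" "supp R f \<subseteq> U" for f U
    unfolding h_def using that
    by (intro N.add.finprod_mono_neutral_cong_left)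
      (auto simp: supp_def mr_carrier z subset_iff intro!: add_hom_closed[OF \<phi>])
  show "h \<in> add_hom P N"
  proof (rule add_homI)
    fix f assume "f \<in> carrier P"
    then show "h f \<in> carrier N" unfolding h_def
      by (intro N.finsum_closed) (auto simp: mr_carrier intro!: add_hom_closed[OF \<phi>])
  next
    fix f g assume f: "f \<in> carrier P" "g \<in> carrier P"
    let ?U = "supp R f \<union> supp R g"
    have U: "finite ?U" "?U \<subseteq> carrier M" using f by (auto simp: mr_carrier)
    have s: "supp R (f \<oplus>\<^bsub>P\<^esub> g) \<subseteq> ?U" by (auto simp: supp_def mr_simps)
    have r: "f m \<in> carrier R" "g m \<in> carrier R" for m using f by (auto simp: mr_carrier)
    have "h (f \<oplus>\<^bsub>P\<^esub> g) = (\<Oplus>\<^bsub>N\<^esub>m\<in>?U. \<phi> m ((f \<oplus>\<^bsub>P\<^esub> g) m))"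
      by (rule ext) (use f U s abelian_groupE(1)[OF mr_abelian] in auto)
    also have "\<dots> = (\<Oplus>\<^bsub>N\<^esub>m\<in>?U. \<phi> m (f m) \<oplus>\<^bsub>N\<^esub> \<phi> m (g m))"
      using U r by (intro N.finsum_cong') (auto simp: mr_simps add_hom_add[OF \<phi>] subset_iff intro!: add_hom_closed[OF \<phi>])
    also have "\<dots> = h f \<oplus>\<^bsub>N\<^esub> h g"
      using U r f by (subst N.finsum_addf) (auto simp: ext[of _ ?U] subset_iff intro!: add_hom_closed[OF \<phi>])
    finally show "h (f \<oplus>\<^bsub>P\<^esub> g) = h f \<oplus>\<^bsub>N\<^esub> h g" .
  qed
  fix m r assume m: "m \<in> carrier M" "r \<in> carrier R"
  have "h (single R m r) = (\<Oplus>\<^bsub>N\<^esub>k\<in>{m}. \<phi> k (single R m r k))"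
    using m by (intro ext single_closed) (auto simp: supp_def single_def)
  then show "h (single R m r) = \<phi> m r" using m add_hom_closed[OF \<phi>]
    by (simp add: single_def)
qed

lemma mr_add_hom_eq:
  assumes "h \<in> add_hom P N" "k \<in> add_hom P N" "f \<in> carrier P"
    and "\<And>m r. m \<in> carrier M \<Longrightarrow> r \<in> carrier R \<Longrightarrow> h (single R m r) = k (single R m r)"
  shows "h f = k f"
  using assms(3) by (induct f rule: mr_induct) (auto simp: assms add_hom_add[OF assms(1)] add_hom_add[OF assms(2)])

lemma mr_ring_lift:
  assumes S: "cring S" and \<psi>: "\<psi> \<in> ring_hom R S"
    and \<chi>: "\<And>m. m \<in> carrier M \<Longrightarrow> \<chi> m \<in> carrier S" "\<chi> \<one>\<^bsub>M\<^esub> = \<one>\<^bsub>S\<^esub>"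
      "\<And>m m'. m \<in> carrier M \<Longrightarrow> m' \<in> carrier M \<Longrightarrow> \<chi> (m \<otimes>\<^bsub>M\<^esub> m') = \<chi> m \<otimes>\<^bsub>S\<^esub> \<chi> m'"
  obtains h where "h \<in> ring_hom P S"
    "\<And>m r. m \<in> carrier M \<Longrightarrow> r \<in> carrier R \<Longrightarrow> h (single R m r) = \<psi> r \<otimes>\<^bsub>S\<^esub> \<chi> m"
proof -
  interpret S: cring S by fact
  note \<psi>c = ring_hom_closed[OF \<psi>]
  obtain h where h: "h \<in> add_hom P S"
    "\<And>m r. m \<in> carrier M \<Longrightarrow> r \<in> carrier R \<Longrightarrow> h (single R m r) = \<psi> r \<otimes>\<^bsub>S\<^esub> \<chi> m"
    by (rule mr_lift[OF S.abelian_group_axioms, of "\<lambda>m r. \<psi> r \<otimes>\<^bsub>S\<^esub> \<chi> m"])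
      (auto intro!: add_homI simp: \<psi>c \<chi> ring_hom_add[OF \<psi>] S.l_distr)
  note hc = add_hom_closed[OF h(1)] and ha = add_hom_add[OF h(1)]
  have "h \<in> ring_hom P S"
  proof (rule ring_hom_memI)
    show "h \<one>\<^bsub>P\<^esub> = \<one>\<^bsub>S\<^esub>" by (simp add: mr_simps h \<chi> ring_hom_one[OF \<psi>])
    fix f g assume f: "f \<in> carrier P" and g: "g \<in> carrier P"
    show "h (f \<otimes>\<^bsub>P\<^esub> g) = h f \<otimes>\<^bsub>S\<^esub> h g" using f
    proof (induct f rule: mr_induct)
      case (single m r)
      note 1 = this
      show ?case using g
      proof (induct g rule: mr_induct)
        case (single m' r')
        have "\<psi> r \<in> carrier S" "\<psi> r' \<in> carrier S" "\<chi> m \<in> carrier S" "\<chi> m' \<in> carrier S"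
          using 1 single \<chi> \<psi>c by auto
        moreover have "h (single R m r \<otimes>\<^bsub>P\<^esub> single R m' r') = (\<psi> r \<otimes>\<^bsub>S\<^esub> \<psi> r') \<otimes>\<^bsub>S\<^esub> (\<chi> m \<otimes>\<^bsub>S\<^esub> \<chi> m')"
          using 1 single by (simp add: single_mult h \<chi> ring_hom_mult[OF \<psi>])
        ultimately show ?case using 1 single by (simp add: h S.m_ac)
      next
        case (add f' g')
        then show ?case using 1 by (simp add: mult_add_right single_closed mult_closed ha hc S.r_distr)
      qed
    next
      case (add f' g')
      then show ?case using g by (simp add: mult_add_left mult_closed ha hc S.l_distr)
    qed
  qed (auto simp: hc ha)
  then show thesis using h(2) that by blast
qed

end

text \<open>Multiplicativity is not checked on convolutions: the universal property supplies a ring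
  homomorphism H, and H agrees with coefficientwise application because both are additive and agree
  on monomials.\<close>

lemma monoid_ring_map:
  assumes R: "cring R" and S: "cring S" and M: "comm_monoid M" and h: "h \<in> ring_hom R S"
  shows "(\<lambda>f m. h (f m)) \<in> ring_hom (monoid_ring R M) (monoid_ring S M)"
    and "\<And>m r. r \<in> carrier R \<Longrightarrow> (\<lambda>k. h (single R m r k)) = single S m (h r)"
proof -
  interpret R: monring R M using R M by (simp add: monring_def)
  interpret S: monring S M using S M by (simp add: monring_def)
  interpret PS: cring "monoid_ring S M" by (rule S.mr_cring)
  have hz: "h \<zero>\<^bsub>R\<^esub> = \<zero>\<^bsub>S\<^esub>"
    by (rule add_hom_zero[OF R.R.abelian_group_axioms S.R.abelian_group_axioms ring_hom_add_hom[OF h]])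
  show sing: "\<And>m r. r \<in> carrier R \<Longrightarrow> (\<lambda>k. h (single R m r k)) = single S m (h r)"
    by (auto simp: single_def hz)
  have one: "\<one>\<^bsub>M\<^esub> \<in> carrier M" by simp
  obtain H where H: "H \<in> ring_hom R.P S.P"
    "\<And>m r. m \<in> carrier M \<Longrightarrow> r \<in> carrier R \<Longrightarrow> H (single R m r) = single S \<one>\<^bsub>M\<^esub> (h r) \<otimes>\<^bsub>S.P\<^esub> single S m \<one>\<^bsub>S\<^esub>"
  proof (rule R.mr_ring_lift[OF S.mr_cring, of "\<lambda>r. single S \<one>\<^bsub>M\<^esub> (h r)" "\<lambda>m. single S m \<one>\<^bsub>S\<^esub>"])
    show "(\<lambda>r. single S \<one>\<^bsub>M\<^esub> (h r)) \<in> ring_hom R S.P"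
      using h by (intro ring_hom_memI)
       (auto simp: S.single_closed ring_hom_closed ring_hom_add ring_hom_mult ring_hom_one S.single_mult
         add_hom_add[OF S.single_add_hom[OF one]] S.mr_simps(3))
  qed (auto simp: S.single_closed S.single_mult S.mr_simps(3))
  have H2: "H (single R m r) = single S m (h r)" if "m \<in> carrier M" "r \<in> carrier R" for m r
    using H(2)[OF that] that ring_hom_closed[OF h] by (simp add: S.single_mult)
  have eq: "H f = (\<lambda>m. h (f m))" if f: "f \<in> carrier R.P" for f
  proof
    fix k
    show "H f k = h (f k)"
      by (rule R.mr_add_hom_eq[OF add_hom_comp[OF ring_hom_add_hom[OF H(1)] S.coeff_add_hom]
            add_hom_comp[OF R.coeff_add_hom ring_hom_add_hom[OF h]] f])
        (simp only: H2, simp add: single_def hz)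
  qed
  show "(\<lambda>f m. h (f m)) \<in> ring_hom R.P S.P"
  proof (rule ring_hom_memI)
    show "(\<lambda>m. h (\<one>\<^bsub>R.P\<^esub> m)) = \<one>\<^bsub>S.P\<^esub>"
      using eq[of "\<one>\<^bsub>R.P\<^esub>"] ring_hom_one[OF H(1)] by (simp add: R.mr_simps R.single_closed)
  next
    fix f g assume f: "f \<in> carrier R.P" "g \<in> carrier R.P"
    then show "(\<lambda>m. h (f m)) \<in> carrier S.P" using ring_hom_closed[OF H(1) f(1)] by (simp add: eq)
    show "(\<lambda>m. h ((f \<otimes>\<^bsub>R.P\<^esub> g) m)) = (\<lambda>m. h (f m)) \<otimes>\<^bsub>S.P\<^esub> (\<lambda>m. h (g m))"
      using ring_hom_mult[OF H(1) f] f by (simp add: eq R.mult_closed)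
    show "(\<lambda>m. h ((f \<oplus>\<^bsub>R.P\<^esub> g) m)) = (\<lambda>m. h (f m)) \<oplus>\<^bsub>S.P\<^esub> (\<lambda>m. h (g m))"
      using ring_hom_add[OF H(1) f] f abelian_groupE(1)[OF R.mr_abelian f] by (simp add: eq)
  qed
qed

lemma free_comm_monoid_comm_monoid: "comm_monoid (free_comm_monoid S)"
  by (rule comm_monoidI) (auto simp: free_comm_monoid_def ac_simps)

lemma fcm_simps [simp]: "w \<in> carrier (free_comm_monoid S) \<longleftrightarrow> set_mset w \<subseteq> S"
  "w \<otimes>\<^bsub>free_comm_monoid S\<^esub> w' = w + w'" "\<one>\<^bsub>free_comm_monoid S\<^esub> = {#}"
  by (auto simp: free_comm_monoid_def)

section \<open>Quotients\<close>

locale quot = P?: cring P + I?: ideal I P for P (structure) and I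
begin

lemma quot_cring: "cring (P Quot I)" by (rule quotient_is_cring[OF P.is_cring])

lemma coset_hom: "(\<lambda>p. I +>\<^bsub>P\<^esub> p) \<in> ring_hom P (P Quot I)" by (rule rcos_ring_hom)

lemma quot_elem: "U \<in> carrier (P Quot I) \<longleftrightarrow> (\<exists>p\<in>carrier P. U = I +>\<^bsub>P\<^esub> p)"
  by (auto simp: FactRing_def A_RCOSETS_def' )

lemma coset_eq_iff:
  assumes "p \<in> carrier P" "q \<in> carrier P"
  shows "I +>\<^bsub>P\<^esub> p = I +>\<^bsub>P\<^esub> q \<longleftrightarrow> p \<ominus>\<^bsub>P\<^esub> q \<in> I"
  by (metis a_repr_independence' a_rcos_module_minus a_rcos_self assms P.ring_axioms)

text \<open>The value is taken at a representative chosen by \<open>SOME\<close>; two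
  representatives differ by an element of I, on which h vanishes.\<close>

lemma quot_lift:
  assumes N: "abelian_group N" and h: "h \<in> add_hom P N" and k: "\<And>i. i \<in> I \<Longrightarrow> h i = \<zero>\<^bsub>N\<^esub>"
  obtains h' where "h' \<in> add_hom (P Quot I) N" "\<And>p. p \<in> carrier P \<Longrightarrow> h' (I +>\<^bsub>P\<^esub> p) = h p"
proof
  interpret N: abelian_group N by fact
  define h' where "h' U = h (SOME p. p \<in> carrier P \<and> U = I +>\<^bsub>P\<^esub> p)" for U
  show *: "h' (I +>\<^bsub>P\<^esub> p) = h p" if p: "p \<in> carrier P" for p
  proof -
    define q where "q = (SOME q. q \<in> carrier P \<and> I +>\<^bsub>P\<^esub> p = I +>\<^bsub>P\<^esub> q)"
    have q: "q \<in> carrier P \<and> I +>\<^bsub>P\<^esub> p = I +>\<^bsub>P\<^esub> q" 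
      unfolding q_def by (rule someI[where P = "\<lambda>q. q \<in> carrier P \<and> I +>\<^bsub>P\<^esub> p = I +>\<^bsub>P\<^esub> q"]) (use p in simp)
    then have "h (p \<ominus>\<^bsub>P\<^esub> q) = \<zero>\<^bsub>N\<^esub>" using p coset_eq_iff k by auto
    then have "h p \<ominus>\<^bsub>N\<^esub> h q = \<zero>\<^bsub>N\<^esub>" using p q add_hom_minus[OF P.abelian_group_axioms N h] by auto
    then have "h p = h q" using p q add_hom_closed[OF h] 
      by (metis a_minus_def N.minus_equality N.minus_minus N.a_inv_closed add_hom_closed[OF h])
    then show ?thesis by (simp add: h'_def q_def)
  qed
  show "h' \<in> add_hom (P Quot I) N"
    using coset_hom
    by (intro add_homI) (auto simp: quot_elem * add_hom_closed[OF h] add_hom_add[OF h] ring_hom_add[OF coset_hom, symmetric])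
qed

lemma quot_ring_lift:
  assumes N: "cring N" and h: "h \<in> ring_hom P N" and k: "\<And>i. i \<in> I \<Longrightarrow> h i = \<zero>\<^bsub>N\<^esub>"
  obtains h' where "h' \<in> ring_hom (P Quot I) N" "\<And>p. p \<in> carrier P \<Longrightarrow> h' (I +>\<^bsub>P\<^esub> p) = h p"
proof -
  interpret N: cring N by fact
  obtain h' where h': "h' \<in> add_hom (P Quot I) N" "\<And>p. p \<in> carrier P \<Longrightarrow> h' (I +>\<^bsub>P\<^esub> p) = h p"
    using quot_lift[OF N.abelian_group_axioms ring_hom_add_hom[OF h] k] by blast
  have "h' \<in> ring_hom (P Quot I) N"
  proof (rule ring_hom_memI)
    fix U V assume "U \<in> carrier (P Quot I)" "V \<in> carrier (P Quot I)"
    then show "h' (U \<otimes>\<^bsub>P Quot I\<^esub> V) = h' U \<otimes>\<^bsub>N\<^esub> h' V"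
      by (auto simp: quot_elem h' ring_hom_mult[OF coset_hom, symmetric] ring_hom_mult[OF h])
  next
    show "h' \<one>\<^bsub>P Quot I\<^esub> = \<one>\<^bsub>N\<^esub>"
      by (simp add: ring_hom_one[OF coset_hom, symmetric] h' ring_hom_one[OF h])
  qed (auto simp: add_hom_closed[OF h'(1)] add_hom_add[OF h'(1)])
  then show thesis using h'(2) that by blast
qed

end

lemma ring_hom_zero_ideal:
  assumes P: "cring P" and N: "cring N" and h: "h \<in> ring_hom P N" and G: "G \<subseteq> carrier P"
    and k: "\<And>g. g \<in> G \<Longrightarrow> h g = \<zero>\<^bsub>N\<^esub>" and i: "i \<in> genideal P G"
  shows "h i = \<zero>\<^bsub>N\<^esub>"
proof -
  interpret P: cring P by fact
  interpret N: cring N by fact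
  interpret h: ring_hom_ring P N h using h P N by (auto intro!: ring_hom_ringI2 simp: cring_def)
  have "genideal P G \<subseteq> a_kernel P N h"
    by (rule P.genideal_minimal[OF h.kernel_is_ideal]) (unfold a_kernel_def', use G k in blast)
  then show ?thesis using i h.kernel_zero by blast
qed

lemma algebra_via_simps [simp]:
  "carrier (algebra_via S \<phi>) = carrier S" "\<zero>\<^bsub>algebra_via S \<phi>\<^esub> = \<zero>\<^bsub>S\<^esub>" "\<one>\<^bsub>algebra_via S \<phi>\<^esub> = \<one>\<^bsub>S\<^esub>"
  "u \<otimes>\<^bsub>algebra_via S \<phi>\<^esub> v = u \<otimes>\<^bsub>S\<^esub> v" "u \<oplus>\<^bsub>algebra_via S \<phi>\<^esub> v = u \<oplus>\<^bsub>S\<^esub> v"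
  "a \<odot>\<^bsub>algebra_via S \<phi>\<^esub> u = \<phi> a \<otimes>\<^bsub>S\<^esub> u"
  by (auto simp: algebra_via_def)

text \<open>\<open>algebra_via\<close> produces a record of another type than the ring it is built
  from, so the ring axioms are carried over field by field.\<close>

lemma cring_cong:
  assumes "cring S" "carrier T = carrier S" "ring.zero T = ring.zero S" "one T = one S"
    "monoid.mult T = monoid.mult S" "add T = add S"
  shows "cring T"
proof -
  interpret S: cring S by fact
  show ?thesis
  proof (intro cringI abelian_groupI comm_monoidI; unfold assms(2-))
    fix x assume "x \<in> carrier S"
    then show "\<exists>y\<in>carrier S. y \<oplus>\<^bsub>S\<^esub> x = \<zero>\<^bsub>S\<^esub>" using S.add.l_inv_ex by simp
  qed (use S.m_assoc S.m_comm S.a_assoc S.a_comm S.l_distr in auto)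
qed

lemma algebra_viaI:
  assumes A: "cring A" and S: "cring S" and \<phi>: "\<phi> \<in> ring_hom A S"
  shows "algebra A (algebra_via S \<phi>)"
proof -
  interpret A: cring A by fact
  interpret S: cring S by fact
  note \<phi>c = ring_hom_closed[OF \<phi>]
  show ?thesis
    by (rule algebraI[OF A cring_cong[OF S]])
      (auto simp: \<phi>c ring_hom_add[OF \<phi>] ring_hom_mult[OF \<phi>] ring_hom_one[OF \<phi>] S.l_distr S.r_distr S.m_assoc fun_eq_iff)
qed

section \<open>Divided power sequences\<close>

text \<open>Series f(t) = \<Sum> s(m) t^m of exponential type: the conditions say that s(m) behaves
  like x^m / m!. The sum in this module is the product of series, and a scalar a acts by f(t)
  \<mapsto> f(a t). Divided powers are represented by it, see \<open>dp_lift\<close>.\<close>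

definition edp :: "('s, 'x) ring_scheme \<Rightarrow> ('s, nat \<Rightarrow> 's) module"
  where "edp S =
    \<lparr>carrier = {s. (\<forall>m. s m \<in> carrier S) \<and> s 0 = \<one>\<^bsub>S\<^esub>
        \<and> (\<forall>m l. s m \<otimes>\<^bsub>S\<^esub> s l = add_pow S ((m + l) choose m) (s (m + l)))},
     monoid.mult = (\<lambda>s t. s), one = (\<lambda>m. if m = 0 then \<one>\<^bsub>S\<^esub> else \<zero>\<^bsub>S\<^esub>),
     ring.zero = (\<lambda>m. if m = 0 then \<one>\<^bsub>S\<^esub> else \<zero>\<^bsub>S\<^esub>),
     add = (\<lambda>s t m. \<Oplus>\<^bsub>S\<^esub>j\<in>{0..m}. s j \<otimes>\<^bsub>S\<^esub> t (m - j)),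
     smult = (\<lambda>a s m. a [^]\<^bsub>S\<^esub> m \<otimes>\<^bsub>S\<^esub> s m)\<rparr>"

lemma edp_carrier: "s \<in> carrier (edp S) \<longleftrightarrow> (\<forall>m. s m \<in> carrier S) \<and> s 0 = \<one>\<^bsub>S\<^esub>
        \<and> (\<forall>m l. s m \<otimes>\<^bsub>S\<^esub> s l = add_pow S ((m + l) choose m) (s (m + l)))"
  by (simp add: edp_def)

lemma edp_simps: "\<zero>\<^bsub>edp S\<^esub> = (\<lambda>m. if m = 0 then \<one>\<^bsub>S\<^esub> else \<zero>\<^bsub>S\<^esub>)"
  "s \<oplus>\<^bsub>edp S\<^esub> t = (\<lambda>m. \<Oplus>\<^bsub>S\<^esub>j\<in>{..m}. s j \<otimes>\<^bsub>S\<^esub> t (m - j))"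
  "a \<odot>\<^bsub>edp S\<^esub> s = (\<lambda>m. a [^]\<^bsub>S\<^esub> m \<otimes>\<^bsub>S\<^esub> s m)"
  by (simp_all add: edp_def atMost_atLeast0)

lemma edp_closed: "s \<in> carrier (edp S) \<Longrightarrow> s m \<in> carrier S"
  by (simp add: edp_carrier)

text \<open>Collecting a product of two convolutions by p = j + k produces these coefficients. It is
  Vandermonde's identity; the indices lost by the bound on the second component are those where one
  of the binomial coefficients vanishes.\<close>

lemma sum_binomial_binomial:
  fixes p m l :: nat
  assumes "p \<le> m + l"
  shows "(\<Sum>j\<in>{q\<in>{..m} \<times> {..l}. fst q + snd q = p}. (p choose fst j) * ((m + l - p) choose (m - fst j)))
    = (m + l) choose m"
proof -
  let ?g = "\<lambda>j. (p choose j) * ((m + l - p) choose (m - j))"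
  have "(\<Sum>j\<in>{q\<in>{..m} \<times> {..l}. fst q + snd q = p}. ?g (fst j)) = (\<Sum>j\<in>{j\<in>{..m}. j \<le> p \<and> p - j \<le> l}. ?g j)"
    by (rule sum.reindex_bij_witness[of _ "\<lambda>j. (j, p - j)" fst]) auto
  also have "\<dots> = (\<Sum>j\<le>m. ?g j)"
  proof (rule sum.mono_neutral_left)
    show "\<forall>j\<in>{..m} - {j \<in> {..m}. j \<le> p \<and> p - j \<le> l}. ?g j = 0"
    proof
      fix j assume "j \<in> {..m} - {j \<in> {..m}. j \<le> p \<and> p - j \<le> l}"
      then have "p < j \<or> m + l - p < m - j" using assms by auto
      then show "?g j = 0" by auto
    qed
  qed auto
  also have "\<dots> = (m + l) choose m" using vandermonde[of p "m + l - p" m] assms by simp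
  finally show ?thesis .
qed

section \<open>The module of exponential sequences over a ring\<close>

context cring
begin

text \<open>A term of the product is s(j) t(m-j) s(k) t(l-k), and the product rules for s and t turn
  it into a multiple of s(j+k) t(m+l-j-k). For fixed p = j + k the multiples add up to
  \<open>(m + l) choose m\<close> by \<open>sum_binomial_binomial\<close>.\<close>

lemma edp_conv_closed:
  assumes "s \<in> carrier (edp R)" "t \<in> carrier (edp R)"
  shows "s \<oplus>\<^bsub>edp R\<^esub> t \<in> carrier (edp R)"
proof -
  have c: "s m \<in> carrier R" "t m \<in> carrier R" for m using assms by (auto simp: edp_closed)
  have st: "s m \<otimes> s l = add_pow R ((m + l) choose m) (s (m + l))"
    "t m \<otimes> t l = add_pow R ((m + l) choose m) (t (m + l))" for m l using assms by (auto simp: edp_carrier)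
  have "(\<Oplus>j\<in>{..m}. s j \<otimes> t (m - j)) \<otimes> (\<Oplus>k\<in>{..l}. s k \<otimes> t (l - k))
     = add_pow R ((m + l) choose m) (\<Oplus>p\<in>{..m + l}. s p \<otimes> t (m + l - p))" for m l
  proof -
    let ?c = "\<lambda>q p. (p choose fst q) * ((m + l - p) choose (m - fst q))"
    have "(\<Oplus>j\<in>{..m}. s j \<otimes> t (m - j)) \<otimes> (\<Oplus>k\<in>{..l}. s k \<otimes> t (l - k))
      = (\<Oplus>q\<in>{..m} \<times> {..l}. (s (fst q) \<otimes> t (m - fst q)) \<otimes> (s (snd q) \<otimes> t (l - snd q)))"
      using c by (intro finsum_mult_finsum) auto
    also have "\<dots> = (\<Oplus>q\<in>{..m} \<times> {..l}. add_pow R (?c q (fst q + snd q)) (s (fst q + snd q) \<otimes> t (m + l - (fst q + snd q))))"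
    proof (rule finsum_cong')
      fix q assume q: "q \<in> {..m} \<times> {..l}"
      obtain j k where jk: "q = (j, k)" by (cases q)
      have e: "(m - j) + (l - k) = m + l - (j + k)" using q jk by auto
      have "(s j \<otimes> t (m - j)) \<otimes> (s k \<otimes> t (l - k)) = (s j \<otimes> s k) \<otimes> (t (m - j) \<otimes> t (l - k))"
        using c by (simp add: m_ac)
      also have "\<dots> = add_pow R (j + k choose j) (s (j + k)) \<otimes> add_pow R ((m + l - (j + k)) choose (m - j)) (t (m + l - (j + k)))"
        using e by (simp add: st)
      also have "\<dots> = add_pow R (?c q (j + k)) (s (j + k) \<otimes> t (m + l - (j + k)))"
        using c jk by (simp add: add_pow_ldistr add_pow_rdistr add.nat_pow_pow mult.commute)
      finally show "(s (fst q) \<otimes> t (m - fst q)) \<otimes> (s (snd q) \<otimes> t (l - snd q))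
        = add_pow R (?c q (fst q + snd q)) (s (fst q + snd q) \<otimes> t (m + l - (fst q + snd q)))" using jk by simp
    qed (use c in auto)
    also have "\<dots> = (\<Oplus>p\<in>{..m + l}. \<Oplus>q\<in>{q\<in>{..m} \<times> {..l}. fst q + snd q = p}.
        add_pow R (?c q (fst q + snd q)) (s (fst q + snd q) \<otimes> t (m + l - (fst q + snd q))))"
      using c by (intro add.finprod_group) auto
    also have "\<dots> = (\<Oplus>p\<in>{..m + l}. add_pow R ((m + l) choose m) (s p \<otimes> t (m + l - p)))"
    proof (rule finsum_cong')
      fix p assume p: "p \<in> {..m + l}"
      have "(\<Oplus>q\<in>{q\<in>{..m} \<times> {..l}. fst q + snd q = p}.
          add_pow R (?c q (fst q + snd q)) (s (fst q + snd q) \<otimes> t (m + l - (fst q + snd q))))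
        = (\<Oplus>q\<in>{q\<in>{..m} \<times> {..l}. fst q + snd q = p}. add_pow R (?c q p) (s p \<otimes> t (m + l - p)))"
        using c by (intro finsum_cong') auto
      also have "\<dots> = add_pow R ((m + l) choose m) (s p \<otimes> t (m + l - p))"
        using c p sum_binomial_binomial[of p m l] by (subst finsum_add_pow) auto
      finally show "(\<Oplus>q\<in>{q\<in>{..m} \<times> {..l}. fst q + snd q = p}.
          add_pow R (?c q (fst q + snd q)) (s (fst q + snd q) \<otimes> t (m + l - (fst q + snd q))))
        = add_pow R ((m + l) choose m) (s p \<otimes> t (m + l - p))" .
    qed (use c in auto)
    also have "\<dots> = add_pow R ((m + l) choose m) (\<Oplus>p\<in>{..m + l}. s p \<otimes> t (m + l - p))"
    proof (rule add_hom_finsum[symmetric])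
      show "(\<lambda>u. add_pow R ((m + l) choose m) u) \<in> add_hom R R"
        by (rule add_homI) (auto simp: add.nat_pow_distrib)
    qed (use c abelian_group_axioms in auto)
    finally show ?thesis .
  qed
  then show ?thesis using c assms by (auto simp: edp_carrier edp_simps)
qed

lemma edp_conv_comm:
  assumes "\<And>m. s m \<in> carrier R" "\<And>m. t m \<in> carrier R"
  shows "(\<Oplus>j\<in>{..m}. s j \<otimes> t (m - j)) = (\<Oplus>j\<in>{..m::nat}. t j \<otimes> s (m - j))"
proof -
  have "bij_betw (\<lambda>j. m - j) {..m} {..m}" by (rule bij_betw_byWitness[of _ "\<lambda>j. m - j"]) auto
  from add.finprod_bij[OF this, of "\<lambda>j. s j \<otimes> t (m - j)"]
  have "(\<Oplus>j\<in>{..m}. s j \<otimes> t (m - j)) = (\<Oplus>j\<in>{..m}. s (m - j) \<otimes> t (m - (m - j)))" using assms by auto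
  also have "\<dots> = (\<Oplus>j\<in>{..m}. t j \<otimes> s (m - j))"
    using assms by (intro finsum_cong') (auto simp: m_comm)
  finally show ?thesis .
qed

lemma edp_conv_assoc:
  assumes c: "\<And>m. s m \<in> carrier R" "\<And>m. t m \<in> carrier R" "\<And>m. u m \<in> carrier R"
  shows "(\<Oplus>j\<in>{..m}. (\<Oplus>i\<in>{..j}. s i \<otimes> t (j - i)) \<otimes> u (m - j))
    = (\<Oplus>i\<in>{..m::nat}. s i \<otimes> (\<Oplus>k\<in>{..m - i}. t k \<otimes> u (m - i - k)))"
proof -
  have "(\<Oplus>j\<in>{..m}. (\<Oplus>i\<in>{..j}. s i \<otimes> t (j - i)) \<otimes> u (m - j)) = (\<Oplus>j\<in>{..m}. \<Oplus>i\<in>{..j}. (s i \<otimes> t (j - i)) \<otimes> u (m - j))"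
    using c by (intro finsum_cong') (auto intro!: finsum_ldistr)
  also have "\<dots> = (\<Oplus>p\<in>Sigma {..m} (\<lambda>j. {..j}). (s (snd p) \<otimes> t (fst p - snd p)) \<otimes> u (m - fst p))"
    using c by (intro add.finprod_Sigma) auto
  also have "\<dots> = (\<Oplus>p\<in>Sigma {..m} (\<lambda>j. {..j}). (\<lambda>q. s (fst q) \<otimes> (t (snd q) \<otimes> u (m - fst q - snd q))) (snd p, fst p - snd p))"
    using c by (intro finsum_cong') (auto simp: m_assoc)
  also have "\<dots> = (\<Oplus>q\<in>Sigma {..m} (\<lambda>i. {..m - i}). s (fst q) \<otimes> (t (snd q) \<otimes> u (m - fst q - snd q)))"
  proof (rule add.finprod_bij)
    show "bij_betw (\<lambda>p. (snd p, fst p - snd p)) (Sigma {..m} (\<lambda>j. {..j})) (Sigma {..m} (\<lambda>i. {..m - i}))"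
      by (rule bij_betw_byWitness[of _ "\<lambda>q. (fst q + snd q, fst q)"]) auto
  qed (use c in auto)
  also have "\<dots> = (\<Oplus>i\<in>{..m}. \<Oplus>k\<in>{..m - i}. s i \<otimes> (t k \<otimes> u (m - i - k)))"
    using c by (intro add.finprod_Sigma[symmetric]) auto
  also have "\<dots> = (\<Oplus>i\<in>{..m}. s i \<otimes> (\<Oplus>k\<in>{..m - i}. t k \<otimes> u (m - i - k)))"
    using c by (intro finsum_cong') (auto intro!: finsum_rdistr[symmetric])
  finally show ?thesis .
qed

lemma zero_nat_pow: "\<zero> [^] (m::nat) = (if m = 0 then \<one> else \<zero>)"
  by (cases m) auto

lemma edp_smult_closed:
  assumes "a \<in> carrier R" "s \<in> carrier (edp R)" shows "a \<odot>\<^bsub>edp R\<^esub> s \<in> carrier (edp R)"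
proof -
  have c: "s m \<in> carrier R" for m using assms by (auto simp: edp_closed)
  have "(a [^] m \<otimes> s m) \<otimes> (a [^] l \<otimes> s l) = add_pow R ((m + l) choose m) (a [^] (m + l) \<otimes> s (m + l))" for m l
  proof -
    have "(a [^] m \<otimes> s m) \<otimes> (a [^] l \<otimes> s l) = a [^] (m + l) \<otimes> (s m \<otimes> s l)"
      using c assms by (simp add: m_ac nat_pow_mult[symmetric])
    then show ?thesis using c assms by (simp add: edp_carrier add_pow_rdistr)
  qed
  then show ?thesis using assms c by (auto simp: edp_carrier edp_simps)
qed

text \<open>The product rule enters here: s(j) s(m-j) is \<open>m choose j\<close> times s(m), which
  matches the binomial expansion of the m-th power of a + b.\<close>

lemma edp_smult_add:
  assumes "a \<in> carrier R" "b \<in> carrier R" "s \<in> carrier (edp R)"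
  shows "(a \<oplus> b) \<odot>\<^bsub>edp R\<^esub> s = a \<odot>\<^bsub>edp R\<^esub> s \<oplus>\<^bsub>edp R\<^esub> b \<odot>\<^bsub>edp R\<^esub> s"
proof
  fix m
  have c: "s m \<in> carrier R" for m using assms by (auto simp: edp_closed)
  have "(a \<oplus> b) [^] m \<otimes> s m = (\<Oplus>j\<in>{..m}. add_pow R (m choose j) (a [^] j \<otimes> b [^] (m - j)) \<otimes> s m)"
    using assms c by (simp add: binomial_theorem finsum_ldistr)
  also have "\<dots> = (\<Oplus>j\<in>{..m}. (a [^] j \<otimes> s j) \<otimes> (b [^] (m - j) \<otimes> s (m - j)))"
  proof (rule finsum_cong')
    fix j assume "j \<in> {..m}"
    then have e: "s j \<otimes> s (m - j) = add_pow R (m choose j) (s m)" using assms by (simp add: edp_carrier)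
    have "(a [^] j \<otimes> s j) \<otimes> (b [^] (m - j) \<otimes> s (m - j)) = (a [^] j \<otimes> b [^] (m - j)) \<otimes> (s j \<otimes> s (m - j))"
      using assms c by (simp add: m_ac)
    also have "\<dots> = add_pow R (m choose j) (a [^] j \<otimes> b [^] (m - j)) \<otimes> s m"
      using assms c by (simp add: e add_pow_ldistr add_pow_rdistr)
    finally show "add_pow R (m choose j) (a [^] j \<otimes> b [^] (m - j)) \<otimes> s m = (a [^] j \<otimes> s j) \<otimes> (b [^] (m - j) \<otimes> s (m - j))" ..
  qed (use assms c in auto)
  finally show "((a \<oplus> b) \<odot>\<^bsub>edp R\<^esub> s) m = (a \<odot>\<^bsub>edp R\<^esub> s \<oplus>\<^bsub>edp R\<^esub> b \<odot>\<^bsub>edp R\<^esub> s) m"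
    by (simp add: edp_simps)
qed

lemma edp_zero_smult:
  assumes "s \<in> carrier (edp R)" shows "\<zero> \<odot>\<^bsub>edp R\<^esub> s = \<zero>\<^bsub>edp R\<^esub>"
  using assms by (auto simp: edp_simps zero_nat_pow edp_carrier fun_eq_iff)

lemma edp_one_smult:
  assumes "s \<in> carrier (edp R)" shows "\<one> \<odot>\<^bsub>edp R\<^esub> s = s"
  using assms by (auto simp: edp_simps edp_carrier fun_eq_iff)

lemma edp_zero_closed: "\<zero>\<^bsub>edp R\<^esub> \<in> carrier (edp R)"
  by (auto simp: edp_simps edp_carrier)

lemma edp_zero_add: assumes "s \<in> carrier (edp R)" shows "\<zero>\<^bsub>edp R\<^esub> \<oplus>\<^bsub>edp R\<^esub> s = s"
proof
  fix m
  have c: "s m \<in> carrier R" for m using assms by (auto simp: edp_closed)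
  have "(\<Oplus>j\<in>{..m}. (if j = 0 then \<one> else \<zero>) \<otimes> s (m - j)) = (\<Oplus>j\<in>{..m}. if 0 = j then s (m - j) else \<zero>)"
    using c by (intro finsum_cong') auto
  also have "\<dots> = s (m - 0)" using c by (intro finsum_singleton) auto
  finally show "(\<zero>\<^bsub>edp R\<^esub> \<oplus>\<^bsub>edp R\<^esub> s) m = s m" by (simp add: edp_simps)
qed

lemma edp_abelian: "abelian_group (edp R)"
proof (rule abelian_groupI)
  fix s t u assume stu: "s \<in> carrier (edp R)" "t \<in> carrier (edp R)" "u \<in> carrier (edp R)"
  then have c: "s m \<in> carrier R" "t m \<in> carrier R" "u m \<in> carrier R" for m by (auto simp: edp_closed)
  show "(s \<oplus>\<^bsub>edp R\<^esub> t) \<oplus>\<^bsub>edp R\<^esub> u = s \<oplus>\<^bsub>edp R\<^esub> (t \<oplus>\<^bsub>edp R\<^esub> u)"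
    unfolding edp_simps by (rule ext, rule edp_conv_assoc) (rule c)+
next
  fix s t assume st: "s \<in> carrier (edp R)" "t \<in> carrier (edp R)"
  then have c: "s m \<in> carrier R" "t m \<in> carrier R" for m by (auto simp: edp_closed)
  show "s \<oplus>\<^bsub>edp R\<^esub> t = t \<oplus>\<^bsub>edp R\<^esub> s" unfolding edp_simps by (rule ext, rule edp_conv_comm) (rule c)+
  show "s \<oplus>\<^bsub>edp R\<^esub> t \<in> carrier (edp R)" using st by (rule edp_conv_closed)
next
  fix s assume s: "s \<in> carrier (edp R)"
  \<comment> \<open>The inverse of f(t) is f(-t), the action of -1 on s: by
    \<open>edp_smult_add\<close> their sum is the action of 0, which gives the constant series
    1.\<close>
  have "(\<ominus> \<one>) \<odot>\<^bsub>edp R\<^esub> s \<oplus>\<^bsub>edp R\<^esub> \<one> \<odot>\<^bsub>edp R\<^esub> s = \<zero>\<^bsub>edp R\<^esub>"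
    using s edp_smult_add[of "\<ominus> \<one>" \<one> s] by (simp add: l_neg edp_zero_smult)
  then show "\<exists>t\<in>carrier (edp R). t \<oplus>\<^bsub>edp R\<^esub> s = \<zero>\<^bsub>edp R\<^esub>"
    using s by (intro bexI[of _ "(\<ominus> \<one>) \<odot>\<^bsub>edp R\<^esub> s"]) (auto simp: edp_one_smult edp_smult_closed)
qed (auto simp: edp_zero_closed edp_zero_add)

lemma edp_module: "module R (edp R)"
proof (rule moduleI[OF is_cring edp_abelian])
  fix a s t assume a: "a \<in> carrier R" and st: "s \<in> carrier (edp R)" "t \<in> carrier (edp R)"
  then have c: "s m \<in> carrier R" "t m \<in> carrier R" for m by (auto simp: edp_closed)
  show "a \<odot>\<^bsub>edp R\<^esub> (s \<oplus>\<^bsub>edp R\<^esub> t) = a \<odot>\<^bsub>edp R\<^esub> s \<oplus>\<^bsub>edp R\<^esub> a \<odot>\<^bsub>edp R\<^esub> t"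
  proof
    fix m
    have "a [^] m \<otimes> (\<Oplus>j\<in>{..m}. s j \<otimes> t (m - j)) = (\<Oplus>j\<in>{..m}. a [^] m \<otimes> (s j \<otimes> t (m - j)))"
      using a c by (intro finsum_rdistr) auto
    also have "\<dots> = (\<Oplus>j\<in>{..m}. (a [^] j \<otimes> s j) \<otimes> (a [^] (m - j) \<otimes> t (m - j)))"
    proof (rule finsum_cong')
      fix j assume "j \<in> {..m}"
      then have "a [^] m = a [^] j \<otimes> a [^] (m - j)" using a by (simp add: nat_pow_mult)
      then show "a [^] m \<otimes> (s j \<otimes> t (m - j)) = (a [^] j \<otimes> s j) \<otimes> (a [^] (m - j) \<otimes> t (m - j))"
        using a c by (simp add: m_ac)
    qed (use a c in auto)
    finally show "(a \<odot>\<^bsub>edp R\<^esub> (s \<oplus>\<^bsub>edp R\<^esub> t)) m = (a \<odot>\<^bsub>edp R\<^esub> s \<oplus>\<^bsub>edp R\<^esub> a \<odot>\<^bsub>edp R\<^esub> t) m"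
      by (simp add: edp_simps)
  qed
next
  fix a b s assume "a \<in> carrier R" "b \<in> carrier R" "s \<in> carrier (edp R)"
  then show "(a \<otimes> b) \<odot>\<^bsub>edp R\<^esub> s = a \<odot>\<^bsub>edp R\<^esub> (b \<odot>\<^bsub>edp R\<^esub> s)"
    by (simp add: edp_simps edp_closed nat_pow_distrib m_assoc)
qed (auto simp: edp_smult_closed edp_smult_add edp_one_smult)

end

lemma edp_map:
  assumes R: "cring R" and S: "cring S" and h: "h \<in> ring_hom R S"
  shows "(\<lambda>s m. h (s m)) \<in> add_hom (edp R) (edp S)"
    and "\<And>a s. a \<in> carrier R \<Longrightarrow> s \<in> carrier (edp R) \<Longrightarrow> (\<lambda>m. h ((a \<odot>\<^bsub>edp R\<^esub> s) m)) = h a \<odot>\<^bsub>edp S\<^esub> (\<lambda>m. h (s m))"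
proof -
  interpret R: cring R by fact
  interpret S: cring S by fact
  interpret h: ring_hom_cring R S h using h by unfold_locales
  note np = add_hom_nat_pow[OF R.abelian_group_axioms S.abelian_group_axioms ring_hom_add_hom[OF h]]
  show "(\<lambda>s m. h (s m)) \<in> add_hom (edp R) (edp S)"
  proof (rule add_homI)
    fix s assume s: "s \<in> carrier (edp R)"
    have "h (s m) \<otimes>\<^bsub>S\<^esub> h (s l) = add_pow S ((m + l) choose m) (h (s (m + l)))" for m l
      using s np[of "s (m + l)"] h.hom_mult[of "s m" "s l", symmetric]
      by (simp add: edp_carrier del: h.hom_mult)
    then show "(\<lambda>m. h (s m)) \<in> carrier (edp S)" using s by (auto simp: edp_carrier)
  next
    fix s t assume st: "s \<in> carrier (edp R)" "t \<in> carrier (edp R)"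
    then show "(\<lambda>m. h ((s \<oplus>\<^bsub>edp R\<^esub> t) m)) = (\<lambda>m. h (s m)) \<oplus>\<^bsub>edp S\<^esub> (\<lambda>m. h (t m))"
      by (auto simp: edp_simps edp_closed fun_eq_iff intro!: S.finsum_cong')
  qed
  fix a s assume "a \<in> carrier R" "s \<in> carrier (edp R)"
  then show "(\<lambda>m. h ((a \<odot>\<^bsub>edp R\<^esub> s) m)) = h a \<odot>\<^bsub>edp S\<^esub> (\<lambda>m. h (s m))"
    by (auto simp: edp_simps edp_closed fun_eq_iff h.ring.hom_nat_pow)
qed

text \<open>A multi-index over \<open>insert i I\<close> is the multiplicity of i together with a
  multi-index over I; this is the induction step of \<open>edp_finsum\<close>.\<close>

lemma bij_multisets_of_size_insert:
  assumes "i \<notin> I"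
  shows "bij_betw (\<lambda>p. replicate_mset (fst p) i + snd p) (Sigma {..m} (\<lambda>j. multisets_of_size I (m - j))) (multisets_of_size (insert i I) m)"
proof (rule bij_betw_byWitness[of _ "\<lambda>c. (count c i, filter_mset (\<lambda>k. k \<noteq> i) c)"])
  have z: "count c i = 0" if "c \<in> multisets_of_size I k" for c k using that assms by (auto simp: multisets_of_size_def not_in_iff[symmetric])
  have f: "filter_mset (\<lambda>k. k \<noteq> i) c = c" if "c \<in> multisets_of_size I k" for c k
    using that assms by (auto simp: multisets_of_size_def filter_mset_eq_conv)
  show "\<forall>p\<in>Sigma {..m} (\<lambda>j. multisets_of_size I (m - j)).
      (count (replicate_mset (fst p) i + snd p) i, filter_mset (\<lambda>k. k \<noteq> i) (replicate_mset (fst p) i + snd p)) = p"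
    using z f by auto
  have e: "replicate_mset (count c i) i + filter_mset (\<lambda>k. k \<noteq> i) c = c" for c
    by (rule multiset_eqI) auto
  then show "\<forall>c\<in>multisets_of_size (insert i I) m. replicate_mset (fst (count c i, filter_mset (\<lambda>k. k \<noteq> i) c)) i
      + snd (count c i, filter_mset (\<lambda>k. k \<noteq> i) c) = c" by simp
  show "(\<lambda>p. replicate_mset (fst p) i + snd p) ` Sigma {..m} (\<lambda>j. multisets_of_size I (m - j)) \<subseteq> multisets_of_size (insert i I) m"
    by (auto simp: multisets_of_size_def split: if_splits)
  have "count c i + size (filter_mset (\<lambda>k. k \<noteq> i) c) = size c" for c
    using arg_cong[OF e[of c], of size] by simp
  then have "count c i \<le> size c" "size (filter_mset (\<lambda>k. k \<noteq> i) c) = size c - count c i" for c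
    by (metis le_add1, metis diff_add_inverse)
  then show "(\<lambda>c. (count c i, filter_mset (\<lambda>k. k \<noteq> i) c)) ` multisets_of_size (insert i I) m \<subseteq> Sigma {..m} (\<lambda>j. multisets_of_size I (m - j))"
    by (auto simp: multisets_of_size_def)
qed

context cring
begin

text \<open>The m-th coefficient of a product of finitely many series. A multi-index is encoded as a
  multiset, \<open>count c i\<close> being the exponent at i.\<close>

lemma edp_finsum:
  fixes I :: "'i set"
  assumes "finite I" "\<And>i. i \<in> I \<Longrightarrow> s i \<in> carrier (edp R)"
  shows "finsum (edp R) s I m = (\<Oplus>c\<in>multisets_of_size I m. \<Otimes>i\<in>I. s i (count c i))"
  using assms
proof (induct I arbitrary: m rule: finite_induct)
  case empty
  interpret E: abelian_group "edp R" by (rule edp_abelian)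
  have "multisets_of_size ({} :: 'i set) m = (if m = 0 then {{#}} else {})" by (auto simp: multisets_of_size_def)
  then show ?case by (cases "m = 0") (simp_all add: edp_simps)
next
  case (insert i I)
  interpret E: abelian_group "edp R" by (rule edp_abelian)
  have c: "s i m \<in> carrier R" "k \<in> I \<Longrightarrow> s k m \<in> carrier R" for m k
    using insert(4)[of i] insert(4)[of k] by (auto simp: edp_closed)
  have pc: "(\<Otimes>k\<in>I. s k (count d k)) \<in> carrier R" for d using c by auto
  have "finsum (edp R) s (insert i I) m = (s i \<oplus>\<^bsub>edp R\<^esub> finsum (edp R) s I) m"
    using insert by (subst E.finsum_insert) auto
  also have "\<dots> = (\<Oplus>j\<in>{..m}. s i j \<otimes> (\<Oplus>d\<in>multisets_of_size I (m - j). \<Otimes>k\<in>I. s k (count d k)))"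
    using insert by (simp add: edp_simps)
  also have "\<dots> = (\<Oplus>j\<in>{..m}. \<Oplus>d\<in>multisets_of_size I (m - j). s i j \<otimes> (\<Otimes>k\<in>I. s k (count d k)))"
    using c insert(1) by (intro finsum_cong') (auto intro!: finsum_rdistr finite_multisets_of_size finsum_closed)
  also have "\<dots> = (\<Oplus>p\<in>Sigma {..m} (\<lambda>j. multisets_of_size I (m - j)). s i (fst p) \<otimes> (\<Otimes>k\<in>I. s k (count (snd p) k)))"
    using c insert(1) by (intro add.finprod_Sigma) (auto simp: finite_multisets_of_size)
  also have "\<dots> = (\<Oplus>p\<in>Sigma {..m} (\<lambda>j. multisets_of_size I (m - j)).
      (\<lambda>d. \<Otimes>k\<in>insert i I. s k (count d k)) (replicate_mset (fst p) i + snd p))"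
  proof (rule finsum_cong')
    fix p assume "p \<in> Sigma {..m} (\<lambda>j. multisets_of_size I (m - j))"
    then have "count (snd p) i = 0" using insert(2) by (auto simp: multisets_of_size_def not_in_iff[symmetric])
    moreover have "(\<Otimes>k\<in>I. s k (count (replicate_mset (fst p) i + snd p) k)) = (\<Otimes>k\<in>I. s k (count (snd p) k))"
      using insert(2) c by (intro finprod_cong') auto
    ultimately show "s i (fst p) \<otimes> (\<Otimes>k\<in>I. s k (count (snd p) k))
       = (\<lambda>d. \<Otimes>k\<in>insert i I. s k (count d k)) (replicate_mset (fst p) i + snd p)"
      using insert(1,2) c by (subst finprod_insert) auto
  qed (use insert c in auto)
  also have "\<dots> = (\<Oplus>d\<in>multisets_of_size (insert i I) m. \<Otimes>k\<in>insert i I. s k (count d k))"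
    using insert c by (intro add.finprod_bij bij_multisets_of_size_insert) auto
  finally show ?case .
qed

end

section \<open>The divided power algebra\<close>

context cring
begin

text \<open>The value of the monomial w when each variable i is replaced by \<open>g i\<close>;
  \<open>finprod\<close> runs over a set, hence the explicit powers.\<close>

definition mset_prod :: "('i \<Rightarrow> 'a) \<Rightarrow> 'i multiset \<Rightarrow> 'a"
  where "mset_prod g w = (\<Otimes>i\<in>set_mset w. g i [^] count w i)"

lemma mset_prod_extend:
  assumes "finite U" "set_mset w \<subseteq> U" "\<And>i. i \<in> U \<Longrightarrow> g i \<in> carrier R"
  shows "mset_prod g w = (\<Otimes>i\<in>U. g i [^] count w i)"
  unfolding mset_prod_def using assms
  by (intro finprod_mono_neutral_cong_left) (auto simp: not_in_iff)

lemma mset_prod_union: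
  assumes "\<And>i. i \<in># w + w' \<Longrightarrow> g i \<in> carrier R"
  shows "mset_prod g (w + w') = mset_prod g w \<otimes> mset_prod g w'"
proof -
  let ?U = "set_mset (w + w')"
  have "mset_prod g (w + w') = (\<Otimes>i\<in>?U. g i [^] count w i \<otimes> g i [^] count w' i)"
    unfolding mset_prod_def using assms by (intro finprod_cong') (auto simp: nat_pow_mult)
  also have "\<dots> = (\<Otimes>i\<in>?U. g i [^] count w i) \<otimes> (\<Otimes>i\<in>?U. g i [^] count w' i)"
    using assms by (intro finprod_multf) auto
  also have "\<dots> = mset_prod g w \<otimes> mset_prod g w'"
    using assms by (intro arg_cong2[where f = "(\<otimes>)"] mset_prod_extend[symmetric]) auto
  finally show ?thesis .
qed

lemma mset_prod_simps:
  "mset_prod g {#} = \<one>" "g i \<in> carrier R \<Longrightarrow> mset_prod g {#i#} = g i"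
  by (auto simp: mset_prod_def)

lemma mset_prod_closed: "(\<And>i. i \<in># w \<Longrightarrow> g i \<in> carrier R) \<Longrightarrow> mset_prod g w \<in> carrier R"
  unfolding mset_prod_def by (rule finprod_closed) auto

end

locale dpow = module A M
  for A :: "('a, 'x) ring_scheme" (structure) and M :: "('a, 'm, 'y) module_scheme" (structure)
begin

abbreviation "PP \<equiv> dp_poly A M"
abbreviation "DI \<equiv> dp_ideal A M"
abbreviation "G \<equiv> dp_algebra A M"
abbreviation "\<gamma> \<equiv> gam A M"
abbreviation "cls p \<equiv> DI +>\<^bsub>PP\<^esub> p"

sublocale mr: monring A "free_comm_monoid ((UNIV :: nat set) \<times> carrier M)"
  rewrites "monoid_ring A (free_comm_monoid ((UNIV :: nat set) \<times> carrier M)) = PP"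
  by (auto simp: monring_def R.is_cring free_comm_monoid_comm_monoid dp_poly_def)

sublocale PP: cring PP by (rule mr.mr_cring)

definition rels where "rels = (let P = dp_poly A M; g = dp_var A in
     ({g 0 x \<ominus>\<^bsub>P\<^esub> \<one>\<^bsub>P\<^esub> | x. x \<in> carrier M}
      \<union> {g m (c \<odot>\<^bsub>M\<^esub> x) \<ominus>\<^bsub>P\<^esub> dp_const A (c [^]\<^bsub>A\<^esub> m) \<otimes>\<^bsub>P\<^esub> g m x | m c x.
          c \<in> carrier A \<and> x \<in> carrier M}
      \<union> {g m (x \<oplus>\<^bsub>M\<^esub> y) \<ominus>\<^bsub>P\<^esub> (\<Oplus>\<^bsub>P\<^esub>j\<in>{0..m}. g j x \<otimes>\<^bsub>P\<^esub> g (m - j) y) | m x y.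
          x \<in> carrier M \<and> y \<in> carrier M}
      \<union> {g m x \<otimes>\<^bsub>P\<^esub> g l x \<ominus>\<^bsub>P\<^esub> add_pow P ((m + l) choose m) (g (m + l) x) | m l x.
          x \<in> carrier M}))"

lemma DI_eq: "DI = genideal PP rels"
  by (simp add: dp_ideal_def rels_def Let_def)

lemma var_closed: "x \<in> carrier M \<Longrightarrow> dp_var A m x \<in> carrier PP"
  unfolding dp_var_def by (rule mr.single_closed) auto

lemma const_closed: "a \<in> carrier A \<Longrightarrow> dp_const A a \<in> carrier PP"
  unfolding dp_const_def by (rule mr.single_closed) auto

lemma rels_closed: "rels \<subseteq> carrier PP"
  by (auto simp: rels_def Let_def var_closed const_closed)

sublocale Q: quot PP DI
  unfolding quot_def DI_eq by (simp add: PP.is_cring PP.genideal_ideal rels_closed)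

lemma const_hom: "dp_const A \<in> ring_hom A PP"
proof (rule ring_hom_memI)
  fix a b assume "a \<in> carrier A" "b \<in> carrier A"
  then show "dp_const A (a \<oplus>\<^bsub>A\<^esub> b) = dp_const A a \<oplus>\<^bsub>PP\<^esub> dp_const A b"
    "dp_const A (a \<otimes>\<^bsub>A\<^esub> b) = dp_const A a \<otimes>\<^bsub>PP\<^esub> dp_const A b"
    unfolding dp_const_def using add_hom_add[OF mr.single_add_hom[of "{#}"]] mr.single_mult[of "{#}" "{#}"] by simp_all
qed (simp_all add: const_closed, simp add: dp_const_def mr.mr_simps)

lemma G_algebra: "algebra A G"
  unfolding dp_algebra_def
  by (rule algebra_viaI[OF R.is_cring Q.quot_cring]) (rule ring_hom_comp[OF const_hom Q.coset_hom])

sublocale G: cring G by (rule algebra.M_cring[OF G_algebra])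

sublocale GA: algebra A G by (rule G_algebra)

lemma cls_hom: "(\<lambda>p. cls p) \<in> ring_hom PP G"
  using Q.coset_hom unfolding ring_hom_def dp_algebra_def by simp

sublocale cls: ring_hom_cring PP G "\<lambda>p. cls p"
  using cls_hom by unfold_locales

lemma G_elem: "U \<in> carrier G \<longleftrightarrow> (\<exists>p\<in>carrier PP. U = cls p)"
  by (simp add: dp_algebra_def Q.quot_elem)

lemma cls_rel: "p \<ominus>\<^bsub>PP\<^esub> q \<in> rels \<Longrightarrow> p \<in> carrier PP \<Longrightarrow> q \<in> carrier PP \<Longrightarrow> cls p = cls q"
  by (subst Q.coset_eq_iff) (simp_all add: DI_eq subsetD[OF PP.genideal_self[OF rels_closed]])

lemma gam_eq: "\<gamma> m x = cls (dp_var A m x)" by (simp add: gam_def)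

lemma gam_closed [simp]: "x \<in> carrier M \<Longrightarrow> \<gamma> m x \<in> carrier G"
  by (simp add: gam_eq var_closed)

lemma smult_eq: "a \<odot>\<^bsub>G\<^esub> U = cls (dp_const A a) \<otimes>\<^bsub>G\<^esub> U"
  by (simp add: dp_algebra_def)

lemma gam_0: assumes "x \<in> carrier M" shows "\<gamma> 0 x = \<one>\<^bsub>G\<^esub>"
proof -
  have "dp_var A 0 x \<ominus>\<^bsub>PP\<^esub> \<one>\<^bsub>PP\<^esub> \<in> rels" using assms unfolding rels_def Let_def by blast
  then have "cls (dp_var A 0 x) = cls \<one>\<^bsub>PP\<^esub>" using assms by (intro cls_rel) (auto simp: var_closed)
  then show ?thesis by (simp add: gam_eq)
qed

lemma gam_smult:
  assumes "x \<in> carrier M" "c \<in> carrier A" shows "\<gamma> m (c \<odot>\<^bsub>M\<^esub> x) = (c [^]\<^bsub>A\<^esub> m) \<odot>\<^bsub>G\<^esub> \<gamma> m x"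
proof -
  have "dp_var A m (c \<odot>\<^bsub>M\<^esub> x) \<ominus>\<^bsub>PP\<^esub> dp_const A (c [^]\<^bsub>A\<^esub> m) \<otimes>\<^bsub>PP\<^esub> dp_var A m x \<in> rels"
    using assms unfolding rels_def Let_def by blast
  then have "cls (dp_var A m (c \<odot>\<^bsub>M\<^esub> x)) = cls (dp_const A (c [^]\<^bsub>A\<^esub> m) \<otimes>\<^bsub>PP\<^esub> dp_var A m x)"
    using assms by (intro cls_rel) (auto simp: var_closed const_closed)
  then show ?thesis using assms by (simp add: gam_eq smult_eq var_closed const_closed)
qed

lemma gam_add:
  assumes "x \<in> carrier M" "y \<in> carrier M"
  shows "\<gamma> m (x \<oplus>\<^bsub>M\<^esub> y) = (\<Oplus>\<^bsub>G\<^esub>j\<in>{0..m}. \<gamma> j x \<otimes>\<^bsub>G\<^esub> \<gamma> (m - j) y)"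
proof -
  have "dp_var A m (x \<oplus>\<^bsub>M\<^esub> y) \<ominus>\<^bsub>PP\<^esub> (\<Oplus>\<^bsub>PP\<^esub>j\<in>{0..m}. dp_var A j x \<otimes>\<^bsub>PP\<^esub> dp_var A (m - j) y) \<in> rels"
    using assms unfolding rels_def Let_def by blast
  then have "cls (dp_var A m (x \<oplus>\<^bsub>M\<^esub> y)) = cls (\<Oplus>\<^bsub>PP\<^esub>j\<in>{0..m}. dp_var A j x \<otimes>\<^bsub>PP\<^esub> dp_var A (m - j) y)"
    using assms by (intro cls_rel) (auto simp: var_closed const_closed)
  also have "\<dots> = (\<Oplus>\<^bsub>G\<^esub>j\<in>{0..m}. cls (dp_var A j x \<otimes>\<^bsub>PP\<^esub> dp_var A (m - j) y))"
    using assms by (intro add_hom_finsum[OF PP.abelian_group_axioms G.abelian_group_axioms ring_hom_add_hom[OF cls_hom]])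
      (auto simp: var_closed)
  also have "\<dots> = (\<Oplus>\<^bsub>G\<^esub>j\<in>{0..m}. \<gamma> j x \<otimes>\<^bsub>G\<^esub> \<gamma> (m - j) y)"
    using assms by (intro G.finsum_cong') (auto simp: var_closed gam_eq)
  finally show ?thesis by (simp add: gam_eq)
qed

lemma gam_mult:
  assumes "x \<in> carrier M"
  shows "\<gamma> m x \<otimes>\<^bsub>G\<^esub> \<gamma> l x = add_pow G ((m + l) choose m) (\<gamma> (m + l) x)"
proof -
  have "dp_var A m x \<otimes>\<^bsub>PP\<^esub> dp_var A l x \<ominus>\<^bsub>PP\<^esub> add_pow PP ((m + l) choose m) (dp_var A (m + l) x) \<in> rels"
    using assms unfolding rels_def Let_def by blast
  then have "cls (dp_var A m x \<otimes>\<^bsub>PP\<^esub> dp_var A l x) = cls (add_pow PP ((m + l) choose m) (dp_var A (m + l) x))"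
    using assms by (intro cls_rel) (auto simp: var_closed)
  moreover have "cls (add_pow PP k p) = add_pow G k (cls p)" if "p \<in> carrier PP" for p and k :: nat
    by (rule add_hom_nat_pow[OF PP.abelian_group_axioms G.abelian_group_axioms ring_hom_add_hom[OF cls_hom] that])
  ultimately show ?thesis using assms by (simp add: gam_eq var_closed)
qed

lemma gam_edp: "x \<in> carrier M \<Longrightarrow> (\<lambda>m. \<gamma> m x) \<in> carrier (edp G)"
  by (simp add: edp_carrier gam_0 gam_mult)

text \<open>Together with \<open>gam_edp\<close> and \<open>gam_smult\<close> this restates the
  defining relations: sending x to the sequence of its divided powers is a linear map into
  \<open>edp G\<close>, and by \<open>dp_lift\<close> the universal one.\<close>

lemma gam_edp_add_hom: "(\<lambda>x m. \<gamma> m x) \<in> add_hom M (edp G)"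
  by (rule add_homI) (auto simp: gam_edp gam_add edp_simps atMost_atLeast0)

lemma smult_one_hom: "(\<lambda>a. a \<odot>\<^bsub>G\<^esub> \<one>\<^bsub>G\<^esub>) \<in> ring_hom A G"
  by (rule ring_hom_memI)
   (auto simp: GA.smult_l_distr GA.smult_assoc2 GA.smult_assoc1)

lemma smult_via_one: "a \<in> carrier A \<Longrightarrow> u \<in> carrier G \<Longrightarrow> a \<odot>\<^bsub>G\<^esub> u = (a \<odot>\<^bsub>G\<^esub> \<one>\<^bsub>G\<^esub>) \<otimes>\<^bsub>G\<^esub> u"
  by (simp add: GA.smult_assoc2)

text \<open>A monomial is built up one variable at a time, the coefficient sitting on the empty
  monomial; hence the middle case multiplies an arbitrary element by a single \<gamma>.\<close>

lemma G_induct [consumes 1, case_names const gam add]: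
  assumes U: "U \<in> carrier G"
    and 1: "\<And>a. a \<in> carrier A \<Longrightarrow> Q (a \<odot>\<^bsub>G\<^esub> \<one>\<^bsub>G\<^esub>)"
    and 2: "\<And>m x u. x \<in> carrier M \<Longrightarrow> u \<in> carrier G \<Longrightarrow> Q u \<Longrightarrow> Q (\<gamma> m x \<otimes>\<^bsub>G\<^esub> u)"
    and 3: "\<And>u v. u \<in> carrier G \<Longrightarrow> v \<in> carrier G \<Longrightarrow> Q u \<Longrightarrow> Q v \<Longrightarrow> Q (u \<oplus>\<^bsub>G\<^esub> v)"
  shows "Q U"
proof -
  obtain p where p: "p \<in> carrier PP" "U = cls p" using U G_elem by auto
  have "Q (cls p)" using p(1)
  proof (induct p rule: mr.mr_induct)
    case (single w r)
    then show ?case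
    proof (induct w)
      case empty
      then show ?case using 1[of r] by (simp add: smult_eq dp_const_def[symmetric] const_closed)
    next
      case (add p w)
      obtain m x where mx: "p = (m, x)" by (cases p)
      have "single A (add_mset p w) r = dp_var A m x \<otimes>\<^bsub>PP\<^esub> single A w r"
        using add mx unfolding dp_var_def by (subst mr.single_mult) auto
      moreover have "single A w r \<in> carrier PP" using add by (intro mr.single_closed) auto
      ultimately show ?case using add mx 2[of x "cls (single A w r)" m] by (simp add: gam_eq var_closed)
    qed
  next
    case (add f g)
    then show ?case using 3 by simp
  qed
  then show ?thesis using p by simp
qed

lemma G_hom_eq:
  assumes S: "cring S" and h: "h \<in> ring_hom G S" "k \<in> ring_hom G S"
    and 1: "\<And>a. a \<in> carrier A \<Longrightarrow> h (a \<odot>\<^bsub>G\<^esub> \<one>\<^bsub>G\<^esub>) = k (a \<odot>\<^bsub>G\<^esub> \<one>\<^bsub>G\<^esub>)"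
    and 2: "\<And>m x. x \<in> carrier M \<Longrightarrow> h (\<gamma> m x) = k (\<gamma> m x)"
    and u: "u \<in> carrier G"
  shows "h u = k u"
  using u by (induct u rule: G_induct)
    (auto simp: 1 2 ring_hom_mult[OF h(1)] ring_hom_mult[OF h(2)] ring_hom_add[OF h(1)] ring_hom_add[OF h(2)])

text \<open>Universal property of the divided power algebra. When \<open>g x m\<close> is
  substituted for \<gamma>^m(x), the four families of relations become, in this order: s(0) = 1,
  compatibility of g with scalars, additivity of g, and the product rule in
  \<open>edp S\<close>.\<close>

lemma dp_lift:
  assumes S: "cring S" and \<phi>: "\<phi> \<in> ring_hom A S" and g: "g \<in> add_hom M (edp S)"
    and gs: "\<And>a x. a \<in> carrier A \<Longrightarrow> x \<in> carrier M \<Longrightarrow> g (a \<odot>\<^bsub>M\<^esub> x) = \<phi> a \<odot>\<^bsub>edp S\<^esub> g x"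
  obtains h where "h \<in> ring_hom G S" "\<And>m x. x \<in> carrier M \<Longrightarrow> h (\<gamma> m x) = g x m"
    "\<And>a u. a \<in> carrier A \<Longrightarrow> u \<in> carrier G \<Longrightarrow> h (a \<odot>\<^bsub>G\<^esub> u) = \<phi> a \<otimes>\<^bsub>S\<^esub> h u"
proof -
  interpret S: cring S by fact
  interpret \<phi>: ring_hom_cring A S \<phi> using \<phi> by unfold_locales
  have gE: "g x \<in> carrier (edp S)" if "x \<in> carrier M" for x using add_hom_closed[OF g that] .
  then have gc: "g x m \<in> carrier S" if "x \<in> carrier M" for x m using that by (auto simp: edp_closed)
  define \<chi> where "\<chi> = S.mset_prod (\<lambda>(m, x). g x m)"
  obtain h0 where h0: "h0 \<in> ring_hom PP S"
    and h0s: "\<And>w r. w \<in> carrier (free_comm_monoid ((UNIV :: nat set) \<times> carrier M)) \<Longrightarrow> r \<in> carrier A \<Longrightarrow> h0 (single A w r) = \<phi> r \<otimes>\<^bsub>S\<^esub> \<chi> w"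
  proof (rule mr.mr_ring_lift[OF S \<phi>, of \<chi>])
    fix w assume "w \<in> carrier (free_comm_monoid ((UNIV :: nat set) \<times> carrier M))"
    then show "\<chi> w \<in> carrier S" unfolding \<chi>_def by (intro S.mset_prod_closed) (auto simp: gc)
  next
    fix w w' assume "w \<in> carrier (free_comm_monoid ((UNIV :: nat set) \<times> carrier M))" "w' \<in> carrier (free_comm_monoid ((UNIV :: nat set) \<times> carrier M))"
    then have "\<chi> (w + w') = \<chi> w \<otimes>\<^bsub>S\<^esub> \<chi> w'" unfolding \<chi>_def
      by (intro S.mset_prod_union) (auto simp: gc)
    then show "\<chi> (w \<otimes>\<^bsub>free_comm_monoid ((UNIV :: nat set) \<times> carrier M)\<^esub> w') = \<chi> w \<otimes>\<^bsub>S\<^esub> \<chi> w'" by simp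
  next
    show "\<chi> \<one>\<^bsub>free_comm_monoid ((UNIV :: nat set) \<times> carrier M)\<^esub> = \<one>\<^bsub>S\<^esub>"
      by (simp add: \<chi>_def S.mset_prod_simps)
  qed (rule that)
  interpret h0: ring_hom_cring PP S h0 using h0 by unfold_locales
  have var: "h0 (dp_var A m x) = g x m" if "x \<in> carrier M" for m x
    using that gc[of x m] by (simp add: dp_var_def h0s \<chi>_def S.mset_prod_simps)
  have const: "h0 (dp_const A a) = \<phi> a" if "a \<in> carrier A" for a
    using that by (simp add: dp_const_def h0s \<chi>_def S.mset_prod_simps)
  have eq0: "h0 (p \<ominus>\<^bsub>PP\<^esub> q) = \<zero>\<^bsub>S\<^esub>" if "p \<in> carrier PP" "q \<in> carrier PP" "h0 p = h0 q" for p q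
    using that by (simp add: a_minus_def S.r_neg)
  have kill: "h0 r = \<zero>\<^bsub>S\<^esub>" if "r \<in> rels" for r
    using that unfolding rels_def Let_def
  proof (elim UnE CollectE exE conjE)
    fix x assume "r = dp_var A 0 x \<ominus>\<^bsub>PP\<^esub> \<one>\<^bsub>PP\<^esub>" "x \<in> carrier M"
    then show ?thesis using gE[of x] by (auto intro!: eq0 simp: var_closed var edp_carrier)
  next
    fix m c x assume "r = dp_var A m (c \<odot>\<^bsub>M\<^esub> x) \<ominus>\<^bsub>PP\<^esub> dp_const A (c [^]\<^bsub>A\<^esub> m) \<otimes>\<^bsub>PP\<^esub> dp_var A m x"
      "c \<in> carrier A" "x \<in> carrier M"
    then show ?thesis
      by (auto intro!: eq0 simp: var_closed const_closed var const gs edp_simps \<phi>.ring.hom_nat_pow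
          S.minus_eq S.r_neg gc)
  next
    fix m x y assume *: "r = dp_var A m (x \<oplus>\<^bsub>M\<^esub> y) \<ominus>\<^bsub>PP\<^esub> (\<Oplus>\<^bsub>PP\<^esub>j\<in>{0..m}. dp_var A j x \<otimes>\<^bsub>PP\<^esub> dp_var A (m - j) y)"
      "x \<in> carrier M" "y \<in> carrier M"
    have "h0 (\<Oplus>\<^bsub>PP\<^esub>j\<in>{0..m}. dp_var A j x \<otimes>\<^bsub>PP\<^esub> dp_var A (m - j) y) = (\<Oplus>\<^bsub>S\<^esub>j\<in>{0..m}. g x j \<otimes>\<^bsub>S\<^esub> g y (m - j))"
      using * by (subst h0.hom_finsum) (auto simp: var_closed var gc intro!: S.finsum_cong')
    then show ?thesis using *
      by (auto intro!: eq0 simp: var_closed var add_hom_add[OF g] edp_simps atMost_atLeast0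
          S.minus_eq S.r_neg gc)
  next
    fix m l x assume *: "r = dp_var A m x \<otimes>\<^bsub>PP\<^esub> dp_var A l x \<ominus>\<^bsub>PP\<^esub> add_pow PP ((m + l) choose m) (dp_var A (m + l) x)"
      "x \<in> carrier M"
    have "h0 (add_pow PP k p) = add_pow S k (h0 p)" if "p \<in> carrier PP" for p and k :: nat
      by (rule add_hom_nat_pow[OF PP.abelian_group_axioms S.abelian_group_axioms ring_hom_add_hom[OF h0] that])
    then show ?thesis using * gE[of x]
      by (auto intro!: eq0 simp: var_closed var edp_carrier)
  qed
  obtain h where h: "h \<in> ring_hom (PP Quot DI) S" "\<And>p. p \<in> carrier PP \<Longrightarrow> h (cls p) = h0 p"
    using ring_hom_zero_ideal[OF PP.is_cring S h0 rels_closed kill] Q.quot_ring_lift[OF S h0] unfolding DI_eq by metis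
  have hG: "h \<in> ring_hom G S" using h(1) unfolding ring_hom_def dp_algebra_def by simp
  show thesis
  proof (rule that[OF hG])
    show "h (\<gamma> m x) = g x m" if "x \<in> carrier M" for m x
      using that by (simp add: gam_eq h(2) var_closed var)
    show "h (a \<odot>\<^bsub>G\<^esub> u) = \<phi> a \<otimes>\<^bsub>S\<^esub> h u" if "a \<in> carrier A" "u \<in> carrier G" for a u
      using that by (simp add: smult_eq ring_hom_mult[OF hG] h(2) const_closed const)
  qed
qed

subsection \<open>The homogeneous parts\<close>

abbreviation "part \<equiv> dp_part A M"

lemma part_iff: "U \<in> part n \<longleftrightarrow> (\<exists>p\<in>carrier PP. U = cls p \<and> (\<forall>w\<in>supp A p. sum_mset (image_mset fst w) = n))"
  by (auto simp: dp_part_def)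

lemma part_closed: "U \<in> part n \<Longrightarrow> U \<in> carrier G"
  by (auto simp: part_iff)

lemma part_zero: "\<zero>\<^bsub>G\<^esub> \<in> part n"
  unfolding part_iff by (rule bexI[of _ "\<zero>\<^bsub>PP\<^esub>"]) (auto simp: supp_def mr.mr_simps[symmetric] cls.hom_zero, simp add: mr.mr_simps)

lemma part_add: assumes "U \<in> part n" "V \<in> part n" shows "U \<oplus>\<^bsub>G\<^esub> V \<in> part n"
proof -
  obtain p q where p: "p \<in> carrier PP" "U = cls p" "\<forall>w\<in>supp A p. sum_mset (image_mset fst w) = n"
    and q: "q \<in> carrier PP" "V = cls q" "\<forall>w\<in>supp A q. sum_mset (image_mset fst w) = n"
    using assms by (auto simp: part_iff)
  have "supp A (p \<oplus>\<^bsub>PP\<^esub> q) \<subseteq> supp A p \<union> supp A q" by (auto simp: supp_def mr.mr_simps)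
  then show ?thesis unfolding part_iff using p q by (intro bexI[of _ "p \<oplus>\<^bsub>PP\<^esub> q"]) auto
qed

lemma part_mult: assumes "U \<in> part n" "V \<in> part k" shows "U \<otimes>\<^bsub>G\<^esub> V \<in> part (n + k)"
proof -
  obtain p q where p: "p \<in> carrier PP" "U = cls p" "\<forall>w\<in>supp A p. sum_mset (image_mset fst w) = n"
    and q: "q \<in> carrier PP" "V = cls q" "\<forall>w\<in>supp A q. sum_mset (image_mset fst w) = k"
    using assms by (auto simp: part_iff)
  have "\<forall>w\<in>supp A (p \<otimes>\<^bsub>PP\<^esub> q). sum_mset (image_mset fst w) = n + k"
    using mr.supp_mult[OF p(1) q(1)] p(3) q(3) by fastforce
  then show ?thesis unfolding part_iff using p q by (intro bexI[of _ "p \<otimes>\<^bsub>PP\<^esub> q"]) auto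
qed

lemma supp_single: "supp A (single A w a) \<subseteq> {w}" by (auto simp: supp_def single_def)

lemma part_const: "a \<in> carrier A \<Longrightarrow> a \<odot>\<^bsub>G\<^esub> \<one>\<^bsub>G\<^esub> \<in> part 0"
  unfolding part_iff using supp_single[of "{#}" a]
  by (intro bexI[of _ "dp_const A a"] conjI) (simp_all add: smult_eq const_closed, auto simp: dp_const_def)

lemma part_gam: "x \<in> carrier M \<Longrightarrow> \<gamma> m x \<in> part m"
  unfolding part_iff using supp_single[of "{#(m,x)#}" "\<one>\<^bsub>A\<^esub>"]
  by (intro bexI[of _ "dp_var A m x"] conjI) (simp_all add: gam_eq var_closed, auto simp: dp_var_def)

lemma part_smult: assumes "a \<in> carrier A" "U \<in> part n" shows "a \<odot>\<^bsub>G\<^esub> U \<in> part n"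
  using part_mult[OF part_const[OF assms(1)] assms(2)] 
    smult_via_one[OF assms(1) part_closed[OF assms(2)]] by simp

lemma part_one: "\<one>\<^bsub>G\<^esub> \<in> part 0"
  using part_const[of "\<one>\<^bsub>A\<^esub>"] by simp

lemma part_finsum: "(\<And>i. i \<in> I \<Longrightarrow> f i \<in> part n) \<Longrightarrow> finsum G f I \<in> part n"
  by (rule G.finsum_in_set) (auto simp: part_zero part_add part_closed)

lemma part_finprod:
  assumes "finite I" "\<And>i. i \<in> I \<Longrightarrow> f i \<in> part (d i)"
  shows "finprod G f I \<in> part (\<Sum>i\<in>I. d i)"
  using assms
proof (induct I rule: finite_induct)
  case (insert i I)
  then have "f \<in> I \<rightarrow> carrier G" "f i \<in> carrier G" by (auto intro: part_closed)
  then show ?case using insert part_mult[of "f i" "d i"] by (simp add: G.finprod_insert)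
qed (simp add: part_one)

lemma sum_count: assumes "finite I" "set_mset c \<subseteq> I" shows "(\<Sum>i\<in>I. count c i) = size c"
proof -
  have "(\<Sum>i\<in>set_mset c. count c i) = (\<Sum>i\<in>I. count c i)"
    by (rule sum.mono_neutral_left) (use assms in \<open>auto simp: not_in_iff\<close>)
  then show ?thesis by (simp add: size_multiset_overloaded_eq)
qed

text \<open>Divided monomials, indexed like the monomials T^c: the exponents form the multiset c,
  whose size is the degree. The same element of M may stand under several indices.\<close>

abbreviation gprod :: "'i set \<Rightarrow> ('i \<Rightarrow> 'm) \<Rightarrow> 'i multiset \<Rightarrow> ('a, 'm) dpow"
  where "gprod I x c \<equiv> (\<Otimes>\<^bsub>G\<^esub>i\<in>I. \<gamma> (count c i) (x i))"

lemma gprod_part: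
  assumes "finite I" "x \<in> I \<rightarrow> carrier M" "c \<in> multisets_of_size I n" shows "gprod I x c \<in> part n"
proof -
  have "gprod I x c \<in> part (\<Sum>i\<in>I. count c i)"
    using assms by (intro part_finprod part_gam) auto
  then show ?thesis using sum_count[of I c] assms by (simp add: multisets_of_size_def)
qed

text \<open>The index sets can be chosen beyond any given bound, hence disjoint for several monomials.\<close>

lemma monomial_gprod:
  assumes "set_mset w \<subseteq> UNIV \<times> carrier M"
  shows "\<exists>I x c. finite I \<and> I \<subseteq> {k::nat..} \<and> x \<in> I \<rightarrow> carrier M
    \<and> c \<in> multisets_of_size I (sum_mset (image_mset fst w))
    \<and> cls (single A w \<one>\<^bsub>A\<^esub>) = gprod I x c"
  using assms
proof (induct w)
  case empty
  show ?case
    by (rule exI[of _ "{}"], rule exI[of _ "\<lambda>_. \<zero>\<^bsub>M\<^esub>"], rule exI[of _ "{#}"])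
      (use cls.hom_one in \<open>auto simp: multisets_of_size_def mr.mr_simps\<close>)
next
  case (add p w)
  obtain m y where p: "p = (m, y)" by (cases p)
  then obtain I x c where I: "finite I" "I \<subseteq> {k..}" "x \<in> I \<rightarrow> carrier M"
    "c \<in> multisets_of_size I (sum_mset (image_mset fst w))" "cls (single A w \<one>\<^bsub>A\<^esub>) = gprod I x c"
    using add by auto
  define i where "i = Suc (Max (insert k I))"
  have "j < i" if "j \<in> insert k I" for j
    using I(1) that unfolding i_def by (simp add: less_Suc_eq_le)
  then have i: "i \<notin> I" "k \<le> i" by (auto intro: less_imp_le)
  have y: "y \<in> carrier M" using add p by auto
  have c0: "count c i = 0" using i I by (auto simp: multisets_of_size_def not_in_iff[symmetric])
  have "gprod I (x(i := y)) (c + replicate_mset m i) = gprod I x c"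
    using i I by (intro G.finprod_cong') (auto intro!: gam_closed)
  then have "gprod (insert i I) (x(i := y)) (c + replicate_mset m i) = \<gamma> m y \<otimes>\<^bsub>G\<^esub> gprod I x c"
    using I i y c0 by (subst G.finprod_insert) (auto intro!: gam_closed)
  moreover have "single A (add_mset p w) \<one>\<^bsub>A\<^esub> = dp_var A m y \<otimes>\<^bsub>PP\<^esub> single A w \<one>\<^bsub>A\<^esub>"
    using add p unfolding dp_var_def by (subst mr.single_mult) auto
  moreover have "single A w \<one>\<^bsub>A\<^esub> \<in> carrier PP" using add by (intro mr.single_closed) auto
  ultimately have "cls (single A (add_mset p w) \<one>\<^bsub>A\<^esub>) = gprod (insert i I) (x(i := y)) (c + replicate_mset m i)"
    using y I by (simp add: gam_eq var_closed)
  moreover have "c + replicate_mset m i \<in> multisets_of_size (insert i I) (sum_mset (image_mset fst (add_mset p w)))"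
    using I p by (auto simp: multisets_of_size_def)
  ultimately show ?case using I i y
    by (intro exI[of _ "insert i I"] exI[of _ "x(i := y)"] exI[of _ "c + replicate_mset m i"]) auto
qed

text \<open>The bound k passes on the freedom of \<open>monomial_gprod\<close>: a proof about
  several homogeneous elements picks k above the index sets already chosen, and k = 0 where
  disjointness does not matter.\<close>

lemma part_induct [consumes 1, case_names zero gprod add]:
  assumes U: "U \<in> part n"
    and z: "Q \<zero>\<^bsub>G\<^esub>"
    and s: "\<And>I x c a. finite I \<Longrightarrow> I \<subseteq> {k::nat..} \<Longrightarrow> x \<in> I \<rightarrow> carrier M \<Longrightarrow> c \<in> multisets_of_size I n
      \<Longrightarrow> a \<in> carrier A \<Longrightarrow> Q (a \<odot>\<^bsub>G\<^esub> gprod I x c)"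
    and ad: "\<And>u v. u \<in> part n \<Longrightarrow> v \<in> part n \<Longrightarrow> Q u \<Longrightarrow> Q v \<Longrightarrow> Q (u \<oplus>\<^bsub>G\<^esub> v)"
  shows "Q U"
proof -
  obtain p where p: "p \<in> carrier PP" "U = cls p" "\<forall>w\<in>supp A p. sum_mset (image_mset fst w) = n"
    using U by (auto simp: part_iff)
  have "cls p \<in> part n \<and> Q (cls p)"
  proof (rule mr.mr_supp_induct[OF p(1)])
    show "cls \<zero>\<^bsub>PP\<^esub> \<in> part n \<and> Q (cls \<zero>\<^bsub>PP\<^esub>)" using z part_zero by simp
  next
    fix w assume w: "w \<in> supp A p" "w \<in> carrier (free_comm_monoid ((UNIV :: nat set) \<times> carrier M))"
    then obtain I :: "nat set" and x c where I: "finite I" "I \<subseteq> {k..}" "x \<in> I \<rightarrow> carrier M"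
      "c \<in> multisets_of_size I n" "cls (single A w \<one>\<^bsub>A\<^esub>) = gprod I x c"
      using monomial_gprod[of w k] p(3) by auto
    have a: "p w \<in> carrier A" using p by (auto simp: mr.mr_carrier)
    have "single A w (p w) = dp_const A (p w) \<otimes>\<^bsub>PP\<^esub> single A w \<one>\<^bsub>A\<^esub>"
      using a w unfolding dp_const_def by (subst mr.single_mult) auto
    moreover have "single A w \<one>\<^bsub>A\<^esub> \<in> carrier PP" using w by (intro mr.single_closed) auto
    ultimately have "cls (single A w (p w)) = p w \<odot>\<^bsub>G\<^esub> gprod I x c"
      using a I by (simp add: smult_eq const_closed)
    then show "cls (single A w (p w)) \<in> part n \<and> Q (cls (single A w (p w)))"
      using s[OF I(1-4) a] I a by (simp add: part_smult gprod_part)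
  next
    fix f g assume "f \<in> carrier PP" "g \<in> carrier PP" "cls f \<in> part n \<and> Q (cls f)" "cls g \<in> part n \<and> Q (cls g)"
    then show "cls (f \<oplus>\<^bsub>PP\<^esub> g) \<in> part n \<and> Q (cls (f \<oplus>\<^bsub>PP\<^esub> g))" using ad part_add by simp
  qed
  then show ?thesis using p by simp
qed

text \<open>Multinomial formula: the sum is pushed through the additive map into
  \<open>edp G\<close> and evaluated there by \<open>edp_finsum\<close>.\<close>

lemma gam_finsum:
  assumes "finite I" "x \<in> I \<rightarrow> carrier M"
  shows "\<gamma> m (\<Oplus>\<^bsub>M\<^esub>i\<in>I. x i) = (\<Oplus>\<^bsub>G\<^esub>c\<in>multisets_of_size I m. gprod I x c)"
proof -
  have "(\<lambda>m. \<gamma> m (\<Oplus>\<^bsub>M\<^esub>i\<in>I. x i)) = finsum (edp G) (\<lambda>i m. \<gamma> m (x i)) I"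
    by (rule add_hom_finsum[OF M.abelian_group_axioms G.edp_abelian gam_edp_add_hom assms(2)])
  then have "\<gamma> m (\<Oplus>\<^bsub>M\<^esub>i\<in>I. x i) = finsum (edp G) (\<lambda>i m. \<gamma> m (x i)) I m" by metis
  also have "\<dots> = (\<Oplus>\<^bsub>G\<^esub>c\<in>multisets_of_size I m. gprod I x c)"
    using assms by (intro G.edp_finsum) (auto intro!: gam_edp)
  finally show ?thesis .
qed

end

section \<open>Tensor products of algebras\<close>

lemma add_hom_int:
  assumes N: "abelian_group N" and h: "h \<in> add_hom \<Z> N"
  shows "h k = add_pow N (k :: int) (h 1)"
proof -
  interpret N: abelian_group N by fact
  have h1: "h 1 \<in> carrier N" using add_hom_closed[OF h, of 1] by simp
  have Zab: "abelian_group \<Z>" by (rule int.abelian_group_axioms)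
  have n: "h (int n) = add_pow N (int n) (h 1)" for n
  proof (induct n)
    case 0 then show ?case using add_hom_zero[OF Zab N h] by (simp add: add_pow_int_ge)
  next
    case (Suc n)
    have "h (int (Suc n)) = h (int n \<oplus>\<^bsub>\<Z>\<^esub> 1)" by (simp add: add.commute)
    also have "\<dots> = add_pow N (int n) (h 1) \<oplus>\<^bsub>N\<^esub> h 1" using add_hom_add[OF h, of "int n" 1] Suc by simp
    also have "\<dots> = add_pow N (int (Suc n)) (h 1)" using h1 by (simp only: add_pow_int_ge nat_int of_nat_0_le_iff N.add.nat_pow_Suc)
    finally show ?case .
  qed
  show ?thesis
  proof (cases "k \<ge> 0")
    case True then show ?thesis using n[of "nat k"] by simp
  next
    case False
    then have "h k = h (\<ominus>\<^bsub>\<Z>\<^esub> int (nat (- k)))" by (simp add: int_a_inv_eq)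
    also have "\<dots> = \<ominus>\<^bsub>N\<^esub> add_pow N (nat (- k)) (h 1)"
      using add_hom_a_inv[OF Zab N h, of "int (nat (- k))"] n[of "nat (- k)"] by (simp add: add_pow_int_ge)
    finally show ?thesis using False by (simp add: add_pow_int_lt)
  qed
qed

locale tens =
  fixes A :: "('a, 'x) ring_scheme" and F :: "('a, 'f, 'y) module_scheme" and C :: "('a, 'c, 'z) module_scheme"
  assumes AF: "algebra A F" and AC: "algebra A C"
begin

sublocale A: cring A by (rule algebra.R_cring[OF AF])
sublocale F: cring F by (rule algebra.M_cring[OF AF])
sublocale C: cring C by (rule algebra.M_cring[OF AC])
sublocale AF: algebra A F by (rule AF)
sublocale AC: algebra A C by (rule AC)

abbreviation "PR \<equiv> pair_ring F C"
abbreviation "TI \<equiv> tensor_ideal A F C"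
abbreviation "T \<equiv> tensor_algebra A F C"
abbreviation "tn \<equiv> tensor A F C"
abbreviation "sg y c \<equiv> single \<Z> (y, c) (1 :: int)"

sublocale mr: monring "\<Z>" "F \<times>\<times> C"
  rewrites "monoid_ring \<Z> (F \<times>\<times> C) = PR"
proof -
  have "comm_monoid (F \<times>\<times> C)"
    by (rule comm_monoidI) (auto simp: F.m_ac C.m_ac)
  then show "monring \<Z> (F \<times>\<times> C)" using int_is_cring by (simp add: monring_def)
  show "monoid_ring \<Z> (F \<times>\<times> C) = PR" by (simp add: pair_ring_def)
qed

sublocale PR: cring PR by (rule mr.mr_cring)

definition trels where "trels = (let P = pair_ring F C; s = (\<lambda>y c. single \<Z> (y, c) 1) in
     ({s (y \<oplus>\<^bsub>F\<^esub> y') c \<ominus>\<^bsub>P\<^esub> (s y c \<oplus>\<^bsub>P\<^esub> s y' c) | y y' c.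
         y \<in> carrier F \<and> y' \<in> carrier F \<and> c \<in> carrier C}
      \<union> {s y (c \<oplus>\<^bsub>C\<^esub> c') \<ominus>\<^bsub>P\<^esub> (s y c \<oplus>\<^bsub>P\<^esub> s y c') | y c c'.
         y \<in> carrier F \<and> c \<in> carrier C \<and> c' \<in> carrier C}
      \<union> {s (a \<odot>\<^bsub>F\<^esub> y) c \<ominus>\<^bsub>P\<^esub> s y (a \<odot>\<^bsub>C\<^esub> c) | a y c.
         a \<in> carrier A \<and> y \<in> carrier F \<and> c \<in> carrier C}))"

lemma TI_eq: "TI = genideal PR trels"
  by (simp add: tensor_ideal_def trels_def Let_def)

lemma sg_closed: "y \<in> carrier F \<Longrightarrow> c \<in> carrier C \<Longrightarrow> sg y c \<in> carrier PR"
  by (rule mr.single_closed) auto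

lemma trels_closed: "trels \<subseteq> carrier PR"
  unfolding trels_def Let_def by (auto simp: sg_closed)

sublocale Q: quot PR TI
  unfolding quot_def TI_eq by (simp add: PR.is_cring PR.genideal_ideal trels_closed)

lemma trels_I:
  "y \<in> carrier F \<Longrightarrow> y' \<in> carrier F \<Longrightarrow> c \<in> carrier C \<Longrightarrow>
    sg (y \<oplus>\<^bsub>F\<^esub> y') c \<ominus>\<^bsub>PR\<^esub> (sg y c \<oplus>\<^bsub>PR\<^esub> sg y' c) \<in> trels"
  "y \<in> carrier F \<Longrightarrow> c \<in> carrier C \<Longrightarrow> c' \<in> carrier C \<Longrightarrow>
    sg y (c \<oplus>\<^bsub>C\<^esub> c') \<ominus>\<^bsub>PR\<^esub> (sg y c \<oplus>\<^bsub>PR\<^esub> sg y c') \<in> trels"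
  "a \<in> carrier A \<Longrightarrow> y \<in> carrier F \<Longrightarrow> c \<in> carrier C \<Longrightarrow>
    sg (a \<odot>\<^bsub>F\<^esub> y) c \<ominus>\<^bsub>PR\<^esub> sg y (a \<odot>\<^bsub>C\<^esub> c) \<in> trels"
  unfolding trels_def Let_def by blast+

abbreviation "QR \<equiv> PR Quot TI"

lemma cls_rel: "p \<ominus>\<^bsub>PR\<^esub> q \<in> trels \<Longrightarrow> p \<in> carrier PR \<Longrightarrow> q \<in> carrier PR \<Longrightarrow> TI +>\<^bsub>PR\<^esub> p = TI +>\<^bsub>PR\<^esub> q"
  by (subst Q.coset_eq_iff) (simp_all add: TI_eq subsetD[OF PR.genideal_self[OF trels_closed]])

lemma tn_closed: "y \<in> carrier F \<Longrightarrow> c \<in> carrier C \<Longrightarrow> tn y c \<in> carrier QR"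
  unfolding tensor_def by (rule ring_hom_closed[OF Q.coset_hom]) (rule sg_closed)

lemma tn_mult:
  assumes "y \<in> carrier F" "c \<in> carrier C" "y' \<in> carrier F" "c' \<in> carrier C"
  shows "tn y c \<otimes>\<^bsub>QR\<^esub> tn y' c' = tn (y \<otimes>\<^bsub>F\<^esub> y') (c \<otimes>\<^bsub>C\<^esub> c')"
proof -
  have "sg y c \<otimes>\<^bsub>PR\<^esub> sg y' c' = sg (y \<otimes>\<^bsub>F\<^esub> y') (c \<otimes>\<^bsub>C\<^esub> c')"
    using assms by (subst mr.single_mult) auto
  then show ?thesis unfolding tensor_def
    using assms ring_hom_mult[OF Q.coset_hom, of "sg y c" "sg y' c'"] by (simp add: sg_closed)
qed

lemma tn_add_left:
  assumes "y \<in> carrier F" "y' \<in> carrier F" "c \<in> carrier C"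
  shows "tn (y \<oplus>\<^bsub>F\<^esub> y') c = tn y c \<oplus>\<^bsub>QR\<^esub> tn y' c"
  unfolding tensor_def using assms cls_rel[OF trels_I(1)[of y y' c]]
    ring_hom_add[OF Q.coset_hom, of "sg y c" "sg y' c"] by (simp add: sg_closed)

lemma tn_add_right:
  assumes "y \<in> carrier F" "c \<in> carrier C" "c' \<in> carrier C"
  shows "tn y (c \<oplus>\<^bsub>C\<^esub> c') = tn y c \<oplus>\<^bsub>QR\<^esub> tn y c'"
  unfolding tensor_def using assms cls_rel[OF trels_I(2)[of y c c']]
    ring_hom_add[OF Q.coset_hom, of "sg y c" "sg y c'"] by (simp add: sg_closed)

lemma tn_balanced:
  assumes "a \<in> carrier A" "y \<in> carrier F" "c \<in> carrier C"
  shows "tn (a \<odot>\<^bsub>F\<^esub> y) c = tn y (a \<odot>\<^bsub>C\<^esub> c)"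
  unfolding tensor_def using assms cls_rel[OF trels_I(3)[of a y c]] by (simp add: sg_closed)

lemma tn_one: "tn \<one>\<^bsub>F\<^esub> \<one>\<^bsub>C\<^esub> = \<one>\<^bsub>QR\<^esub>"
proof -
  have "\<one>\<^bsub>PR\<^esub> = sg \<one>\<^bsub>F\<^esub> \<one>\<^bsub>C\<^esub>" by (simp add: mr.mr_simps DirProd_def)
  then show ?thesis using ring_hom_one[OF Q.coset_hom] by (simp add: tensor_def)
qed

lemma T_simps: "carrier T = carrier QR" "\<zero>\<^bsub>T\<^esub> = \<zero>\<^bsub>QR\<^esub>" "\<one>\<^bsub>T\<^esub> = \<one>\<^bsub>QR\<^esub>"
  "u \<otimes>\<^bsub>T\<^esub> v = u \<otimes>\<^bsub>QR\<^esub> v" "u \<oplus>\<^bsub>T\<^esub> v = u \<oplus>\<^bsub>QR\<^esub> v"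
  "c \<odot>\<^bsub>T\<^esub> u = tn \<one>\<^bsub>F\<^esub> c \<otimes>\<^bsub>QR\<^esub> u"
  unfolding tensor_algebra_def by simp_all

lemma T_algebra: "algebra C T"
  unfolding tensor_algebra_def
  by (rule algebra_viaI[OF C.is_cring Q.quot_cring])
    (rule ring_hom_memI; simp add: tn_closed tn_mult tn_add_right tn_one)

sublocale T: cring T by (rule algebra.M_cring[OF T_algebra])
sublocale TA: algebra C T by (rule T_algebra)

lemmas t_closed [simp] = tn_closed[folded T_simps]
lemmas t_mult = tn_mult[folded T_simps]
lemmas t_add_left = tn_add_left[folded T_simps]
lemmas t_one = tn_one[folded T_simps]

lemma t_smult:
  assumes "y \<in> carrier F" "c \<in> carrier C" "c' \<in> carrier C"
  shows "c \<odot>\<^bsub>T\<^esub> tn y c' = tn y (c \<otimes>\<^bsub>C\<^esub> c')"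
  using assms tn_mult[of "\<one>\<^bsub>F\<^esub>" c y c'] by (simp add: T_simps)

lemma t_add_hom_left: "c \<in> carrier C \<Longrightarrow> (\<lambda>y. tn y c) \<in> add_hom F T"
  by (rule add_homI) (auto simp: t_add_left)

lemma cls_add_hom: "(\<lambda>p. TI +>\<^bsub>PR\<^esub> p) \<in> add_hom PR T"
  using ring_hom_add_hom[OF Q.coset_hom] unfolding add_hom_def by (simp add: T_simps)

text \<open>An integer coefficient can be moved into the first factor, so every element is a sum of
  pure tensors, without signs or multiples. \<open>T_induct\<close> depends on this.\<close>

lemma cls_single:
  assumes "y \<in> carrier F" "c \<in> carrier C"
  shows "TI +>\<^bsub>PR\<^esub> single \<Z> (y, c) k = tn (add_pow F k y) c"
proof -
  have h: "(\<lambda>k. TI +>\<^bsub>PR\<^esub> single \<Z> (y, c) k) \<in> add_hom \<Z> T"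
    using assms by (intro add_hom_comp[OF mr.single_add_hom cls_add_hom]) auto
  have "TI +>\<^bsub>PR\<^esub> single \<Z> (y, c) k = add_pow T k (tn y c)"
    using add_hom_int[OF T.abelian_group_axioms h, of k] by (simp add: tensor_def)
  also have "\<dots> = tn (add_pow F k y) c"
    by (rule add_hom_int_pow[OF F.abelian_group_axioms T.abelian_group_axioms t_add_hom_left, symmetric]) (use assms in auto)
  finally show ?thesis .
qed

lemma T_induct [consumes 1, case_names tensor add]:
  assumes U: "U \<in> carrier T"
    and 1: "\<And>y c. y \<in> carrier F \<Longrightarrow> c \<in> carrier C \<Longrightarrow> Q (tn y c)"
    and 2: "\<And>u v. u \<in> carrier T \<Longrightarrow> v \<in> carrier T \<Longrightarrow> Q u \<Longrightarrow> Q v \<Longrightarrow> Q (u \<oplus>\<^bsub>T\<^esub> v)"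
  shows "Q U"
proof -
  obtain p where p: "p \<in> carrier PR" "U = TI +>\<^bsub>PR\<^esub> p" using U Q.quot_elem by (auto simp: T_simps)
  have "Q (TI +>\<^bsub>PR\<^esub> p)" using p(1)
  proof (induct p rule: mr.mr_induct)
    case (single m k)
    then show ?case using 1 by (cases m) (auto simp: cls_single)
  next
    case (add f g)
    then show ?case using 2 add_hom_add[OF cls_add_hom, of f g] add_hom_closed[OF cls_add_hom] by simp
  qed
  then show ?thesis using p by simp
qed

lemma T_add_hom_eq:
  assumes "h \<in> add_hom T N" "k \<in> add_hom T N" "U \<in> carrier T"
    and "\<And>y c. y \<in> carrier F \<Longrightarrow> c \<in> carrier C \<Longrightarrow> h (tn y c) = k (tn y c)"
  shows "h U = k U"
  using assms(3) by (induct U rule: T_induct)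
    (auto simp: assms(4) add_hom_add[OF assms(1)] add_hom_add[OF assms(2)])

text \<open>The relations generate an ideal, whereas \<beta> defines only an additive map h0, so it
  is not enough that h0 kills the relations. A relation times a pair (u, d) is again a relation,
  hence h0 kills all multiples of relations as well.\<close>

lemma t_lift:
  assumes N: "abelian_group N"
    and c: "\<And>y c. y \<in> carrier F \<Longrightarrow> c \<in> carrier C \<Longrightarrow> \<beta> y c \<in> carrier N"
    and l: "\<And>y y' c. y \<in> carrier F \<Longrightarrow> y' \<in> carrier F \<Longrightarrow> c \<in> carrier C \<Longrightarrow> \<beta> (y \<oplus>\<^bsub>F\<^esub> y') c = \<beta> y c \<oplus>\<^bsub>N\<^esub> \<beta> y' c"
    and r: "\<And>y c c'. y \<in> carrier F \<Longrightarrow> c \<in> carrier C \<Longrightarrow> c' \<in> carrier C \<Longrightarrow> \<beta> y (c \<oplus>\<^bsub>C\<^esub> c') = \<beta> y c \<oplus>\<^bsub>N\<^esub> \<beta> y c'"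
    and b: "\<And>a y c. a \<in> carrier A \<Longrightarrow> y \<in> carrier F \<Longrightarrow> c \<in> carrier C \<Longrightarrow> \<beta> (a \<odot>\<^bsub>F\<^esub> y) c = \<beta> y (a \<odot>\<^bsub>C\<^esub> c)"
  obtains h where "h \<in> add_hom T N" "\<And>y c. y \<in> carrier F \<Longrightarrow> c \<in> carrier C \<Longrightarrow> h (tn y c) = \<beta> y c"
proof -
  interpret N: abelian_group N by fact
  obtain h0 where h0: "h0 \<in> add_hom PR N"
    "\<And>m k. m \<in> carrier (F \<times>\<times> C) \<Longrightarrow> k \<in> carrier \<Z> \<Longrightarrow> h0 (single \<Z> m k) = add_pow N k (\<beta> (fst m) (snd m))"
    by (rule mr.mr_lift[OF N, of "\<lambda>m k. add_pow N k (\<beta> (fst m) (snd m))"])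
      (auto intro!: N.add_pow_int_hom c)
  note h0a = add_hom_add[OF h0(1)] and h0c = add_hom_closed[OF h0(1)]
  have h0s: "h0 (single \<Z> (u, d) k \<otimes>\<^bsub>PR\<^esub> sg y e) = add_pow N k (\<beta> (u \<otimes>\<^bsub>F\<^esub> y) (d \<otimes>\<^bsub>C\<^esub> e))"
    if "u \<in> carrier F" "d \<in> carrier C" "y \<in> carrier F" "e \<in> carrier C" for u d k y e
    using that by (subst mr.single_mult) (auto simp: h0)
  \<comment> \<open>By additivity in q it is enough to multiply by a single pair with an integer
    coefficient.\<close>
  have zero: "h0 (q \<otimes>\<^bsub>PR\<^esub> (p \<ominus>\<^bsub>PR\<^esub> p')) = \<zero>\<^bsub>N\<^esub>"
    if q: "q \<in> carrier PR" and p: "p \<in> carrier PR" "p' \<in> carrier PR"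
      and e: "\<And>u d k. u \<in> carrier F \<Longrightarrow> d \<in> carrier C \<Longrightarrow> h0 (single \<Z> (u, d) k \<otimes>\<^bsub>PR\<^esub> p) = h0 (single \<Z> (u, d) k \<otimes>\<^bsub>PR\<^esub> p')"
    for q p p'
  proof -
    have "h0 (q \<otimes>\<^bsub>PR\<^esub> p) = h0 (q \<otimes>\<^bsub>PR\<^esub> p')" using q
    proof (induct q rule: mr.mr_induct)
      case (single m k)
      then show ?case using e by (cases m) auto
    next
      case (add f g)
      then show ?case using p by (simp add: PR.l_distr h0a)
    qed
    moreover have "q \<otimes>\<^bsub>PR\<^esub> (p \<ominus>\<^bsub>PR\<^esub> p') = q \<otimes>\<^bsub>PR\<^esub> p \<ominus>\<^bsub>PR\<^esub> q \<otimes>\<^bsub>PR\<^esub> p'"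
      using q p by (simp add: PR.minus_eq PR.r_distr PR.r_minus)
    ultimately show ?thesis using q p
      by (simp add: add_hom_minus[OF PR.abelian_group_axioms N h0(1)] h0c N.r_neg a_minus_def[of N])
  qed
  have rel: "h0 (q \<otimes>\<^bsub>PR\<^esub> t) = \<zero>\<^bsub>N\<^esub>" if q: "q \<in> carrier PR" and t: "t \<in> trels" for q t
    using t unfolding trels_def Let_def
  proof (elim UnE CollectE exE conjE)
    fix y y' e assume *: "t = sg (y \<oplus>\<^bsub>F\<^esub> y') e \<ominus>\<^bsub>PR\<^esub> (sg y e \<oplus>\<^bsub>PR\<^esub> sg y' e)" "y \<in> carrier F" "y' \<in> carrier F" "e \<in> carrier C"
    have "h0 (single \<Z> (u, d) k \<otimes>\<^bsub>PR\<^esub> sg (y \<oplus>\<^bsub>F\<^esub> y') e) = h0 (single \<Z> (u, d) k \<otimes>\<^bsub>PR\<^esub> (sg y e \<oplus>\<^bsub>PR\<^esub> sg y' e))"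
      if "u \<in> carrier F" "d \<in> carrier C" for u d k
    proof -
      have s: "single \<Z> (u, d) k \<in> carrier PR" using that by (intro mr.single_closed) auto
      then show ?thesis using that *
        by (simp add: PR.r_distr sg_closed h0a h0s F.r_distr l c N.add.int_pow_distrib)
    qed
    then show ?thesis using * q zero sg_closed by simp
  next
    fix y e e' assume *: "t = sg y (e \<oplus>\<^bsub>C\<^esub> e') \<ominus>\<^bsub>PR\<^esub> (sg y e \<oplus>\<^bsub>PR\<^esub> sg y e')" "y \<in> carrier F" "e \<in> carrier C" "e' \<in> carrier C"
    have "h0 (single \<Z> (u, d) k \<otimes>\<^bsub>PR\<^esub> sg y (e \<oplus>\<^bsub>C\<^esub> e')) = h0 (single \<Z> (u, d) k \<otimes>\<^bsub>PR\<^esub> (sg y e \<oplus>\<^bsub>PR\<^esub> sg y e'))"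
      if "u \<in> carrier F" "d \<in> carrier C" for u d k
    proof -
      have s: "single \<Z> (u, d) k \<in> carrier PR" using that by (intro mr.single_closed) auto
      then show ?thesis using that *
        by (simp add: PR.r_distr sg_closed h0a h0s C.r_distr r c N.add.int_pow_distrib)
    qed
    then show ?thesis using * q zero sg_closed by simp
  next
    fix a y e assume *: "t = sg (a \<odot>\<^bsub>F\<^esub> y) e \<ominus>\<^bsub>PR\<^esub> sg y (a \<odot>\<^bsub>C\<^esub> e)" "a \<in> carrier A" "y \<in> carrier F" "e \<in> carrier C"
    have "h0 (single \<Z> (u, d) k \<otimes>\<^bsub>PR\<^esub> sg (a \<odot>\<^bsub>F\<^esub> y) e) = h0 (single \<Z> (u, d) k \<otimes>\<^bsub>PR\<^esub> sg y (a \<odot>\<^bsub>C\<^esub> e))"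
      if "u \<in> carrier F" "d \<in> carrier C" for u d k
    proof -
      have "u \<otimes>\<^bsub>F\<^esub> (a \<odot>\<^bsub>F\<^esub> y) = a \<odot>\<^bsub>F\<^esub> (u \<otimes>\<^bsub>F\<^esub> y)" "d \<otimes>\<^bsub>C\<^esub> (a \<odot>\<^bsub>C\<^esub> e) = a \<odot>\<^bsub>C\<^esub> (d \<otimes>\<^bsub>C\<^esub> e)"
        using that * AF.smult_assoc2[of a y u] AC.smult_assoc2[of a e d] by (simp_all add: F.m_comm C.m_comm)
      then show ?thesis using that * by (simp add: h0s b)
    qed
    then show ?thesis using * q zero sg_closed by simp
  qed
  \<comment> \<open>K is the largest ideal inside the kernel of h0. It contains the relations, hence
    the ideal that they generate.\<close>
  define K where "K = {p \<in> carrier PR. \<forall>q\<in>carrier PR. h0 (q \<otimes>\<^bsub>PR\<^esub> p) = \<zero>\<^bsub>N\<^esub>}"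
  have "ideal K PR"
  proof (rule idealI[OF PR.ring_axioms])
    show "subgroup K (add_monoid PR)"
    proof (rule PR.add.subgroupI)
      show "K \<noteq> {}" unfolding K_def using add_hom_zero[OF PR.abelian_group_axioms N h0(1)] by auto
      fix p assume "p \<in> K"
      then show "\<ominus>\<^bsub>PR\<^esub> p \<in> K" unfolding K_def
        using add_hom_a_inv[OF PR.abelian_group_axioms N h0(1)] by (auto simp: PR.r_minus)
    next
      fix p q assume "p \<in> K" "q \<in> K"
      then show "p \<oplus>\<^bsub>PR\<^esub> q \<in> K" unfolding K_def by (auto simp: PR.r_distr h0a)
    qed (auto simp: K_def)
    fix p q assume "p \<in> K" and q: "q \<in> carrier PR"
    then have p: "p \<in> carrier PR" "\<And>r. r \<in> carrier PR \<Longrightarrow> h0 (r \<otimes>\<^bsub>PR\<^esub> p) = \<zero>\<^bsub>N\<^esub>" by (auto simp: K_def)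
    show "q \<otimes>\<^bsub>PR\<^esub> p \<in> K" unfolding K_def using p q by (auto simp: PR.m_assoc[symmetric])
    then show "p \<otimes>\<^bsub>PR\<^esub> q \<in> K" using p(1) q by (simp add: PR.m_comm)
  qed
  moreover have "trels \<subseteq> K" unfolding K_def using trels_closed rel by auto
  ultimately have "TI \<subseteq> K" unfolding TI_eq by (rule PR.genideal_minimal)
  then have kill: "h0 i = \<zero>\<^bsub>N\<^esub>" if "i \<in> TI" for i
  proof -
    have "i \<in> carrier PR" "h0 (\<one>\<^bsub>PR\<^esub> \<otimes>\<^bsub>PR\<^esub> i) = \<zero>\<^bsub>N\<^esub>" using that \<open>TI \<subseteq> K\<close> unfolding K_def by blast+
    then show ?thesis by simp
  qed
  obtain h where h: "h \<in> add_hom QR N" "\<And>p. p \<in> carrier PR \<Longrightarrow> h (TI +>\<^bsub>PR\<^esub> p) = h0 p"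
    using Q.quot_lift[OF N h0(1) kill] by blast
  have "h \<in> add_hom T N" using h(1) unfolding add_hom_def by (simp add: T_simps)
  moreover have "h (tn y e) = \<beta> y e" if "y \<in> carrier F" "e \<in> carrier C" for y e
  proof -
    have "h (tn y e) = add_pow N (1 :: int) (\<beta> y e)" using that by (simp add: tensor_def h sg_closed h0)
    then show ?thesis using c[OF that] by (simp add: add_pow_int_ge)
  qed
  ultimately show thesis using that by blast
qed

end

lemma (in comm_monoid) finprod_commute:
  assumes "finite A" "finite B" "\<And>a b. a \<in> A \<Longrightarrow> b \<in> B \<Longrightarrow> g a b \<in> carrier G"
  shows "finprod G (\<lambda>a. finprod G (g a) B) A = finprod G (\<lambda>b. finprod G (\<lambda>a. g a b) A) B"
proof -
  have "finprod G (\<lambda>a. finprod G (g a) B) A = finprod G (\<lambda>p. g (fst p) (snd p)) (A \<times> B)"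
    using assms by (intro finprod_Sigma) auto
  also have "\<dots> = finprod G (\<lambda>p. g (fst (prod.swap p)) (snd (prod.swap p))) (B \<times> A)"
    using assms by (intro finprod_bij[symmetric]) (auto simp: bij_betw_def image_def)
  also have "\<dots> = finprod G (\<lambda>p. g (snd p) (fst p)) (B \<times> A)" by simp
  also have "\<dots> = finprod G (\<lambda>b. finprod G (\<lambda>a. g a b) A) B"
    using assms by (intro finprod_Sigma[symmetric]) auto
  finally show ?thesis .
qed

section \<open>Generic divided powers\<close>

abbreviation "ncm \<equiv> free_comm_monoid (UNIV :: nat set)"
abbreviation "npoly R \<equiv> monoid_ring R ncm"

text \<open>\<open>npoly R\<close> is the polynomial ring over \<open>R\<close> in variables \<open>T\<^sub>0, T\<^sub>1, \<dots>\<close>; for divided power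
  sequences \<open>t\<^sub>i\<close> over \<open>R\<close>, \<open>gen R I t\<close> is the sequence \<open>\<Sum>\<^sub>i T\<^sub>i \<cdot> t\<^sub>i\<close>.\<close>

definition gen :: "('r, 'x) ring_scheme \<Rightarrow> nat set \<Rightarrow> (nat \<Rightarrow> nat \<Rightarrow> 'r) \<Rightarrow> nat \<Rightarrow> nat multiset \<Rightarrow> 'r"
  where "gen R I t = finsum (edp (npoly R))
    (\<lambda>i. single R {#i#} \<one>\<^bsub>R\<^esub> \<odot>\<^bsub>edp (npoly R)\<^esub> (\<lambda>m. single R {#} (t i m))) I"

locale nvar = R?: cring R for R :: "('r, 'x) ring_scheme" (structure)
begin

sublocale mr: monring R ncm
  by (simp add: monring_def R.is_cring free_comm_monoid_comm_monoid)

abbreviation "NP \<equiv> npoly R"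
abbreviation "tv i \<equiv> single R {#i#} \<one>\<^bsub>R\<^esub>"

sublocale NP: cring NP by (rule mr.mr_cring)
sublocale E: module NP "edp NP" by (rule NP.edp_module)

lemma sc [simp]: "r \<in> carrier R \<Longrightarrow> single R w r \<in> carrier NP"
  by (rule mr.single_closed) auto

lemma sm [simp]: "r \<in> carrier R \<Longrightarrow> s \<in> carrier R \<Longrightarrow>
    single R w r \<otimes>\<^bsub>NP\<^esub> single R w' s = single R (w + w') (r \<otimes>\<^bsub>R\<^esub> s)"
  by (subst mr.single_mult) auto

lemma one_eq: "\<one>\<^bsub>NP\<^esub> = single R {#} \<one>\<^bsub>R\<^esub>" by (simp add: mr.mr_simps)

lemma iota_hom: "single R {#} \<in> ring_hom R NP"
  by (rule ring_hom_memI) (auto simp: one_eq add_hom_add[OF mr.single_add_hom])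

lemma iota_edp: "t \<in> carrier (edp R) \<Longrightarrow> (\<lambda>m. single R {#} (t m)) \<in> carrier (edp NP)"
  using add_hom_closed[OF edp_map(1)[OF R.is_cring NP.is_cring iota_hom]] .

lemma tv_pow: "tv i [^]\<^bsub>NP\<^esub> k = single R (replicate_mset k i) \<one>\<^bsub>R\<^esub>"
  by (induct k) (auto simp: one_eq)

lemma finprod_single:
  assumes "finite I" "u \<in> I \<rightarrow> carrier R"
  shows "(\<Otimes>\<^bsub>NP\<^esub>i\<in>I. single R (w i) (u i)) = single R (\<Sum>i\<in>I. w i) (finprod R u I)"
  using assms
proof (induct I rule: finite_induct)
  case (insert i I)
  then have "u \<in> I \<rightarrow> carrier R" "u i \<in> carrier R" by auto
  then show ?case using insert by (subst NP.finprod_insert) (auto simp: Pi_iff)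
qed (simp add: one_eq)

lemma sum_replicate_mset:
  assumes "finite I" "set_mset c \<subseteq> I" shows "(\<Sum>i\<in>I. replicate_mset (count c i) i) = c"
proof (rule multiset_eqI)
  fix k
  have "count (\<Sum>i\<in>I. replicate_mset (count c i) i) k = (\<Sum>i\<in>I. if k = i then count c i else 0)"
    by (simp add: count_sum)
  also have "\<dots> = count c k" using assms by (auto simp: sum.delta' not_in_iff)
  finally show "count (\<Sum>i\<in>I. replicate_mset (count c i) i) k = count c k" .
qed

lemma gen_closed:
  assumes "\<And>i. i \<in> I \<Longrightarrow> t i \<in> carrier (edp R)"
  shows "gen R I t \<in> carrier (edp NP)"
  unfolding gen_def using assms by (intro E.finsum_closed) (auto intro!: E.smult_closed iota_edp)

text \<open>By \<open>edp_finsum\<close> the term of degree m is a sum over multi-indices d, in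
  which the powers of the T_i combine to T^d. Different d give different monomials, so each
  coefficient is a single product. In this way products of divided powers become coefficients of one
  sequence.\<close>

lemma gen_coeff:
  assumes I: "finite I" and t: "\<And>i. i \<in> I \<Longrightarrow> t i \<in> carrier (edp R)"
  shows "gen R I t m c = (if c \<in> multisets_of_size I m then \<Otimes>\<^bsub>R\<^esub>i\<in>I. t i (count c i) else \<zero>\<^bsub>R\<^esub>)"
proof -
  have tc: "i \<in> I \<Longrightarrow> t i k \<in> carrier R" for i k using t by (auto simp: edp_closed)
  let ?S = "multisets_of_size I m"
  have "gen R I t m = (\<Oplus>\<^bsub>NP\<^esub>d\<in>?S. \<Otimes>\<^bsub>NP\<^esub>i\<in>I. (tv i \<odot>\<^bsub>edp NP\<^esub> (\<lambda>m. single R {#} (t i m))) (count d i))"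
    unfolding gen_def using I t by (intro NP.edp_finsum) (auto intro!: E.smult_closed iota_edp)
  also have "\<dots> = (\<Oplus>\<^bsub>NP\<^esub>d\<in>?S. single R d (\<Otimes>\<^bsub>R\<^esub>i\<in>I. t i (count d i)))"
  proof (rule NP.finsum_cong')
    fix d assume d: "d \<in> ?S"
    have "(\<Otimes>\<^bsub>NP\<^esub>i\<in>I. (tv i \<odot>\<^bsub>edp NP\<^esub> (\<lambda>m. single R {#} (t i m))) (count d i))
      = (\<Otimes>\<^bsub>NP\<^esub>i\<in>I. single R (replicate_mset (count d i) i) (t i (count d i)))"
      using tc by (intro NP.finprod_cong') (auto simp: edp_simps tv_pow)
    also have "\<dots> = single R d (\<Otimes>\<^bsub>R\<^esub>i\<in>I. t i (count d i))"
      using d I tc by (subst finprod_single) (auto simp: sum_replicate_mset multisets_of_size_def)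
    finally show "(\<Otimes>\<^bsub>NP\<^esub>i\<in>I. (tv i \<odot>\<^bsub>edp NP\<^esub> (\<lambda>m. single R {#} (t i m))) (count d i))
      = single R d (\<Otimes>\<^bsub>R\<^esub>i\<in>I. t i (count d i))" .
  qed (use tc in auto)
  finally have "gen R I t m c = (\<Oplus>\<^bsub>R\<^esub>d\<in>?S. single R d (\<Otimes>\<^bsub>R\<^esub>i\<in>I. t i (count d i)) c)"
    using tc by (simp add: mr.coeff_finsum)
  also have "\<dots> = (\<Oplus>\<^bsub>R\<^esub>d\<in>?S. if c = d then \<Otimes>\<^bsub>R\<^esub>i\<in>I. t i (count d i) else \<zero>\<^bsub>R\<^esub>)"
    by (simp add: single_def)
  also have "\<dots> = (if c \<in> ?S then \<Otimes>\<^bsub>R\<^esub>i\<in>I. t i (count c i) else \<zero>\<^bsub>R\<^esub>)"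
  proof (cases "c \<in> ?S")
    case True
    then show ?thesis using tc I by (simp add: R.finsum_singleton finite_multisets_of_size)
  next
    case False
    then have "(\<Oplus>\<^bsub>R\<^esub>d\<in>?S. if c = d then \<Otimes>\<^bsub>R\<^esub>i\<in>I. t i (count d i) else \<zero>\<^bsub>R\<^esub>) = (\<Oplus>\<^bsub>R\<^esub>d\<in>?S. \<zero>\<^bsub>R\<^esub>)"
      by (intro R.finsum_cong') auto
    with False show ?thesis by simp
  qed
  finally show ?thesis .
qed

lemma gen_map:
  assumes I: "finite I" and t: "\<And>i. i \<in> I \<Longrightarrow> t i \<in> carrier (edp R)" and S: "cring S" and h: "h \<in> ring_hom R S"
  shows "(\<lambda>c. h (gen R I t m c)) = gen S I (\<lambda>i k. h (t i k)) m"
proof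
  fix c
  interpret S: nvar S using S by (simp add: nvar_def)
  interpret h: ring_hom_cring R S h using h by unfold_locales
  have t': "i \<in> I \<Longrightarrow> (\<lambda>k. h (t i k)) \<in> carrier (edp S)" for i
    using add_hom_closed[OF edp_map(1)[OF R.is_cring S h] t] .
  have tc: "i \<in> I \<Longrightarrow> t i k \<in> carrier R" for i k using t by (auto simp: edp_closed)
  show "h (gen R I t m c) = gen S I (\<lambda>i k. h (t i k)) m c"
    using tc by (simp add: gen_coeff[OF I t] S.gen_coeff[OF I t'] h.hom_finprod Pi_iff o_def)
qed

lemma gen_add:
  assumes "\<And>i. i \<in> I \<Longrightarrow> t i \<in> carrier (edp R)" "\<And>i. i \<in> I \<Longrightarrow> t' i \<in> carrier (edp R)"
  shows "gen R I (\<lambda>i. t i \<oplus>\<^bsub>edp R\<^esub> t' i) = gen R I t \<oplus>\<^bsub>edp NP\<^esub> gen R I t'"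
proof -
  note m = edp_map(1)[OF R.is_cring NP.is_cring iota_hom]
  have "gen R I (\<lambda>i. t i \<oplus>\<^bsub>edp R\<^esub> t' i) = (\<Oplus>\<^bsub>edp NP\<^esub>i\<in>I.
      tv i \<odot>\<^bsub>edp NP\<^esub> (\<lambda>m. single R {#} (t i m)) \<oplus>\<^bsub>edp NP\<^esub> tv i \<odot>\<^bsub>edp NP\<^esub> (\<lambda>m. single R {#} (t' i m)))"
    unfolding gen_def using assms
    by (intro E.M.finsum_cong')
      (auto simp: add_hom_add[OF m] E.smult_r_distr iota_edp intro!: E.smult_closed iota_edp)
  also have "\<dots> = gen R I t \<oplus>\<^bsub>edp NP\<^esub> gen R I t'"
    unfolding gen_def using assms by (intro E.M.finsum_addf) (auto intro!: E.smult_closed iota_edp)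
  finally show ?thesis .
qed

lemma gen_smult:
  assumes a: "a \<in> carrier R" and t: "\<And>i. i \<in> I \<Longrightarrow> t i \<in> carrier (edp R)"
  shows "gen R I (\<lambda>i. a \<odot>\<^bsub>edp R\<^esub> t i) = single R {#} a \<odot>\<^bsub>edp NP\<^esub> gen R I t"
proof -
  note m = edp_map(2)[OF R.is_cring NP.is_cring iota_hom a]
  have "gen R I (\<lambda>i. a \<odot>\<^bsub>edp R\<^esub> t i) = (\<Oplus>\<^bsub>edp NP\<^esub>i\<in>I.
      single R {#} a \<odot>\<^bsub>edp NP\<^esub> (tv i \<odot>\<^bsub>edp NP\<^esub> (\<lambda>m. single R {#} (t i m))))"
    unfolding gen_def using t a
    by (intro E.M.finsum_cong')
      (auto simp: m E.smult_assoc1[symmetric] iota_edp R.m_comm intro!: E.smult_closed iota_edp)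
  also have "\<dots> = single R {#} a \<odot>\<^bsub>edp NP\<^esub> gen R I t"
  proof -
    have l: "(\<lambda>s. single R {#} a \<odot>\<^bsub>edp NP\<^esub> s) \<in> add_hom (edp NP) (edp NP)"
      using a by (intro add_homI) (auto simp: E.smult_r_distr)
    show ?thesis unfolding gen_def using t
      by (intro add_hom_finsum[OF E.M.abelian_group_axioms E.M.abelian_group_axioms l, symmetric])
        (auto intro!: E.smult_closed iota_edp)
  qed
  finally show ?thesis .
qed

text \<open>Exchanging the two sets of variables of \<open>R[T][U]\<close>.\<close>

lemma swap_hom:
  obtains sw where "sw \<in> ring_hom (npoly NP) (npoly NP)"
    "\<And>f c d. f \<in> carrier (npoly NP) \<Longrightarrow> sw f c d = f d c"
proof -
  interpret N: nvar NP by (simp add: nvar_def NP.is_cring)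
  note map = monoid_ring_map[OF R.is_cring NP.is_cring free_comm_monoid_comm_monoid iota_hom]
  \<comment> \<open>A coefficient, which is a polynomial in the inner variables, is reread as a
    polynomial in the outer ones with constant coefficients; an outer monomial becomes an inner
    one.\<close>
  obtain sw where sw: "sw \<in> ring_hom (npoly NP) (npoly NP)"
    "\<And>d f. d \<in> carrier ncm \<Longrightarrow> f \<in> carrier NP \<Longrightarrow>
      sw (single NP d f) = (\<lambda>m. single R {#} (f m)) \<otimes>\<^bsub>npoly NP\<^esub> single NP {#} (single R d \<one>\<^bsub>R\<^esub>)"
    by (rule N.mr.mr_ring_lift[OF N.NP.is_cring map(1), of "\<lambda>d. single NP {#} (single R d \<one>\<^bsub>R\<^esub>)"])
      (auto simp: N.one_eq one_eq)
  have sw1: "sw (single NP d (single R c r)) = single NP c (single R d r)" if "r \<in> carrier R" for c d r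
    using that by (simp add: sw(2) map(2))
  have "sw f c d = f d c" if f: "f \<in> carrier (npoly NP)" for f c d
    using f
  proof (induct f rule: N.mr.mr_induct)
    case (single d' g)
    then have g: "g \<in> carrier NP" by simp
    have e1: "(\<lambda>g. sw (single NP d' g) c d) \<in> add_hom NP R"
      by (rule add_hom_comp[OF add_hom_comp[OF add_hom_comp[OF N.mr.single_add_hom ring_hom_add_hom[OF sw(1)]] N.mr.coeff_add_hom] mr.coeff_add_hom]) simp
    have e2: "(\<lambda>g. single NP d' g d c) \<in> add_hom NP R"
      by (rule add_hom_comp[OF add_hom_comp[OF N.mr.single_add_hom N.mr.coeff_add_hom] mr.coeff_add_hom]) simp
    show ?case
      by (rule mr.mr_add_hom_eq[OF e1 e2 g]) (simp add: sw1, simp add: single_def mr.mr_simps)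
  next
    case (add f g)
    then show ?case using add_hom_add[OF ring_hom_add_hom[OF sw(1)]] by (simp add: N.mr.mr_simps mr.mr_simps)
  qed
  with sw(1) that show thesis by blast
qed

text \<open>Both sides come from the double sum of (T_i U_j) \<cdot> t(i, j). They differ in the
  order of summation and in which set of variables is the inner one, and the latter is corrected by
  \<open>swap_hom\<close>.\<close>

lemma gen_swap:
  assumes I: "finite I" and J: "finite J"
    and t: "\<And>i j. i \<in> I \<Longrightarrow> j \<in> J \<Longrightarrow> t i j \<in> carrier (edp R)"
  shows "gen NP J (\<lambda>j. gen R I (\<lambda>i. t i j)) n d c = gen NP I (\<lambda>i. gen R J (\<lambda>j. t i j)) n c d"
proof -
  interpret N: nvar NP by (simp add: nvar_def NP.is_cring)
  let ?E = "edp (npoly NP)"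
  let ?i = "\<lambda>f m. single NP {#} (f m)" and ?ii = "\<lambda>t m. single NP {#} (single R {#} (t m))"
  note mi = edp_map[OF NP.is_cring N.NP.is_cring N.iota_hom]
  have cl: "?ii (t i j) \<in> carrier ?E" if "i \<in> I" "j \<in> J" for i j
    using N.iota_edp[OF iota_edp[OF t[OF that]]] .
  \<comment> \<open>The inner sequence is embedded coefficientwise and the outer variable is
    multiplied in, so that one monomial in both sets of variables acts on each t(i, j). The index
    sets are arbitrary because both orders are brought to this form.\<close>
  have dbl: "gen NP J (\<lambda>j. gen R I (\<lambda>i. t i j)) = (\<Oplus>\<^bsub>?E\<^esub>j\<in>J. \<Oplus>\<^bsub>?E\<^esub>i\<in>I. single NP {#j#} (tv i) \<odot>\<^bsub>?E\<^esub> ?ii (t i j))"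
    if I: "finite I" "finite J" and t: "\<And>i j. i \<in> I \<Longrightarrow> j \<in> J \<Longrightarrow> t i j \<in> carrier (edp R)" for I J t
  proof -
    have cl: "?ii (t i j) \<in> carrier ?E" if "i \<in> I" "j \<in> J" for i j
      using N.iota_edp[OF iota_edp[OF t[OF that]]] .
    have "N.tv j \<odot>\<^bsub>?E\<^esub> ?i (gen R I (\<lambda>i. t i j)) = (\<Oplus>\<^bsub>?E\<^esub>i\<in>I. single NP {#j#} (tv i) \<odot>\<^bsub>?E\<^esub> ?ii (t i j))"
      if j: "j \<in> J" for j
    proof -
      have "?i (gen R I (\<lambda>i. t i j)) = (\<Oplus>\<^bsub>?E\<^esub>i\<in>I. ?i (tv i \<odot>\<^bsub>edp NP\<^esub> (\<lambda>m. single R {#} (t i j m))))"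
        unfolding gen_def using t j
        by (intro add_hom_finsum[OF E.M.abelian_group_axioms N.E.M.abelian_group_axioms mi(1)])
          (auto intro!: E.smult_closed iota_edp)
      also have "\<dots> = (\<Oplus>\<^bsub>?E\<^esub>i\<in>I. single NP {#} (tv i) \<odot>\<^bsub>?E\<^esub> ?ii (t i j))"
        using t j cl by (intro N.E.M.finsum_cong') (auto simp: mi(2) iota_edp)
      finally have "N.tv j \<odot>\<^bsub>?E\<^esub> ?i (gen R I (\<lambda>i. t i j))
          = N.tv j \<odot>\<^bsub>?E\<^esub> (\<Oplus>\<^bsub>?E\<^esub>i\<in>I. single NP {#} (tv i) \<odot>\<^bsub>?E\<^esub> ?ii (t i j))" by simp
      also have "\<dots> = (\<Oplus>\<^bsub>?E\<^esub>i\<in>I. N.tv j \<odot>\<^bsub>?E\<^esub> (single NP {#} (tv i) \<odot>\<^bsub>?E\<^esub> ?ii (t i j)))"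
      proof -
        have l: "(\<lambda>s. N.tv j \<odot>\<^bsub>?E\<^esub> s) \<in> add_hom ?E ?E"
          by (intro add_homI) (auto simp: N.E.smult_r_distr)
        show ?thesis using cl j
          by (intro add_hom_finsum[OF N.E.M.abelian_group_axioms N.E.M.abelian_group_axioms l]) auto
      qed
      also have "\<dots> = (\<Oplus>\<^bsub>?E\<^esub>i\<in>I. single NP {#j#} (tv i) \<odot>\<^bsub>?E\<^esub> ?ii (t i j))"
        using cl j by (intro N.E.M.finsum_cong') (auto simp: N.E.smult_assoc1[symmetric])
      finally show ?thesis .
    qed
    then show ?thesis unfolding gen_def[of NP] using cl by (intro N.E.M.finsum_cong') auto
  qed
  obtain sw where sw: "sw \<in> ring_hom (npoly NP) (npoly NP)"
    "\<And>f c d. f \<in> carrier (npoly NP) \<Longrightarrow> sw f c d = f d c" using swap_hom by blast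
  note ms = edp_map[OF N.NP.is_cring N.NP.is_cring sw(1)]
  have sws: "sw (single NP w (single R v r)) = single NP v (single R w r)" if "r \<in> carrier R" for w v r
    using that by (intro ext) (simp add: sw(2), simp add: single_def mr.mr_simps)
  have dblt: "gen NP J (\<lambda>j. gen R I (\<lambda>i. t i j)) = (\<Oplus>\<^bsub>?E\<^esub>j\<in>J. \<Oplus>\<^bsub>?E\<^esub>i\<in>I. single NP {#j#} (tv i) \<odot>\<^bsub>?E\<^esub> ?ii (t i j))"
    by (rule dbl) (use I J t in auto)
  have "(\<lambda>m. sw (gen NP J (\<lambda>j. gen R I (\<lambda>i. t i j)) m))
      = (\<Oplus>\<^bsub>?E\<^esub>j\<in>J. (\<lambda>m. sw ((\<Oplus>\<^bsub>?E\<^esub>i\<in>I. single NP {#j#} (tv i) \<odot>\<^bsub>?E\<^esub> ?ii (t i j)) m)))"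
    unfolding dblt using cl
    by (intro add_hom_finsum[OF N.E.M.abelian_group_axioms N.E.M.abelian_group_axioms ms(1)]) auto
  also have "\<dots> = (\<Oplus>\<^bsub>?E\<^esub>j\<in>J. \<Oplus>\<^bsub>?E\<^esub>i\<in>I. (\<lambda>m. sw ((single NP {#j#} (tv i) \<odot>\<^bsub>?E\<^esub> ?ii (t i j)) m)))"
    using cl
    by (intro N.E.M.finsum_cong' add_hom_finsum[OF N.E.M.abelian_group_axioms N.E.M.abelian_group_axioms ms(1)] refl)
      (auto intro!: N.E.M.finsum_closed add_hom_closed[OF ms(1)])
  also have "\<dots> = (\<Oplus>\<^bsub>?E\<^esub>j\<in>J. \<Oplus>\<^bsub>?E\<^esub>i\<in>I. single NP {#i#} (tv j) \<odot>\<^bsub>?E\<^esub> ?ii (t i j))"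
  proof -
    have "(\<lambda>m. sw ((single NP {#j#} (tv i) \<odot>\<^bsub>?E\<^esub> ?ii (t i j)) m)) = single NP {#i#} (tv j) \<odot>\<^bsub>?E\<^esub> ?ii (t i j)"
      if "i \<in> I" "j \<in> J" for i j
    proof -
      have "t i j m \<in> carrier R" for m using t[OF that] by (simp add: edp_closed)
      then show ?thesis using cl[OF that] by (simp add: ms(2) sws)
    qed
    then show ?thesis using cl by (intro N.E.M.finsum_cong') (auto intro!: N.E.M.finsum_closed N.E.M.finsum_cong')
  qed
  also have "\<dots> = (\<Oplus>\<^bsub>?E\<^esub>i\<in>I. \<Oplus>\<^bsub>?E\<^esub>j\<in>J. single NP {#i#} (tv j) \<odot>\<^bsub>?E\<^esub> ?ii (t i j))"
    using I J cl by (intro N.E.M.add.finprod_commute) auto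
  also have "\<dots> = gen NP I (\<lambda>i. gen R J (\<lambda>j. t i j))"
    by (rule dbl[OF J I, of "\<lambda>j i. t i j", symmetric]) (use t in auto)
  finally have "(\<lambda>m. sw (gen NP J (\<lambda>j. gen R I (\<lambda>i. t i j)) m)) = gen NP I (\<lambda>i. gen R J (\<lambda>j. t i j))" .
  from fun_cong[OF fun_cong[OF fun_cong[OF this, of n], of c], of d]
  have "sw (gen NP J (\<lambda>j. gen R I (\<lambda>i. t i j)) n) c d = gen NP I (\<lambda>i. gen R J (\<lambda>j. t i j)) n c d" .
  moreover have "gen NP J (\<lambda>j. gen R I (\<lambda>i. t i j)) n \<in> carrier (npoly NP)"
    by (rule edp_closed[OF N.gen_closed[OF gen_closed]]) (use t in auto)
  ultimately show ?thesis by (simp add: sw(2))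
qed

end

section \<open>The second product\<close>

locale dpa =
  fixes A :: "('a, 'x) ring_scheme" and F :: "('a, 'f, 'y) module_scheme"
  assumes AF: "algebra A F"
begin

sublocale A: cring A by (rule algebra.R_cring[OF AF])
sublocale F: cring F by (rule algebra.M_cring[OF AF])
sublocale AF: algebra A F by (rule AF)
sublocale dpow A F by (simp add: dpow_def algebra.module[OF AF])
sublocale nG: nvar G by (simp add: nvar_def G.is_cring)

abbreviation "GT \<equiv> npoly G"

lemma AF_smult_assoc: "a \<in> carrier A \<Longrightarrow> x \<in> carrier F \<Longrightarrow> y \<in> carrier F \<Longrightarrow> x \<otimes>\<^bsub>F\<^esub> (a \<odot>\<^bsub>F\<^esub> y) = a \<odot>\<^bsub>F\<^esub> (x \<otimes>\<^bsub>F\<^esub> y)"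
  using AF.smult_assoc2[of a y x] by (simp add: F.m_comm)

lemma smult_one_pow: "a \<in> carrier A \<Longrightarrow> (a \<odot>\<^bsub>G\<^esub> \<one>\<^bsub>G\<^esub>) [^]\<^bsub>G\<^esub> (m::nat) = (a [^]\<^bsub>A\<^esub> m) \<odot>\<^bsub>G\<^esub> \<one>\<^bsub>G\<^esub>"
  by (induct m) (auto simp: GA.smult_assoc2 GA.smult_assoc1[symmetric] A.m_comm)

lemma gam_edp_smult:
  assumes "a \<in> carrier A" "x \<in> carrier F"
  shows "(\<lambda>m. \<gamma> m (a \<odot>\<^bsub>F\<^esub> x)) = (a \<odot>\<^bsub>G\<^esub> \<one>\<^bsub>G\<^esub>) \<odot>\<^bsub>edp G\<^esub> (\<lambda>m. \<gamma> m x)"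
  using assms by (simp add: edp_simps gam_smult smult_one_pow GA.smult_assoc2)

lemma iota_smult_hom: "(\<lambda>a. single G {#} (a \<odot>\<^bsub>G\<^esub> \<one>\<^bsub>G\<^esub>)) \<in> ring_hom A GT"
  by (rule ring_hom_comp[OF smult_one_hom nG.iota_hom])

definition is_Phi where "is_Phi I x \<Phi> \<longleftrightarrow> \<Phi> \<in> ring_hom G GT
   \<and> (\<forall>m. \<forall>y\<in>carrier F. \<Phi> (\<gamma> m y) = gen G I (\<lambda>i m. \<gamma> m (x i \<otimes>\<^bsub>F\<^esub> y)) m)
   \<and> (\<forall>a\<in>carrier A. \<forall>u\<in>carrier G. \<Phi> (a \<odot>\<^bsub>G\<^esub> u) = single G {#} (a \<odot>\<^bsub>G\<^esub> \<one>\<^bsub>G\<^esub>) \<otimes>\<^bsub>GT\<^esub> \<Phi> u)"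

text \<open>Multiplication by \<open>\<Sum>\<^sub>i T\<^sub>i x\<^sub>i\<close> is an endomorphism of \<open>F[T]\<close>; this is the induced map
  \<open>\<Gamma>(F) \<rightarrow> \<Gamma>(F)[T]\<close>.\<close>

definition Phi where "Phi I x = (SOME \<Phi>. is_Phi I x \<Phi>)"

text \<open>The sequence that \<open>dp_lift\<close> asks for at y is \<Sum> T_i \<cdot>
  \<gamma>(x_i y), the divided powers of (\<Sum> T_i x_i) y. It is linear in y by
  \<open>gen_add\<close> and \<open>gen_smult\<close>.\<close>

lemma is_Phi_Phi:
  assumes x: "x \<in> I \<rightarrow> carrier F" shows "is_Phi I x (Phi I x)"
proof -
  have xi: "x i \<in> carrier F" if "i \<in> I" for i using x that by auto
  obtain h where "h \<in> ring_hom G GT"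
    "\<And>m y. y \<in> carrier F \<Longrightarrow> h (\<gamma> m y) = gen G I (\<lambda>i m. \<gamma> m (x i \<otimes>\<^bsub>F\<^esub> y)) m"
    "\<And>a u. a \<in> carrier A \<Longrightarrow> u \<in> carrier G \<Longrightarrow> h (a \<odot>\<^bsub>G\<^esub> u) = single G {#} (a \<odot>\<^bsub>G\<^esub> \<one>\<^bsub>G\<^esub>) \<otimes>\<^bsub>GT\<^esub> h u"
  proof (rule dp_lift[OF nG.NP.is_cring iota_smult_hom, of "\<lambda>y. gen G I (\<lambda>i m. \<gamma> m (x i \<otimes>\<^bsub>F\<^esub> y))"])
    show "(\<lambda>y. gen G I (\<lambda>i m. \<gamma> m (x i \<otimes>\<^bsub>F\<^esub> y))) \<in> add_hom F (edp GT)"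
    proof (rule add_homI)
      fix y assume "y \<in> carrier F"
      then show "gen G I (\<lambda>i m. \<gamma> m (x i \<otimes>\<^bsub>F\<^esub> y)) \<in> carrier (edp GT)"
        by (intro nG.gen_closed gam_edp) (simp add: xi)
    next
      fix y y' assume y: "y \<in> carrier F" "y' \<in> carrier F"
      have "gen G I (\<lambda>i m. \<gamma> m (x i \<otimes>\<^bsub>F\<^esub> (y \<oplus>\<^bsub>F\<^esub> y'))) =
          gen G I (\<lambda>i. (\<lambda>m. \<gamma> m (x i \<otimes>\<^bsub>F\<^esub> y)) \<oplus>\<^bsub>edp G\<^esub> (\<lambda>m. \<gamma> m (x i \<otimes>\<^bsub>F\<^esub> y')))"
        unfolding gen_def using y xi
        by (intro nG.E.M.finsum_cong')
          (auto simp: F.r_distr add_hom_add[OF gam_edp_add_hom, symmetric] intro!: nG.E.smult_closed nG.iota_edp G.edp_conv_closed gam_edp)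
      then show "gen G I (\<lambda>i m. \<gamma> m (x i \<otimes>\<^bsub>F\<^esub> (y \<oplus>\<^bsub>F\<^esub> y'))) =
          gen G I (\<lambda>i m. \<gamma> m (x i \<otimes>\<^bsub>F\<^esub> y)) \<oplus>\<^bsub>edp GT\<^esub> gen G I (\<lambda>i m. \<gamma> m (x i \<otimes>\<^bsub>F\<^esub> y'))"
        using y xi by (simp add: nG.gen_add gam_edp)
    qed
    fix a y assume a: "a \<in> carrier A" "y \<in> carrier F"
    have "gen G I (\<lambda>i m. \<gamma> m (x i \<otimes>\<^bsub>F\<^esub> (a \<odot>\<^bsub>F\<^esub> y))) =
        gen G I (\<lambda>i. (a \<odot>\<^bsub>G\<^esub> \<one>\<^bsub>G\<^esub>) \<odot>\<^bsub>edp G\<^esub> (\<lambda>m. \<gamma> m (x i \<otimes>\<^bsub>F\<^esub> y)))"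
      unfolding gen_def using a xi
      by (intro nG.E.M.finsum_cong')
        (auto simp: AF_smult_assoc gam_edp_smult[symmetric] intro!: nG.E.smult_closed nG.iota_edp gam_edp)
    then show "gen G I (\<lambda>i m. \<gamma> m (x i \<otimes>\<^bsub>F\<^esub> (a \<odot>\<^bsub>F\<^esub> y))) =
        single G {#} (a \<odot>\<^bsub>G\<^esub> \<one>\<^bsub>G\<^esub>) \<odot>\<^bsub>edp GT\<^esub> gen G I (\<lambda>i m. \<gamma> m (x i \<otimes>\<^bsub>F\<^esub> y))"
      using a xi by (simp add: nG.gen_smult gam_edp)
  qed (rule that)
  then have "is_Phi I x h" by (simp add: is_Phi_def)
  then show ?thesis unfolding Phi_def by (rule someI[of "is_Phi I x"])
qed

lemma Phi_hom: "x \<in> I \<rightarrow> carrier F \<Longrightarrow> Phi I x \<in> ring_hom G GT"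
  and Phi_gam: "x \<in> I \<rightarrow> carrier F \<Longrightarrow> y \<in> carrier F \<Longrightarrow> Phi I x (\<gamma> m y) = gen G I (\<lambda>i m. \<gamma> m (x i \<otimes>\<^bsub>F\<^esub> y)) m"
  and Phi_smult: "x \<in> I \<rightarrow> carrier F \<Longrightarrow> a \<in> carrier A \<Longrightarrow> u \<in> carrier G
    \<Longrightarrow> Phi I x (a \<odot>\<^bsub>G\<^esub> u) = single G {#} (a \<odot>\<^bsub>G\<^esub> \<one>\<^bsub>G\<^esub>) \<otimes>\<^bsub>GT\<^esub> Phi I x u"
  using is_Phi_Phi unfolding is_Phi_def by blast+

lemma gprod_closed: "x \<in> I \<rightarrow> carrier F \<Longrightarrow> gprod I x c \<in> carrier G"
  by (intro G.finprod_closed) (auto intro!: gam_closed)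

lemma Phi_gam_coeff:
  assumes "finite I" "x \<in> I \<rightarrow> carrier F" "y \<in> carrier F"
  shows "Phi I x (\<gamma> m y) c = (if c \<in> multisets_of_size I m then gprod I (\<lambda>i. x i \<otimes>\<^bsub>F\<^esub> y) c else \<zero>\<^bsub>G\<^esub>)"
  unfolding Phi_gam[OF assms(2,3)] by (rule nG.gen_coeff) (use assms in \<open>auto intro!: gam_edp\<close>)

lemma coeff_smult:
  assumes "a \<in> carrier A" "f \<in> carrier GT"
  shows "(single G {#} (a \<odot>\<^bsub>G\<^esub> \<one>\<^bsub>G\<^esub>) \<otimes>\<^bsub>GT\<^esub> f) c = a \<odot>\<^bsub>G\<^esub> f c"
proof -
  have h1: "(\<lambda>f. (single G {#} (a \<odot>\<^bsub>G\<^esub> \<one>\<^bsub>G\<^esub>) \<otimes>\<^bsub>GT\<^esub> f) c) \<in> add_hom GT G"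
    using assms by (intro add_hom_comp[OF _ nG.mr.coeff_add_hom] add_homI) (auto simp: nG.NP.r_distr)
  have h2: "(\<lambda>f. a \<odot>\<^bsub>G\<^esub> f c) \<in> add_hom GT G"
    using assms by (intro add_hom_comp[OF nG.mr.coeff_add_hom] add_homI) (auto simp: GA.smult_r_distr)
  show ?thesis
    by (rule nG.mr.mr_add_hom_eq[OF h1 h2 assms(2)]) (use assms in \<open>simp_all add: GA.smult_assoc2, simp add: single_def\<close>)
qed

lemma GT_coeff: "f \<in> carrier GT \<Longrightarrow> f c \<in> carrier G" by (simp add: nG.mr.mr_carrier)

lemma Phi_closed: "x \<in> I \<rightarrow> carrier F \<Longrightarrow> v \<in> carrier G \<Longrightarrow> Phi I x v \<in> carrier GT"
  by (rule ring_hom_closed[OF Phi_hom])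

lemma Phi_smult_coeff:
  assumes "x \<in> I \<rightarrow> carrier F" "a \<in> carrier A" "v \<in> carrier G"
  shows "Phi I x (a \<odot>\<^bsub>G\<^esub> v) c = a \<odot>\<^bsub>G\<^esub> Phi I x v c"
  using assms by (simp add: Phi_smult coeff_smult Phi_closed)

text \<open>Bihomogeneous elements: coefficients of degree n in \<Gamma>(F), monomials of degree n
  in T. Since \<open>Phi\<close> sends divided monomials of degree n here, \<open>mu\<close>
  preserves \<Gamma>^n and unequal degrees do not interact.\<close>

definition Gr where "Gr n = {f \<in> carrier GT. \<forall>c. f c \<in> part n \<and> (size c \<noteq> n \<longrightarrow> f c = \<zero>\<^bsub>G\<^esub>)}"

lemma Gr_mult:
  assumes "f \<in> Gr m" "g \<in> Gr n" shows "f \<otimes>\<^bsub>GT\<^esub> g \<in> Gr (m + n)"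
proof -
  have f: "f \<in> carrier GT" "\<And>c. f c \<in> part m" "\<And>c. size c \<noteq> m \<Longrightarrow> f c = \<zero>\<^bsub>G\<^esub>"
    and g: "g \<in> carrier GT" "\<And>c. g c \<in> part n" "\<And>c. size c \<noteq> n \<Longrightarrow> g c = \<zero>\<^bsub>G\<^esub>"
    using assms by (auto simp: Gr_def)
  have fg: "f c \<in> carrier G" "g c \<in> carrier G" for c using f(1) g(1) GT_coeff by auto
  have eq: "(f \<otimes>\<^bsub>GT\<^esub> g) c = (\<Oplus>\<^bsub>G\<^esub>p\<in>{p\<in>supp G f \<times> supp G g. fst p + snd p = c}. f (fst p) \<otimes>\<^bsub>G\<^esub> g (snd p))" for c
    using nG.mr.mult_eq[OF f(1) g(1), of "supp G f" "supp G g" c] f(1) g(1) by (simp add: nG.mr.mr_carrier)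
  have "(f \<otimes>\<^bsub>GT\<^esub> g) c \<in> part (m + n)" for c
    unfolding eq by (intro part_finsum part_mult f g)
  moreover have "(f \<otimes>\<^bsub>GT\<^esub> g) c = \<zero>\<^bsub>G\<^esub>" if "size c \<noteq> m + n" for c
    unfolding eq
  proof (rule G.add.finprod_one_eqI)
    fix p assume "p \<in> {p\<in>supp G f \<times> supp G g. fst p + snd p = c}"
    then have "size (fst p) \<noteq> m \<or> size (snd p) \<noteq> n" using that by auto
    then show "f (fst p) \<otimes>\<^bsub>G\<^esub> g (snd p) = \<zero>\<^bsub>G\<^esub>" using f(3) g(3) fg by auto
  qed
  ultimately show ?thesis using f(1) g(1) by (simp add: Gr_def)
qed

lemma Gr_finprod:
  assumes "finite J" "\<And>j. j \<in> J \<Longrightarrow> f j \<in> Gr (d j)"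
  shows "(\<Otimes>\<^bsub>GT\<^esub>j\<in>J. f j) \<in> Gr (\<Sum>j\<in>J. d j)"
  using assms
proof (induct J rule: finite_induct)
  case empty
  then show ?case
    by (simp add: Gr_def) (auto simp: nG.one_eq single_def part_one part_zero)
next
  case (insert j J)
  then have "f \<in> J \<rightarrow> carrier GT" "f j \<in> carrier GT" by (auto simp: Gr_def)
  then show ?case using insert Gr_mult[of "f j"] by (simp add: nG.NP.finprod_insert)
qed

lemma Phi_gprod_Gr:
  assumes "finite I" "x \<in> I \<rightarrow> carrier F" "finite J" "y \<in> J \<rightarrow> carrier F" "set_mset d \<subseteq> J"
  shows "Phi I x (gprod J y d) \<in> Gr (size d)"
proof -
  interpret h: ring_hom_cring G GT "Phi I x" using Phi_hom[OF assms(2)] by unfold_locales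
  have "Phi I x (gprod J y d) = (\<Otimes>\<^bsub>GT\<^esub>j\<in>J. Phi I x (\<gamma> (count d j) (y j)))"
    using assms by (subst h.hom_finprod) (auto simp: o_def intro!: gam_closed)
  moreover have "Phi I x (\<gamma> m y) \<in> Gr m" if "y \<in> carrier F" for m y
    using that assms gprod_part[of I "\<lambda>i. x i \<otimes>\<^bsub>F\<^esub> y"] Phi_closed[OF assms(2), of "\<gamma> m y"]
    by (auto simp: Gr_def Phi_gam_coeff part_zero multisets_of_size_def Pi_iff)
  ultimately have "Phi I x (gprod J y d) \<in> Gr (\<Sum>j\<in>J. count d j)"
    using assms by (auto intro!: Gr_finprod)
  then show ?thesis using sum_count[of J d] assms by simp
qed

text \<open>For n the common size of c and d, both sides are the coefficient at T^c U^d of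
  \<gamma>^n((\<Sum> T_i x_i)(\<Sum> U_j y_j)). The variables are exchanged by
  \<open>gen_swap\<close>, the factors by commutativity of F.\<close>

lemma Phi_sym:
  assumes I: "finite I" "x \<in> I \<rightarrow> carrier F" "set_mset c \<subseteq> I"
    and J: "finite J" "y \<in> J \<rightarrow> carrier F" "set_mset d \<subseteq> J"
  shows "Phi I x (gprod J y d) c = Phi J y (gprod I x c) d"
proof (cases "size c = size d")
  \<comment> \<open>The two polynomials are homogeneous, of degrees \<open>size d\<close> and
    \<open>size c\<close>, and the coefficients asked for lie in other degrees; both are
    zero.\<close>
  case False
  then show ?thesis
    using Phi_gprod_Gr[OF I(1,2) J] Phi_gprod_Gr[OF J(1,2) I] by (simp add: Gr_def)
next
  case True
  interpret N: nvar GT by (simp add: nvar_def nG.NP.is_cring)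
  \<comment> \<open>The divided monomial is the coefficient at U^d of a generic sequence by
    \<open>gen_coeff\<close>, and \<open>gen_map\<close> lets \<open>Phi I x\<close> act inside that
    sequence.\<close>
  have *: "Phi I x (gprod J y d) c = gen GT J (\<lambda>j. gen G I (\<lambda>i m. \<gamma> m (x i \<otimes>\<^bsub>F\<^esub> y j))) (size d) d c"
    if I: "finite I" "x \<in> I \<rightarrow> carrier F" "set_mset c \<subseteq> I"
      and J: "finite J" "y \<in> J \<rightarrow> carrier F" "set_mset d \<subseteq> J" for I J x y c d
  proof -
    have d: "d \<in> multisets_of_size J (size d)" using J by (simp add: multisets_of_size_def)
    have yj: "j \<in> J \<Longrightarrow> y j \<in> carrier F" for j using J by auto
    have "gprod J y d = gen G J (\<lambda>j m. \<gamma> m (y j)) (size d) d"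
      using d J by (subst nG.gen_coeff) (auto intro!: gam_edp)
    also have "Phi I x \<dots> = gen GT J (\<lambda>j m. Phi I x (\<gamma> m (y j))) (size d) d"
      using nG.gen_map[OF J(1) _ nG.NP.is_cring Phi_hom[OF I(2)], of "\<lambda>j m. \<gamma> m (y j)" "size d"] yj
      by (metis gam_edp)
    also have "\<dots> = gen GT J (\<lambda>j. gen G I (\<lambda>i m. \<gamma> m (x i \<otimes>\<^bsub>F\<^esub> y j))) (size d) d"
    proof -
      have e: "(\<lambda>m. Phi I x (\<gamma> m (y j))) = gen G I (\<lambda>i m. \<gamma> m (x i \<otimes>\<^bsub>F\<^esub> y j))" if "j \<in> J" for j
        using Phi_gam[OF I(2) yj[OF that]] by auto
      have cl: "gen G I (\<lambda>i m. \<gamma> m (x i \<otimes>\<^bsub>F\<^esub> y j)) \<in> carrier (edp GT)" if "j \<in> J" for j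
        using I yj[OF that] by (intro nG.gen_closed gam_edp) auto
      have "gen GT J (\<lambda>j m. Phi I x (\<gamma> m (y j))) = gen GT J (\<lambda>j. gen G I (\<lambda>i m. \<gamma> m (x i \<otimes>\<^bsub>F\<^esub> y j)))"
        unfolding gen_def[of GT]
      proof (rule N.E.M.finsum_cong')
        show "(\<lambda>i. single GT {#i#} \<one>\<^bsub>GT\<^esub> \<odot>\<^bsub>edp (npoly GT)\<^esub> (\<lambda>m. single GT {#} (gen G I (\<lambda>ia m. \<gamma> m (x ia \<otimes>\<^bsub>F\<^esub> y i)) m)))
          \<in> J \<rightarrow> carrier (edp (npoly GT))"
          using cl by (auto intro!: N.E.smult_closed N.iota_edp)
      qed (simp_all add: e[symmetric])
      then show ?thesis by simp
    qed
    finally show ?thesis by simp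
  qed
  have te: "(\<lambda>m. \<gamma> m (x i \<otimes>\<^bsub>F\<^esub> y j)) \<in> carrier (edp G)" if "i \<in> I" "j \<in> J" for i j
    using that I J by (intro gam_edp) auto
  have "Phi I x (gprod J y d) c = gen GT I (\<lambda>i. gen G J (\<lambda>j m. \<gamma> m (x i \<otimes>\<^bsub>F\<^esub> y j))) (size d) c d"
    unfolding *[OF I J] by (rule nG.gen_swap[OF I(1) J(1) te])
  also have "\<dots> = gen GT I (\<lambda>i. gen G J (\<lambda>j m. \<gamma> m (y j \<otimes>\<^bsub>F\<^esub> x i))) (size c) c d"
  proof -
    have e: "gen G J (\<lambda>j m. \<gamma> m (x i \<otimes>\<^bsub>F\<^esub> y j)) = gen G J (\<lambda>j m. \<gamma> m (y j \<otimes>\<^bsub>F\<^esub> x i))"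
      and cl: "gen G J (\<lambda>j m. \<gamma> m (y j \<otimes>\<^bsub>F\<^esub> x i)) \<in> carrier (edp GT)" if i: "i \<in> I" for i
    proof -
      have "x i \<in> carrier F" using i I by auto
      then have c: "x i \<otimes>\<^bsub>F\<^esub> y j = y j \<otimes>\<^bsub>F\<^esub> x i" "y j \<otimes>\<^bsub>F\<^esub> x i \<in> carrier F" if "j \<in> J" for j
        using J that by (auto intro!: F.m_comm)
      show "gen G J (\<lambda>j m. \<gamma> m (x i \<otimes>\<^bsub>F\<^esub> y j)) = gen G J (\<lambda>j m. \<gamma> m (y j \<otimes>\<^bsub>F\<^esub> x i))"
        unfolding gen_def using c
        by (intro nG.E.M.finsum_cong') (auto intro!: nG.E.smult_closed nG.iota_edp gam_edp)
      show "gen G J (\<lambda>j m. \<gamma> m (y j \<otimes>\<^bsub>F\<^esub> x i)) \<in> carrier (edp GT)"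
        using c by (intro nG.gen_closed gam_edp) auto
    qed
    have "gen GT I (\<lambda>i. gen G J (\<lambda>j m. \<gamma> m (x i \<otimes>\<^bsub>F\<^esub> y j))) = gen GT I (\<lambda>i. gen G J (\<lambda>j m. \<gamma> m (y j \<otimes>\<^bsub>F\<^esub> x i)))"
      unfolding gen_def[of GT]
    proof (rule N.E.M.finsum_cong')
      show "(\<lambda>i. single GT {#i#} \<one>\<^bsub>GT\<^esub> \<odot>\<^bsub>edp (npoly GT)\<^esub> (\<lambda>m. single GT {#} (gen G J (\<lambda>j m. \<gamma> m (y j \<otimes>\<^bsub>F\<^esub> x i)) m)))
        \<in> I \<rightarrow> carrier (edp (npoly GT))"
        using cl by (auto intro!: N.E.smult_closed N.iota_edp)
    qed (simp_all add: e)
    then show ?thesis using True by simp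
  qed
  also have "\<dots> = Phi J y (gprod I x c) d" using *[OF J I] by simp
  finally show ?thesis .
qed

subsection \<open>Construction\<close>

text \<open>The last clause determines m, since divided monomials span \<open>G\<close> over A. The
  product is set up on all of \<open>G\<close> at once; by \<open>Phi_gprod_Gr\<close> elements of
  different degrees have product zero.\<close>

definition is_mu where "is_mu m \<longleftrightarrow> (\<forall>u\<in>carrier G. \<forall>v\<in>carrier G. m u v \<in> carrier G \<and> m u v = m v u)
    \<and> (\<forall>v\<in>carrier G. (\<lambda>u. m u v) \<in> add_hom G G)
    \<and> (\<forall>a\<in>carrier A. \<forall>u\<in>carrier G. \<forall>v\<in>carrier G. m (a \<odot>\<^bsub>G\<^esub> u) v = a \<odot>\<^bsub>G\<^esub> m u v)
    \<and> (\<forall>I x c v. finite I \<longrightarrow> x \<in> I \<rightarrow> carrier F \<longrightarrow> set_mset c \<subseteq> I \<longrightarrow> v \<in> carrier G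
        \<longrightarrow> m (gprod I x c) v = Phi I x v c)"

text \<open>Well-definedness in the first argument is that in the second one, by symmetry.\<close>

lemma mu_exists: "\<exists>m. is_mu m"
proof -
  let ?W = "carrier (free_comm_monoid ((UNIV :: nat set) \<times> carrier F))"
  have "\<forall>w\<in>?W. \<exists>r :: nat set \<times> (nat \<Rightarrow> 'f) \<times> nat multiset. case r of (I, x, c) \<Rightarrow> finite I \<and> x \<in> I \<rightarrow> carrier F \<and> set_mset c \<subseteq> I
      \<and> cls (single A w \<one>\<^bsub>A\<^esub>) = gprod I x c"
  proof
    fix w assume "w \<in> ?W"
    then obtain I :: "nat set" and x c where "finite I" "x \<in> I \<rightarrow> carrier F"
      "c \<in> multisets_of_size I (sum_mset (image_mset fst w))"
      "cls (single A w \<one>\<^bsub>A\<^esub>) = gprod I x c" using monomial_gprod[of w 0] by auto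
    then show "\<exists>r :: nat set \<times> (nat \<Rightarrow> 'f) \<times> nat multiset. case r of (I, x, c) \<Rightarrow> finite I \<and> x \<in> I \<rightarrow> carrier F \<and> set_mset c \<subseteq> I
      \<and> cls (single A w \<one>\<^bsub>A\<^esub>) = gprod I x c"
      by (intro exI[of _ "(I, x, c)"]) (auto simp: multisets_of_size_def)
  qed
  \<comment> \<open>One way of writing each monomial as a divided monomial is fixed. That the
    outcome agrees with \<open>Phi\<close> for every other way is the last clause of
    \<open>is_mu\<close>, proved at the end.\<close>
  from bchoice[OF this] obtain rep :: "(nat \<times> 'f) multiset \<Rightarrow> nat set \<times> (nat \<Rightarrow> 'f) \<times> nat multiset" where "\<forall>w\<in>?W. case rep w of (I, x, c) \<Rightarrow> finite I \<and> x \<in> I \<rightarrow> carrier F \<and> set_mset c \<subseteq> I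
      \<and> cls (single A w \<one>\<^bsub>A\<^esub>) = gprod I x c" by (elim exE) (rule that)
  note r = this
  define I where "I w = fst (rep w)" for w
  define x where "x w = fst (snd (rep w))" for w
  define c where "c w = snd (snd (rep w))" for w
  have rep: "finite (I w)" "x w \<in> I w \<rightarrow> carrier F" "set_mset (c w) \<subseteq> I w"
      "cls (single A w \<one>\<^bsub>A\<^esub>) = gprod (I w) (x w) (c w)" if "w \<in> ?W" for w
    using bspec[OF r that] unfolding case_prod_beta I_def x_def c_def by blast+
  have cls_single: "cls (single A w a) = a \<odot>\<^bsub>G\<^esub> gprod (I w) (x w) (c w)" if "w \<in> ?W" "a \<in> carrier A" for w a
  proof -
    have "single A w a = dp_const A a \<otimes>\<^bsub>PP\<^esub> single A w \<one>\<^bsub>A\<^esub>"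
      using that unfolding dp_const_def by (subst mr.single_mult) auto
    moreover have "single A w \<one>\<^bsub>A\<^esub> \<in> carrier PP" using that by (intro mr.single_closed) auto
    ultimately show ?thesis using that rep[OF that(1)] by (simp add: smult_eq const_closed)
  qed
  let ?b = "\<lambda>w v. Phi (I w) (x w) v (c w)"
  have bc: "?b w v \<in> carrier G" if "w \<in> ?W" "v \<in> carrier G" for w v
    using GT_coeff[OF Phi_closed] rep[OF that(1)] that by blast
  have bh: "(\<lambda>v. ?b w v) \<in> add_hom G G" if "w \<in> ?W" for w
    using add_hom_comp[OF ring_hom_add_hom[OF Phi_hom] nG.mr.coeff_add_hom] rep[OF that] by blast
  have "\<exists>h. h \<in> add_hom PP G \<and> (\<forall>w\<in>?W. \<forall>a\<in>carrier A. h (single A w a) = a \<odot>\<^bsub>G\<^esub> ?b w v)" if v: "v \<in> carrier G" for v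
  proof -
    obtain h where "h \<in> add_hom PP G" "\<And>w a. w \<in> ?W \<Longrightarrow> a \<in> carrier A \<Longrightarrow> h (single A w a) = a \<odot>\<^bsub>G\<^esub> ?b w v"
    proof (rule mr.mr_lift[OF G.abelian_group_axioms, of "\<lambda>w a. a \<odot>\<^bsub>G\<^esub> ?b w v"])
      fix w assume "w \<in> ?W"
      then show "(\<lambda>a. a \<odot>\<^bsub>G\<^esub> ?b w v) \<in> add_hom A G" using bc v by (intro add_homI) (auto simp: GA.smult_l_distr)
    qed (rule that)
    then show ?thesis by blast
  qed
  then obtain L where L: "\<And>v. v \<in> carrier G \<Longrightarrow> L v \<in> add_hom PP G"
    "\<And>v w a. v \<in> carrier G \<Longrightarrow> w \<in> ?W \<Longrightarrow> a \<in> carrier A \<Longrightarrow> L v (single A w a) = a \<odot>\<^bsub>G\<^esub> ?b w v" by metis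
  have Ladd: "(\<lambda>v. L v p) \<in> add_hom G G" if "p \<in> carrier PP" for p
  proof (rule add_homI)
    show "L v p \<in> carrier G" if "v \<in> carrier G" for v using add_hom_closed[OF L(1)[OF that] \<open>p \<in> _\<close>] .
    fix u v assume uv: "u \<in> carrier G" "v \<in> carrier G"
    have k: "(\<lambda>p. L u p \<oplus>\<^bsub>G\<^esub> L v p) \<in> add_hom PP G"
      using uv L(1) by (intro add_homI) (auto simp: add_hom_closed[OF L(1)] add_hom_add[OF L(1)] G.a_ac)
    show "L (u \<oplus>\<^bsub>G\<^esub> v) p = L u p \<oplus>\<^bsub>G\<^esub> L v p"
      by (rule mr.mr_add_hom_eq[OF L(1) k that]) (use uv in \<open>auto simp: L(2) bc add_hom_add[OF bh] GA.smult_r_distr\<close>)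
  qed
  \<comment> \<open>The right side depends on p only through \<open>cls p\<close>. This makes
    \<open>mu\<close> below independent of the representative taken by \<open>SOME\<close>.\<close>
  have Lsym: "L (cls q) p = L (cls p) q" if p: "p \<in> carrier PP" and q: "q \<in> carrier PP" for p q
    using p
  proof (induct p rule: mr.mr_induct)
    case (single w a)
    note w = single
    show ?case using q
    proof (induct q rule: mr.mr_induct)
      case (single w' a')
      let ?g = "gprod (I w) (x w) (c w)" and ?g' = "gprod (I w') (x w') (c w')"
      have g: "?g \<in> carrier G" "?g' \<in> carrier G" using rep w single by (auto intro!: gprod_closed)
      have "L (cls (single A w' a')) (single A w a) = a \<odot>\<^bsub>G\<^esub> (a' \<odot>\<^bsub>G\<^esub> ?b w ?g')"
        using w single g rep[OF w(1)] by (simp add: cls_single L(2) Phi_smult_coeff)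
      moreover have "L (cls (single A w a)) (single A w' a') = a' \<odot>\<^bsub>G\<^esub> (a \<odot>\<^bsub>G\<^esub> ?b w' ?g)"
        using w single g rep[OF single(1)] by (simp add: cls_single L(2) Phi_smult_coeff)
      moreover have "?b w ?g' = ?b w' ?g"
        using rep[OF w(1)] rep[OF single(1)] by (intro Phi_sym) auto
      ultimately show ?case using w single g bc[OF single(1) g(1)] by (simp add: GA.smult_assoc1[symmetric] A.m_comm)
    next
      case (add f g)
      have s: "single A w a \<in> carrier PP" using w by (intro mr.single_closed) auto
      then show ?case using add add_hom_add[OF Ladd[OF s]] add_hom_add[OF L(1)[of "cls (single A w a)"]] by simp
    qed
  next
    case (add f g)
    then show ?case using q add_hom_add[OF Ladd[OF q]] add_hom_add[OF L(1)[of "cls q"]] by simp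
  qed
  define mu where "mu u v = L v (SOME p. p \<in> carrier PP \<and> u = cls p)" for u v
  have mu: "mu (cls p) v = L v p" if p: "p \<in> carrier PP" and v: "v \<in> carrier G" for p v
  proof -
    define p' where "p' = (SOME q. q \<in> carrier PP \<and> cls p = cls q)"
    have p': "p' \<in> carrier PP \<and> cls p = cls p'"
      unfolding p'_def by (rule someI[where P = "\<lambda>q. q \<in> carrier PP \<and> cls p = cls q"]) (use p in simp)
    obtain q where q: "q \<in> carrier PP" "v = cls q" using v G_elem by auto
    have "L v p' = L v p" using Lsym[OF _ q(1)] p p' q(2) by metis
    then show ?thesis by (simp add: mu_def p'_def)
  qed
  have smult_cls: "a \<odot>\<^bsub>G\<^esub> cls p = cls (dp_const A a \<otimes>\<^bsub>PP\<^esub> p)" if "a \<in> carrier A" "p \<in> carrier PP" for a p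
    using that by (simp add: smult_eq const_closed)
  show ?thesis unfolding is_mu_def
  proof (intro exI[of _ mu] conjI ballI allI impI)
    fix u v assume uv: "u \<in> carrier G" "v \<in> carrier G"
    then obtain p q where pq: "p \<in> carrier PP" "u = cls p" "q \<in> carrier PP" "v = cls q" using G_elem by auto
    show "mu u v \<in> carrier G" using pq uv(2) by (simp only: pq(2) mu) (rule add_hom_closed[OF L(1)], auto)
    show "mu u v = mu v u" using pq uv Lsym[of p q] mu[of p v] mu[of q u] by simp
  next
    fix v assume v: "v \<in> carrier G"
    show "(\<lambda>u. mu u v) \<in> add_hom G G"
    proof (rule add_homI)
      fix u assume "u \<in> carrier G"
      then obtain p where "p \<in> carrier PP" "u = cls p" using G_elem by auto
      then show "mu u v \<in> carrier G" using v by (simp add: mu add_hom_closed[OF L(1)])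
      fix u' assume "u' \<in> carrier G"
      then obtain p' where p': "p' \<in> carrier PP" "u' = cls p'" using G_elem by auto
      then have "u \<oplus>\<^bsub>G\<^esub> u' = cls (p \<oplus>\<^bsub>PP\<^esub> p')" using \<open>p \<in> _\<close> \<open>u = _\<close> by simp
      then show "mu (u \<oplus>\<^bsub>G\<^esub> u') v = mu u v \<oplus>\<^bsub>G\<^esub> mu u' v"
        using p' \<open>p \<in> _\<close> \<open>u = _\<close> v mu[of "p \<oplus>\<^bsub>PP\<^esub> p'" v] by (simp add: mu add_hom_add[OF L(1)])
    qed
  next
    fix a u v assume a: "a \<in> carrier A" and uv: "u \<in> carrier G" "v \<in> carrier G"
    obtain p where p: "p \<in> carrier PP" "u = cls p" using uv G_elem by auto
    have h1: "(\<lambda>p. L v (dp_const A a \<otimes>\<^bsub>PP\<^esub> p)) \<in> add_hom PP G"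
      using a by (intro add_hom_comp[OF _ L(1)[OF uv(2)]] add_homI) (auto simp: const_closed PP.r_distr)
    have h2: "(\<lambda>p. a \<odot>\<^bsub>G\<^esub> L v p) \<in> add_hom PP G"
      using a by (intro add_hom_comp[OF L(1)[OF uv(2)]] add_homI) (auto simp: GA.smult_r_distr)
    have "L v (dp_const A a \<otimes>\<^bsub>PP\<^esub> p) = a \<odot>\<^bsub>G\<^esub> L v p"
    proof (rule mr.mr_add_hom_eq[OF h1 h2 p(1)])
      fix w r assume w: "w \<in> ?W" "r \<in> carrier A"
      have "dp_const A a \<otimes>\<^bsub>PP\<^esub> single A w r = single A w (a \<otimes>\<^bsub>A\<^esub> r)"
        using w a unfolding dp_const_def by (subst mr.single_mult) auto
      then show "L v (dp_const A a \<otimes>\<^bsub>PP\<^esub> single A w r) = a \<odot>\<^bsub>G\<^esub> L v (single A w r)"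
        using w a uv by (simp add: L(2) bc GA.smult_assoc1)
    qed
    then show "mu (a \<odot>\<^bsub>G\<^esub> u) v = a \<odot>\<^bsub>G\<^esub> mu u v"
      using a p uv(2) mu[of "dp_const A a \<otimes>\<^bsub>PP\<^esub> p" v] mu[of p v] by (simp only: p(2) smult_cls) (simp add: const_closed)
  next
    fix I' :: "nat set" and x' c' v assume I': "finite I'" "x' \<in> I' \<rightarrow> carrier F" "set_mset c' \<subseteq> I'" and v: "v \<in> carrier G"
    obtain q where q: "q \<in> carrier PP" "v = cls q" using v G_elem by auto
    let ?g = "gprod I' x' c'"
    have g: "?g \<in> carrier G" by (rule gprod_closed[OF I'(2)])
    obtain p where p: "p \<in> carrier PP" "?g = cls p" using g G_elem by auto
    have "mu ?g v = L ?g q" using p q v mu[of p v] Lsym[of p q] by simp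
    \<comment> \<open>The index set is arbitrary now, not one of those fixed by \<open>rep\<close>.
      Both sides are additive in q, and on monomials \<open>Phi_sym\<close> compares them.\<close>
    also have "\<dots> = Phi I' x' (cls q) c'"
    proof (rule mr.mr_add_hom_eq[OF L(1)[OF g] _ q(1)])
      show "(\<lambda>q. Phi I' x' (cls q) c') \<in> add_hom PP G"
        by (rule add_hom_comp[OF ring_hom_add_hom[OF cls_hom]
              add_hom_comp[OF ring_hom_add_hom[OF Phi_hom[OF I'(2)]] nG.mr.coeff_add_hom]])
      fix w r assume w: "w \<in> ?W" "r \<in> carrier A"
      have "Phi (I w) (x w) ?g (c w) = Phi I' x' (gprod (I w) (x w) (c w)) c'"
        using rep[OF w(1)] I' by (intro Phi_sym) auto
      then show "L ?g (single A w r) = Phi I' x' (cls (single A w r)) c'"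
        using w g rep[OF w(1)] I' by (simp add: L(2) cls_single Phi_smult_coeff gprod_closed)
    qed
    finally show "mu ?g v = Phi I' x' v c'" using q by simp
  qed
qed

definition mu where "mu = (SOME m. is_mu m)"

lemma is_mu_mu: "is_mu mu" unfolding mu_def by (rule someI_ex[OF mu_exists])

lemmas mu_props = is_mu_mu[unfolded is_mu_def]

lemma mu_closed [simp]: "u \<in> carrier G \<Longrightarrow> v \<in> carrier G \<Longrightarrow> mu u v \<in> carrier G"
  using mu_props[THEN conjunct1] by blast

lemma mu_comm: "u \<in> carrier G \<Longrightarrow> v \<in> carrier G \<Longrightarrow> mu u v = mu v u"
  using mu_props[THEN conjunct1] by blast

lemma mu_add_hom: "v \<in> carrier G \<Longrightarrow> (\<lambda>u. mu u v) \<in> add_hom G G"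
  using mu_props[THEN conjunct2, THEN conjunct1] by blast

lemma mu_smult: "a \<in> carrier A \<Longrightarrow> u \<in> carrier G \<Longrightarrow> v \<in> carrier G \<Longrightarrow> mu (a \<odot>\<^bsub>G\<^esub> u) v = a \<odot>\<^bsub>G\<^esub> mu u v"
  using mu_props[THEN conjunct2, THEN conjunct2, THEN conjunct1] by blast

lemma mu_gprod: "finite I \<Longrightarrow> x \<in> I \<rightarrow> carrier F \<Longrightarrow> set_mset c \<subseteq> I \<Longrightarrow> v \<in> carrier G
        \<Longrightarrow> mu (gprod I x c) v = Phi I x v c"
  using mu_props[THEN conjunct2, THEN conjunct2, THEN conjunct2] by blast

lemma mu_add: "u \<in> carrier G \<Longrightarrow> u' \<in> carrier G \<Longrightarrow> v \<in> carrier G \<Longrightarrow> mu (u \<oplus>\<^bsub>G\<^esub> u') v = mu u v \<oplus>\<^bsub>G\<^esub> mu u' v"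
  using add_hom_add[OF mu_add_hom] .

lemma mu_add_right: "u \<in> carrier G \<Longrightarrow> v \<in> carrier G \<Longrightarrow> v' \<in> carrier G \<Longrightarrow> mu u (v \<oplus>\<^bsub>G\<^esub> v') = mu u v \<oplus>\<^bsub>G\<^esub> mu u v'"
  by (simp add: mu_comm[of u] mu_add)

lemma mu_smult_right: "a \<in> carrier A \<Longrightarrow> u \<in> carrier G \<Longrightarrow> v \<in> carrier G \<Longrightarrow> mu u (a \<odot>\<^bsub>G\<^esub> v) = a \<odot>\<^bsub>G\<^esub> mu u v"
  by (simp add: mu_comm[of u] mu_smult)

lemma mu_zero: "v \<in> carrier G \<Longrightarrow> mu \<zero>\<^bsub>G\<^esub> v = \<zero>\<^bsub>G\<^esub>" "v \<in> carrier G \<Longrightarrow> mu v \<zero>\<^bsub>G\<^esub> = \<zero>\<^bsub>G\<^esub>"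
  using add_hom_zero[OF G.abelian_group_axioms G.abelian_group_axioms mu_add_hom] by (auto simp: mu_comm)

text \<open>After induction in both arguments only divided monomials are left, and there the value
  is a coefficient of an element of \<open>Gr n\<close>.\<close>

lemma mu_part:
  assumes "u \<in> part n" "v \<in> part n" shows "mu u v \<in> part n"
  using assms(1)
proof (induct u rule: part_induct[where k = 0])
  case zero then show ?case using assms part_closed by (simp add: mu_zero part_zero)
next
  case (add u v') then show ?case using assms part_closed by (simp add: mu_add part_add)
next
  case (gprod I x c a)
  then have g: "gprod I x c \<in> carrier G" "set_mset c \<subseteq> I" by (auto intro!: gprod_closed simp: multisets_of_size_def)
  note v = part_closed[OF assms(2)]
  have "mu v (gprod I x c) \<in> part n" using assms(2)
  proof (induct v rule: part_induct[where k = 0])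
    case zero then show ?case using g by (simp add: mu_zero part_zero)
  next
    case (add u v') then show ?case using g part_closed by (simp add: mu_add part_add)
  next
    case (gprod J y d b)
    then have g': "gprod J y d \<in> carrier G" "set_mset d \<subseteq> J" by (auto intro!: gprod_closed simp: multisets_of_size_def)
    have "Phi J y (gprod I x c) \<in> Gr (size c)"
      using gprod g g' \<open>x \<in> I \<rightarrow> carrier F\<close> \<open>finite I\<close> by (intro Phi_gprod_Gr)
    then have "mu (gprod J y d) (gprod I x c) \<in> part n"
      using gprod g g' \<open>c \<in> multisets_of_size I n\<close> by (simp add: mu_gprod Gr_def multisets_of_size_def)
    then show ?case using gprod g g' by (simp add: mu_smult part_smult)
  qed
  then have "mu (gprod I x c) v \<in> part n" using g v by (simp add: mu_comm)
  then show ?case using gprod g v by (simp add: mu_smult part_smult)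
qed

lemma gam_as_gprod: "y \<in> carrier F \<Longrightarrow> \<gamma> m y = gprod {0} (\<lambda>_. y) (replicate_mset m (0::nat))"
  by simp

text \<open>With a single variable T this is the coefficient at T^n of \<gamma>^n(T x y).\<close>

lemma mu_gam_gam:
  assumes "x \<in> carrier F" "y \<in> carrier F" shows "mu (\<gamma> n x) (\<gamma> n y) = \<gamma> n (x \<otimes>\<^bsub>F\<^esub> y)"
proof -
  have "mu (gprod {0} (\<lambda>_. x) (replicate_mset n (0::nat))) (\<gamma> n y) = Phi {0} (\<lambda>_. x) (\<gamma> n y) (replicate_mset n 0)"
    by (rule mu_gprod) (use assms in auto)
  then have "mu (\<gamma> n x) (\<gamma> n y) = Phi {0} (\<lambda>_. x) (\<gamma> n y) (replicate_mset n 0)"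
    by (simp only: gam_as_gprod[OF assms(1), of n, symmetric])
  also have "\<dots> = gprod {0} (\<lambda>_. x \<otimes>\<^bsub>F\<^esub> y) (replicate_mset n (0::nat))"
    using assms by (subst Phi_gam_coeff) (auto simp: multisets_of_size_def)
  finally show ?thesis by (simp only: gam_as_gprod[OF F.m_closed[OF assms], of n, symmetric])
qed

end

section \<open>Base change\<close>

lemma finprod_algebra_via: "finprod (algebra_via S \<phi>) f I = finprod S f I"
  by (simp add: finprod_def algebra_via_def)

lemma pow_algebra_via: "u [^]\<^bsub>algebra_via S \<phi>\<^esub> (k::nat) = u [^]\<^bsub>S\<^esub> k"
  by (simp add: nat_pow_def algebra_via_def)

lemma algebra_finprod_smult:
  assumes alg: "algebra R M" and "finite I" "a \<in> I \<rightarrow> carrier R" "u \<in> I \<rightarrow> carrier M"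
  shows "(\<Otimes>\<^bsub>M\<^esub>i\<in>I. a i \<odot>\<^bsub>M\<^esub> u i) = (\<Otimes>\<^bsub>R\<^esub>i\<in>I. a i) \<odot>\<^bsub>M\<^esub> (\<Otimes>\<^bsub>M\<^esub>i\<in>I. u i)"
proof -
  interpret M: cring M by (rule algebra.M_cring[OF alg])
  interpret R: cring R by (rule algebra.R_cring[OF alg])
  interpret RM: algebra R M by (rule alg)
  show ?thesis using assms(2-)
  proof (induct I rule: finite_induct)
    case (insert i I)
    then have c: "a i \<in> carrier R" "u i \<in> carrier M" "a \<in> I \<rightarrow> carrier R" "u \<in> I \<rightarrow> carrier M"
      "(\<lambda>i. a i \<odot>\<^bsub>M\<^esub> u i) \<in> I \<rightarrow> carrier M" by (auto intro!: RM.smult_closed)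
    have pc: "finprod R a I \<in> carrier R" "finprod M u I \<in> carrier M" using c by auto
    have "(a i \<odot>\<^bsub>M\<^esub> u i) \<otimes>\<^bsub>M\<^esub> (finprod R a I \<odot>\<^bsub>M\<^esub> finprod M u I)
      = (a i \<otimes>\<^bsub>R\<^esub> finprod R a I) \<odot>\<^bsub>M\<^esub> (u i \<otimes>\<^bsub>M\<^esub> finprod M u I)"
      using c pc RM.smult_assoc2[of "finprod R a I" "finprod M u I" "u i"]
      by (simp add: RM.smult_assoc2 RM.smult_assoc1 M.m_comm[of "u i"])
    then show ?case using insert c by simp
  qed simp
qed

context dpa
begin

text \<open>What the comparison of coefficients uses about a product on \<Gamma>^n. Associativity
  and unit are left out, so that the comparison can be applied to \<open>mu\<close> before they are
  known, and in order to prove them.\<close>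

definition cbil where "cbil n m \<longleftrightarrow>
   (\<forall>u\<in>part n. \<forall>v\<in>part n. m u v \<in> part n \<and> m u v = m v u)
 \<and> (\<forall>u\<in>part n. \<forall>u'\<in>part n. \<forall>v\<in>part n. m (u \<oplus>\<^bsub>G\<^esub> u') v = m u v \<oplus>\<^bsub>G\<^esub> m u' v)
 \<and> (\<forall>a\<in>carrier A. \<forall>u\<in>part n. \<forall>v\<in>part n. m (a \<odot>\<^bsub>G\<^esub> u) v = a \<odot>\<^bsub>G\<^esub> m u v)"

lemma cbilD:
  assumes "cbil n m"
  shows "\<And>u v. u \<in> part n \<Longrightarrow> v \<in> part n \<Longrightarrow> m u v \<in> part n"
    and "\<And>u v. u \<in> part n \<Longrightarrow> v \<in> part n \<Longrightarrow> m u v = m v u"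
    and "\<And>u u' v. u \<in> part n \<Longrightarrow> u' \<in> part n \<Longrightarrow> v \<in> part n \<Longrightarrow> m (u \<oplus>\<^bsub>G\<^esub> u') v = m u v \<oplus>\<^bsub>G\<^esub> m u' v"
    and "\<And>a u v. a \<in> carrier A \<Longrightarrow> u \<in> part n \<Longrightarrow> v \<in> part n \<Longrightarrow> m (a \<odot>\<^bsub>G\<^esub> u) v = a \<odot>\<^bsub>G\<^esub> m u v"
  using assms unfolding cbil_def by blast+

lemma cbil_mu: "cbil n mu"
  unfolding cbil_def
  by (intro conjI ballI; (rule mu_part mu_comm mu_add mu_smult; simp add: part_closed))

lemma part_with_simps:
  "carrier (dp_part_with A F n m) = part n" "\<zero>\<^bsub>dp_part_with A F n m\<^esub> = \<zero>\<^bsub>G\<^esub>"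
  "\<one>\<^bsub>dp_part_with A F n m\<^esub> = \<gamma> n \<one>\<^bsub>F\<^esub>" "u \<otimes>\<^bsub>dp_part_with A F n m\<^esub> v = m u v"
  "u \<oplus>\<^bsub>dp_part_with A F n m\<^esub> v = u \<oplus>\<^bsub>G\<^esub> v" "a \<odot>\<^bsub>dp_part_with A F n m\<^esub> u = a \<odot>\<^bsub>G\<^esub> u"
  by (simp_all add: dp_part_with_def)

lemma algebra_cbil:
  assumes "algebra A (dp_part_with A F n m)" shows "cbil n m"
proof -
  interpret Hr: cring "dp_part_with A F n m" by (rule algebra.M_cring[OF assms])
  interpret H: algebra A "dp_part_with A F n m" by fact
  show ?thesis unfolding cbil_def
    using Hr.m_closed Hr.m_comm Hr.l_distr H.smult_assoc2 by (simp add: part_with_simps)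
qed

lemma algebra_part_with:
  assumes m: "cbil n m"
    and assoc: "\<And>u v w. u \<in> part n \<Longrightarrow> v \<in> part n \<Longrightarrow> w \<in> part n \<Longrightarrow> m (m u v) w = m u (m v w)"
    and unit: "\<And>u. u \<in> part n \<Longrightarrow> m (\<gamma> n \<one>\<^bsub>F\<^esub>) u = u"
  shows "algebra A (dp_part_with A F n m)"
proof -
  have neg: "\<ominus>\<^bsub>G\<^esub> u \<in> part n" if "u \<in> part n" for u
  proof -
    have "(\<ominus>\<^bsub>A\<^esub> \<one>\<^bsub>A\<^esub>) \<odot>\<^bsub>G\<^esub> u = \<ominus>\<^bsub>G\<^esub> u" using part_closed[OF that] by (simp add: GA.smult_l_minus)
    then show ?thesis using part_smult[OF _ that, of "\<ominus>\<^bsub>A\<^esub> \<one>\<^bsub>A\<^esub>"] by simp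
  qed
  have ab: "abelian_group (dp_part_with A F n m)"
  proof (rule abelian_groupI; simp only: part_with_simps)
    fix u v w assume "u \<in> part n" "v \<in> part n" "w \<in> part n"
    then show "u \<oplus>\<^bsub>G\<^esub> v \<oplus>\<^bsub>G\<^esub> w = u \<oplus>\<^bsub>G\<^esub> (v \<oplus>\<^bsub>G\<^esub> w)" by (simp add: part_closed G.a_assoc)
  next
    fix u v assume "u \<in> part n" "v \<in> part n"
    then show "u \<oplus>\<^bsub>G\<^esub> v = v \<oplus>\<^bsub>G\<^esub> u" by (simp add: part_closed G.a_comm)
  next
    fix u assume u: "u \<in> part n"
    then show "\<zero>\<^bsub>G\<^esub> \<oplus>\<^bsub>G\<^esub> u = u" by (simp add: part_closed)
    show "\<exists>v\<in>part n. v \<oplus>\<^bsub>G\<^esub> u = \<zero>\<^bsub>G\<^esub>" using neg[OF u] u by (intro bexI[of _ "\<ominus>\<^bsub>G\<^esub> u"]) (simp_all add: part_closed G.l_neg)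
  qed (simp_all add: part_add part_zero)
  have cr: "cring (dp_part_with A F n m)"
  proof (rule cringI[OF ab comm_monoidI]; simp only: part_with_simps)
    show "\<gamma> n \<one>\<^bsub>F\<^esub> \<in> part n" by (rule part_gam) simp
  qed (fact cbilD[OF m] assoc unit)+
  show ?thesis
    by (rule algebraI[OF A.is_cring cr]; simp only: part_with_simps)
      (simp_all add: part_smult part_closed GA.smult_l_distr GA.smult_r_distr GA.smult_assoc1 cbilD(4)[OF m])
qed

text \<open>Here h is additive on \<Gamma>^n only, which is not the whole carrier of
  \<open>G\<close>, so \<open>add_hom_finsum\<close> does not apply.\<close>

lemma part_additive_finsum:
  assumes h: "\<And>u. u \<in> part n \<Longrightarrow> h u \<in> carrier G" "\<And>u v. u \<in> part n \<Longrightarrow> v \<in> part n \<Longrightarrow> h (u \<oplus>\<^bsub>G\<^esub> v) = h u \<oplus>\<^bsub>G\<^esub> h v"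
    and f: "\<And>i. i \<in> P \<Longrightarrow> f i \<in> part n"
  shows "h (\<Oplus>\<^bsub>G\<^esub>i\<in>P. f i) = (\<Oplus>\<^bsub>G\<^esub>i\<in>P. h (f i))"
proof -
  have z: "h \<zero>\<^bsub>G\<^esub> = \<zero>\<^bsub>G\<^esub>"
    using h(2)[OF part_zero part_zero] h(1)[OF part_zero] by (metis G.add.r_cancel_one' G.l_zero G.zero_closed)
  show ?thesis using f
  proof (induct P rule: infinite_finite_induct)
    case (insert i P)
    then have c: "f i \<in> carrier G" "f \<in> P \<rightarrow> carrier G" "h (f i) \<in> carrier G" "(\<lambda>i. h (f i)) \<in> P \<rightarrow> carrier G"
      using part_closed h(1) by auto
    have "finsum G f P \<in> part n" using insert by (intro part_finsum) auto
    then show ?case using insert c h(2) by (simp add: G.finsum_insert)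
  qed (simp_all add: z)
qed

end

locale base_change =
  fixes A :: "('a, 'x) ring_scheme" and F :: "('a, 'f, 'y) module_scheme" and B :: "('a, 'b, 'z) module_scheme"
  assumes AF: "algebra A F" and AB: "algebra A B"
begin

sublocale dpa A F by (simp add: dpa_def AF)
sublocale t: tens A F B by (simp add: tens_def AF AB)
sublocale D: dpa B "tensor_algebra A F B" by (simp add: dpa_def t.T_algebra)

lemma kappa_exists: "\<exists>\<kappa>. is_base_change_map A F B \<kappa>"
proof -
  have hB: "(\<lambda>a. a \<odot>\<^bsub>B\<^esub> \<one>\<^bsub>B\<^esub>) \<in> ring_hom A B"
    by (rule ring_hom_memI) (auto simp: t.AC.smult_l_distr t.AC.smult_assoc2 t.AC.smult_assoc1)
  have g: "(\<lambda>y m. D.\<gamma> m (t.tn y \<one>\<^bsub>B\<^esub>)) \<in> add_hom F (edp D.G)"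
    by (rule add_hom_comp[OF t.t_add_hom_left D.gam_edp_add_hom]) simp
  obtain \<kappa> where "\<kappa> \<in> ring_hom G D.G" "\<And>m y. y \<in> carrier F \<Longrightarrow> \<kappa> (\<gamma> m y) = D.\<gamma> m (t.tn y \<one>\<^bsub>B\<^esub>)"
    "\<And>a u. a \<in> carrier A \<Longrightarrow> u \<in> carrier G \<Longrightarrow> \<kappa> (a \<odot>\<^bsub>G\<^esub> u) = ((a \<odot>\<^bsub>B\<^esub> \<one>\<^bsub>B\<^esub>) \<odot>\<^bsub>D.G\<^esub> \<one>\<^bsub>D.G\<^esub>) \<otimes>\<^bsub>D.G\<^esub> \<kappa> u"
  proof (rule dp_lift[OF D.G.is_cring ring_hom_comp[OF hB D.smult_one_hom] g])
    fix a y assume a: "a \<in> carrier A" "y \<in> carrier F"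
    have "t.tn (a \<odot>\<^bsub>F\<^esub> y) \<one>\<^bsub>B\<^esub> = (a \<odot>\<^bsub>B\<^esub> \<one>\<^bsub>B\<^esub>) \<odot>\<^bsub>t.T\<^esub> t.tn y \<one>\<^bsub>B\<^esub>"
      using a by (simp add: t.tn_balanced t.t_smult)
    then show "(\<lambda>m. D.\<gamma> m (t.tn (a \<odot>\<^bsub>F\<^esub> y) \<one>\<^bsub>B\<^esub>)) = ((a \<odot>\<^bsub>B\<^esub> \<one>\<^bsub>B\<^esub>) \<odot>\<^bsub>D.G\<^esub> \<one>\<^bsub>D.G\<^esub>) \<odot>\<^bsub>edp D.G\<^esub> (\<lambda>m. D.\<gamma> m (t.tn y \<one>\<^bsub>B\<^esub>))"
      using a by (simp add: D.gam_edp_smult)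
  qed (rule that)
  then show ?thesis unfolding is_base_change_map_def Let_def
    by (intro exI[of _ \<kappa>]) (auto simp: D.smult_via_one[symmetric] ring_hom_closed simp del: t.T_simps D.GA.smult_assoc2)
qed

context
  fixes \<kappa> assumes k: "is_base_change_map A F B \<kappa>"
begin

lemma kappa_hom: "\<kappa> \<in> ring_hom G D.G"
  and kappa_gam: "y \<in> carrier F \<Longrightarrow> \<kappa> (\<gamma> m y) = D.\<gamma> m (t.tn y \<one>\<^bsub>B\<^esub>)"
  and kappa_smult: "a \<in> carrier A \<Longrightarrow> u \<in> carrier G \<Longrightarrow> \<kappa> (a \<odot>\<^bsub>G\<^esub> u) = (a \<odot>\<^bsub>B\<^esub> \<one>\<^bsub>B\<^esub>) \<odot>\<^bsub>D.G\<^esub> \<kappa> u"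
  using k unfolding is_base_change_map_def Let_def by blast+

lemma kappa_closed: "u \<in> carrier G \<Longrightarrow> \<kappa> u \<in> carrier D.G"
  using ring_hom_closed[OF kappa_hom] .

lemma kappa_gprod:
  assumes "x \<in> I \<rightarrow> carrier F"
  shows "\<kappa> (gprod I x c) = D.gprod I (\<lambda>i. t.tn (x i) \<one>\<^bsub>B\<^esub>) c"
proof -
  interpret h: ring_hom_cring G D.G \<kappa> using kappa_hom by unfold_locales
  have "\<kappa> (gprod I x c) = (\<Otimes>\<^bsub>D.G\<^esub>i\<in>I. \<kappa> (\<gamma> (count c i) (x i)))"
    using assms by (subst h.hom_finprod) (auto simp: o_def intro!: gam_closed)
  also have "\<dots> = D.gprod I (\<lambda>i. t.tn (x i) \<one>\<^bsub>B\<^esub>) c"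
    using assms by (intro D.G.finprod_cong') (auto intro!: kappa_gam D.gam_closed t.t_closed)
  finally show ?thesis .
qed

lemma kappa_part:
  assumes "u \<in> part n" shows "\<kappa> u \<in> D.part n"
  using assms
proof (induct u rule: part_induct[where k = 0])
  case zero
  then show ?case
    using add_hom_zero[OF G.abelian_group_axioms D.G.abelian_group_axioms ring_hom_add_hom[OF kappa_hom]] D.part_zero by simp
next
  case (gprod I x c a)
  have "D.gprod I (\<lambda>i. t.tn (x i) \<one>\<^bsub>B\<^esub>) c \<in> D.part n" using gprod by (intro D.gprod_part) (auto intro!: t.t_closed)
  then show ?case using gprod gprod_closed[of x I c]
    by (simp add: kappa_smult kappa_gprod D.part_smult)
next
  case (add u v)
  then show ?case using ring_hom_add[OF kappa_hom] part_closed D.part_add by simp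
qed

text \<open>Both sides are ring homomorphisms in v, so they are compared on scalars and on the
  \<gamma>^m(y). There the claim is that base change turns multiplication by \<Sum> T_i x_i into
  multiplication by \<Sum> T_i (x_i \<otimes> 1).\<close>

lemma kappa_Phi:
  assumes I: "finite I" "x \<in> I \<rightarrow> carrier F" and v: "v \<in> carrier G"
  shows "(\<lambda>c. \<kappa> (Phi I x v c)) = D.Phi I (\<lambda>i. t.tn (x i) \<one>\<^bsub>B\<^esub>) (\<kappa> v)"
proof -
  let ?x = "\<lambda>i. t.tn (x i) \<one>\<^bsub>B\<^esub>"
  have x': "?x \<in> I \<rightarrow> carrier t.T" using I by (auto intro!: t.t_closed)
  note map = monoid_ring_map[OF G.is_cring D.G.is_cring free_comm_monoid_comm_monoid kappa_hom]
  show ?thesis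
  proof (rule G_hom_eq[OF D.nG.NP.is_cring ring_hom_comp[OF Phi_hom[OF I(2)] map(1)] ring_hom_comp[OF kappa_hom D.Phi_hom[OF x']] _ _ v])
    fix a assume a: "a \<in> carrier A"
    have 1: "Phi I x (a \<odot>\<^bsub>G\<^esub> \<one>\<^bsub>G\<^esub>) = single G {#} (a \<odot>\<^bsub>G\<^esub> \<one>\<^bsub>G\<^esub>)"
      using a I by (simp add: Phi_smult ring_hom_one[OF Phi_hom])
    have "D.Phi I ?x (\<kappa> (a \<odot>\<^bsub>G\<^esub> \<one>\<^bsub>G\<^esub>)) = single D.G {#} (\<kappa> (a \<odot>\<^bsub>G\<^esub> \<one>\<^bsub>G\<^esub>))"
      using a x' by (simp add: kappa_smult ring_hom_one[OF kappa_hom] D.Phi_smult ring_hom_one[OF D.Phi_hom])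
    then show "(\<lambda>c. \<kappa> (Phi I x (a \<odot>\<^bsub>G\<^esub> \<one>\<^bsub>G\<^esub>) c)) = D.Phi I ?x (\<kappa> (a \<odot>\<^bsub>G\<^esub> \<one>\<^bsub>G\<^esub>))"
      using a by (simp add: 1 map(2))
  next
    fix m y assume y: "y \<in> carrier F"
    have xi: "i \<in> I \<Longrightarrow> x i \<in> carrier F" for i using I by auto
    have "(\<lambda>c. \<kappa> (Phi I x (\<gamma> m y) c)) = gen D.G I (\<lambda>i k. \<kappa> (\<gamma> k (x i \<otimes>\<^bsub>F\<^esub> y))) m"
      unfolding Phi_gam[OF I(2) y] using xi y
      by (intro nG.gen_map[OF I(1) _ D.G.is_cring kappa_hom]) (auto intro!: gam_edp)
    also have "\<dots> = gen D.G I (\<lambda>i k. D.\<gamma> k (?x i \<otimes>\<^bsub>t.T\<^esub> t.tn y \<one>\<^bsub>B\<^esub>)) m"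
    proof -
      have e: "D.\<gamma> k (t.tn (x i) \<one>\<^bsub>B\<^esub> \<otimes>\<^bsub>t.T\<^esub> t.tn y \<one>\<^bsub>B\<^esub>) = \<kappa> (\<gamma> k (x i \<otimes>\<^bsub>F\<^esub> y))" if "i \<in> I" for i k
        using xi[OF that] y by (simp add: t.t_mult kappa_gam)
      have c: "(\<lambda>k. D.\<gamma> k (?x i \<otimes>\<^bsub>t.T\<^esub> t.tn y \<one>\<^bsub>B\<^esub>)) \<in> carrier (edp D.G)" if "i \<in> I" for i
        using xi[OF that] y by (intro D.gam_edp) simp
      have "gen D.G I (\<lambda>i k. \<kappa> (\<gamma> k (x i \<otimes>\<^bsub>F\<^esub> y))) = gen D.G I (\<lambda>i k. D.\<gamma> k (?x i \<otimes>\<^bsub>t.T\<^esub> t.tn y \<one>\<^bsub>B\<^esub>))"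
        unfolding gen_def
      proof (rule D.nG.E.M.finsum_cong')
        show "(\<lambda>i. single D.G {#i#} \<one>\<^bsub>D.G\<^esub> \<odot>\<^bsub>edp (npoly D.G)\<^esub> (\<lambda>k. single D.G {#} (D.\<gamma> k (?x i \<otimes>\<^bsub>t.T\<^esub> t.tn y \<one>\<^bsub>B\<^esub>))))
          \<in> I \<rightarrow> carrier (edp (npoly D.G))"
          using c by (auto intro!: D.nG.E.smult_closed D.nG.iota_edp)
      qed (simp_all only: e)
      then show ?thesis by (rule fun_cong)
    qed
    also have "\<dots> = D.Phi I ?x (\<kappa> (\<gamma> m y))"
      unfolding kappa_gam[OF y] using y by (intro D.Phi_gam[OF x', symmetric]) simp
    finally show "(\<lambda>c. \<kappa> (Phi I x (\<gamma> m y) c)) = D.Phi I ?x (\<kappa> (\<gamma> m y))" .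
  qed
qed

text \<open>On divided monomials this is \<open>kappa_Phi\<close> read at one coefficient. It makes
  \<open>D.mu\<close> the product \<nu> that \<open>is_second_product\<close> asks for.\<close>

lemma kappa_mu:
  assumes u: "u \<in> part n" and v: "v \<in> carrier G"
  shows "D.mu (\<kappa> u) (\<kappa> v) = \<kappa> (mu u v)"
  using u
proof (induct u rule: part_induct[where k = 0])
  case zero
  then show ?case
    using add_hom_zero[OF G.abelian_group_axioms D.G.abelian_group_axioms ring_hom_add_hom[OF kappa_hom]] v
    by (simp add: mu_zero D.mu_zero kappa_closed)
next
  case (gprod I x c a)
  have x': "(\<lambda>i. t.tn (x i) \<one>\<^bsub>B\<^esub>) \<in> I \<rightarrow> carrier t.T" using gprod by (auto intro!: t.t_closed)
  have c: "set_mset c \<subseteq> I" using gprod by (simp add: multisets_of_size_def)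
  have g: "gprod I x c \<in> carrier G" using gprod by (intro gprod_closed)
  have "D.mu (\<kappa> (gprod I x c)) (\<kappa> v) = \<kappa> (mu (gprod I x c) v)"
    using gprod c x' v fun_cong[OF kappa_Phi[OF gprod(1,3) v], of c]
    by (simp add: kappa_gprod D.mu_gprod kappa_closed mu_gprod)
  then show ?case using gprod g v by (simp add: kappa_smult mu_smult D.mu_smult kappa_closed)
next
  case (add u w)
  then show ?case using v ring_hom_add[OF kappa_hom] part_closed by (simp add: mu_add D.mu_add kappa_closed)
qed

end

end

section \<open>Polynomial base change and uniqueness of the second product\<close>

locale poly_base_change =
  fixes A :: "('a, 'x) ring_scheme" and F :: "('a, 'f, 'y) module_scheme"
  assumes AF: "algebra A F"
begin

text \<open>The polynomial ring A[T] as an A-algebra. Its elements have exactly the type over which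
  \<open>is_second_product\<close> lets B range, so an arbitrary second product can be tested on
  it.\<close>

abbreviation B :: "('a, nat multiset \<Rightarrow> 'a) module" where "B \<equiv> algebra_via (npoly A) (single A {#})"

sublocale nA: nvar A by (simp add: nvar_def algebra.R_cring[OF AF])

lemma B_algebra: "algebra A B"
  by (rule algebra_viaI[OF nA.R.is_cring nA.NP.is_cring nA.iota_hom])

sublocale base_change A F B by (simp add: base_change_def AF B_algebra)

abbreviation "Tk c \<equiv> single A c \<one>\<^bsub>A\<^esub>"
abbreviation "\<psi> f \<equiv> (\<lambda>m. f m \<odot>\<^bsub>G\<^esub> \<one>\<^bsub>G\<^esub>)"

lemma psi_hom: "(\<lambda>f. \<psi> f) \<in> ring_hom B GT"
  and psi_single: "r \<in> carrier A \<Longrightarrow> \<psi> (single A c r) = single G c (r \<odot>\<^bsub>G\<^esub> \<one>\<^bsub>G\<^esub>)"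
  using monoid_ring_map[OF nA.R.is_cring G.is_cring free_comm_monoid_comm_monoid smult_one_hom]
  by (simp_all add: ring_hom_def)

lemma Tk_closed: "Tk c \<in> carrier B" by simp

text \<open>The B-linear extension of y \<mapsto> \<gamma>(y) to F[T], with values in sequences over
  \<Gamma>(F)[T]. It is the input for \<open>dp_lift\<close> over B in
  \<open>sigma_exists\<close>.\<close>

lemma ext_exists:
  "\<exists>e. e \<in> add_hom t.T (edp GT)
    \<and> (\<forall>y\<in>carrier F. \<forall>b\<in>carrier B. e (t.tn y b) = \<psi> b \<odot>\<^bsub>edp GT\<^esub> (\<lambda>m. single G {#} (\<gamma> m y)))"
proof -
  let ?i = "\<lambda>y m. single G {#} (\<gamma> m y)"
  note m = edp_map[OF G.is_cring nG.NP.is_cring nG.iota_hom]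
  have ic: "?i y \<in> carrier (edp GT)" if "y \<in> carrier F" for y
    by (rule nG.iota_edp[OF gam_edp[OF that]])
  have pc: "\<psi> b \<in> carrier GT" if "b \<in> carrier B" for b using ring_hom_closed[OF psi_hom that] .
  obtain e where "e \<in> add_hom t.T (edp GT)"
    "\<And>y b. y \<in> carrier F \<Longrightarrow> b \<in> carrier B \<Longrightarrow> e (t.tn y b) = \<psi> b \<odot>\<^bsub>edp GT\<^esub> ?i y"
  proof (rule t.t_lift[OF nG.NP.edp_abelian, of "\<lambda>y b. \<psi> b \<odot>\<^bsub>edp GT\<^esub> ?i y"])
    fix y b assume yb: "y \<in> carrier F" "b \<in> carrier B"
    show "\<psi> b \<odot>\<^bsub>edp GT\<^esub> ?i y \<in> carrier (edp GT)" using yb ic pc by (intro nG.E.smult_closed)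
    {
      fix y' assume y': "y' \<in> carrier F"
      have "?i (y \<oplus>\<^bsub>F\<^esub> y') = ?i y \<oplus>\<^bsub>edp GT\<^esub> ?i y'"
        using add_hom_add[OF add_hom_comp[OF gam_edp_add_hom m(1)] yb(1) y'] .
      then show "\<psi> b \<odot>\<^bsub>edp GT\<^esub> ?i (y \<oplus>\<^bsub>F\<^esub> y') = \<psi> b \<odot>\<^bsub>edp GT\<^esub> ?i y \<oplus>\<^bsub>edp GT\<^esub> \<psi> b \<odot>\<^bsub>edp GT\<^esub> ?i y'"
        using nG.E.smult_r_distr[OF pc[OF yb(2)] ic[OF yb(1)] ic[OF y']] by simp
    next
      fix b' assume b': "b' \<in> carrier B"
      show "\<psi> (b \<oplus>\<^bsub>B\<^esub> b') \<odot>\<^bsub>edp GT\<^esub> ?i y = \<psi> b \<odot>\<^bsub>edp GT\<^esub> ?i y \<oplus>\<^bsub>edp GT\<^esub> \<psi> b' \<odot>\<^bsub>edp GT\<^esub> ?i y"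
        unfolding ring_hom_add[OF psi_hom yb(2) b'] by (rule nG.E.smult_l_distr[OF pc[OF yb(2)] pc[OF b'] ic[OF yb(1)]])
    next
      fix a assume a: "a \<in> carrier A"
      have ac: "single G {#} (a \<odot>\<^bsub>G\<^esub> \<one>\<^bsub>G\<^esub>) \<in> carrier GT" using a by simp
      have "?i (a \<odot>\<^bsub>F\<^esub> y) = single G {#} (a \<odot>\<^bsub>G\<^esub> \<one>\<^bsub>G\<^esub>) \<odot>\<^bsub>edp GT\<^esub> ?i y"
        using m(2)[OF _ gam_edp[OF yb(1)], of "a \<odot>\<^bsub>G\<^esub> \<one>\<^bsub>G\<^esub>"] a by (simp add: gam_edp_smult[OF a yb(1), symmetric])
      then have "\<psi> b \<odot>\<^bsub>edp GT\<^esub> ?i (a \<odot>\<^bsub>F\<^esub> y) = (\<psi> b \<otimes>\<^bsub>GT\<^esub> single G {#} (a \<odot>\<^bsub>G\<^esub> \<one>\<^bsub>G\<^esub>)) \<odot>\<^bsub>edp GT\<^esub> ?i y"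
        by (simp only: nG.E.smult_assoc1[OF pc[OF yb(2)] ac ic[OF yb(1)]])
      also have "\<psi> b \<otimes>\<^bsub>GT\<^esub> single G {#} (a \<odot>\<^bsub>G\<^esub> \<one>\<^bsub>G\<^esub>) = \<psi> (a \<odot>\<^bsub>B\<^esub> b)"
      proof -
        have "\<psi> (a \<odot>\<^bsub>B\<^esub> b) = \<psi> (single A {#} a) \<otimes>\<^bsub>GT\<^esub> \<psi> b"
          using ring_hom_mult[OF psi_hom, of "single A {#} a" b] yb a by simp
        then show ?thesis using a pc[OF yb(2)] ac by (simp only: psi_single nG.NP.m_comm)
      qed
      finally show "\<psi> b \<odot>\<^bsub>edp GT\<^esub> ?i (a \<odot>\<^bsub>F\<^esub> y) = \<psi> (a \<odot>\<^bsub>B\<^esub> b) \<odot>\<^bsub>edp GT\<^esub> ?i y" .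
    }
  qed (rule that)
  then show ?thesis by blast
qed

text \<open>A left inverse of the canonical map from \<Gamma>(F)[T] to the divided power algebra of
  F[T] over A[T]: it brings \<Sum> T^c \<kappa>(u_c) back to the polynomial with coefficients
  u_c.\<close>

lemma sigma_exists:
  assumes k: "is_base_change_map A F B \<kappa>"
  shows "\<exists>\<sigma>. \<sigma> \<in> ring_hom D.G GT \<and> (\<forall>u\<in>carrier G. \<sigma> (\<kappa> u) = single G {#} u)
    \<and> (\<forall>b\<in>carrier B. \<forall>U\<in>carrier D.G. \<sigma> (b \<odot>\<^bsub>D.G\<^esub> U) = \<psi> b \<otimes>\<^bsub>GT\<^esub> \<sigma> U)"
proof -
  let ?i = "\<lambda>y m. single G {#} (\<gamma> m y)"
  have ic: "?i y \<in> carrier (edp GT)" if "y \<in> carrier F" for y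
    by (rule nG.iota_edp[OF gam_edp[OF that]])
  have pc: "\<psi> b \<in> carrier GT" if "b \<in> carrier B" for b using ring_hom_closed[OF psi_hom that] .
  obtain e where e: "e \<in> add_hom t.T (edp GT)"
    "\<And>y b. y \<in> carrier F \<Longrightarrow> b \<in> carrier B \<Longrightarrow> e (t.tn y b) = \<psi> b \<odot>\<^bsub>edp GT\<^esub> ?i y" using ext_exists by blast
  have es: "e (b \<odot>\<^bsub>t.T\<^esub> U) = \<psi> b \<odot>\<^bsub>edp GT\<^esub> e U" if b: "b \<in> carrier B" and U: "U \<in> carrier t.T" for b U
  proof (rule t.T_add_hom_eq[OF _ _ U])
    show "(\<lambda>U. e (b \<odot>\<^bsub>t.T\<^esub> U)) \<in> add_hom t.T (edp GT)"
      using b by (intro add_hom_comp[OF _ e(1)] add_homI t.TA.smult_closed t.TA.smult_r_distr)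
    show "(\<lambda>U. \<psi> b \<odot>\<^bsub>edp GT\<^esub> e U) \<in> add_hom t.T (edp GT)"
      using pc[OF b] by (intro add_hom_comp[OF e(1)] add_homI nG.E.smult_closed nG.E.smult_r_distr)
    fix y b' assume y: "y \<in> carrier F" "b' \<in> carrier B"
    have bb: "b \<otimes>\<^bsub>B\<^esub> b' \<in> carrier B" using b y(2) by (rule t.C.m_closed)
    have "e (b \<odot>\<^bsub>t.T\<^esub> t.tn y b') = e (t.tn y (b \<otimes>\<^bsub>B\<^esub> b'))" by (simp only: t.t_smult[OF y(1) b y(2)])
    also have "\<dots> = (\<psi> b \<otimes>\<^bsub>GT\<^esub> \<psi> b') \<odot>\<^bsub>edp GT\<^esub> ?i y"
      by (simp only: e(2)[OF y(1) bb] ring_hom_mult[OF psi_hom b y(2)])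
    also have "\<dots> = \<psi> b \<odot>\<^bsub>edp GT\<^esub> e (t.tn y b')"
      by (simp only: nG.E.smult_assoc1[OF pc[OF b] pc[OF y(2)] ic[OF y(1)]] e(2)[OF y])
    finally show "e (b \<odot>\<^bsub>t.T\<^esub> t.tn y b') = \<psi> b \<odot>\<^bsub>edp GT\<^esub> e (t.tn y b')" .
  qed
  obtain \<sigma> where \<sigma>: "\<sigma> \<in> ring_hom D.G GT" "\<And>m Xa. Xa \<in> carrier t.T \<Longrightarrow> \<sigma> (D.\<gamma> m Xa) = e Xa m"
    "\<And>b U. b \<in> carrier B \<Longrightarrow> U \<in> carrier D.G \<Longrightarrow> \<sigma> (b \<odot>\<^bsub>D.G\<^esub> U) = \<psi> b \<otimes>\<^bsub>GT\<^esub> \<sigma> U"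
    using D.dp_lift[OF nG.NP.is_cring psi_hom e(1) es] by blast
  have "\<sigma> (\<kappa> u) = single G {#} u" if u: "u \<in> carrier G" for u
  proof (rule G_hom_eq[OF nG.NP.is_cring ring_hom_comp[OF kappa_hom[OF k] \<sigma>(1)] nG.iota_hom _ _ u])
    fix a assume a: "a \<in> carrier A"
    have sa: "single A {#} a \<in> carrier B" using a by simp
    have "a \<odot>\<^bsub>B\<^esub> \<one>\<^bsub>B\<^esub> = single A {#} a" using a by (simp add: nA.one_eq)
    then have "\<sigma> (\<kappa> (a \<odot>\<^bsub>G\<^esub> \<one>\<^bsub>G\<^esub>)) = \<sigma> (single A {#} a \<odot>\<^bsub>D.G\<^esub> \<one>\<^bsub>D.G\<^esub>)"
      using a by (simp only: kappa_smult[OF k a G.one_closed] ring_hom_one[OF kappa_hom[OF k]])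
    also have "\<dots> = \<psi> (single A {#} a) \<otimes>\<^bsub>GT\<^esub> \<one>\<^bsub>GT\<^esub>"
      by (simp only: \<sigma>(3)[OF sa D.G.one_closed] ring_hom_one[OF \<sigma>(1)])
    also have "\<dots> = single G {#} (a \<odot>\<^bsub>G\<^esub> \<one>\<^bsub>G\<^esub>)" using a by (simp add: psi_single)
    finally show "\<sigma> (\<kappa> (a \<odot>\<^bsub>G\<^esub> \<one>\<^bsub>G\<^esub>)) = single G {#} (a \<odot>\<^bsub>G\<^esub> \<one>\<^bsub>G\<^esub>)" .
  next
    fix m y assume y: "y \<in> carrier F"
    have "\<sigma> (\<kappa> (\<gamma> m y)) = (\<psi> \<one>\<^bsub>B\<^esub> \<odot>\<^bsub>edp GT\<^esub> ?i y) m"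
      by (simp only: kappa_gam[OF k y] \<sigma>(2)[OF t.t_closed[OF y t.C.one_closed]] e(2)[OF y t.C.one_closed])
    also have "\<psi> \<one>\<^bsub>B\<^esub> = \<one>\<^bsub>GT\<^esub>" by (rule ring_hom_one[OF psi_hom])
    also have "\<one>\<^bsub>GT\<^esub> \<odot>\<^bsub>edp GT\<^esub> ?i y = ?i y" using ic[OF y] by (rule nG.E.smult_one)
    finally show "\<sigma> (\<kappa> (\<gamma> m y)) = single G {#} (\<gamma> m y)" .
  qed
  then show ?thesis using \<sigma> by blast
qed

lemma Tk_prod:
  assumes "finite I" "set_mset c \<subseteq> I"
  shows "(\<Otimes>\<^bsub>B\<^esub>i\<in>I. Tk {#i#} [^]\<^bsub>B\<^esub> count c i) = Tk c"
proof -
  have "(\<Otimes>\<^bsub>npoly A\<^esub>i\<in>I. Tk {#i#} [^]\<^bsub>npoly A\<^esub> count c i) = (\<Otimes>\<^bsub>npoly A\<^esub>i\<in>I. single A (replicate_mset (count c i) i) \<one>\<^bsub>A\<^esub>)"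
    by (simp add: nA.tv_pow)
  also have "\<dots> = single A (\<Sum>i\<in>I. replicate_mset (count c i) i) (\<Otimes>\<^bsub>A\<^esub>i\<in>I. \<one>\<^bsub>A\<^esub>)"
    using assms(1) by (intro nA.finprod_single) auto
  also have "\<dots> = Tk c" using assms by (simp add: nA.sum_replicate_mset)
  finally show ?thesis by (simp add: finprod_algebra_via pow_algebra_via)
qed

text \<open>The generic linear combination \<Sum> T_i x_i in F[T]. By \<open>gam_lc\<close> its
  \<gamma>^n has all divided monomials of degree n in the x_i as coefficients.\<close>

definition lc :: "nat set \<Rightarrow> (nat \<Rightarrow> 'f) \<Rightarrow> ('f, nat multiset \<Rightarrow> 'a) tens"
  where "lc I x = (\<Oplus>\<^bsub>t.T\<^esub>i\<in>I. t.tn (x i) (Tk {#i#}))"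

lemma lc_closed: "x \<in> I \<rightarrow> carrier F \<Longrightarrow> lc I x \<in> carrier t.T"
  unfolding lc_def by (intro t.T.finsum_closed) (auto intro!: t.t_closed)

section \<open>Expansions in the variables T and their coefficients\<close>

context
  fixes \<kappa> assumes k: "is_base_change_map A F B \<kappa>"
begin

text \<open>Indexing by p instead of by monomials keeps this form stable under products, where the
  index set becomes P \<times> Q. Injectivity of w is asked for only when coefficients are read
  off.\<close>

definition expn where "expn P w u = (\<Oplus>\<^bsub>D.G\<^esub>p\<in>P. Tk (w p) \<odot>\<^bsub>D.G\<^esub> \<kappa> (u p))"

text \<open>\<open>gam_finsum\<close> expands the sum; the powers of the T_i leave \<gamma> by
  \<open>gam_smult\<close> and multiply to T^c.\<close>

lemma gam_lc:
  assumes I: "finite I" "x \<in> I \<rightarrow> carrier F"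
  shows "D.\<gamma> n (lc I x) = expn (multisets_of_size I n) (\<lambda>c. c) (gprod I x)"
proof -
  let ?z = "\<lambda>i. t.tn (x i) (Tk {#i#})" and ?x = "\<lambda>i. t.tn (x i) \<one>\<^bsub>B\<^esub>"
  have xi: "x i \<in> carrier F" if "i \<in> I" for i using I that by auto
  have T: "Tk c \<in> carrier B" for c by (rule Tk_closed)
  have xc: "?x i \<in> carrier t.T" if "i \<in> I" for i by (rule t.t_closed[OF xi[OF that] t.C.one_closed])
  have z: "?z i = Tk {#i#} \<odot>\<^bsub>t.T\<^esub> ?x i" if "i \<in> I" for i
    by (simp only: t.t_smult[OF xi[OF that] T t.C.one_closed] t.C.r_one[OF T])
  have "D.\<gamma> n (lc I x) = (\<Oplus>\<^bsub>D.G\<^esub>c\<in>multisets_of_size I n. D.gprod I ?z c)"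
    unfolding lc_def using I by (intro D.gam_finsum) (auto intro!: t.t_closed)
  also have "\<dots> = expn (multisets_of_size I n) (\<lambda>c. c) (gprod I x)"
    unfolding expn_def
  proof (rule D.G.finsum_cong')
    fix c assume "c \<in> multisets_of_size I n"
    then have c: "set_mset c \<subseteq> I" by (simp add: multisets_of_size_def)
    have "D.gprod I ?z c = (\<Otimes>\<^bsub>D.G\<^esub>i\<in>I. (Tk {#i#} [^]\<^bsub>B\<^esub> count c i) \<odot>\<^bsub>D.G\<^esub> D.\<gamma> (count c i) (?x i))"
    proof (rule D.G.finprod_cong')
      fix i assume i: "i \<in> I"
      show "D.\<gamma> (count c i) (?z i) = (Tk {#i#} [^]\<^bsub>B\<^esub> count c i) \<odot>\<^bsub>D.G\<^esub> D.\<gamma> (count c i) (?x i)"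
        unfolding z[OF i] by (rule D.gam_smult[OF xc[OF i] T])
    qed (use xc T in \<open>auto intro!: D.GA.smult_closed t.C.nat_pow_closed D.gam_closed simp del: algebra_via_simps\<close>)
    also have "\<dots> = Tk c \<odot>\<^bsub>D.G\<^esub> D.gprod I ?x c"
      unfolding Tk_prod[OF I(1) c, symmetric]
      by (rule algebra_finprod_smult[OF D.GA.algebra_axioms I(1)])
        (use xc T in \<open>auto intro!: t.C.nat_pow_closed D.gam_closed simp del: algebra_via_simps\<close>)
    also have "\<dots> = Tk c \<odot>\<^bsub>D.G\<^esub> \<kappa> (gprod I x c)" by (simp only: kappa_gprod[OF k I(2)])
    finally show "D.gprod I ?z c = Tk c \<odot>\<^bsub>D.G\<^esub> \<kappa> (gprod I x c)" .
  qed (use T I in \<open>auto intro!: D.GA.smult_closed kappa_closed[OF k] gprod_closed\<close>)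
  finally show ?thesis .
qed

definition \<sigma> where "\<sigma> = (SOME \<sigma>. \<sigma> \<in> ring_hom D.G GT \<and> (\<forall>u\<in>carrier G. \<sigma> (\<kappa> u) = single G {#} u)
    \<and> (\<forall>b\<in>carrier B. \<forall>U\<in>carrier D.G. \<sigma> (b \<odot>\<^bsub>D.G\<^esub> U) = \<psi> b \<otimes>\<^bsub>GT\<^esub> \<sigma> U))"

lemma sigma: "\<sigma> \<in> ring_hom D.G GT" "u \<in> carrier G \<Longrightarrow> \<sigma> (\<kappa> u) = single G {#} u"
  "b \<in> carrier B \<Longrightarrow> U \<in> carrier D.G \<Longrightarrow> \<sigma> (b \<odot>\<^bsub>D.G\<^esub> U) = \<psi> b \<otimes>\<^bsub>GT\<^esub> \<sigma> U"
  using someI_ex[OF sigma_exists[OF k], folded \<sigma>_def] by blast+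

text \<open>Since w is injective on P, exactly one term contributes to the monomial w(p).\<close>

lemma sigma_expn:
  assumes P: "finite P" "u \<in> P \<rightarrow> carrier G" and w: "inj_on w P" and p: "p \<in> P"
  shows "\<sigma> (expn P w u) (w p) = u p"
proof -
  have uc: "u q \<in> carrier G" if "q \<in> P" for q using P that by auto
  have T: "Tk c \<in> carrier B" for c by (rule Tk_closed)
  have "\<sigma> (expn P w u) = (\<Oplus>\<^bsub>GT\<^esub>q\<in>P. \<sigma> (Tk (w q) \<odot>\<^bsub>D.G\<^esub> \<kappa> (u q)))"
    unfolding expn_def using T uc
    by (intro add_hom_finsum[OF D.G.abelian_group_axioms nG.NP.abelian_group_axioms ring_hom_add_hom[OF sigma(1)]])
      (auto intro!: D.GA.smult_closed kappa_closed[OF k])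
  also have "\<dots> = (\<Oplus>\<^bsub>GT\<^esub>q\<in>P. single G (w q) (u q))"
  proof (rule nG.NP.finsum_cong')
    fix q assume q: "q \<in> P"
    have "\<sigma> (Tk (w q) \<odot>\<^bsub>D.G\<^esub> \<kappa> (u q)) = \<psi> (Tk (w q)) \<otimes>\<^bsub>GT\<^esub> single G {#} (u q)"
      by (simp only: sigma(3)[OF T kappa_closed[OF k uc[OF q]]] sigma(2)[OF uc[OF q]])
    also have "\<dots> = single G (w q) (u q)" using uc[OF q] by (simp add: psi_single)
    finally show "\<sigma> (Tk (w q) \<odot>\<^bsub>D.G\<^esub> \<kappa> (u q)) = single G (w q) (u q)" .
  qed (use uc in auto)
  finally have "\<sigma> (expn P w u) (w p) = (\<Oplus>\<^bsub>G\<^esub>q\<in>P. single G (w q) (u q) (w p))"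
    using uc by (simp add: nG.mr.coeff_finsum)
  also have "\<dots> = (\<Oplus>\<^bsub>G\<^esub>q\<in>P. if p = q then u q else \<zero>\<^bsub>G\<^esub>)"
  proof (rule G.finsum_cong')
    fix q assume q: "q \<in> P"
    have "(w p = w q) = (p = q)" using w p q by (auto simp: inj_on_def)
    then show "single G (w q) (u q) (w p) = (if p = q then u q else \<zero>\<^bsub>G\<^esub>)" by (simp add: single_def)
  qed (use uc in auto)
  also have "\<dots> = u p" by (rule G.finsum_singleton[OF p P(1)]) (use uc in auto)
  finally show ?thesis .
qed

text \<open>Bilinearity of \<nu> over A[T] multiplies the monomials, and compatibility with \<kappa>
  expresses the products of the coefficients by m.\<close>

lemma nu_expn:
  assumes nu: "D.cbil n \<nu>" and comp: "\<And>u v. u \<in> part n \<Longrightarrow> v \<in> part n \<Longrightarrow> \<nu> (\<kappa> u) (\<kappa> v) = \<kappa> (m u v)"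
    and m: "\<And>u v. u \<in> part n \<Longrightarrow> v \<in> part n \<Longrightarrow> m u v \<in> part n"
    and P: "finite P" "u \<in> P \<rightarrow> part n" and Q: "finite Q" "v \<in> Q \<rightarrow> part n"
  shows "\<nu> (expn P w u) (expn Q w' v) = expn (P \<times> Q) (\<lambda>p. w (fst p) + w' (snd p)) (\<lambda>p. m (u (fst p)) (v (snd p)))"
proof -
  note nuD = D.cbilD[OF nu]
  have T: "Tk c \<in> carrier B" for c by (rule Tk_closed)
  have up: "u p \<in> part n" if "p \<in> P" for p using P that by auto
  have vq: "v q \<in> part n" if "q \<in> Q" for q using Q that by auto
  have kp: "Tk c \<odot>\<^bsub>D.G\<^esub> \<kappa> u \<in> D.part n" if "u \<in> part n" for c u
    by (rule D.part_smult[OF T kappa_part[OF k that]])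
  have V: "expn Q w' v \<in> D.part n" unfolding expn_def by (rule D.part_finsum) (rule kp[OF vq])
  have nc: "\<nu> U V \<in> carrier D.G" if "U \<in> D.part n" "V \<in> D.part n" for U V
    by (rule D.part_closed[OF nuD(1)[OF that]])
  have "\<nu> (expn P w u) (expn Q w' v) = (\<Oplus>\<^bsub>D.G\<^esub>p\<in>P. \<nu> (Tk (w p) \<odot>\<^bsub>D.G\<^esub> \<kappa> (u p)) (expn Q w' v))"
    unfolding expn_def[of P] by (rule D.part_additive_finsum[of n "\<lambda>U. \<nu> U (expn Q w' v)"])
      (use nc nuD(3) V kp up in blast)+
  also have "\<dots> = (\<Oplus>\<^bsub>D.G\<^esub>p\<in>P. \<Oplus>\<^bsub>D.G\<^esub>q\<in>Q. Tk (w p + w' q) \<odot>\<^bsub>D.G\<^esub> \<kappa> (m (u p) (v q)))"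
  proof (rule D.G.finsum_cong')
    fix p assume p: "p \<in> P"
    have U: "Tk (w p) \<odot>\<^bsub>D.G\<^esub> \<kappa> (u p) \<in> D.part n" by (rule kp[OF up[OF p]])
    have ku: "\<kappa> (u p) \<in> D.part n" by (rule kappa_part[OF k up[OF p]])
    have "\<nu> (Tk (w p) \<odot>\<^bsub>D.G\<^esub> \<kappa> (u p)) (expn Q w' v) = \<nu> (expn Q w' v) (Tk (w p) \<odot>\<^bsub>D.G\<^esub> \<kappa> (u p))"
      by (rule nuD(2)[OF U V])
    also have "\<dots> = (\<Oplus>\<^bsub>D.G\<^esub>q\<in>Q. \<nu> (Tk (w' q) \<odot>\<^bsub>D.G\<^esub> \<kappa> (v q)) (Tk (w p) \<odot>\<^bsub>D.G\<^esub> \<kappa> (u p)))"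
      unfolding expn_def by (rule D.part_additive_finsum[of n "\<lambda>V. \<nu> V (Tk (w p) \<odot>\<^bsub>D.G\<^esub> \<kappa> (u p))"])
        (use nc nuD(3) U kp vq in blast)+
    also have "\<dots> = (\<Oplus>\<^bsub>D.G\<^esub>q\<in>Q. Tk (w p + w' q) \<odot>\<^bsub>D.G\<^esub> \<kappa> (m (u p) (v q)))"
    proof (rule D.G.finsum_cong')
      fix q assume q: "q \<in> Q"
      have kv: "\<kappa> (v q) \<in> D.part n" by (rule kappa_part[OF k vq[OF q]])
      have "\<nu> (Tk (w' q) \<odot>\<^bsub>D.G\<^esub> \<kappa> (v q)) (Tk (w p) \<odot>\<^bsub>D.G\<^esub> \<kappa> (u p))
        = Tk (w' q) \<odot>\<^bsub>D.G\<^esub> \<nu> (\<kappa> (v q)) (Tk (w p) \<odot>\<^bsub>D.G\<^esub> \<kappa> (u p))" by (rule nuD(4)[OF T kv U])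
      also have "\<nu> (\<kappa> (v q)) (Tk (w p) \<odot>\<^bsub>D.G\<^esub> \<kappa> (u p)) = Tk (w p) \<odot>\<^bsub>D.G\<^esub> \<nu> (\<kappa> (u p)) (\<kappa> (v q))"
        by (simp only: nuD(2)[OF kv U] nuD(4)[OF T ku kv])
      also have "\<nu> (\<kappa> (u p)) (\<kappa> (v q)) = \<kappa> (m (u p) (v q))" by (rule comp[OF up[OF p] vq[OF q]])
      also have "Tk (w' q) \<odot>\<^bsub>D.G\<^esub> (Tk (w p) \<odot>\<^bsub>D.G\<^esub> \<kappa> (m (u p) (v q))) = (Tk (w' q) \<otimes>\<^bsub>B\<^esub> Tk (w p)) \<odot>\<^bsub>D.G\<^esub> \<kappa> (m (u p) (v q))"
        by (rule D.GA.smult_assoc1[OF T T, symmetric]) (rule kappa_closed[OF k part_closed[OF m[OF up[OF p] vq[OF q]]]])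
      also have "Tk (w' q) \<otimes>\<^bsub>B\<^esub> Tk (w p) = Tk (w p + w' q)" by (simp add: add.commute)
      finally show "\<nu> (Tk (w' q) \<odot>\<^bsub>D.G\<^esub> \<kappa> (v q)) (Tk (w p) \<odot>\<^bsub>D.G\<^esub> \<kappa> (u p)) = Tk (w p + w' q) \<odot>\<^bsub>D.G\<^esub> \<kappa> (m (u p) (v q))" .
    qed (auto intro!: D.part_closed kp m up[OF p] vq)
    finally show "\<nu> (Tk (w p) \<odot>\<^bsub>D.G\<^esub> \<kappa> (u p)) (expn Q w' v) = (\<Oplus>\<^bsub>D.G\<^esub>q\<in>Q. Tk (w p + w' q) \<odot>\<^bsub>D.G\<^esub> \<kappa> (m (u p) (v q)))" .
  qed (rule refl, rule funcsetI, rule D.G.finsum_closed, auto intro!: D.part_closed kp m up vq)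
  also have "\<dots> = expn (P \<times> Q) (\<lambda>p. w (fst p) + w' (snd p)) (\<lambda>p. m (u (fst p)) (v (snd p)))"
    unfolding expn_def using P(1) Q(1)
    by (intro D.G.add.finprod_Sigma) (auto intro!: D.part_closed kp m up vq)
  finally show ?thesis .
qed

lemma gprod_in_part: "finite I \<Longrightarrow> x \<in> I \<rightarrow> carrier F \<Longrightarrow> gprod I x \<in> multisets_of_size I n \<rightarrow> part n"
  by (auto intro!: gprod_part)

text \<open>Restricting c + d to the indices in I gives back c. This is why the factors of a product
  are written with disjoint index sets: the monomial T^(c + d) then belongs to one pair
  only.\<close>

lemma disjoint_mset_add_inj:
  assumes "set_mset c \<subseteq> I" "set_mset c' \<subseteq> I" "set_mset d \<inter> I = {}" "set_mset d' \<inter> I = {}" "c + d = c' + d'"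
  shows "c = c' \<and> d = (d' :: 'i multiset)"
proof -
  have f: "filter_mset (\<lambda>i. i \<in> I) (c + d) = c" if "set_mset c \<subseteq> I" "set_mset d \<inter> I = {}" for c d :: "'i multiset"
    using that by (intro multiset_eqI) (auto simp: not_in_iff[symmetric])
  have "filter_mset (\<lambda>i. i \<in> I) (c + d) = c" "filter_mset (\<lambda>i. i \<in> I) (c' + d') = c'"
    by (rule f[OF assms(1,3)], rule f[OF assms(2,4)])
  then have "c = c'" unfolding assms(5) by (rule trans[OF sym])
  then show ?thesis using assms(5) by simp
qed

text \<open>Coefficients are compared in \<gamma>^n(X) \<gamma>^n(Y) = \<gamma>^n(X Y) for generic X
  and Y. The right side does not involve m, so for the same \<kappa> any two such products agree on
  divided monomials with disjoint indices.\<close>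

lemma product_coeff:
  assumes nu: "D.cbil n \<nu>" and comp: "\<And>u v. u \<in> part n \<Longrightarrow> v \<in> part n \<Longrightarrow> \<nu> (\<kappa> u) (\<kappa> v) = \<kappa> (m u v)"
    and gam: "\<And>Xa Y. Xa \<in> carrier t.T \<Longrightarrow> Y \<in> carrier t.T \<Longrightarrow> \<nu> (D.\<gamma> n Xa) (D.\<gamma> n Y) = D.\<gamma> n (Xa \<otimes>\<^bsub>t.T\<^esub> Y)"
    and m: "\<And>u v. u \<in> part n \<Longrightarrow> v \<in> part n \<Longrightarrow> m u v \<in> part n"
    and I: "finite I" "x \<in> I \<rightarrow> carrier F" "c \<in> multisets_of_size I n"
    and J: "finite J" "y \<in> J \<rightarrow> carrier F" "d \<in> multisets_of_size J n" and dj: "I \<inter> J = {}"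
  shows "m (gprod I x c) (gprod J y d) = \<sigma> (D.\<gamma> n (lc I x \<otimes>\<^bsub>t.T\<^esub> lc J y)) (c + d)"
proof -
  let ?P = "multisets_of_size I n \<times> multisets_of_size J n"
  have inj: "inj_on (\<lambda>p. fst p + snd p) ?P"
  proof (rule inj_onI)
    fix p q assume "p \<in> ?P" "q \<in> ?P" "fst p + snd p = fst q + snd q"
    then show "p = q" using dj disjoint_mset_add_inj[of "fst p" I "fst q" "snd p" "snd q"]
      by (force simp: multisets_of_size_def prod_eq_iff)
  qed
  have e: "D.\<gamma> n (lc I x \<otimes>\<^bsub>t.T\<^esub> lc J y) = expn ?P (\<lambda>p. fst p + snd p) (\<lambda>p. m (gprod I x (fst p)) (gprod J y (snd p)))"
    unfolding gam[OF lc_closed[OF I(2)] lc_closed[OF J(2)], symmetric] gam_lc[OF I(1,2)] gam_lc[OF J(1,2)]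
    by (rule nu_expn[OF nu comp m _ gprod_in_part[OF I(1,2)] _ gprod_in_part[OF J(1,2)]])
      (use I(1) J(1) in \<open>auto intro!: finite_multisets_of_size\<close>)
  have cl: "(\<lambda>p. m (gprod I x (fst p)) (gprod J y (snd p))) \<in> ?P \<rightarrow> carrier G"
    using I J by (auto intro!: part_closed m gprod_part)
  show ?thesis unfolding e
    using sigma_expn[OF _ cl inj, of "(c, d)"] I J by (simp add: finite_multisets_of_size)
qed

text \<open>The same comparison for three factors. The coefficient depends on X, Y, Z only through
  their product in F[T], which is where associativity comes from.\<close>

lemma product3_coeff:
  assumes nu: "D.cbil n \<nu>" and comp: "\<And>u v. u \<in> part n \<Longrightarrow> v \<in> part n \<Longrightarrow> \<nu> (\<kappa> u) (\<kappa> v) = \<kappa> (m u v)"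
    and gam: "\<And>Xa Y. Xa \<in> carrier t.T \<Longrightarrow> Y \<in> carrier t.T \<Longrightarrow> \<nu> (D.\<gamma> n Xa) (D.\<gamma> n Y) = D.\<gamma> n (Xa \<otimes>\<^bsub>t.T\<^esub> Y)"
    and m: "\<And>u v. u \<in> part n \<Longrightarrow> v \<in> part n \<Longrightarrow> m u v \<in> part n"
    and I: "finite I" "x \<in> I \<rightarrow> carrier F" "c \<in> multisets_of_size I n"
    and J: "finite J" "y \<in> J \<rightarrow> carrier F" "d \<in> multisets_of_size J n"
    and K: "finite K" "z \<in> K \<rightarrow> carrier F" "e \<in> multisets_of_size K n"
    and dj: "I \<inter> J = {}" "I \<inter> K = {}" "J \<inter> K = {}"
  shows "m (m (gprod I x c) (gprod J y d)) (gprod K z e)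
    = \<sigma> (D.\<gamma> n ((lc I x \<otimes>\<^bsub>t.T\<^esub> lc J y) \<otimes>\<^bsub>t.T\<^esub> lc K z)) (c + d + e)"
proof -
  let ?P = "(multisets_of_size I n \<times> multisets_of_size J n) \<times> multisets_of_size K n"
  let ?w = "\<lambda>p. fst (fst p) + snd (fst p) + snd p"
  have inj: "inj_on ?w ?P"
  proof (rule inj_onI)
    fix p q assume p: "p \<in> ?P" "q \<in> ?P" "?w p = ?w q"
    then have 1: "fst (fst p) + snd (fst p) = fst (fst q) + snd (fst q) \<and> snd p = snd q"
      using dj by (intro disjoint_mset_add_inj[of _ "I \<union> J"]) (force simp: multisets_of_size_def)+
    then have "fst (fst p) = fst (fst q) \<and> snd (fst p) = snd (fst q)"
      using dj p by (intro disjoint_mset_add_inj[of _ I]) (force simp: multisets_of_size_def)+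
    then show "p = q" using 1 by (simp add: prod_eq_iff)
  qed
  note Xc = lc_closed[OF I(2)] and Yc = lc_closed[OF J(2)] and Zc = lc_closed[OF K(2)]
  have e2: "D.\<gamma> n (lc I x \<otimes>\<^bsub>t.T\<^esub> lc J y) = expn (multisets_of_size I n \<times> multisets_of_size J n) (\<lambda>p. fst p + snd p) (\<lambda>p. m (gprod I x (fst p)) (gprod J y (snd p)))"
    unfolding gam[OF Xc Yc, symmetric] gam_lc[OF I(1,2)] gam_lc[OF J(1,2)]
    by (rule nu_expn[OF nu comp m _ gprod_in_part[OF I(1,2)] _ gprod_in_part[OF J(1,2)]])
      (use I(1) J(1) in \<open>auto intro!: finite_multisets_of_size\<close>)
  have mp: "(\<lambda>p. m (gprod I x (fst p)) (gprod J y (snd p))) \<in> multisets_of_size I n \<times> multisets_of_size J n \<rightarrow> part n"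
    using I J by (auto intro!: m gprod_part)
  have e3: "D.\<gamma> n ((lc I x \<otimes>\<^bsub>t.T\<^esub> lc J y) \<otimes>\<^bsub>t.T\<^esub> lc K z)
      = expn ?P ?w (\<lambda>p. m (m (gprod I x (fst (fst p))) (gprod J y (snd (fst p)))) (gprod K z (snd p)))"
    unfolding gam[OF t.T.m_closed[OF Xc Yc] Zc, symmetric] e2 gam_lc[OF K(1,2)]
    by (rule nu_expn[OF nu comp m _ mp _ gprod_in_part[OF K(1,2)]])
      (use I(1) J(1) K(1) in \<open>auto intro!: finite_multisets_of_size\<close>)
  have cl: "(\<lambda>p. m (m (gprod I x (fst (fst p))) (gprod J y (snd (fst p)))) (gprod K z (snd p))) \<in> ?P \<rightarrow> carrier G"
    using I J K by (auto intro!: part_closed m gprod_part)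
  show ?thesis unfolding e3
    using sigma_expn[OF _ cl inj, of "((c, d), e)"] I J K by (simp add: finite_multisets_of_size)
qed

lemma product_one:
  fixes I :: "nat set"
  assumes nu: "D.cbil n \<nu>" and comp: "\<And>u v. u \<in> part n \<Longrightarrow> v \<in> part n \<Longrightarrow> \<nu> (\<kappa> u) (\<kappa> v) = \<kappa> (m u v)"
    and gam: "\<And>Xa Y. Xa \<in> carrier t.T \<Longrightarrow> Y \<in> carrier t.T \<Longrightarrow> \<nu> (D.\<gamma> n Xa) (D.\<gamma> n Y) = D.\<gamma> n (Xa \<otimes>\<^bsub>t.T\<^esub> Y)"
    and m: "\<And>u v. u \<in> part n \<Longrightarrow> v \<in> part n \<Longrightarrow> m u v \<in> part n"
    and I: "finite I" "x \<in> I \<rightarrow> carrier F" "c \<in> multisets_of_size I n"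
  shows "m (\<gamma> n \<one>\<^bsub>F\<^esub>) (gprod I x c) = gprod I x c"
proof -
  let ?Q = "multisets_of_size I n"
  have fQ: "finite ?Q" using I(1) by (rule finite_multisets_of_size)
  have one: "\<gamma> n \<one>\<^bsub>F\<^esub> \<in> part n" by (rule part_gam) simp
  have T1: "Tk {#} = \<one>\<^bsub>B\<^esub>" by (simp add: nA.one_eq)
  have k1: "\<kappa> (\<gamma> n \<one>\<^bsub>F\<^esub>) = D.\<gamma> n \<one>\<^bsub>t.T\<^esub>" by (simp only: kappa_gam[OF k F.one_closed] t.t_one)
  \<comment> \<open>\<gamma>^n(1) is an expansion with one term and the empty monomial, so that
    \<open>nu_expn\<close> covers multiplication by it.\<close>
  have "expn {()} (\<lambda>_. {#}) (\<lambda>_. \<gamma> n \<one>\<^bsub>F\<^esub>) = D.\<gamma> n \<one>\<^bsub>t.T\<^esub>"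
    unfolding expn_def T1 k1 D.GA.smult_one[OF D.gam_closed[OF t.T.one_closed]]
    using D.gam_closed[OF t.T.one_closed] by simp
  then have "D.\<gamma> n (lc I x) = \<nu> (expn {()} (\<lambda>_. {#}) (\<lambda>_. \<gamma> n \<one>\<^bsub>F\<^esub>)) (expn ?Q (\<lambda>c. c) (gprod I x))"
    using gam[OF t.T.one_closed lc_closed[OF I(2)]] by (simp only: gam_lc[OF I(1,2), symmetric] t.T.l_one[OF lc_closed[OF I(2)]])
  also have "\<dots> = expn ({()} \<times> ?Q) (\<lambda>p. {#} + snd p) (\<lambda>p. m (\<gamma> n \<one>\<^bsub>F\<^esub>) (gprod I x (snd p)))"
    by (rule nu_expn[OF nu comp m _ _ _ gprod_in_part[OF I(1,2)]]) (use one fQ in auto)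
  finally have e: "D.\<gamma> n (lc I x) = expn ({()} \<times> ?Q) (\<lambda>p. {#} + snd p) (\<lambda>p. m (\<gamma> n \<one>\<^bsub>F\<^esub>) (gprod I x (snd p)))" .
  have cl: "(\<lambda>p. m (\<gamma> n \<one>\<^bsub>F\<^esub>) (gprod I x (snd p))) \<in> {()} \<times> ?Q \<rightarrow> carrier G"
    using I one by (auto intro!: part_closed m gprod_part)
  have "\<sigma> (D.\<gamma> n (lc I x)) c = m (\<gamma> n \<one>\<^bsub>F\<^esub>) (gprod I x c)"
    unfolding e using sigma_expn[OF _ cl, of "\<lambda>p. {#} + snd p" "((), c)"] I fQ by (simp add: inj_on_def)
  moreover have "\<sigma> (D.\<gamma> n (lc I x)) c = gprod I x c"
    unfolding gam_lc[OF I(1,2)] using sigma_expn[OF fQ _ _ I(3), of "gprod I x" "\<lambda>c. c"] gprod_closed[OF I(2)] by simp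
  ultimately show ?thesis by simp
qed

end

end

section \<open>Associativity, unit and uniqueness of the second product\<close>

context dpa
begin

lemma mu_assoc:
  assumes u: "u \<in> part n" and v: "v \<in> part n" and w: "w \<in> part n"
  shows "mu (mu u v) w = mu u (mu v w)"
proof -
  interpret b: poly_base_change A F by (simp add: poly_base_change_def AF)
  obtain \<kappa> where k: "is_base_change_map A F b.B \<kappa>" using b.kappa_exists by blast
  note pc = part_closed
  have comp: "b.D.mu (\<kappa> u) (\<kappa> v) = \<kappa> (mu u v)" if "u \<in> part n" "v \<in> part n" for u v
    by (rule b.kappa_mu[OF k that(1) pc[OF that(2)]])
  have mp: "mu u v \<in> part n" if "u \<in> part n" "v \<in> part n" for u v by (rule mu_part[OF that])
  have gg: "b.D.mu (b.D.\<gamma> n U) (b.D.\<gamma> n V) = b.D.\<gamma> n (U \<otimes>\<^bsub>b.t.T\<^esub> V)"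
    if "U \<in> carrier b.t.T" "V \<in> carrier b.t.T" for U V
    by (rule b.D.mu_gam_gam[OF that])
  note pr = b.product3_coeff[OF k b.D.cbil_mu, of n mu]
  have g: "mu (mu (gprod I x c) (gprod J y d)) (gprod K z e) = mu (gprod I x c) (mu (gprod J y d) (gprod K z e))"
    if I: "finite I" "x \<in> I \<rightarrow> carrier F" "c \<in> multisets_of_size I n"
    and J: "finite J" "y \<in> J \<rightarrow> carrier F" "d \<in> multisets_of_size J n"
    and K: "finite K" "z \<in> K \<rightarrow> carrier F" "e \<in> multisets_of_size K n"
    and dj: "I \<inter> J = {}" "I \<inter> K = {}" "J \<inter> K = {}" for I J K :: "nat set" and x y z c d e
  proof -
    note Xa = b.lc_closed[OF I(2)] and Y = b.lc_closed[OF J(2)] and Z = b.lc_closed[OF K(2)]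
    have dj': "J \<inter> I = {}" "K \<inter> I = {}" using dj by auto
    have 1: "mu (mu (gprod I x c) (gprod J y d)) (gprod K z e)
      = b.\<sigma> \<kappa> (b.D.\<gamma> n ((b.lc I x \<otimes>\<^bsub>b.t.T\<^esub> b.lc J y) \<otimes>\<^bsub>b.t.T\<^esub> b.lc K z)) (c + d + e)"
      by (rule pr[OF comp gg mp I J K dj])
    \<comment> \<open>The coefficient formula is for products bracketed to the left. The factors are
      therefore rotated: u (v w) is (v w) u by commutativity, and both triple products have the same
      coefficient.\<close>
    have 2: "mu (mu (gprod J y d) (gprod K z e)) (gprod I x c)
      = b.\<sigma> \<kappa> (b.D.\<gamma> n ((b.lc J y \<otimes>\<^bsub>b.t.T\<^esub> b.lc K z) \<otimes>\<^bsub>b.t.T\<^esub> b.lc I x)) (d + e + c)"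
      by (rule pr[OF comp gg mp J K I dj(3) dj'])
    have 3: "(b.lc J y \<otimes>\<^bsub>b.t.T\<^esub> b.lc K z) \<otimes>\<^bsub>b.t.T\<^esub> b.lc I x = (b.lc I x \<otimes>\<^bsub>b.t.T\<^esub> b.lc J y) \<otimes>\<^bsub>b.t.T\<^esub> b.lc K z"
      using Xa Y Z by (simp only: b.t.T.m_ac b.t.T.m_closed)
    have 4: "d + e + c = c + d + e" by (simp add: add.commute add.left_commute)
    have "mu (mu (gprod J y d) (gprod K z e)) (gprod I x c) = mu (gprod I x c) (mu (gprod J y d) (gprod K z e))"
      by (intro mu_comm mu_closed gprod_closed I J K)
    then show ?thesis using 1 2 unfolding 3 4 by simp
  qed
  show ?thesis using u
  proof (induct u rule: part_induct[where k = 0])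
    case zero then show ?case using v w by (simp add: mu_zero pc)
  next
    case (add u u') then show ?case using v w by (simp add: mu_add pc)
  next
    case (gprod I x c a)
    note I = this
    \<comment> \<open>\<open>insert 0 I\<close> keeps the maximum defined when I is empty. The
      bounds k1 and k2 make the three index sets pairwise disjoint, as \<open>product3_coeff\<close>
      requires.\<close>
    define k1 where "k1 = Suc (Max (insert 0 I))"
    have k1: "i < k1" if "i \<in> I" for i unfolding k1_def using I(1) that by (simp add: less_Suc_eq_le)
    let ?u = "gprod I x c"
    have uc: "?u \<in> carrier G" using I by (intro gprod_closed)
    have "mu (mu ?u v) w = mu ?u (mu v w)" using v
    proof (induct v rule: part_induct[where k = k1])
      case zero then show ?case using uc w by (simp add: mu_zero pc)
    next
      case (add u u') then show ?case using uc w by (simp add: mu_add mu_add_right pc)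
    next
      case (gprod J y d b)
      note J = this
      define k2 where "k2 = Suc (Max (insert k1 J))"
      have k2: "i < k2" if "i \<in> insert k1 J" for i unfolding k2_def using J(1) that by (simp add: less_Suc_eq_le)
      let ?v = "gprod J y d"
      have vc: "?v \<in> carrier G" using J by (intro gprod_closed)
      have "mu (mu ?u ?v) w = mu ?u (mu ?v w)" using w
      proof (induct w rule: part_induct[where k = k2])
        case zero then show ?case using uc vc by (simp add: mu_zero pc)
      next
        case (add u u') then show ?case using uc vc by (simp add: mu_add mu_add_right pc)
      next
        case (gprod K z e b')
        have wc: "gprod K z e \<in> carrier G" using gprod by (intro gprod_closed)
        have dj: "I \<inter> J = {}" "I \<inter> K = {}" "J \<inter> K = {}"
          using k1 k2 J(2) gprod(2) by (force, force, force)
        have "mu (mu ?u ?v) (gprod K z e) = mu ?u (mu ?v (gprod K z e))"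
          by (rule g[OF I(1,3,4) J(1,3,4) gprod(1,3,4) dj])
        then show ?case using uc vc wc gprod by (simp add: mu_smult_right)
      qed
      then show ?case using uc vc w J pc[OF w] by (simp add: mu_smult_right mu_smult)
    qed
    then show ?case using uc I pc[OF v] pc[OF w] by (simp add: mu_smult)
  qed
qed

lemma mu_unit: assumes "u \<in> part n" shows "mu (\<gamma> n \<one>\<^bsub>F\<^esub>) u = u"
  using assms
proof (induct u rule: part_induct[where k = 0])
  case zero then show ?case by (simp add: mu_zero)
next
  case (add u u') then show ?case by (simp add: mu_add_right part_closed)
next
  case (gprod I x c a)
  interpret b: poly_base_change A F by (simp add: poly_base_change_def AF)
  obtain \<kappa> where k: "is_base_change_map A F b.B \<kappa>" using b.kappa_exists by blast
  have "mu (\<gamma> n \<one>\<^bsub>F\<^esub>) (gprod I x c) = gprod I x c"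
    by (rule b.product_one[OF k b.D.cbil_mu b.kappa_mu[OF k] b.D.mu_gam_gam mu_part])
      (use gprod part_closed in auto)
  moreover have "gprod I x c \<in> carrier G" using gprod by (intro gprod_closed)
  ultimately show ?case using gprod by (simp add: mu_smult_right)
qed

lemma mu_algebra: "algebra A (dp_part_with A F n mu)"
  by (rule algebra_part_with[OF cbil_mu mu_assoc mu_unit])

lemma second_product_mu: "is_second_product A F n mu"
  unfolding is_second_product_def Let_def
proof (intro conjI allI impI mu_algebra)
  fix B :: "('a, nat multiset \<Rightarrow> 'a) module"
  assume B: "algebra A B"
  interpret b: base_change A F B by (simp add: base_change_def AF B)
  obtain \<kappa> where k: "is_base_change_map A F B \<kappa>" using b.kappa_exists by blast
  show "\<exists>\<kappa> \<nu>. is_base_change_map A F B \<kappa> \<and>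
          algebra B (dp_part_with B b.t.T n \<nu>) \<and>
          (\<forall>u\<in>part n. \<forall>v\<in>part n. \<nu> (\<kappa> u) (\<kappa> v) = \<kappa> (mu u v)) \<and>
          (\<forall>x\<in>carrier b.t.T. \<forall>y\<in>carrier b.t.T. \<nu> (b.D.\<gamma> n x) (b.D.\<gamma> n y) = b.D.\<gamma> n (x \<otimes>\<^bsub>b.t.T\<^esub> y))"
    by (intro exI[of _ \<kappa>] exI[of _ b.D.mu] conjI ballI k b.D.mu_algebra b.D.mu_gam_gam b.kappa_mu[OF k] part_closed)
qed

text \<open>By \<open>product_coeff\<close> m and \<open>mu\<close> agree on divided monomials with
  disjoint indices, and bilinearity does the rest. This identifies the product chosen by
  \<open>SOME\<close> in \<open>dp_n\<close> with \<open>mu\<close>.\<close>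

lemma second_product_unique:
  assumes sp: "is_second_product A F n m" and u: "u \<in> part n" and v: "v \<in> part n"
  shows "m u v = mu u v"
proof -
  interpret b: poly_base_change A F by (simp add: poly_base_change_def AF)
  have "\<exists>\<kappa> \<nu>. is_base_change_map A F b.B \<kappa> \<and> algebra b.B (dp_part_with b.B b.t.T n \<nu>)
      \<and> (\<forall>u\<in>part n. \<forall>v\<in>part n. \<nu> (\<kappa> u) (\<kappa> v) = \<kappa> (m u v))
      \<and> (\<forall>U\<in>carrier b.t.T. \<forall>V\<in>carrier b.t.T. \<nu> (b.D.\<gamma> n U) (b.D.\<gamma> n V) = b.D.\<gamma> n (U \<otimes>\<^bsub>b.t.T\<^esub> V))"
    by (rule sp[unfolded is_second_product_def Let_def, THEN conjunct2, THEN spec, THEN mp, OF b.B_algebra])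
  then obtain \<kappa> \<nu> where *: "is_base_change_map A F b.B \<kappa> \<and> algebra b.B (dp_part_with b.B b.t.T n \<nu>)
      \<and> (\<forall>u\<in>part n. \<forall>v\<in>part n. \<nu> (\<kappa> u) (\<kappa> v) = \<kappa> (m u v))
      \<and> (\<forall>U\<in>carrier b.t.T. \<forall>V\<in>carrier b.t.T. \<nu> (b.D.\<gamma> n U) (b.D.\<gamma> n V) = b.D.\<gamma> n (U \<otimes>\<^bsub>b.t.T\<^esub> V))"
    by (elim exE) (rule that)
  have k: "is_base_change_map A F b.B \<kappa>" by (rule *[THEN conjunct1])
  have nu: "algebra b.B (dp_part_with b.B b.t.T n \<nu>)" by (rule *[THEN conjunct2, THEN conjunct1])
  have comp: "\<nu> (\<kappa> u) (\<kappa> v) = \<kappa> (m u v)" if "u \<in> part n" "v \<in> part n" for u v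
    by (rule *[THEN conjunct2, THEN conjunct2, THEN conjunct1, THEN bspec, OF that(1), THEN bspec, OF that(2)])
  have gam: "\<nu> (b.D.\<gamma> n U) (b.D.\<gamma> n V) = b.D.\<gamma> n (U \<otimes>\<^bsub>b.t.T\<^esub> V)"
    if "U \<in> carrier b.t.T" "V \<in> carrier b.t.T" for U V
    by (rule *[THEN conjunct2, THEN conjunct2, THEN conjunct2, THEN bspec, OF that(1), THEN bspec, OF that(2)])
  have m: "cbil n m" using sp unfolding is_second_product_def by (intro algebra_cbil) blast
  note mD = cbilD[OF m]
  have comp': "b.D.mu (\<kappa> u) (\<kappa> v) = \<kappa> (mu u v)" if "u \<in> part n" "v \<in> part n" for u v
    by (rule b.kappa_mu[OF k that(1) part_closed[OF that(2)]])
  have z: "m \<zero>\<^bsub>G\<^esub> v = \<zero>\<^bsub>G\<^esub>" if "v \<in> part n" for v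
    using mD(3)[OF part_zero part_zero that] part_closed[OF mD(1)[OF part_zero that]]
    by (metis G.add.r_cancel_one' G.l_zero G.zero_closed)
  have g: "m (gprod I x c) (gprod J y d) = mu (gprod I x c) (gprod J y d)"
    if "finite I" "x \<in> I \<rightarrow> carrier F" "c \<in> multisets_of_size I n" "finite J" "y \<in> J \<rightarrow> carrier F" "d \<in> multisets_of_size J n" "I \<inter> J = {}"
    for I J :: "nat set" and x y c d
    using b.product_coeff[OF k b.D.algebra_cbil[OF nu] comp gam mD(1) that]
      b.product_coeff[OF k b.D.cbil_mu comp' b.D.mu_gam_gam mu_part that] by simp
  show ?thesis using u
  proof (induct u rule: part_induct[where k = 0])
    case zero then show ?case using v by (simp add: mu_zero part_closed z)
  next
    case (add u u') then show ?case using v mD(3) by (simp add: mu_add part_closed)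
  next
    case (gprod I x c a)
    note I = this
    define k1 where "k1 = Suc (Max (insert 0 I))"
    have k1: "i < k1" if "i \<in> I" for i unfolding k1_def using I(1) that by (simp add: less_Suc_eq_le)
    let ?u = "gprod I x c"
    have up: "?u \<in> part n" using I by (intro gprod_part)
    have "m v ?u = mu v ?u" using v
    proof (induct v rule: part_induct[where k = k1])
      case zero then show ?case using up by (simp add: mu_zero part_closed z)
    next
      case (add u u') then show ?case using up mD(3) by (simp add: mu_add part_closed)
    next
      case (gprod J y d b)
      have vp: "gprod J y d \<in> part n" using gprod by (intro gprod_part)
      have "J \<inter> I = {}" using k1 gprod(2) by force
      then have "m (gprod J y d) ?u = mu (gprod J y d) ?u" by (rule g[OF gprod(1,3,4) I(1,3,4)])
      then show ?case using up vp gprod mD(4) by (simp add: mu_smult part_closed)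
    qed
    then have "m ?u v = mu ?u v" using mD(2)[OF up v] mu_comm[OF part_closed[OF up] part_closed[OF v]] by simp
    then show ?case using up I v mD(4) by (simp add: mu_smult part_closed)
  qed
qed

abbreviation "Gn n \<equiv> dp_n A F n"

lemma Gn_algebra: "algebra A (Gn n)"
proof -
  have "is_second_product A F n (SOME m. is_second_product A F n m)"
    by (rule someI[of "is_second_product A F n", OF second_product_mu])
  then show ?thesis unfolding dp_n_def is_second_product_def by blast
qed

lemma Gn_simps:
  "carrier (Gn n) = part n" "\<zero>\<^bsub>Gn n\<^esub> = \<zero>\<^bsub>G\<^esub>" "\<one>\<^bsub>Gn n\<^esub> = \<gamma> n \<one>\<^bsub>F\<^esub>"
  "u \<oplus>\<^bsub>Gn n\<^esub> v = u \<oplus>\<^bsub>G\<^esub> v" "a \<odot>\<^bsub>Gn n\<^esub> u = a \<odot>\<^bsub>G\<^esub> u"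
  by (simp_all add: dp_n_def part_with_simps)

lemma Gn_mult: "u \<in> part n \<Longrightarrow> v \<in> part n \<Longrightarrow> u \<otimes>\<^bsub>Gn n\<^esub> v = mu u v"
  unfolding dp_n_def part_with_simps
  by (rule second_product_unique[OF someI[of "is_second_product A F n", OF second_product_mu]])

end

section \<open>Determinants\<close>

text \<open>The determinant of the matrix z(i, j) with i and j in I; j is the column and \<sigma> j
  the row. A type class is enough here, since it is applied to polynomials over the
  integers.\<close>

definition alt :: "nat set \<Rightarrow> (nat \<Rightarrow> nat \<Rightarrow> 'r) \<Rightarrow> 'r :: comm_ring_1"
  where "alt I z = (\<Sum>\<sigma> | \<sigma> permutes I. of_int (sign \<sigma>) * (\<Prod>j\<in>I. z (\<sigma> j) j))"

text \<open>The cofactor of the entry (k, l). It is written with permutations of all of I that send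
  l to k, so that no minor has to be reindexed and no extra sign appears.\<close>

definition alt_cof :: "nat set \<Rightarrow> (nat \<Rightarrow> nat \<Rightarrow> 'r) \<Rightarrow> nat \<Rightarrow> nat \<Rightarrow> 'r :: comm_ring_1"
  where "alt_cof I z k l = (\<Sum>\<sigma> | \<sigma> permutes I \<and> \<sigma> l = k. of_int (sign \<sigma>) * (\<Prod>j\<in>I - {l}. z (\<sigma> j) j))"

lemma sign_swap_comp:
  assumes "finite I" "\<sigma> permutes I" "a \<in> I" "b \<in> I" "a \<noteq> b"
  shows "sign (transpose a b \<circ> \<sigma>) = - sign \<sigma>" "sign (\<sigma> \<circ> transpose a b) = - sign \<sigma>"
  using assms by (simp_all add: sign_compose permutation_swap_id sign_swap_id permutation_permutes[THEN iffD2, OF exI])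

text \<open>T pairs even with odd permutations, so the two halves of the sum cancel. Concluding from
  \<Sum> = -\<Sum> would require that 2 is not a zero divisor.\<close>

lemma alt_zero_aux:
  fixes f :: "(nat \<Rightarrow> nat) \<Rightarrow> 'r :: comm_ring_1"
  assumes I: "finite I" and T: "\<And>\<sigma>. \<sigma> permutes I \<Longrightarrow> T \<sigma> permutes I" "\<And>\<sigma>. \<sigma> permutes I \<Longrightarrow> T (T \<sigma>) = \<sigma>"
    "\<And>\<sigma>. \<sigma> permutes I \<Longrightarrow> sign (T \<sigma>) = - sign \<sigma>" "\<And>\<sigma>. \<sigma> permutes I \<Longrightarrow> f (T \<sigma>) = f \<sigma>"
  shows "(\<Sum>\<sigma> | \<sigma> permutes I. of_int (sign \<sigma>) * f \<sigma>) = 0"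
proof -
  let ?E = "{\<sigma>. \<sigma> permutes I \<and> sign \<sigma> = 1}" and ?O = "{\<sigma>. \<sigma> permutes I \<and> sign \<sigma> = - 1}"
  have fin: "finite {\<sigma>. \<sigma> permutes I}" by (rule finite_permutations[OF I])
  have u: "{\<sigma>. \<sigma> permutes I} = ?E \<union> ?O" by (auto simp: sign_def)
  have "finite ?E" "finite ?O" using fin by (auto intro: finite_subset[rotated])
  then have "(\<Sum>\<sigma>\<in>?E \<union> ?O. of_int (sign \<sigma>) * f \<sigma>)
      = (\<Sum>\<sigma>\<in>?E. of_int (sign \<sigma>) * f \<sigma>) + (\<Sum>\<sigma>\<in>?O. of_int (sign \<sigma>) * f \<sigma>)"
    by (rule sum.union_disjoint) auto
  then have "(\<Sum>\<sigma> | \<sigma> permutes I. of_int (sign \<sigma>) * f \<sigma>)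
      = (\<Sum>\<sigma>\<in>?E. of_int (sign \<sigma>) * f \<sigma>) + (\<Sum>\<sigma>\<in>?O. of_int (sign \<sigma>) * f \<sigma>)"
    by (simp only: u)
  also have "(\<Sum>\<sigma>\<in>?O. of_int (sign \<sigma>) * f \<sigma>) = (\<Sum>\<sigma>\<in>?E. - (of_int (sign \<sigma>) * f \<sigma>))"
    by (rule sum.reindex_bij_witness[of _ T T]) (auto simp: T)
  finally show ?thesis by (simp add: sum_negf)
qed

lemma alt_equal_rows:
  assumes I: "finite I" and ab: "a \<in> I" "b \<in> I" "a \<noteq> b" and e: "\<And>j. j \<in> I \<Longrightarrow> z a j = z b j"
  shows "alt I z = 0"
  unfolding alt_def
proof (rule alt_zero_aux[OF I, of "\<lambda>\<sigma>. transpose a b \<circ> \<sigma>"])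
  fix \<sigma> assume s: "\<sigma> permutes I"
  show "transpose a b \<circ> \<sigma> permutes I" using s ab by (intro permutes_compose permutes_swap_id)
  show "sign (transpose a b \<circ> \<sigma>) = - sign \<sigma>" using I s ab by (rule sign_swap_comp)
  show "(\<Prod>j\<in>I. z ((transpose a b \<circ> \<sigma>) j) j) = (\<Prod>j\<in>I. z (\<sigma> j) j)"
    using e by (intro prod.cong) (auto simp: transpose_def)
qed (auto simp: fun_eq_iff)

lemma alt_equal_cols:
  assumes I: "finite I" and ab: "a \<in> I" "b \<in> I" "a \<noteq> b" and e: "\<And>i. i \<in> I \<Longrightarrow> z i a = z i b"
  shows "alt I z = 0"
  unfolding alt_def
proof (rule alt_zero_aux[OF I, of "\<lambda>\<sigma>. \<sigma> \<circ> transpose a b"])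
  fix \<sigma> assume s: "\<sigma> permutes I"
  have t: "transpose a b permutes I" by (rule permutes_swap_id[OF ab(1,2)])
  show "\<sigma> \<circ> transpose a b permutes I" using s t by (intro permutes_compose)
  show "sign (\<sigma> \<circ> transpose a b) = - sign \<sigma>" using I s ab by (rule sign_swap_comp)
  have "(\<Prod>j\<in>I. z (\<sigma> (transpose a b j)) j) = (\<Prod>j\<in>I. z (\<sigma> (transpose a b j)) (transpose a b j))"
    using e ab s by (intro prod.cong refl) (auto simp: transpose_def permutes_in_image)
  also have "\<dots> = (\<Prod>j\<in>I. z (\<sigma> j) j)"
    by (rule prod.permute[OF t, of "\<lambda>j. z (\<sigma> j) j", unfolded o_def, symmetric])
  finally show "(\<Prod>j\<in>I. z ((\<sigma> \<circ> transpose a b) j) j) = (\<Prod>j\<in>I. z (\<sigma> j) j)" by simp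
qed (auto simp: fun_eq_iff)

lemma sum_permutes_by_image:
  assumes "finite I" "k \<in> I"
  shows "(\<Sum>\<sigma> | \<sigma> permutes I. f \<sigma>) = (\<Sum>i\<in>I. \<Sum>\<sigma> | \<sigma> permutes I \<and> \<sigma> k = i. f \<sigma> :: 'r :: comm_monoid_add)"
proof -
  have "(\<Sum>i\<in>I. \<Sum>\<sigma>\<in>{\<sigma> \<in> {\<sigma>. \<sigma> permutes I}. \<sigma> k = i}. f \<sigma>) = (\<Sum>\<sigma> | \<sigma> permutes I. f \<sigma>)"
    using assms by (intro sum.group) (auto simp: finite_permutations permutes_in_image)
  then show ?thesis by (simp add: conj_commute)
qed

text \<open>Row k is used in the column l with \<sigma> l = k, so the permutations are grouped by
  the value of the inverse of \<sigma> at k.\<close>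

lemma alt_row_expand:
  assumes I: "finite I" and k: "k \<in> I"
  shows "alt I (z(k := u)) = (\<Sum>l\<in>I. alt_cof I z k l * u l)"
proof -
  have "alt I (z(k := u)) = (\<Sum>l\<in>I. \<Sum>\<sigma> | \<sigma> permutes I \<and> Hilbert_Choice.inv \<sigma> k = l. of_int (sign \<sigma>) * (\<Prod>j\<in>I. (z(k := u)) (\<sigma> j) j))"
  proof -
    have "(\<Sum>i\<in>I. \<Sum>\<sigma>\<in>{\<sigma> \<in> {\<sigma>. \<sigma> permutes I}. Hilbert_Choice.inv \<sigma> k = i}. of_int (sign \<sigma>) * (\<Prod>j\<in>I. (z(k := u)) (\<sigma> j) j)) = alt I (z(k := u))"
      unfolding alt_def using I k by (intro sum.group) (auto simp: finite_permutations permutes_in_image permutes_inv)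
    then show ?thesis by (simp add: conj_commute)
  qed
  also have "\<dots> = (\<Sum>l\<in>I. alt_cof I z k l * u l)"
  proof (rule sum.cong)
    fix l assume l: "l \<in> I"
    have S: "{\<sigma>. \<sigma> permutes I \<and> Hilbert_Choice.inv \<sigma> k = l} = {\<sigma>. \<sigma> permutes I \<and> \<sigma> l = k}"
      using permutes_inv_eq by fastforce
    have "of_int (sign \<sigma>) * (\<Prod>j\<in>I. (z(k := u)) (\<sigma> j) j) = of_int (sign \<sigma>) * (\<Prod>j\<in>I - {l}. z (\<sigma> j) j) * u l"
      if s: "\<sigma> permutes I" "\<sigma> l = k" for \<sigma>
    proof -
      have "(\<Prod>j\<in>I. (z(k := u)) (\<sigma> j) j) = u l * (\<Prod>j\<in>I - {l}. (z(k := u)) (\<sigma> j) j)"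
        using I l s by (simp add: prod.remove)
      also have "(\<Prod>j\<in>I - {l}. (z(k := u)) (\<sigma> j) j) = (\<Prod>j\<in>I - {l}. z (\<sigma> j) j)"
      proof (rule prod.cong)
        fix j assume "j \<in> I - {l}"
        then have "\<sigma> j \<noteq> k" using s permutes_inj[OF s(1)] by (auto dest: injD)
        then show "(z(k := u)) (\<sigma> j) j = z (\<sigma> j) j" by simp
      qed simp
      finally show ?thesis by (simp add: mult_ac)
    qed
    then show "(\<Sum>\<sigma> | \<sigma> permutes I \<and> Hilbert_Choice.inv \<sigma> k = l. of_int (sign \<sigma>) * (\<Prod>j\<in>I. (z(k := u)) (\<sigma> j) j)) = alt_cof I z k l * u l"
      unfolding S alt_cof_def sum_distrib_right by (intro sum.cong) auto
  qed simp
  finally show ?thesis .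
qed

text \<open>The sum is the determinant with column l replaced by column j, which has two equal
  columns unless j = l.\<close>

lemma alt_cof_col:
  assumes I: "finite I" and l: "l \<in> I" and j: "j \<in> I"
  shows "(\<Sum>i\<in>I. alt_cof I z i l * z i j) = (if j = l then alt I z else 0)"
proof -
  have "(\<Sum>i\<in>I. alt_cof I z i l * z i j)
      = (\<Sum>i\<in>I. \<Sum>\<sigma> | \<sigma> permutes I \<and> \<sigma> l = i. of_int (sign \<sigma>) * (\<Prod>m\<in>I. z (\<sigma> m) (if m = l then j else m)))"
  proof (rule sum.cong)
    fix i assume "i \<in> I"
    have "of_int (sign \<sigma>) * (\<Prod>m\<in>I - {l}. z (\<sigma> m) m) * z i j = of_int (sign \<sigma>) * (\<Prod>m\<in>I. z (\<sigma> m) (if m = l then j else m))"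
      if s: "\<sigma> permutes I" "\<sigma> l = i" for \<sigma>
    proof -
      have "(\<Prod>m\<in>I. z (\<sigma> m) (if m = l then j else m)) = z i j * (\<Prod>m\<in>I - {l}. z (\<sigma> m) (if m = l then j else m))"
        using I l s by (simp add: prod.remove)
      also have "(\<Prod>m\<in>I - {l}. z (\<sigma> m) (if m = l then j else m)) = (\<Prod>m\<in>I - {l}. z (\<sigma> m) m)"
        by (intro prod.cong) auto
      finally show ?thesis by (simp add: mult_ac)
    qed
    then show "alt_cof I z i l * z i j = (\<Sum>\<sigma> | \<sigma> permutes I \<and> \<sigma> l = i. of_int (sign \<sigma>) * (\<Prod>m\<in>I. z (\<sigma> m) (if m = l then j else m)))"
      unfolding alt_cof_def sum_distrib_right by (intro sum.cong) auto
  qed simp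
  also have "\<dots> = alt I (\<lambda>i m. z i (if m = l then j else m))"
    unfolding alt_def by (rule sum_permutes_by_image[OF I l, symmetric])
  also have "\<dots> = (if j = l then alt I z else 0)"
  proof (cases "j = l")
    case True
    then have "(\<lambda>i m. z i (if m = l then j else m)) = z" by (auto simp: fun_eq_iff)
    with True show ?thesis by simp
  next
    case False
    then show ?thesis using alt_equal_cols[OF I j l False, of "\<lambda>i m. z i (if m = l then j else m)"] by simp
  qed
  finally show ?thesis .
qed

text \<open>Each determinant is expanded along its row i. Summing over i first, only the column l =
  j survives, by \<open>alt_cof_col\<close>.\<close>

lemma cramer:
  assumes I: "finite I" and j: "j \<in> I"
  shows "(\<Sum>i\<in>I. alt I (z(i := u)) * z i j) = alt I z * u j"
proof -
  have "(\<Sum>i\<in>I. alt I (z(i := u)) * z i j) = (\<Sum>i\<in>I. \<Sum>l\<in>I. alt_cof I z i l * u l * z i j)"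
    by (simp add: alt_row_expand[OF I] sum_distrib_right)
  also have "\<dots> = (\<Sum>l\<in>I. u l * (\<Sum>i\<in>I. alt_cof I z i l * z i j))"
    by (subst sum.swap) (simp add: sum_distrib_left mult_ac)
  also have "\<dots> = (\<Sum>l\<in>I. if l = j then u l * alt I z else 0)"
    by (intro sum.cong) (auto simp: alt_cof_col[OF I _ j])
  also have "\<dots> = alt I z * u j" using I j by (simp add: mult.commute)
  finally show ?thesis .
qed

text \<open>The cofactors along row k do not change with i. So the second determinant is expanded
  along row k, \<open>cramer\<close> is applied in each column l, and the result is put together
  again.\<close>

lemma alt_cramer_product:
  assumes I: "finite I" and k: "k \<in> I"
  shows "(\<Sum>i\<in>I. alt I (z(i := u)) * alt I (z(k := \<lambda>j. z i j * v j))) = alt I z * alt I (z(k := \<lambda>j. u j * v j))"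
proof -
  have "(\<Sum>i\<in>I. alt I (z(i := u)) * alt I (z(k := \<lambda>j. z i j * v j)))
      = (\<Sum>i\<in>I. \<Sum>l\<in>I. alt_cof I z k l * v l * (alt I (z(i := u)) * z i l))"
    by (simp add: alt_row_expand[OF I k] sum_distrib_left mult_ac)
  also have "\<dots> = (\<Sum>l\<in>I. alt_cof I z k l * v l * (\<Sum>i\<in>I. alt I (z(i := u)) * z i l))"
    by (subst sum.swap) (simp add: sum_distrib_left)
  also have "\<dots> = (\<Sum>l\<in>I. alt_cof I z k l * v l * (alt I z * u l))"
    by (intro sum.cong refl) (simp only: cramer[OF I])
  also have "\<dots> = alt I z * alt I (z(k := \<lambda>j. u j * v j))"
    by (simp add: alt_row_expand[OF I k] sum_distrib_left mult_ac)
  finally show ?thesis .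
qed

section \<open>Products of norms\<close>

text \<open>Induction on J: an extensional choice function on \<open>insert j J\<close> is one on J
  updated at j, and this correspondence is bijective.\<close>

lemma (in cring) finprod_finsum:
  assumes "finite J" "finite I" "\<And>j i. j \<in> J \<Longrightarrow> i \<in> I \<Longrightarrow> f j i \<in> carrier R"
  shows "(\<Otimes>j\<in>J. \<Oplus>i\<in>I. f j i) = (\<Oplus>g\<in>J \<rightarrow>\<^sub>E I. \<Otimes>j\<in>J. f j (g j))"
  using assms
proof (induct J rule: finite_induct)
  case empty
  then show ?case by simp
next
  case (insert j J)
  let ?h = "\<lambda>p. (snd p)(j := fst p)"
  have fin: "finite (J \<rightarrow>\<^sub>E I)" using insert by (intro finite_PiE) auto
  have c: "f j i \<in> carrier R" "k \<in> J \<Longrightarrow> f k i \<in> carrier R" if "i \<in> I" for k i using insert that by auto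
  have pc: "(\<Otimes>k\<in>J. f k (g k)) \<in> carrier R" if "g \<in> J \<rightarrow>\<^sub>E I" for g
    using that c by (intro finprod_closed) (auto simp: PiE_iff)
  have "(\<Otimes>j\<in>insert j J. \<Oplus>i\<in>I. f j i) = (\<Oplus>i\<in>I. f j i) \<otimes> (\<Otimes>j\<in>J. \<Oplus>i\<in>I. f j i)"
    using insert c by (intro finprod_insert) (auto intro!: finsum_closed)
  also have "(\<Otimes>j\<in>J. \<Oplus>i\<in>I. f j i) = (\<Oplus>g\<in>J \<rightarrow>\<^sub>E I. \<Otimes>j\<in>J. f j (g j))" using insert by simp
  also have "(\<Oplus>i\<in>I. f j i) \<otimes> (\<Oplus>g\<in>J \<rightarrow>\<^sub>E I. \<Otimes>j\<in>J. f j (g j))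
      = (\<Oplus>p\<in>I \<times> (J \<rightarrow>\<^sub>E I). f j (fst p) \<otimes> (\<Otimes>k\<in>J. f k (snd p k)))"
    using insert fin c pc by (intro finsum_mult_finsum) auto
  also have "\<dots> = (\<Oplus>p\<in>I \<times> (J \<rightarrow>\<^sub>E I). \<Otimes>k\<in>insert j J. f k (?h p k))"
  proof (rule finsum_cong')
    fix p assume p: "p \<in> I \<times> (J \<rightarrow>\<^sub>E I)"
    then have i: "fst p \<in> I" and g: "snd p \<in> J \<rightarrow>\<^sub>E I" by auto
    have "(\<Otimes>k\<in>J. f k (?h p k)) = (\<Otimes>k\<in>J. f k (snd p k))"
      using insert g c by (intro finprod_cong') (auto simp: PiE_iff)
    then show "f j (fst p) \<otimes> (\<Otimes>k\<in>J. f k (snd p k)) = (\<Otimes>k\<in>insert j J. f k (?h p k))"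
      using insert i g c by (subst finprod_insert) (auto simp: PiE_iff)
  qed (use insert c in \<open>auto intro!: finprod_closed simp: PiE_iff\<close>)
  also have "\<dots> = (\<Oplus>g\<in>insert j J \<rightarrow>\<^sub>E I. \<Otimes>k\<in>insert j J. f k (g k))"
  proof (rule add.finprod_bij)
    show "bij_betw ?h (I \<times> (J \<rightarrow>\<^sub>E I)) (insert j J \<rightarrow>\<^sub>E I)"
      unfolding bij_betw_def
    proof
      show "inj_on ?h (I \<times> (J \<rightarrow>\<^sub>E I))"
      proof (rule inj_onI)
        fix p q assume p: "p \<in> I \<times> (J \<rightarrow>\<^sub>E I)" and q: "q \<in> I \<times> (J \<rightarrow>\<^sub>E I)" and e: "?h p = ?h q"
        have "fst p = fst q" using fun_cong[OF e, of j] by simp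
        moreover have "snd p = snd q"
        proof (rule PiE_ext[of _ J "\<lambda>_. I"])
          fix k assume "k \<in> J"
          then show "snd p k = snd q k" using fun_cong[OF e, of k] insert(2) by (auto split: if_splits)
        qed (use p q in auto)
        ultimately show "p = q" by (simp add: prod_eq_iff)
      qed
      show "?h ` (I \<times> (J \<rightarrow>\<^sub>E I)) = insert j J \<rightarrow>\<^sub>E I"
        by (simp add: PiE_insert_eq case_prod_beta')
    qed
  qed (use insert c in \<open>auto intro!: finprod_closed simp: PiE_iff\<close>)
  finally show ?case .
qed

locale norms = dpa A F
  for A :: "('a, 'x) ring_scheme" and F :: "('a, 'f, 'y) module_scheme" +
  fixes n :: nat
begin

abbreviation "ix \<equiv> {1..n}"

text \<open>The image of the pure tensor of the a_i. It is the divided monomial with all exponents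
  1, see \<open>br_gprod\<close>, so that \<open>mu_gprod\<close> applies to it.\<close>

definition br :: "(nat \<Rightarrow> 'f) \<Rightarrow> ('a, 'f) dpow" where "br a = (\<Otimes>\<^bsub>G\<^esub>i\<in>ix. \<gamma> 1 (a i))"

lemma mset_ix: "mset_set ix \<in> multisets_of_size ix n"
  by (simp add: multisets_of_size_def)

lemma br_gprod: "a \<in> ix \<rightarrow> carrier F \<Longrightarrow> br a = gprod ix a (mset_set ix)"
  unfolding br_def by (intro G.finprod_cong') (auto intro!: gam_closed)

lemma br_part: "a \<in> ix \<rightarrow> carrier F \<Longrightarrow> br a \<in> part n"
  using gprod_part[OF _ _ mset_ix] by (simp add: br_gprod)

lemma br_closed: "a \<in> ix \<rightarrow> carrier F \<Longrightarrow> br a \<in> carrier G"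
  using br_part part_closed by blast

lemma br_cong: "(\<And>i. i \<in> ix \<Longrightarrow> a i = b i) \<Longrightarrow> b \<in> ix \<rightarrow> carrier F \<Longrightarrow> br a = br b"
  unfolding br_def by (intro G.finprod_cong') (auto intro!: gam_closed)

text \<open>In degree one a single exponent is 1, and the other factors are \<gamma>^0 = 1.\<close>

lemma Phi_gam_1:
  assumes "finite I" "a \<in> I \<rightarrow> carrier F" "y \<in> carrier F"
  shows "Phi I a (\<gamma> 1 y) = (\<Oplus>\<^bsub>GT\<^esub>i\<in>I. single G {#i#} (\<gamma> 1 (a i \<otimes>\<^bsub>F\<^esub> y)))"
proof
  fix c
  have ai: "i \<in> I \<Longrightarrow> a i \<in> carrier F" for i using assms by auto
  have r: "(\<Oplus>\<^bsub>GT\<^esub>i\<in>I. single G {#i#} (\<gamma> 1 (a i \<otimes>\<^bsub>F\<^esub> y))) c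
      = (\<Oplus>\<^bsub>G\<^esub>i\<in>I. if c = {#i#} then \<gamma> 1 (a i \<otimes>\<^bsub>F\<^esub> y) else \<zero>\<^bsub>G\<^esub>)"
    by (rule trans[OF nG.mr.coeff_finsum]) (use ai assms(3) in \<open>blast intro: nG.sc gam_closed F.m_closed\<close>, simp only: single_def)
  show "Phi I a (\<gamma> 1 y) c = (\<Oplus>\<^bsub>GT\<^esub>i\<in>I. single G {#i#} (\<gamma> 1 (a i \<otimes>\<^bsub>F\<^esub> y))) c"
  proof (cases "c \<in> multisets_of_size I 1")
    case True
    then obtain k where k: "c = {#k#}" "k \<in> I" 
      using size_1_singleton_mset[of c] by (force simp: multisets_of_size_def)
    have "Phi I a (\<gamma> 1 y) c = (\<Otimes>\<^bsub>G\<^esub>i\<in>I. if k = i then \<gamma> 1 (a i \<otimes>\<^bsub>F\<^esub> y) else \<one>\<^bsub>G\<^esub>)"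
      unfolding Phi_gam_coeff[OF assms] if_P[OF True]
    proof (rule G.finprod_cong')
      fix i assume "i \<in> I"
      then show "\<gamma> (count c i) (a i \<otimes>\<^bsub>F\<^esub> y) = (if k = i then \<gamma> 1 (a i \<otimes>\<^bsub>F\<^esub> y) else \<one>\<^bsub>G\<^esub>)"
        using k ai assms(3) by (simp add: gam_0)
    qed (use ai assms(3) in auto)
    also have "\<dots> = \<gamma> 1 (a k \<otimes>\<^bsub>F\<^esub> y)" using k assms ai by (intro G.finprod_singleton) auto
    also have "\<dots> = (\<Oplus>\<^bsub>G\<^esub>i\<in>I. if k = i then \<gamma> 1 (a i \<otimes>\<^bsub>F\<^esub> y) else \<zero>\<^bsub>G\<^esub>)"
      using k assms ai by (intro G.add.finprod_singleton[symmetric]) auto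
    finally show ?thesis unfolding r using k by simp
  next
    case False
    then have "(\<Oplus>\<^bsub>G\<^esub>i\<in>I. if c = {#i#} then \<gamma> 1 (a i \<otimes>\<^bsub>F\<^esub> y) else \<zero>\<^bsub>G\<^esub>) = \<zero>\<^bsub>G\<^esub>"
      by (intro G.add.finprod_one_eqI) (auto simp: multisets_of_size_def)
    then show ?thesis unfolding r Phi_gam_coeff[OF assms] using False by simp
  qed
qed

text \<open>A map of a finite set onto itself is bijective. Hence the product of the variables
  T_g(j) contains each variable exactly once only for bijections g, which selects the permutations
  in \<open>mu_br\<close>.\<close>

lemma sum_single_perm:
  assumes g: "g \<in> I \<rightarrow>\<^sub>E I" and I: "finite I"
  shows "(\<Sum>j\<in>I. {#g j#}) = mset_set I \<longleftrightarrow> bij_betw g I I"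
proof
  have s: "(\<Sum>j\<in>I. {#g j#}) = image_mset g (mset_set I)"
    using I by (induct I rule: finite_induct) auto
  { assume "(\<Sum>j\<in>I. {#g j#}) = mset_set I"
    then have "set_mset (image_mset g (mset_set I)) = set_mset (mset_set I)" using s by simp
    then have "g ` I = I" using I by simp
    then show "bij_betw g I I" using I by (simp add: bij_betw_def finite_surj_inj eq_card_imp_inj_on) }
  { assume "bij_betw g I I"
    then show "(\<Sum>j\<in>I. {#g j#}) = mset_set I"
      unfolding s by (simp add: bij_betw_def image_mset_mset_set) }
qed

text \<open>\<open>Phi\<close> sends the bracket of a to the product over j of the linear forms
  \<Sum> T_i \<gamma>^1(b_i a_j), and \<open>mu\<close> takes the coefficient at T_1 ... T_n. Among
  all choice functions only the permutations contribute.\<close>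

lemma mu_br:
  assumes a: "a \<in> ix \<rightarrow> carrier F" and b: "b \<in> ix \<rightarrow> carrier F"
  shows "mu (br a) (br b) = (\<Oplus>\<^bsub>G\<^esub>\<sigma>\<in>{\<sigma>. \<sigma> permutes ix}. br (\<lambda>i. a i \<otimes>\<^bsub>F\<^esub> b (\<sigma> i)))"
proof -
  have ai: "i \<in> ix \<Longrightarrow> a i \<in> carrier F" "i \<in> ix \<Longrightarrow> b i \<in> carrier F" for i using a b by auto
  let ?m = "mset_set ix"
  have ms: "set_mset ?m \<subseteq> ix" by simp
  interpret h: ring_hom_cring G GT "Phi ix b" using Phi_hom[OF b] by unfold_locales
  \<comment> \<open>After this exchange the choice function acts on the index of b, as in the
    claim.\<close>
  have "mu (br a) (br b) = mu (br b) (br a)" using a b by (intro mu_comm br_closed)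
  also have "\<dots> = Phi ix b (br a) ?m"
    unfolding br_gprod[OF b] by (rule mu_gprod[OF _ b ms br_closed[OF a]]) simp
  also have "Phi ix b (br a) = (\<Otimes>\<^bsub>GT\<^esub>j\<in>ix. Phi ix b (\<gamma> 1 (a j)))"
    unfolding br_def using ai by (subst h.hom_finprod) (auto simp: o_def)
  also have "\<dots> = (\<Otimes>\<^bsub>GT\<^esub>j\<in>ix. \<Oplus>\<^bsub>GT\<^esub>i\<in>ix. single G {#i#} (\<gamma> 1 (b i \<otimes>\<^bsub>F\<^esub> a j)))"
  proof (rule nG.NP.finprod_cong')
    fix j assume j: "j \<in> ix"
    show "Phi ix b (\<gamma> 1 (a j)) = (\<Oplus>\<^bsub>GT\<^esub>i\<in>ix. single G {#i#} (\<gamma> 1 (b i \<otimes>\<^bsub>F\<^esub> a j)))"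
      by (rule Phi_gam_1[OF _ b ai(1)[OF j]]) simp
  qed (use ai in \<open>auto intro!: nG.NP.finsum_closed\<close>)
  also have "\<dots> = (\<Oplus>\<^bsub>GT\<^esub>g\<in>ix \<rightarrow>\<^sub>E ix. \<Otimes>\<^bsub>GT\<^esub>j\<in>ix. single G {#g j#} (\<gamma> 1 (b (g j) \<otimes>\<^bsub>F\<^esub> a j)))"
    using ai by (intro nG.NP.finprod_finsum) auto
  also have "\<dots> = (\<Oplus>\<^bsub>GT\<^esub>g\<in>ix \<rightarrow>\<^sub>E ix. single G (\<Sum>j\<in>ix. {#g j#}) (\<Otimes>\<^bsub>G\<^esub>j\<in>ix. \<gamma> 1 (b (g j) \<otimes>\<^bsub>F\<^esub> a j)))"
  proof (rule nG.NP.finsum_cong')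
    fix g assume g: "g \<in> ix \<rightarrow>\<^sub>E ix"
    show "(\<Otimes>\<^bsub>GT\<^esub>j\<in>ix. single G {#g j#} (\<gamma> 1 (b (g j) \<otimes>\<^bsub>F\<^esub> a j))) = single G (\<Sum>j\<in>ix. {#g j#}) (\<Otimes>\<^bsub>G\<^esub>j\<in>ix. \<gamma> 1 (b (g j) \<otimes>\<^bsub>F\<^esub> a j))"
      using g ai by (intro nG.finprod_single) (auto simp: PiE_iff)
  qed (use ai in \<open>auto intro!: nG.sc G.finprod_closed simp: PiE_iff\<close>)
  also have "\<dots> ?m = (\<Oplus>\<^bsub>G\<^esub>g\<in>ix \<rightarrow>\<^sub>E ix. single G (\<Sum>j\<in>ix. {#g j#}) (\<Otimes>\<^bsub>G\<^esub>j\<in>ix. \<gamma> 1 (b (g j) \<otimes>\<^bsub>F\<^esub> a j)) ?m)"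
    using ai by (intro nG.mr.coeff_finsum) (auto intro!: nG.sc G.finprod_closed simp: PiE_iff)
  also have "\<dots> = (\<Oplus>\<^bsub>G\<^esub>g\<in>{g \<in> ix \<rightarrow>\<^sub>E ix. bij_betw g ix ix}. \<Otimes>\<^bsub>G\<^esub>j\<in>ix. \<gamma> 1 (b (g j) \<otimes>\<^bsub>F\<^esub> a j))"
  proof (rule G.add.finprod_mono_neutral_cong_right)
    show "finite (ix \<rightarrow>\<^sub>E ix)" by (intro finite_PiE) auto
    fix g assume "g \<in> (ix \<rightarrow>\<^sub>E ix) - {g \<in> ix \<rightarrow>\<^sub>E ix. bij_betw g ix ix}"
    then have "(\<Sum>j\<in>ix. {#g j#}) \<noteq> ?m" using sum_single_perm[of g ix] by auto
    then show "single G (\<Sum>j\<in>ix. {#g j#}) (\<Otimes>\<^bsub>G\<^esub>j\<in>ix. \<gamma> 1 (b (g j) \<otimes>\<^bsub>F\<^esub> a j)) ?m = \<zero>\<^bsub>G\<^esub>" by (simp add: single_def)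
  next
    fix g assume "g \<in> {g \<in> ix \<rightarrow>\<^sub>E ix. bij_betw g ix ix}"
    then have "(\<Sum>j\<in>ix. {#g j#}) = ?m" using sum_single_perm[of g ix] by auto
    then show "single G (\<Sum>j\<in>ix. {#g j#}) (\<Otimes>\<^bsub>G\<^esub>j\<in>ix. \<gamma> 1 (b (g j) \<otimes>\<^bsub>F\<^esub> a j)) ?m = (\<Otimes>\<^bsub>G\<^esub>j\<in>ix. \<gamma> 1 (b (g j) \<otimes>\<^bsub>F\<^esub> a j))"
      by (simp add: single_def)
  next
    have "single G w (\<Otimes>\<^bsub>G\<^esub>j\<in>ix. \<gamma> 1 (b (g j) \<otimes>\<^bsub>F\<^esub> a j)) ?m \<in> carrier G" if "g \<in> ix \<rightarrow>\<^sub>E ix" for g w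
      using that ai by (intro GT_coeff nG.sc G.finprod_closed) (auto simp: PiE_iff)
    then show "(\<lambda>g. single G (\<Sum>j\<in>ix. {#g j#}) (\<Otimes>\<^bsub>G\<^esub>j\<in>ix. \<gamma> 1 (b (g j) \<otimes>\<^bsub>F\<^esub> a j)) ?m) \<in> (ix \<rightarrow>\<^sub>E ix) \<rightarrow> carrier G"
      by blast
  qed auto
  \<comment> \<open>Permutations are functions on all of \<open>nat\<close> that fix everything
    outside the index set, while choice functions are extensional; restriction translates between
    the two.\<close>
  also have "\<dots> = (\<Oplus>\<^bsub>G\<^esub>\<sigma>\<in>{\<sigma>. \<sigma> permutes ix}. \<Otimes>\<^bsub>G\<^esub>j\<in>ix. \<gamma> 1 (b (restrict \<sigma> ix j) \<otimes>\<^bsub>F\<^esub> a j))"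
  proof (rule G.add.finprod_bij[symmetric])
    show "bij_betw (\<lambda>\<sigma>. restrict \<sigma> ix) {\<sigma>. \<sigma> permutes ix} {g \<in> ix \<rightarrow>\<^sub>E ix. bij_betw g ix ix}"
    proof (rule bij_betw_byWitness[of _ "\<lambda>g i. if i \<in> ix then g i else i"])
      show "\<forall>\<sigma>\<in>{\<sigma>. \<sigma> permutes ix}. (\<lambda>i. if i \<in> ix then restrict \<sigma> ix i else i) = \<sigma>"
        using permutes_not_in by fastforce
      show "\<forall>g\<in>{g \<in> ix \<rightarrow>\<^sub>E ix. bij_betw g ix ix}. restrict (\<lambda>i. if i \<in> ix then g i else i) ix = g"
        by (auto simp: fun_eq_iff PiE_iff extensional_def)
      show "(\<lambda>\<sigma>. restrict \<sigma> ix) ` {\<sigma>. \<sigma> permutes ix} \<subseteq> {g \<in> ix \<rightarrow>\<^sub>E ix. bij_betw g ix ix}"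
        using permutes_in_image by (auto dest: permutes_imp_bij simp: bij_betw_restrict_eq) fastforce+
      show "(\<lambda>g i. if i \<in> ix then g i else i) ` {g \<in> ix \<rightarrow>\<^sub>E ix. bij_betw g ix ix} \<subseteq> {\<sigma>. \<sigma> permutes ix}"
      proof (rule image_subsetI, rule CollectI)
        fix g assume "g \<in> {g \<in> ix \<rightarrow>\<^sub>E ix. bij_betw g ix ix}"
        then have "bij_betw g ix ix" by blast
        moreover have "bij_betw (\<lambda>i. if i \<in> ix then g i else i) ix ix \<longleftrightarrow> bij_betw g ix ix"
          by (rule bij_betw_cong) simp
        ultimately have "bij_betw (\<lambda>i. if i \<in> ix then g i else i) ix ix" by blast
        then show "(\<lambda>i. if i \<in> ix then g i else i) permutes ix" by (rule bij_imp_permutes) auto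
      qed
    qed
    show "(\<lambda>g. \<Otimes>\<^bsub>G\<^esub>j\<in>ix. \<gamma> 1 (b (g j) \<otimes>\<^bsub>F\<^esub> a j)) \<in> {g \<in> ix \<rightarrow>\<^sub>E ix. bij_betw g ix ix} \<rightarrow> carrier G"
      using ai by (auto intro!: G.finprod_closed simp: PiE_iff)
  qed
  also have "\<dots> = (\<Oplus>\<^bsub>G\<^esub>\<sigma>\<in>{\<sigma>. \<sigma> permutes ix}. br (\<lambda>i. a i \<otimes>\<^bsub>F\<^esub> b (\<sigma> i)))"
  proof (rule G.finsum_cong')
    fix \<sigma> assume "\<sigma> \<in> {\<sigma>. \<sigma> permutes ix}"
    then have p: "\<sigma> j \<in> ix" if "j \<in> ix" for j using that permutes_in_image by fastforce
    show "(\<Otimes>\<^bsub>G\<^esub>j\<in>ix. \<gamma> 1 (b (restrict \<sigma> ix j) \<otimes>\<^bsub>F\<^esub> a j)) = br (\<lambda>i. a i \<otimes>\<^bsub>F\<^esub> b (\<sigma> i))"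
      unfolding br_def
    proof (rule G.finprod_cong')
      fix j assume j: "j \<in> ix"
      show "\<gamma> 1 (b (restrict \<sigma> ix j) \<otimes>\<^bsub>F\<^esub> a j) = \<gamma> 1 (a j \<otimes>\<^bsub>F\<^esub> b (\<sigma> j))"
        using j F.m_comm[OF ai(2)[OF p[OF j]] ai(1)[OF j]] by simp
    qed (use ai p in \<open>blast intro: gam_closed\<close>)+
  next
    show "(\<lambda>\<sigma>. br (\<lambda>i. a i \<otimes>\<^bsub>F\<^esub> b (\<sigma> i))) \<in> {\<sigma>. \<sigma> permutes ix} \<rightarrow> carrier G"
    proof (rule funcsetI, rule br_closed, rule funcsetI)
      fix \<sigma> i assume "\<sigma> \<in> {\<sigma>. \<sigma> permutes ix}" "i \<in> ix"
      then show "a i \<otimes>\<^bsub>F\<^esub> b (\<sigma> i) \<in> carrier F" using ai permutes_in_image[of \<sigma> ix i] by auto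
    qed
  qed simp
  finally show ?thesis .
qed

end

section \<open>Norms as images of determinants over the integers\<close>

context norms
begin

abbreviation "perms \<equiv> {\<sigma>. \<sigma> permutes ix}"
abbreviation "\<delta> x y \<equiv> norm_delta A F n x y"

definition pF :: "'f multiset \<Rightarrow> 'f" where "pF M = F.mset_prod (\<lambda>f. f) M"

definition place :: "nat \<Rightarrow> (nat \<times> 'f) multiset \<Rightarrow> 'f multiset"
  where "place j m = image_mset snd (filter_mset (\<lambda>p. fst p = j) m)"

text \<open>Variables (j, f) exist for every f of the type, also outside the carrier of F. Monomials
  containing such a variable go to zero, so that \<open>Ev\<close> and \<open>Sm\<close> land in
  \<open>G\<close> without side conditions.\<close>

definition Ev :: "(nat \<times> 'f) multiset \<Rightarrow> ('a, 'f) dpow"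
  where "Ev m = (if snd ` set_mset m \<subseteq> carrier F then br (\<lambda>j. pF (place j m)) else \<zero>\<^bsub>G\<^esub>)"

text \<open>The variable \<open>(j, f)\<close> stands for \<open>f\<close> in the \<open>j\<close>-th factor of \<open>F\<^bsup>\<otimes>n\<^esup>\<close>, and \<open>Sm\<close> is the
  composite of \<open>\<int>[(j, f)] \<rightarrow> F\<^bsup>\<otimes>n\<^esup>\<close> with \<open>a\<^sub>1 \<otimes> \<dots> \<otimes> a\<^sub>n \<mapsto> \<gamma>\<^sup>1(a\<^sub>1) * \<dots> * \<gamma>\<^sup>1(a\<^sub>n)\<close>.\<close>

definition Sm :: "((nat \<times> 'f) multiset \<Rightarrow>\<^sub>0 int) \<Rightarrow> ('a, 'f) dpow"
  where "Sm f = (\<Oplus>\<^bsub>G\<^esub>m\<in>Poly_Mapping.keys f. add_pow G (Poly_Mapping.lookup f m) (Ev m))"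

lemma pF_closed: "set_mset M \<subseteq> carrier F \<Longrightarrow> pF M \<in> carrier F"
  unfolding pF_def by (rule F.mset_prod_closed) auto

lemma pF_simps: "f \<in> carrier F \<Longrightarrow> pF {#f#} = f"
  "set_mset M \<subseteq> carrier F \<Longrightarrow> set_mset N \<subseteq> carrier F \<Longrightarrow> pF (M + N) = pF M \<otimes>\<^bsub>F\<^esub> pF N"
  unfolding pF_def by (auto simp: F.mset_prod_simps intro!: F.mset_prod_union)

lemma pF_fun:
  assumes "\<And>i. i \<in> I \<Longrightarrow> set_mset (p i) \<subseteq> carrier F \<and> pF (p i) = x i"
  shows "x \<in> I \<rightarrow> carrier F"
proof (rule funcsetI)
  fix i assume "i \<in> I"
  then show "x i \<in> carrier F" using assms[of i] pF_closed[of "p i"] by simp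
qed

lemma place_closed: "snd ` set_mset m \<subseteq> carrier F \<Longrightarrow> set_mset (place j m) \<subseteq> carrier F"
  by (auto simp: place_def)

lemma Ev_closed: "Ev m \<in> carrier G"
  unfolding Ev_def by (auto intro!: br_closed pF_closed dest: place_closed)

lemma Sm_extend:
  assumes "finite U" "Poly_Mapping.keys f \<subseteq> U"
  shows "Sm f = (\<Oplus>\<^bsub>G\<^esub>m\<in>U. add_pow G (Poly_Mapping.lookup f m) (Ev m))"
  unfolding Sm_def using assms Ev_closed
  by (intro G.add.finprod_mono_neutral_cong_left) (auto simp: in_keys_iff add_pow_int_ge)

lemma Sm_closed: "Sm f \<in> carrier G"
  unfolding Sm_def by (intro G.finsum_closed) (auto intro: Ev_closed)

lemma Sm_add: "Sm (f + g) = Sm f \<oplus>\<^bsub>G\<^esub> Sm g"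
proof -
  let ?U = "Poly_Mapping.keys f \<union> Poly_Mapping.keys g"
  have U: "finite ?U" by simp
  have "Sm (f + g) = (\<Oplus>\<^bsub>G\<^esub>m\<in>?U. add_pow G (Poly_Mapping.lookup f m) (Ev m) \<oplus>\<^bsub>G\<^esub> add_pow G (Poly_Mapping.lookup g m) (Ev m))"
    by (subst Sm_extend[OF U Poly_Mapping.keys_add])
      (intro G.finsum_cong', auto simp: lookup_add G.add.int_pow_mult Ev_closed)
  also have "\<dots> = Sm f \<oplus>\<^bsub>G\<^esub> Sm g"
    using Ev_closed by (subst G.finsum_addf) (auto simp: Sm_extend[OF U])
  finally show ?thesis .
qed

lemma Sm_zero: "Sm 0 = \<zero>\<^bsub>G\<^esub>" by (simp add: Sm_def)

lemma Sm_sum: "finite P \<Longrightarrow> Sm (\<Sum>p\<in>P. f p) = (\<Oplus>\<^bsub>G\<^esub>p\<in>P. Sm (f p))"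
  by (induct P rule: finite_induct) (simp_all add: Sm_zero Sm_add G.finsum_insert Pi_iff Sm_closed)

lemma Sm_single: "Sm (of_int k * Poly_Mapping.single m 1) = add_pow G k (Ev m)"
proof -
  have "of_int k * Poly_Mapping.single m (1 :: int) = Poly_Mapping.single m k"
    by (simp only: single_of_int[symmetric] mult_single) simp
  then show ?thesis using Sm_extend[of "{m}" "Poly_Mapping.single m k"] Ev_closed by simp
qed

text \<open>An element of F is represented by a multiset whose product \<open>pF\<close> it is. The
  variables (j, y), (j, w) and (j, y w) are unrelated in the polynomial ring; representing y w by
  two elements makes \<open>V\<close> multiplicative, and the matrix entries of Cramer's rule need
  this.\<close>

abbreviation V :: "nat \<Rightarrow> 'f multiset \<Rightarrow> (nat \<times> 'f) multiset \<Rightarrow>\<^sub>0 int"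
  where "V j M \<equiv> Poly_Mapping.single (image_mset (Pair j) M) 1"

abbreviation "Vm p \<equiv> (\<Prod>j\<in>ix. V j (p j))"
abbreviation "Vt q \<equiv> (\<lambda>i j. V j (q i))"

lemma V_add: "V j (M + N) = V j M * V j N" by (simp add: mult_single)

lemma Vm_eq: "finite I \<Longrightarrow> (\<Prod>j\<in>I. V j (p j)) = Poly_Mapping.single (\<Sum>j\<in>I. image_mset (Pair j) (p j)) 1"
  by (induct I rule: finite_induct) (simp_all add: mult_single)

lemma Sm_Vm:
  assumes p: "\<And>j. j \<in> ix \<Longrightarrow> set_mset (p j) \<subseteq> carrier F"
  shows "Sm (of_int k * Vm p) = add_pow G k (br (\<lambda>j. pF (p j)))"
proof -
  let ?m = "\<Sum>j\<in>ix. image_mset (Pair j) (p j)"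
  have pl: "place i (\<Sum>j\<in>I. image_mset (Pair j) (p j)) = (if i \<in> I then p i else {#})" if "finite I" for i I
    using that
  proof (induct I rule: finite_induct)
    case (insert j I)
    have "place i (image_mset (Pair j) (p j)) = (if i = j then p j else {#})"
      by (simp add: place_def filter_mset_image_mset image_mset.compositionality o_def)
    then show ?case using insert by (auto simp: place_def)
  qed (simp add: place_def)
  have "snd ` set_mset ?m \<subseteq> carrier F"
    using p by (force simp: set_mset_sum)
  then have "Ev ?m = br (\<lambda>j. pF (place j ?m))" by (simp add: Ev_def)
  also have "\<dots> = br (\<lambda>j. pF (p j))"
    by (rule br_cong) (use p pF_closed in \<open>auto simp: pl\<close>)
  finally show ?thesis by (simp add: Vm_eq Sm_single)
qed

lemma fin_perms: "finite perms" by (simp add: finite_permutations)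

lemma perm_in: "\<sigma> \<in> perms \<Longrightarrow> i \<in> ix \<Longrightarrow> \<sigma> i \<in> ix"
  using permutes_in_image by fastforce

lemma delta_eq:
  assumes "x \<in> ix \<rightarrow> carrier F" "y \<in> ix \<rightarrow> carrier F"
  shows "\<delta> x y = (\<Oplus>\<^bsub>G\<^esub>\<sigma>\<in>perms. add_pow G (sign \<sigma>) (br (\<lambda>i. x i \<otimes>\<^bsub>F\<^esub> y (\<sigma> i))))"
  by (simp add: norm_delta_def br_def Let_def)

lemma br_perm_closed:
  assumes "x \<in> ix \<rightarrow> carrier F" "y \<in> ix \<rightarrow> carrier F" "\<sigma> \<in> perms"
  shows "(\<lambda>i. x i \<otimes>\<^bsub>F\<^esub> y (\<sigma> i)) \<in> ix \<rightarrow> carrier F"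
  using assms perm_in by blast

text \<open>An integer multiple is also a multiple by a scalar of A, and \<Gamma>^n is closed under
  these.\<close>

lemma part_int_pow:
  assumes "u \<in> part k" shows "add_pow G (z::int) u \<in> part k"
proof -
  have h: "(\<lambda>a. a \<odot>\<^bsub>G\<^esub> u) \<in> add_hom A G"
    using part_closed[OF assms] by (intro add_homI) (auto simp: GA.smult_l_distr)
  have "add_pow A z \<one>\<^bsub>A\<^esub> \<odot>\<^bsub>G\<^esub> u = add_pow G z u"
    using add_hom_int_pow[OF A.abelian_group_axioms G.abelian_group_axioms h A.one_closed, of z] part_closed[OF assms] by simp
  then show ?thesis using part_smult[OF _ assms, of "add_pow A z \<one>\<^bsub>A\<^esub>"] by simp
qed

lemma delta_part:
  assumes "x \<in> ix \<rightarrow> carrier F" "y \<in> ix \<rightarrow> carrier F" shows "\<delta> x y \<in> part n"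
  unfolding delta_eq[OF assms] using br_perm_closed[OF assms] by (intro part_finsum part_int_pow br_part)

lemma delta_Sm:
  assumes p: "\<And>i. i \<in> ix \<Longrightarrow> set_mset (p i) \<subseteq> carrier F \<and> pF (p i) = x i"
    and q: "\<And>i. i \<in> ix \<Longrightarrow> set_mset (q i) \<subseteq> carrier F \<and> pF (q i) = y i"
  shows "\<delta> x y = Sm (Vm p * alt ix (Vt q))"
proof -
  have x: "x \<in> ix \<rightarrow> carrier F" by (rule pF_fun[OF p])
  have y: "y \<in> ix \<rightarrow> carrier F" by (rule pF_fun[OF q])
  have "Vm p * alt ix (Vt q) = (\<Sum>\<sigma>\<in>perms. of_int (sign \<sigma>) * Vm (\<lambda>j. p j + q (\<sigma> j)))"
    unfolding alt_def sum_distrib_left V_add prod.distrib by (intro sum.cong) (auto simp: mult_ac)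
  then have "Sm (Vm p * alt ix (Vt q)) = (\<Oplus>\<^bsub>G\<^esub>\<sigma>\<in>perms. Sm (of_int (sign \<sigma>) * Vm (\<lambda>j. p j + q (\<sigma> j))))"
    by (simp only: Sm_sum[OF fin_perms])
  also have "\<dots> = (\<Oplus>\<^bsub>G\<^esub>\<sigma>\<in>perms. add_pow G (sign \<sigma>) (br (\<lambda>i. x i \<otimes>\<^bsub>F\<^esub> y (\<sigma> i))))"
  proof (rule G.finsum_cong')
    fix \<sigma> assume s: "\<sigma> \<in> perms"
    have c: "set_mset (p j) \<subseteq> carrier F" "set_mset (q (\<sigma> j)) \<subseteq> carrier F"
      "pF (p j) = x j" "pF (q (\<sigma> j)) = y (\<sigma> j)" if "j \<in> ix" for j
      using p[OF that] q[OF perm_in[OF s that]] by blast+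
    have "Sm (of_int (sign \<sigma>) * Vm (\<lambda>j. p j + q (\<sigma> j))) = add_pow G (sign \<sigma>) (br (\<lambda>j. pF (p j + q (\<sigma> j))))"
      by (rule Sm_Vm) (use c in simp)
    also have "br (\<lambda>j. pF (p j + q (\<sigma> j))) = br (\<lambda>i. x i \<otimes>\<^bsub>F\<^esub> y (\<sigma> i))"
      by (rule br_cong[OF _ br_perm_closed[OF x y s]]) (use c in \<open>simp add: pF_simps\<close>)
    finally show "Sm (of_int (sign \<sigma>) * Vm (\<lambda>j. p j + q (\<sigma> j))) = add_pow G (sign \<sigma>) (br (\<lambda>i. x i \<otimes>\<^bsub>F\<^esub> y (\<sigma> i)))" .
  qed (use br_closed[OF br_perm_closed[OF x y]] in \<open>auto\<close>)
  finally show ?thesis unfolding delta_eq[OF x y] ..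
qed

text \<open>By \<open>mu_br\<close> the product of norms is a sum over three permutations \<rho>,
  \<tau> and \<sigma>, the last one coming from the second product. The three determinants also give
  three permutations, and that sum is reindexed to match.\<close>

lemma delta_mult_Sm:
  assumes p: "\<And>i. i \<in> ix \<Longrightarrow> set_mset (p i) \<subseteq> carrier F \<and> pF (p i) = x i"
    and q: "\<And>i. i \<in> ix \<Longrightarrow> set_mset (q i) \<subseteq> carrier F \<and> pF (q i) = y i"
    and r: "\<And>i. i \<in> ix \<Longrightarrow> set_mset (r i) \<subseteq> carrier F \<and> pF (r i) = z i"
    and s: "\<And>i. i \<in> ix \<Longrightarrow> set_mset (s i) \<subseteq> carrier F \<and> pF (s i) = w i"
  shows "\<delta> x y \<otimes>\<^bsub>Gn n\<^esub> \<delta> z w = Sm (Vm p * alt ix (Vt q) * alt ix (Vt r) * alt ix (Vt s))"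
proof -
  have x: "x \<in> ix \<rightarrow> carrier F" by (rule pF_fun[OF p])
  have y: "y \<in> ix \<rightarrow> carrier F" by (rule pF_fun[OF q])
  have z: "z \<in> ix \<rightarrow> carrier F" by (rule pF_fun[OF r])
  have w: "w \<in> ix \<rightarrow> carrier F" by (rule pF_fun[OF s])
  let ?M = "\<lambda>\<rho> \<tau> \<sigma> j. p j + q (\<rho> j) + (r (\<sigma> j) + s (\<tau> (\<sigma> j)))"
  let ?b = "\<lambda>\<rho> i. x i \<otimes>\<^bsub>F\<^esub> y (\<rho> i)" and ?c = "\<lambda>\<tau> i. z i \<otimes>\<^bsub>F\<^esub> w (\<tau> i)"
  have bp: "?b \<rho> \<in> ix \<rightarrow> carrier F" "?c \<rho> \<in> ix \<rightarrow> carrier F" if "\<rho> \<in> perms" for \<rho>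
    using br_perm_closed[OF x y that] br_perm_closed[OF z w that] by auto
  note bc = br_closed[OF bp(1)] and cc = br_closed[OF bp(2)]
  have rs: "alt ix (Vt r) * alt ix (Vt s) = (\<Sum>\<tau>\<in>perms. \<Sum>\<sigma>\<in>perms. of_int (sign \<tau>) * Vm (\<lambda>j. r (\<sigma> j) + s (\<tau> (\<sigma> j))))"
  proof -
    \<comment> \<open>Substituting \<tau> \<circ> \<sigma> for \<tau> costs the sign of \<sigma>,
      which cancels against the sign of the \<sigma>-term in the determinant of r. The signs of
      \<rho> and \<tau> remain, as in the product of norms.\<close>
    have a: "alt ix (Vt s) = of_int (sign \<sigma>) * (\<Sum>\<tau>\<in>perms. of_int (sign \<tau>) * Vm (\<lambda>j. s (\<tau> (\<sigma> j))))" if sg: "\<sigma> \<in> perms" for \<sigma>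
    proof -
      have "alt ix (Vt s) = (\<Sum>\<tau>\<in>perms. of_int (sign (\<tau> \<circ> \<sigma>)) * (\<Prod>j\<in>ix. V j (s ((\<tau> \<circ> \<sigma>) j))))"
        unfolding alt_def using sg by (intro sum_permutations_compose_right) simp
      also have "\<dots> = (\<Sum>\<tau>\<in>perms. of_int (sign \<sigma>) * (of_int (sign \<tau>) * Vm (\<lambda>j. s (\<tau> (\<sigma> j)))))"
      proof (rule sum.cong)
        fix \<tau> assume "\<tau> \<in> perms"
        then have "sign (\<tau> \<circ> \<sigma>) = sign \<tau> * sign \<sigma>"
          using sg by (intro sign_compose permutation_permutes[THEN iffD2] exI[of _ ix]) auto
        then show "of_int (sign (\<tau> \<circ> \<sigma>)) * (\<Prod>j\<in>ix. V j (s ((\<tau> \<circ> \<sigma>) j)))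
          = of_int (sign \<sigma>) * (of_int (sign \<tau>) * Vm (\<lambda>j. s (\<tau> (\<sigma> j))))" by (simp add: mult_ac)
      qed simp
      finally show ?thesis by (simp add: sum_distrib_left)
    qed
    have "alt ix (Vt r) * alt ix (Vt s) = (\<Sum>\<sigma>\<in>perms. of_int (sign \<sigma>) * Vm (\<lambda>j. r (\<sigma> j)) * alt ix (Vt s))"
      by (simp only: alt_def[of ix "Vt r"] sum_distrib_right)
    also have "\<dots> = (\<Sum>\<sigma>\<in>perms. \<Sum>\<tau>\<in>perms. of_int (sign \<tau>) * Vm (\<lambda>j. r (\<sigma> j) + s (\<tau> (\<sigma> j))))"
    proof (rule sum.cong)
      fix \<sigma> assume sg: "\<sigma> \<in> perms"
      have "(of_int (sign \<sigma>) * of_int (sign \<sigma>) :: (nat \<times> 'f) multiset \<Rightarrow>\<^sub>0 int) = 1"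
        by (simp flip: of_int_mult)
      then have "of_int (sign \<sigma>) * Vm (\<lambda>j. r (\<sigma> j)) * alt ix (Vt s)
        = Vm (\<lambda>j. r (\<sigma> j)) * (\<Sum>\<tau>\<in>perms. of_int (sign \<tau>) * Vm (\<lambda>j. s (\<tau> (\<sigma> j))))"
        unfolding a[OF sg] by (metis (no_types, lifting) mult.assoc mult.commute mult.left_neutral)
      also have "\<dots> = (\<Sum>\<tau>\<in>perms. of_int (sign \<tau>) * Vm (\<lambda>j. r (\<sigma> j) + s (\<tau> (\<sigma> j))))"
        unfolding sum_distrib_left V_add prod.distrib by (intro sum.cong) (auto simp: mult_ac)
      finally show "of_int (sign \<sigma>) * Vm (\<lambda>j. r (\<sigma> j)) * alt ix (Vt s) = \<dots>" .
    qed simp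
    finally show ?thesis by (subst sum.swap)
  qed
  have "Vm p * alt ix (Vt q) * (alt ix (Vt r) * alt ix (Vt s))
      = (\<Sum>\<rho>\<in>perms. \<Sum>\<tau>\<in>perms. \<Sum>\<sigma>\<in>perms. of_int (sign \<rho> * sign \<tau>) * Vm (?M \<rho> \<tau> \<sigma>))"
    unfolding rs
  proof -
    have g: "(\<Sum>\<rho>\<in>P. a \<rho>) * (\<Sum>\<tau>\<in>Q. \<Sum>\<sigma>\<in>R. b \<tau> \<sigma>) = (\<Sum>\<rho>\<in>P. \<Sum>\<tau>\<in>Q. \<Sum>\<sigma>\<in>R. a \<rho> * b \<tau> \<sigma>)"
      for P Q R and a :: "(nat \<Rightarrow> nat) \<Rightarrow> (nat \<times> 'f) multiset \<Rightarrow>\<^sub>0 int" and b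
      by (subst sum_distrib_right, rule sum.cong[OF refl], subst sum_distrib_left, rule sum.cong[OF refl], rule sum_distrib_left)
    have "Vm p * alt ix (Vt q) = (\<Sum>\<rho>\<in>perms. of_int (sign \<rho>) * Vm (\<lambda>j. p j + q (\<rho> j)))"
      unfolding alt_def sum_distrib_left V_add prod.distrib by (intro sum.cong) (auto simp: mult_ac)
    then show "Vm p * alt ix (Vt q) * (\<Sum>\<tau>\<in>perms. \<Sum>\<sigma>\<in>perms. of_int (sign \<tau>) * Vm (\<lambda>j. r (\<sigma> j) + s (\<tau> (\<sigma> j))))
      = (\<Sum>\<rho>\<in>perms. \<Sum>\<tau>\<in>perms. \<Sum>\<sigma>\<in>perms. of_int (sign \<rho> * sign \<tau>) * Vm (?M \<rho> \<tau> \<sigma>))"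
      by (simp only: g) (intro sum.cong refl, simp only: of_int_mult V_add prod.distrib mult_ac)
  qed
  then have R: "Sm (Vm p * alt ix (Vt q) * alt ix (Vt r) * alt ix (Vt s))
      = (\<Oplus>\<^bsub>G\<^esub>\<rho>\<in>perms. \<Oplus>\<^bsub>G\<^esub>\<tau>\<in>perms. \<Oplus>\<^bsub>G\<^esub>\<sigma>\<in>perms. Sm (of_int (sign \<rho> * sign \<tau>) * Vm (?M \<rho> \<tau> \<sigma>)))"
    by (simp only: mult.assoc Sm_sum[OF fin_perms])
  have t: "Sm (of_int k * Vm (?M \<rho> \<tau> \<sigma>)) = add_pow G k (br (\<lambda>i. ?b \<rho> i \<otimes>\<^bsub>F\<^esub> ?c \<tau> (\<sigma> i)))"
    if pm: "\<rho> \<in> perms" "\<tau> \<in> perms" "\<sigma> \<in> perms" for \<rho> \<tau> \<sigma> k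
  proof -
    have c: "set_mset (p j) \<subseteq> carrier F" "set_mset (q (\<rho> j)) \<subseteq> carrier F"
      "set_mset (r (\<sigma> j)) \<subseteq> carrier F" "set_mset (s (\<tau> (\<sigma> j))) \<subseteq> carrier F"
      "pF (p j) = x j" "pF (q (\<rho> j)) = y (\<rho> j)" "pF (r (\<sigma> j)) = z (\<sigma> j)" "pF (s (\<tau> (\<sigma> j))) = w (\<tau> (\<sigma> j))"
      if j: "j \<in> ix" for j
      using p[OF j] q[OF perm_in[OF pm(1) j]] r[OF perm_in[OF pm(3) j]] s[OF perm_in[OF pm(2) perm_in[OF pm(3) j]]] by blast+
    have "Sm (of_int k * Vm (?M \<rho> \<tau> \<sigma>)) = add_pow G k (br (\<lambda>j. pF (?M \<rho> \<tau> \<sigma> j)))"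
      by (rule Sm_Vm) (use c in simp)
    also have "br (\<lambda>j. pF (?M \<rho> \<tau> \<sigma> j)) = br (\<lambda>i. ?b \<rho> i \<otimes>\<^bsub>F\<^esub> ?c \<tau> (\<sigma> i))"
      by (rule br_cong[OF _ br_perm_closed[OF bp(1)[OF pm(1)] bp(2)[OF pm(2)] pm(3)]]) (use c in \<open>simp add: pF_simps\<close>)
    finally show ?thesis .
  qed
  note ab = G.abelian_group_axioms
  have muadd: "(\<lambda>v. mu u v) \<in> add_hom G G" if "u \<in> carrier G" for u
    using that by (intro add_homI) (auto simp: mu_add_right)
  let ?B = "\<lambda>\<rho>. br (?b \<rho>)" and ?C = "\<lambda>\<tau>. br (?c \<tau>)"
  have "\<delta> x y \<otimes>\<^bsub>Gn n\<^esub> \<delta> z w = mu (\<delta> x y) (\<delta> z w)"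
    by (intro Gn_mult delta_part x y z w)
  also have "\<dots> = (\<Oplus>\<^bsub>G\<^esub>\<rho>\<in>perms. mu (add_pow G (sign \<rho>) (?B \<rho>)) (\<delta> z w))"
    unfolding delta_eq[OF x y] using bc
    by (intro add_hom_finsum[OF ab ab mu_add_hom]) (auto intro!: part_closed[OF delta_part[OF z w]])
  also have "\<dots> = (\<Oplus>\<^bsub>G\<^esub>\<rho>\<in>perms. \<Oplus>\<^bsub>G\<^esub>\<tau>\<in>perms. \<Oplus>\<^bsub>G\<^esub>\<sigma>\<in>perms.
      add_pow G (sign \<rho> * sign \<tau>) (br (\<lambda>i. ?b \<rho> i \<otimes>\<^bsub>F\<^esub> ?c \<tau> (\<sigma> i))))"
  proof (rule G.finsum_cong')
    fix \<rho> assume rho: "\<rho> \<in> perms"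
    have "mu (add_pow G (sign \<rho>) (?B \<rho>)) (\<delta> z w) = (\<Oplus>\<^bsub>G\<^esub>\<tau>\<in>perms. mu (add_pow G (sign \<rho>) (?B \<rho>)) (add_pow G (sign \<tau>) (?C \<tau>)))"
      unfolding delta_eq[OF z w] using bc[OF rho] cc
      by (intro add_hom_finsum[OF ab ab muadd]) auto
    also have "\<dots> = (\<Oplus>\<^bsub>G\<^esub>\<tau>\<in>perms. \<Oplus>\<^bsub>G\<^esub>\<sigma>\<in>perms. add_pow G (sign \<rho> * sign \<tau>) (br (\<lambda>i. ?b \<rho> i \<otimes>\<^bsub>F\<^esub> ?c \<tau> (\<sigma> i))))"
    proof (rule G.finsum_cong')
      fix \<tau> assume tau: "\<tau> \<in> perms"
      have brc: "br (\<lambda>i. ?b \<rho> i \<otimes>\<^bsub>F\<^esub> ?c \<tau> (\<sigma> i)) \<in> carrier G" if "\<sigma> \<in> perms" for \<sigma>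
        by (rule br_closed[OF br_perm_closed[OF bp(1)[OF rho] bp(2)[OF tau] that]])
      have powh: "(\<lambda>u. add_pow G k u) \<in> add_hom G G" for k :: int
        by (rule add_homI) (auto simp: G.add.int_pow_distrib)
      have "mu (add_pow G (sign \<rho>) (?B \<rho>)) (add_pow G (sign \<tau>) (?C \<tau>)) = add_pow G (sign \<rho>) (add_pow G (sign \<tau>) (mu (?B \<rho>) (?C \<tau>)))"
        using bc[OF rho] cc[OF tau]
        by (simp add: add_hom_int_pow[OF ab ab mu_add_hom] add_hom_int_pow[OF ab ab muadd] G.add.int_pow_pow mult.commute)
      also have "\<dots> = add_pow G (sign \<rho> * sign \<tau>) (mu (?B \<rho>) (?C \<tau>))"
        using bc[OF rho] cc[OF tau] by (simp add: G.add.int_pow_pow mult.commute)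
      also have "mu (?B \<rho>) (?C \<tau>) = (\<Oplus>\<^bsub>G\<^esub>\<sigma>\<in>perms. br (\<lambda>i. ?b \<rho> i \<otimes>\<^bsub>F\<^esub> ?c \<tau> (\<sigma> i)))"
        by (rule mu_br[OF bp(1)[OF rho] bp(2)[OF tau]])
      also have "add_pow G (sign \<rho> * sign \<tau>) \<dots> = (\<Oplus>\<^bsub>G\<^esub>\<sigma>\<in>perms. add_pow G (sign \<rho> * sign \<tau>) (br (\<lambda>i. ?b \<rho> i \<otimes>\<^bsub>F\<^esub> ?c \<tau> (\<sigma> i))))"
        using brc by (intro add_hom_finsum[OF ab ab powh]) auto
      finally show "mu (add_pow G (sign \<rho>) (?B \<rho>)) (add_pow G (sign \<tau>) (?C \<tau>)) = \<dots>" .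
    qed (use br_closed[OF br_perm_closed[OF bp(1)[OF rho] bp(2)]] in \<open>auto intro!: G.finsum_closed\<close>)
    finally show "mu (add_pow G (sign \<rho>) (?B \<rho>)) (\<delta> z w) = \<dots>" .
  qed (use br_closed[OF br_perm_closed[OF bp(1) bp(2)]] in \<open>auto intro!: G.finsum_closed\<close>)
  also have "\<dots> = (\<Oplus>\<^bsub>G\<^esub>\<rho>\<in>perms. \<Oplus>\<^bsub>G\<^esub>\<tau>\<in>perms. \<Oplus>\<^bsub>G\<^esub>\<sigma>\<in>perms. Sm (of_int (sign \<rho> * sign \<tau>) * Vm (?M \<rho> \<tau> \<sigma>)))"
    by (intro G.finsum_cong' refl t[symmetric]) (auto intro!: G.finsum_closed Sm_closed)
  finally show ?thesis unfolding R .
qed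

abbreviation "vx x \<equiv> (\<lambda>i. {#x i :: 'f#})"

lemma vx_ok: "x \<in> ix \<rightarrow> carrier F \<Longrightarrow> i \<in> ix \<Longrightarrow> set_mset (vx x i) \<subseteq> carrier F \<and> pF (vx x i) = x i"
  by (auto simp: pF_simps Pi_iff)

lemma vx_upd:
  assumes "x \<in> ix \<rightarrow> carrier F" "set_mset M \<subseteq> carrier F" "pF M = y" "i \<in> ix"
  shows "set_mset (((vx x)(k := M)) i) \<subseteq> carrier F \<and> pF (((vx x)(k := M)) i) = (x(k := y)) i"
  using assms vx_ok by auto

lemma Vt_upd: "Vt (q(k := M)) = (Vt q)(k := (\<lambda>j. V j M))" by (auto simp: fun_eq_iff)

text \<open>By \<open>delta_mult_Sm\<close> every summand on the left and the product on the right
  contain the factor \<open>Vm (vx x)\<close> and one determinant of \<open>Vt (vx x)\<close>. What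
  remains is \<open>alt_cramer_product\<close>, and \<open>Sm\<close> has to be additive
  only.\<close>

theorem delta_cramer:
  assumes x: "x \<in> ix \<rightarrow> carrier F" and y: "y \<in> carrier F" and w: "w \<in> carrier F" and k: "k \<in> ix"
  shows "(\<Oplus>\<^bsub>G\<^esub>i\<in>ix. \<delta> x (x(i := y)) \<otimes>\<^bsub>Gn n\<^esub> \<delta> x (x(k := x i \<otimes>\<^bsub>F\<^esub> w)))
    = \<delta> x x \<otimes>\<^bsub>Gn n\<^esub> \<delta> x (x(k := y \<otimes>\<^bsub>F\<^esub> w))"
proof -
  let ?p = "vx x" and ?Z = "Vt (vx x)" and ?Y = "\<lambda>j. V j {#y#}" and ?W = "\<lambda>j. V j {#w#}"
  have xi: "x i \<in> carrier F" if "i \<in> ix" for i using x that by auto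
  have pF2: "pF (add_mset b {#a#}) = a \<otimes>\<^bsub>F\<^esub> b" if "a \<in> carrier F" "b \<in> carrier F" for a b
    using that pF_simps(2)[of "{#a#}" "{#b#}"] by (simp add: pF_simps(1))
  have "\<delta> x (x(i := y)) \<otimes>\<^bsub>Gn n\<^esub> \<delta> x (x(k := x i \<otimes>\<^bsub>F\<^esub> w))
      = Sm (Vm ?p * alt ix ?Z * (alt ix (?Z(i := ?Y)) * alt ix (?Z(k := \<lambda>j. ?Z i j * ?W j))))" if i: "i \<in> ix" for i
  proof -
    have "\<delta> x (x(i := y)) \<otimes>\<^bsub>Gn n\<^esub> \<delta> x (x(k := x i \<otimes>\<^bsub>F\<^esub> w))
      = Sm (Vm ?p * alt ix (Vt (?p(i := {#y#}))) * alt ix ?Z * alt ix (Vt (?p(k := {#x i#} + {#w#}))))"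
      by (rule delta_mult_Sm[OF vx_ok[OF x] vx_upd[OF x] vx_ok[OF x] vx_upd[OF x]])
        (use y w xi[OF i] in \<open>simp_all add: pF_simps(1) pF2\<close>)
    then show ?thesis by (simp only: Vt_upd V_add mult_ac)
  qed
  then have "(\<Oplus>\<^bsub>G\<^esub>i\<in>ix. \<delta> x (x(i := y)) \<otimes>\<^bsub>Gn n\<^esub> \<delta> x (x(k := x i \<otimes>\<^bsub>F\<^esub> w)))
     = (\<Oplus>\<^bsub>G\<^esub>i\<in>ix. Sm (Vm ?p * alt ix ?Z * (alt ix (?Z(i := ?Y)) * alt ix (?Z(k := \<lambda>j. ?Z i j * ?W j)))))"
    by (intro G.finsum_cong') (auto intro!: Sm_closed)
  also have "\<dots> = Sm (Vm ?p * alt ix ?Z * (\<Sum>i\<in>ix. alt ix (?Z(i := ?Y)) * alt ix (?Z(k := \<lambda>j. ?Z i j * ?W j))))"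
    unfolding sum_distrib_left by (rule Sm_sum[symmetric]) simp
  also have "(\<Sum>i\<in>ix. alt ix (?Z(i := ?Y)) * alt ix (?Z(k := \<lambda>j. ?Z i j * ?W j))) = alt ix ?Z * alt ix (?Z(k := \<lambda>j. ?Y j * ?W j))"
    by (rule alt_cramer_product[OF _ k]) simp
  also have "Sm (Vm ?p * alt ix ?Z * (alt ix ?Z * alt ix (?Z(k := \<lambda>j. ?Y j * ?W j))))
     = Sm (Vm ?p * alt ix ?Z * alt ix ?Z * alt ix (Vt (?p(k := {#y#} + {#w#}))))"
    by (simp only: Vt_upd V_add mult.assoc)
  also have "\<dots> = \<delta> x x \<otimes>\<^bsub>Gn n\<^esub> \<delta> x (x(k := y \<otimes>\<^bsub>F\<^esub> w))"
    by (rule delta_mult_Sm[OF vx_ok[OF x] vx_ok[OF x] vx_ok[OF x] vx_upd[OF x], symmetric])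
      (use y w in \<open>simp_all add: pF2\<close>)
  finally show ?thesis .
qed

text \<open>The rows i and k of the determinant in \<open>delta_Sm\<close> coincide.\<close>

lemma delta_repeated:
  assumes x: "x \<in> ix \<rightarrow> carrier F" and ik: "i \<in> ix" "k \<in> ix" "i \<noteq> k"
  shows "\<delta> x (x(k := x i)) = \<zero>\<^bsub>G\<^esub>"
proof -
  have xi: "x i \<in> carrier F" using x ik by auto
  have "\<delta> x (x(k := x i)) = Sm (Vm (vx x) * alt ix (Vt ((vx x)(k := {#x i#}))))"
    by (rule delta_Sm[OF vx_ok[OF x] vx_upd[OF x]]) (use xi in \<open>simp_all add: pF_simps\<close>)
  also have "alt ix (Vt ((vx x)(k := {#x i#}))) = 0"
    by (rule alt_equal_rows[OF _ ik]) (use ik in simp_all)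
  finally show ?thesis by (simp only: Sm_zero mult_zero_right)
qed

section \<open>The norm as a linear function of one entry\<close>

lemma gam_1_add: "x \<in> carrier F \<Longrightarrow> y \<in> carrier F \<Longrightarrow> \<gamma> 1 (x \<oplus>\<^bsub>F\<^esub> y) = \<gamma> 1 x \<oplus>\<^bsub>G\<^esub> \<gamma> 1 y"
  by (simp add: gam_add atMost_atLeast0[symmetric] gam_0 G.a_comm)

lemma br_upd:
  assumes a: "a \<in> ix \<rightarrow> carrier F" and j: "j \<in> ix" and y: "y \<in> carrier F"
  shows "br (a(j := y)) = \<gamma> 1 y \<otimes>\<^bsub>G\<^esub> (\<Otimes>\<^bsub>G\<^esub>i\<in>ix - {j}. \<gamma> 1 (a i))"
    and "(\<Otimes>\<^bsub>G\<^esub>i\<in>ix - {j}. \<gamma> 1 (a i)) \<in> carrier G"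
proof -
  have ai: "a i \<in> carrier F" if "i \<in> ix" for i using a that by auto
  show c: "(\<Otimes>\<^bsub>G\<^esub>i\<in>ix - {j}. \<gamma> 1 (a i)) \<in> carrier G" using ai by (intro G.finprod_closed) auto
  have "br (a(j := y)) = (\<Otimes>\<^bsub>G\<^esub>i\<in>insert j (ix - {j}). \<gamma> 1 ((a(j := y)) i))"
    unfolding br_def using j by (simp add: insert_absorb)
  also have "\<dots> = \<gamma> 1 y \<otimes>\<^bsub>G\<^esub> (\<Otimes>\<^bsub>G\<^esub>i\<in>ix - {j}. \<gamma> 1 ((a(j := y)) i))"
    using ai y by (subst G.finprod_insert) auto
  also have "(\<Otimes>\<^bsub>G\<^esub>i\<in>ix - {j}. \<gamma> 1 ((a(j := y)) i)) = (\<Otimes>\<^bsub>G\<^esub>i\<in>ix - {j}. \<gamma> 1 (a i))"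
    using ai by (intro G.finprod_cong') auto
  finally show "br (a(j := y)) = \<gamma> 1 y \<otimes>\<^bsub>G\<^esub> (\<Otimes>\<^bsub>G\<^esub>i\<in>ix - {j}. \<gamma> 1 (a i))" .
qed

lemma delta_linear:
  assumes x: "x \<in> ix \<rightarrow> carrier F" and k: "k \<in> ix"
  shows "(\<lambda>y. \<delta> x (x(k := y))) \<in> add_hom F G"
    and "\<And>a y. a \<in> carrier A \<Longrightarrow> y \<in> carrier F \<Longrightarrow> \<delta> x (x(k := a \<odot>\<^bsub>F\<^esub> y)) = a \<odot>\<^bsub>G\<^esub> \<delta> x (x(k := y))"
proof -
  have xi: "x i \<in> carrier F" if "i \<in> ix" for i using x that by auto
  define t where "t \<sigma> y = br (\<lambda>i. x i \<otimes>\<^bsub>F\<^esub> (x(k := y)) (\<sigma> i))" for \<sigma> y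
  have upd: "x(k := y) \<in> ix \<rightarrow> carrier F" if "y \<in> carrier F" for y using x that by auto
  have tc: "t \<sigma> y \<in> carrier G" if "\<sigma> \<in> perms" "y \<in> carrier F" for \<sigma> y
    unfolding t_def by (rule br_closed[OF br_perm_closed[OF x upd[OF that(2)] that(1)]])
  have de: "\<delta> x (x(k := y)) = (\<Oplus>\<^bsub>G\<^esub>\<sigma>\<in>perms. add_pow G (sign \<sigma>) (t \<sigma> y))" if "y \<in> carrier F" for y
    unfolding t_def by (rule delta_eq[OF x upd[OF that]])
  \<comment> \<open>The inserted entry is used by one factor only, the one at j with \<sigma> j = k.
    So each summand is \<gamma>^1(u y) times a constant, and \<gamma>^1 is linear.\<close>
  have "\<exists>c u. c \<in> carrier G \<and> u \<in> carrier F \<and> (\<forall>y\<in>carrier F. t \<sigma> y = \<gamma> 1 (u \<otimes>\<^bsub>F\<^esub> y) \<otimes>\<^bsub>G\<^esub> c)" if s: "\<sigma> \<in> perms" for \<sigma>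
  proof -
    define j where "j = Hilbert_Choice.inv \<sigma> k"
    have sp: "\<sigma> permutes ix" using s by simp
    have j: "\<sigma> j = k" "j \<in> ix"
      using permutes_inverses(1)[OF sp, of k] permutes_in_image[OF permutes_inv[OF sp], of k] k by (auto simp: j_def)
    let ?a = "\<lambda>i. x i \<otimes>\<^bsub>F\<^esub> x (\<sigma> i)"
    have a: "?a \<in> ix \<rightarrow> carrier F" by (rule br_perm_closed[OF x x s])
    have "t \<sigma> y = \<gamma> 1 (x j \<otimes>\<^bsub>F\<^esub> y) \<otimes>\<^bsub>G\<^esub> (\<Otimes>\<^bsub>G\<^esub>i\<in>ix - {j}. \<gamma> 1 (?a i))" if y: "y \<in> carrier F" for y
    proof -
      have "(\<lambda>i. x i \<otimes>\<^bsub>F\<^esub> (x(k := y)) (\<sigma> i)) = ?a(j := x j \<otimes>\<^bsub>F\<^esub> y)"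
        using j permutes_inj[OF sp] by (auto simp: fun_eq_iff dest: injD)
      then show ?thesis unfolding t_def using br_upd(1)[OF a j(2) F.m_closed[OF xi[OF j(2)] y]] by simp
    qed
    then show ?thesis using br_upd(2)[OF a j(2) xi[OF j(2)]] xi[OF j(2)] by blast
  qed
  then obtain c u where cu: "c \<sigma> \<in> carrier G" "u \<sigma> \<in> carrier F" "y \<in> carrier F \<Longrightarrow> t \<sigma> y = \<gamma> 1 (u \<sigma> \<otimes>\<^bsub>F\<^esub> y) \<otimes>\<^bsub>G\<^esub> c \<sigma>"
    if "\<sigma> \<in> perms" for \<sigma> y by metis
  have tadd: "t \<sigma> (y \<oplus>\<^bsub>F\<^esub> y') = t \<sigma> y \<oplus>\<^bsub>G\<^esub> t \<sigma> y'" if "\<sigma> \<in> perms" "y \<in> carrier F" "y' \<in> carrier F" for \<sigma> y y'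
    using cu(1,2)[OF that(1)] that
    by (simp only: cu(3)[OF that(1)] F.a_closed F.r_distr gam_1_add F.m_closed G.l_distr gam_closed)
  have tsm: "t \<sigma> (a \<odot>\<^bsub>F\<^esub> y) = a \<odot>\<^bsub>G\<^esub> t \<sigma> y" if "\<sigma> \<in> perms" "y \<in> carrier F" "a \<in> carrier A" for \<sigma> y a
  proof -
    have "\<gamma> 1 (u \<sigma> \<otimes>\<^bsub>F\<^esub> (a \<odot>\<^bsub>F\<^esub> y)) = a \<odot>\<^bsub>G\<^esub> \<gamma> 1 (u \<sigma> \<otimes>\<^bsub>F\<^esub> y)"
      using cu(2)[OF that(1)] that gam_smult[of "u \<sigma> \<otimes>\<^bsub>F\<^esub> y" a 1] by (simp add: AF_smult_assoc)
    then show ?thesis using cu(1,2)[OF that(1)] that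
      by (simp only: cu(3)[OF that(1)] AF.smult_closed GA.smult_assoc2 gam_closed F.m_closed)
  qed
  show "(\<lambda>y. \<delta> x (x(k := y))) \<in> add_hom F G"
  proof (rule add_homI)
    fix y assume y: "y \<in> carrier F"
    show "\<delta> x (x(k := y)) \<in> carrier G" by (rule part_closed[OF delta_part[OF x upd[OF y]]])
    fix y' assume y': "y' \<in> carrier F"
    have "\<delta> x (x(k := y \<oplus>\<^bsub>F\<^esub> y')) = (\<Oplus>\<^bsub>G\<^esub>\<sigma>\<in>perms. add_pow G (sign \<sigma>) (t \<sigma> y) \<oplus>\<^bsub>G\<^esub> add_pow G (sign \<sigma>) (t \<sigma> y'))"
      unfolding de[OF F.a_closed[OF y y']] using y y' tc
      by (intro G.finsum_cong') (auto simp: tadd G.add.int_pow_distrib)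
    also have "\<dots> = \<delta> x (x(k := y)) \<oplus>\<^bsub>G\<^esub> \<delta> x (x(k := y'))"
      unfolding de[OF y] de[OF y'] using y y' tc by (intro G.finsum_addf) auto
    finally show "\<delta> x (x(k := y \<oplus>\<^bsub>F\<^esub> y')) = \<delta> x (x(k := y)) \<oplus>\<^bsub>G\<^esub> \<delta> x (x(k := y'))" .
  qed
  fix a y assume a: "a \<in> carrier A" and y: "y \<in> carrier F"
  have h: "(\<lambda>u. a \<odot>\<^bsub>G\<^esub> u) \<in> add_hom G G" using a by (intro add_homI) (auto simp: GA.smult_r_distr)
  note ab = G.abelian_group_axioms
  have "\<delta> x (x(k := a \<odot>\<^bsub>F\<^esub> y)) = (\<Oplus>\<^bsub>G\<^esub>\<sigma>\<in>perms. a \<odot>\<^bsub>G\<^esub> add_pow G (sign \<sigma>) (t \<sigma> y))"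
    unfolding de[OF AF.smult_closed[OF a y]] using a y tc
    by (intro G.finsum_cong') (auto simp: tsm add_hom_int_pow[OF ab ab h])
  also have "\<dots> = a \<odot>\<^bsub>G\<^esub> \<delta> x (x(k := y))"
    unfolding de[OF y] using tc y by (intro add_hom_finsum[OF ab ab h, symmetric]) auto
  finally show "\<delta> x (x(k := a \<odot>\<^bsub>F\<^esub> y)) = a \<odot>\<^bsub>G\<^esub> \<delta> x (x(k := y))" .
qed

end

section \<open>Localization\<close>

locale mult_subset = R?: cring R for R :: "('r, 'x) ring_scheme" (structure) +
  fixes S :: "'r set"
  assumes S_sub: "S \<subseteq> carrier R" and S_one: "\<one>\<^bsub>R\<^esub> \<in> S"
    and S_mult: "\<And>s t. s \<in> S \<Longrightarrow> t \<in> S \<Longrightarrow> s \<otimes>\<^bsub>R\<^esub> t \<in> S"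
begin

abbreviation "fr \<equiv> loc_frac R S"
abbreviation "L \<equiv> localization R S"

lemma Sc [simp]: "s \<in> S \<Longrightarrow> s \<in> carrier R" using S_sub by auto

lemma rel_iff: "((r, s), (r', s')) \<in> loc_rel R S \<longleftrightarrow>
    r \<in> carrier R \<and> s \<in> S \<and> r' \<in> carrier R \<and> s' \<in> S \<and> (\<exists>u\<in>S. u \<otimes> (r \<otimes> s') = u \<otimes> (r' \<otimes> s))"
  by (simp add: loc_rel_def)

lemma loc_equiv: "equiv (carrier R \<times> S) (loc_rel R S)"
proof (rule equivI)
  show "loc_rel R S \<subseteq> (carrier R \<times> S) \<times> (carrier R \<times> S)" by (auto simp: loc_rel_def)
  show "refl_on (carrier R \<times> S) (loc_rel R S)"
    using S_one by (auto simp: refl_on_def loc_rel_def)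
  show "sym (loc_rel R S)" by (rule symI) (auto simp: loc_rel_def, metis)
  show "trans (loc_rel R S)"
  proof (rule transI)
    fix a b c assume ab: "(a, b) \<in> loc_rel R S" and bc: "(b, c) \<in> loc_rel R S"
    obtain r s r' s' r'' s'' where e: "a = (r, s)" "b = (r', s')" "c = (r'', s'')" by (cases a, cases b, cases c)
    obtain u v where u: "u \<in> S" "u \<otimes> (r \<otimes> s') = u \<otimes> (r' \<otimes> s)" and v: "v \<in> S" "v \<otimes> (r' \<otimes> s'') = v \<otimes> (r'' \<otimes> s')"
      and m: "r \<in> carrier R" "s \<in> S" "r' \<in> carrier R" "s' \<in> S" "r'' \<in> carrier R" "s'' \<in> S"
      using ab bc unfolding e rel_iff by blast
    \<comment> \<open>Without cancellation the multiplier has to contain the middle denominator s'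
      besides u and v.\<close>
    have "(u \<otimes> (v \<otimes> s')) \<otimes> (r \<otimes> s'') = (u \<otimes> (r \<otimes> s')) \<otimes> (v \<otimes> s'')" using u(1) v(1) m by (simp add: m_ac)
    also have "\<dots> = (v \<otimes> (r' \<otimes> s'')) \<otimes> (u \<otimes> s)" unfolding u(2) using u(1) v(1) m by (simp add: m_ac)
    also have "\<dots> = (u \<otimes> (v \<otimes> s')) \<otimes> (r'' \<otimes> s)" unfolding v(2) using u(1) v(1) m by (simp add: m_ac)
    finally show "(a, c) \<in> loc_rel R S"
      unfolding e rel_iff using u v m S_mult by blast
  qed
qed

lemma fr_eq:
  assumes "r \<in> carrier R" "s \<in> S" "r' \<in> carrier R" "s' \<in> S"
  shows "fr r s = fr r' s' \<longleftrightarrow> (\<exists>u\<in>S. u \<otimes> (r \<otimes> s') = u \<otimes> (r' \<otimes> s))"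
  unfolding loc_frac_def using eq_equiv_class_iff[OF loc_equiv, of "(r, s)" "(r', s')"] assms
  by (simp add: rel_iff)

lemma fr_eqI:
  assumes "r \<in> carrier R" "s \<in> S" "r' \<in> carrier R" "s' \<in> S" "r \<otimes> s' = r' \<otimes> s"
  shows "fr r s = fr r' s'"
  using assms S_one by (subst fr_eq) auto

lemma L_elem: "U \<in> carrier L \<longleftrightarrow> (\<exists>r\<in>carrier R. \<exists>s\<in>S. U = fr r s)"
  by (auto simp: localization_def quotient_def loc_frac_def)

lemma fr_mem:
  assumes "r \<in> carrier R" "s \<in> S"
  shows "(a, b) \<in> fr r s \<longleftrightarrow> a \<in> carrier R \<and> b \<in> S \<and> (\<exists>u\<in>S. u \<otimes> (r \<otimes> b) = u \<otimes> (a \<otimes> s))"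
  using assms by (simp add: loc_frac_def rel_iff)

lemma fr_self: "r \<in> carrier R \<Longrightarrow> s \<in> S \<Longrightarrow> (r, s) \<in> fr r s"
  using S_one by (auto simp: fr_mem)

text \<open>Operations on fractions are unions over all representatives. If each of them yields the
  same class c, the union is c, because the classes are nonempty by \<open>fr_self\<close>.\<close>

lemma UN_fr:
  assumes f: "\<And>a b a' b'. (a, b) \<in> fr r s \<Longrightarrow> (a', b') \<in> fr r' s' \<Longrightarrow> f a b a' b' = c"
    and m: "r \<in> carrier R" "s \<in> S" "r' \<in> carrier R" "s' \<in> S"
  shows "(\<Union>(a, b)\<in>fr r s. \<Union>(a', b')\<in>fr r' s'. f a b a' b') = c"
proof -
  have "(\<Union>(a, b)\<in>fr r s. \<Union>(a', b')\<in>fr r' s'. f a b a' b') = (\<Union>p\<in>fr r s. \<Union>p'\<in>fr r' s'. c)"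
    using f by (intro SUP_cong refl) (auto split: prod.splits)
  then show ?thesis using fr_self[OF m(1,2)] fr_self[OF m(3,4)] by auto
qed

lemma fr_mult:
  assumes m: "r \<in> carrier R" "s \<in> S" "r' \<in> carrier R" "s' \<in> S"
  shows "fr r s \<otimes>\<^bsub>L\<^esub> fr r' s' = fr (r \<otimes> r') (s \<otimes> s')"
  unfolding localization_def monoid.simps
proof (rule UN_fr[OF _ m])
  fix a b a' b' assume "(a, b) \<in> fr r s" "(a', b') \<in> fr r' s'"
  then obtain u v where c: "a \<in> carrier R" "b \<in> S" "a' \<in> carrier R" "b' \<in> S" "u \<in> S" "v \<in> S"
    and u: "u \<otimes> (r \<otimes> b) = u \<otimes> (a \<otimes> s)" and v: "v \<otimes> (r' \<otimes> b') = v \<otimes> (a' \<otimes> s')"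
    using m by (auto simp: fr_mem)
  have "(u \<otimes> v) \<otimes> ((a \<otimes> a') \<otimes> (s \<otimes> s')) = (u \<otimes> (a \<otimes> s)) \<otimes> (v \<otimes> (a' \<otimes> s'))" using c m by (simp add: m_ac)
  also have "\<dots> = (u \<otimes> v) \<otimes> ((r \<otimes> r') \<otimes> (b \<otimes> b'))" unfolding u[symmetric] v[symmetric] using c m by (simp add: m_ac)
  finally show "fr (a \<otimes> a') (b \<otimes> b') = fr (r \<otimes> r') (s \<otimes> s')"
    using c m S_mult by (subst fr_eq) auto
qed

lemma fr_add:
  assumes m: "r \<in> carrier R" "s \<in> S" "r' \<in> carrier R" "s' \<in> S"
  shows "fr r s \<oplus>\<^bsub>L\<^esub> fr r' s' = fr (r \<otimes> s' \<oplus> r' \<otimes> s) (s \<otimes> s')"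
  unfolding localization_def ring.simps
proof (rule UN_fr[OF _ m])
  fix a b a' b' assume "(a, b) \<in> fr r s" "(a', b') \<in> fr r' s'"
  then obtain u v where c: "a \<in> carrier R" "b \<in> S" "a' \<in> carrier R" "b' \<in> S" "u \<in> S" "v \<in> S"
    and u: "u \<otimes> (r \<otimes> b) = u \<otimes> (a \<otimes> s)" and v: "v \<otimes> (r' \<otimes> b') = v \<otimes> (a' \<otimes> s')"
    using m by (auto simp: fr_mem)
  have "(u \<otimes> v) \<otimes> ((a \<otimes> b' \<oplus> a' \<otimes> b) \<otimes> (s \<otimes> s'))
      = (u \<otimes> (a \<otimes> s)) \<otimes> (v \<otimes> (b' \<otimes> s')) \<oplus> (v \<otimes> (a' \<otimes> s')) \<otimes> (u \<otimes> (b \<otimes> s))"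
    using c m by (simp add: m_ac l_distr r_distr)
  also have "\<dots> = (u \<otimes> v) \<otimes> ((r \<otimes> s' \<oplus> r' \<otimes> s) \<otimes> (b \<otimes> b'))"
    unfolding u[symmetric] v[symmetric] using c m by (simp add: m_ac l_distr r_distr)
  finally show "fr (a \<otimes> b' \<oplus> a' \<otimes> b) (b \<otimes> b') = fr (r \<otimes> s' \<oplus> r' \<otimes> s) (s \<otimes> s')"
    using c m S_mult by (subst fr_eq) auto
qed

lemma L_consts: "\<zero>\<^bsub>L\<^esub> = fr \<zero> \<one>" "\<one>\<^bsub>L\<^esub> = fr \<one> \<one>"
  by (simp_all add: localization_def)

lemma fr_closed: "r \<in> carrier R \<Longrightarrow> s \<in> S \<Longrightarrow> fr r s \<in> carrier L"
  by (auto simp: L_elem)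

lemma L_cring: "cring L"
proof (rule cringI)
  show "abelian_group L"
  proof (rule abelian_groupI)
    fix U V W assume "U \<in> carrier L" "V \<in> carrier L" "W \<in> carrier L"
    then obtain a b c d e f where m: "a \<in> carrier R" "b \<in> S" "c \<in> carrier R" "d \<in> S" "e \<in> carrier R" "f \<in> S"
      and UVW: "U = fr a b" "V = fr c d" "W = fr e f" unfolding L_elem by blast
    show "U \<oplus>\<^bsub>L\<^esub> V \<in> carrier L" using m by (simp add: UVW fr_add fr_closed S_mult)
    show "U \<oplus>\<^bsub>L\<^esub> V \<oplus>\<^bsub>L\<^esub> W = U \<oplus>\<^bsub>L\<^esub> (V \<oplus>\<^bsub>L\<^esub> W)"
      using m by (simp add: UVW fr_add S_mult l_distr r_distr m_ac a_ac)
    show "U \<oplus>\<^bsub>L\<^esub> V = V \<oplus>\<^bsub>L\<^esub> U" using m by (simp add: UVW fr_add a_comm m_comm)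
  next
    show "\<zero>\<^bsub>L\<^esub> \<in> carrier L" by (simp add: L_consts fr_closed S_one)
  next
    fix U assume "U \<in> carrier L"
    then obtain a b where m: "a \<in> carrier R" "b \<in> S" and U: "U = fr a b" unfolding L_elem by blast
    show "\<zero>\<^bsub>L\<^esub> \<oplus>\<^bsub>L\<^esub> U = U" using m by (simp add: U L_consts fr_add S_one)
    have "fr (\<ominus> a) b \<oplus>\<^bsub>L\<^esub> U = fr \<zero> (b \<otimes> b)" using m by (simp add: U fr_add l_minus l_neg)
    also have "\<dots> = \<zero>\<^bsub>L\<^esub>" unfolding L_consts using m by (intro fr_eqI) (auto simp: S_mult S_one)
    finally show "\<exists>V\<in>carrier L. V \<oplus>\<^bsub>L\<^esub> U = \<zero>\<^bsub>L\<^esub>" using m fr_closed[of "\<ominus> a" b] by blast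
  qed
  show "comm_monoid L"
  proof (rule comm_monoidI)
    fix U V W assume "U \<in> carrier L" "V \<in> carrier L" "W \<in> carrier L"
    then obtain a b c d e f where m: "a \<in> carrier R" "b \<in> S" "c \<in> carrier R" "d \<in> S" "e \<in> carrier R" "f \<in> S"
      and UVW: "U = fr a b" "V = fr c d" "W = fr e f" unfolding L_elem by blast
    show "U \<otimes>\<^bsub>L\<^esub> V \<in> carrier L" using m by (simp add: UVW fr_mult fr_closed S_mult)
    show "U \<otimes>\<^bsub>L\<^esub> V \<otimes>\<^bsub>L\<^esub> W = U \<otimes>\<^bsub>L\<^esub> (V \<otimes>\<^bsub>L\<^esub> W)" using m by (simp add: UVW fr_mult S_mult m_assoc)
    show "U \<otimes>\<^bsub>L\<^esub> V = V \<otimes>\<^bsub>L\<^esub> U" using m by (simp add: UVW fr_mult m_comm)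
  next
    show "\<one>\<^bsub>L\<^esub> \<in> carrier L" by (simp add: L_consts fr_closed S_one)
    fix U assume "U \<in> carrier L"
    then show "\<one>\<^bsub>L\<^esub> \<otimes>\<^bsub>L\<^esub> U = U" by (auto simp: L_elem L_consts fr_mult S_one)
  qed
  fix U V W assume "U \<in> carrier L" "V \<in> carrier L" "W \<in> carrier L"
  then obtain a b c d e f where m: "a \<in> carrier R" "b \<in> S" "c \<in> carrier R" "d \<in> S" "e \<in> carrier R" "f \<in> S"
    and UVW: "U = fr a b" "V = fr c d" "W = fr e f" unfolding L_elem by blast
  have "fr ((a \<otimes> d \<oplus> c \<otimes> b) \<otimes> e) (b \<otimes> d \<otimes> f) = fr (a \<otimes> e \<otimes> (d \<otimes> f) \<oplus> c \<otimes> e \<otimes> (b \<otimes> f)) (b \<otimes> f \<otimes> (d \<otimes> f))"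
    using m by (intro fr_eqI) (auto simp: S_mult l_distr r_distr m_ac)
  then show "(U \<oplus>\<^bsub>L\<^esub> V) \<otimes>\<^bsub>L\<^esub> W = U \<otimes>\<^bsub>L\<^esub> W \<oplus>\<^bsub>L\<^esub> V \<otimes>\<^bsub>L\<^esub> W"
    using m by (simp add: UVW fr_mult fr_add S_mult)
qed

lemma fr_add_same:
  assumes "r \<in> carrier R" "r' \<in> carrier R" "s \<in> S"
  shows "fr r s \<oplus>\<^bsub>L\<^esub> fr r' s = fr (r \<oplus> r') s"
  unfolding fr_add[OF assms(1,3,2,3)] using assms
  by (intro fr_eqI) (auto simp: S_mult l_distr r_distr m_ac)

end

section \<open>The Rees algebra\<close>

locale rees = G?: cring G for G (structure) + fixes I assumes I: "ideal I G"
begin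

abbreviation "UG \<equiv> UP G"
abbreviation "RR \<equiv> rees_algebra G I"
abbreviation "Ip \<equiv> ideal_pow G I"
abbreviation "dg \<equiv> in_deg G"

sublocale U: UP_cring G UG by (unfold_locales)

lemma Ip_ideal: "ideal (Ip k) G"
proof (induct k)
  case 0
  then show ?case by (simp add: oneideal)
next
  case (Suc k)
  then show ?case using I by (simp add: ideal_prod_is_ideal)
qed

lemma Ip_closed: "c \<in> Ip k \<Longrightarrow> c \<in> carrier G" using ideal.Icarr[OF Ip_ideal] .

lemma Ip_zero: "\<zero> \<in> Ip k" using additive_subgroup.zero_closed[OF ideal.axioms(1)[OF Ip_ideal]] .

lemma Ip_add: "a \<in> Ip k \<Longrightarrow> b \<in> Ip k \<Longrightarrow> a \<oplus> b \<in> Ip k"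
  using additive_subgroup.a_closed[OF ideal.axioms(1)[OF Ip_ideal]] .

lemma Ip_neg: "a \<in> Ip k \<Longrightarrow> \<ominus> a \<in> Ip k"
  using additive_subgroup.a_inv_closed[OF ideal.axioms(1)[OF Ip_ideal]] Ip_ideal
  by (metis is_abelian_group Ip_closed additive_subgroup.a_inv_closed ideal.axioms(1))

text \<open>Induction on k, and inside it over the generation of a product ideal by products and
  sums. Membership in the carrier is carried along for the distributive law.\<close>

lemma Ip_mult: "a \<in> Ip k \<Longrightarrow> b \<in> Ip l \<Longrightarrow> a \<otimes> b \<in> Ip (k + l)"
proof (induct k arbitrary: a)
  case 0
  then show ?case using ideal.I_l_closed[OF Ip_ideal] by simp
next
  case (Suc k)
  have "a \<in> ideal_prod G I (Ip k)" using Suc by simp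
  then have "a \<in> carrier G \<and> a \<otimes> b \<in> Ip (Suc (k + l))"
  proof (induct a rule: ideal_prod.induct)
    case (prod i j)
    have i: "i \<in> carrier G" using prod ideal.Icarr[OF I] by blast
    have "i \<otimes> (j \<otimes> b) \<in> ideal_prod G I (Ip (k + l))"
      using prod Suc(1)[OF prod(2) Suc(3)] by (intro ideal_prod.prod)
    then show ?case using i Ip_closed[OF prod(2)] Ip_closed[OF Suc(3)] by (simp add: m_assoc)
  next
    case (sum s t)
    then show ?case using Ip_closed[OF Suc(3)] Ip_add[of _ "Suc (k + l)"] by (simp add: l_distr)
  qed
  then show ?case by simp
qed

lemma Ip_1: "c \<in> I \<Longrightarrow> c \<in> Ip 1"
  using ideal_prod.prod[of c I \<one> "carrier G" G] ideal.Icarr[OF I] by simp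

lemma RR_carrier: "p \<in> carrier RR \<longleftrightarrow> p \<in> carrier UG \<and> (\<forall>m. up_ring.coeff UG p m \<in> Ip m)"
  by (simp add: rees_algebra_def)

lemma RR_simps: "\<zero>\<^bsub>RR\<^esub> = \<zero>\<^bsub>UG\<^esub>" "\<one>\<^bsub>RR\<^esub> = \<one>\<^bsub>UG\<^esub>" "p \<otimes>\<^bsub>RR\<^esub> q = p \<otimes>\<^bsub>UG\<^esub> q" "p \<oplus>\<^bsub>RR\<^esub> q = p \<oplus>\<^bsub>UG\<^esub> q"
  by (simp_all add: rees_algebra_def)

text \<open>The m-th coefficient of a product is a sum of elements of I^i I^(m-i), so the condition
  on coefficients cuts out a subring of the polynomial ring.\<close>

lemma RR_cring: "cring RR"
proof -
  note UC = U.UP_cring and UR = cring.axioms(1)[OF U.UP_cring]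
  let ?C = "{p \<in> carrier UG. \<forall>m. up_ring.coeff UG p m \<in> Ip m}"
  have "subring ?C UG"
  proof (rule ring.subringI[OF UR])
    fix p q assume p: "p \<in> ?C" and q: "q \<in> ?C"
    have "(\<Oplus>i\<in>{..m}. up_ring.coeff UG p i \<otimes> up_ring.coeff UG q (m - i)) \<in> Ip m" for m
    proof (rule finsum_in_set)
      fix i assume "i \<in> {..m}"
      then show "up_ring.coeff UG p i \<otimes> up_ring.coeff UG q (m - i) \<in> Ip m"
        using Ip_mult[of "up_ring.coeff UG p i" i "up_ring.coeff UG q (m - i)" "m - i"] p q by simp
    qed (use Ip_zero Ip_closed Ip_add in auto)
    then show "p \<otimes>\<^bsub>UG\<^esub> q \<in> ?C" using p q by simp
    show "p \<oplus>\<^bsub>UG\<^esub> q \<in> ?C" using p q Ip_add by simp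
    show "\<ominus>\<^bsub>UG\<^esub> p \<in> ?C" using p Ip_neg by simp
  qed (use Ip_zero in auto)
  then have "subcring ?C UG" by (rule cring.subcringI'[OF UC])
  moreover have "?C \<subseteq> carrier UG" by auto
  ultimately have "cring (UG\<lparr>carrier := ?C\<rparr>)" using ring.subcring_iff[OF UR] by blast
  then show ?thesis by (rule cring_cong) (simp_all add: rees_algebra_def)
qed

sublocale RR: cring RR by (rule RR_cring)

lemma dg_closed: "c \<in> Ip k \<Longrightarrow> dg k c \<in> carrier RR"
  using Ip_closed[of c k] Ip_zero by (auto simp: RR_carrier in_deg_def)

lemma dg_mult: "c \<in> Ip k \<Longrightarrow> d \<in> Ip l \<Longrightarrow> dg k c \<otimes>\<^bsub>RR\<^esub> dg l d = dg (k + l) (c \<otimes> d)"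
  by (simp add: in_deg_def RR_simps Ip_closed U.monom_mult)

lemma dg_add: "c \<in> Ip k \<Longrightarrow> d \<in> Ip k \<Longrightarrow> dg k c \<oplus>\<^bsub>RR\<^esub> dg k d = dg k (c \<oplus> d)"
  by (simp add: in_deg_def RR_simps Ip_closed)

lemma dg_one: "dg 0 \<one> = \<one>\<^bsub>RR\<^esub>" by (simp add: in_deg_def RR_simps U.monom_one)

lemma dg_zero: "dg k \<zero> = \<zero>\<^bsub>RR\<^esub>" by (simp add: in_deg_def RR_simps)

lemma Ip_pow: "d \<in> I \<Longrightarrow> d [^] (k::nat) \<in> Ip k"
proof (induct k)
  case (Suc k)
  then show ?case using Ip_mult[OF Suc(1)[OF Suc(2)] Ip_1[OF Suc(2)]] by simp
qed simp

lemma dg_pow: assumes "d \<in> I" shows "dg 1 d [^]\<^bsub>RR\<^esub> (k::nat) = dg k (d [^] k)"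
proof (induct k)
  case (Suc k)
  then show ?case using dg_mult[OF Ip_pow[OF assms] Ip_1[OF assms], of k] by simp
qed (simp add: dg_one)

end

locale rees_loc = rees + fixes d assumes d: "d \<in> I"
begin

definition "D = dg 1 d"
definition "Sd = {D [^]\<^bsub>RR\<^esub> k | k :: nat. True}"

lemma D_closed: "D \<in> carrier RR" unfolding D_def by (rule dg_closed[OF Ip_1[OF d]])

lemma Dp: "D [^]\<^bsub>RR\<^esub> (k::nat) \<in> Sd" by (auto simp: Sd_def)

sublocale ms: mult_subset RR Sd
proof
  show "Sd \<subseteq> carrier RR" using D_closed by (auto simp: Sd_def)
  show "\<one>\<^bsub>RR\<^esub> \<in> Sd" using Dp[of 0] by simp
  fix s t assume "s \<in> Sd" "t \<in> Sd"
  then obtain k l :: nat where "s = D [^]\<^bsub>RR\<^esub> k" "t = D [^]\<^bsub>RR\<^esub> l" by (auto simp: Sd_def)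
  then have "s \<otimes>\<^bsub>RR\<^esub> t = D [^]\<^bsub>RR\<^esub> (k + l)" using D_closed by (simp add: RR.nat_pow_mult)
  then show "s \<otimes>\<^bsub>RR\<^esub> t \<in> Sd" using Dp by simp
qed

text \<open>For c in I^k both numerator and denominator have degree k, so these are the fractions of
  degree zero.\<close>

definition "hfr k c = ms.fr (dg k c) (D [^]\<^bsub>RR\<^esub> (k::nat))"

definition "RX = ms.L\<lparr>carrier := {hfr k c | k c. c \<in> Ip k}\<rparr>"

lemma hfr_mult: "c \<in> Ip k \<Longrightarrow> c' \<in> Ip l \<Longrightarrow> hfr k c \<otimes>\<^bsub>ms.L\<^esub> hfr l c' = hfr (k + l) (c \<otimes> c')"
  unfolding hfr_def using Dp D_closed
  by (subst ms.fr_mult) (auto simp: dg_closed dg_mult RR.nat_pow_mult)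

text \<open>Numerator and denominator are multiplied by d^l; fractions with different k are added by
  bringing them to a common denominator in this way.\<close>

lemma hfr_shift: assumes c: "c \<in> Ip k" shows "hfr k c = hfr (k + l) (c \<otimes> d [^] l)"
  unfolding hfr_def
proof (rule ms.fr_eqI)
  have p: "d [^] l \<in> Ip l" "d [^] k \<in> Ip k" "d [^] (k + l) \<in> Ip (k + l)" by (rule Ip_pow[OF d])+
  have dc: "d \<in> carrier G" using d ideal.Icarr[OF I] by blast
  note m = Ip_mult[OF c p(1)]
  show "dg k c \<in> carrier RR" "dg (k + l) (c \<otimes> d [^] l) \<in> carrier RR" by (rule dg_closed[OF c], rule dg_closed[OF m])
  have "c \<otimes> d [^] (k + l) = c \<otimes> d [^] l \<otimes> d [^] k"
    using Ip_closed[OF c] dc by (simp add: m_ac nat_pow_mult[symmetric])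
  then show "dg k c \<otimes>\<^bsub>RR\<^esub> D [^]\<^bsub>RR\<^esub> (k + l) = dg (k + l) (c \<otimes> d [^] l) \<otimes>\<^bsub>RR\<^esub> D [^]\<^bsub>RR\<^esub> k"
    unfolding D_def dg_pow[OF d] dg_mult[OF c p(3)] dg_mult[OF m p(2)] by (simp add: add.commute)
qed (rule Dp)+

lemma hfr_add_same: "c \<in> Ip k \<Longrightarrow> c' \<in> Ip k \<Longrightarrow> hfr k c \<oplus>\<^bsub>ms.L\<^esub> hfr k c' = hfr k (c \<oplus> c')"
  unfolding hfr_def using Dp by (subst ms.fr_add_same) (auto simp: dg_closed dg_add)

lemma hfr_closed: "c \<in> Ip k \<Longrightarrow> hfr k c \<in> carrier ms.L"
  unfolding hfr_def using Dp by (intro ms.fr_closed dg_closed)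

lemma hfr_zero: "hfr k \<zero> = \<zero>\<^bsub>ms.L\<^esub>"
proof -
  have "ms.fr \<zero>\<^bsub>RR\<^esub> (D [^]\<^bsub>RR\<^esub> k) = ms.fr \<zero>\<^bsub>RR\<^esub> \<one>\<^bsub>RR\<^esub>"
    using D_closed by (intro ms.fr_eqI Dp ms.S_one) auto
  then show ?thesis by (simp add: hfr_def ms.L_consts dg_zero)
qed

lemma hfr_one: "hfr 0 \<one> = \<one>\<^bsub>ms.L\<^esub>"
  by (simp add: hfr_def ms.L_consts dg_one)

sublocale L: cring ms.L by (rule ms.L_cring)

lemma RX_cring: "cring RX"
proof -
  let ?C = "{hfr k c | k c. c \<in> Ip k}"
  have sub: "?C \<subseteq> carrier ms.L" using hfr_closed by auto
  have "subring ?C ms.L"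
  proof (rule L.subringI[OF sub])
    show "\<one>\<^bsub>ms.L\<^esub> \<in> ?C" unfolding hfr_one[symmetric] by (rule CollectI) (metis ideal_pow.simps(1) one_closed)
    fix U assume "U \<in> ?C"
    then obtain k c where U: "U = hfr k c" "c \<in> Ip k" by auto
    have "hfr k (\<ominus> c) \<oplus>\<^bsub>ms.L\<^esub> hfr k c = \<zero>\<^bsub>ms.L\<^esub>"
      using U by (simp add: hfr_add_same Ip_neg l_neg Ip_closed hfr_zero)
    then have "\<ominus>\<^bsub>ms.L\<^esub> U = hfr k (\<ominus> c)" unfolding U(1)
      using U hfr_closed Ip_neg by (intro L.minus_equality) auto
    then show "\<ominus>\<^bsub>ms.L\<^esub> U \<in> ?C" using Ip_neg[OF U(2)] by blast
    fix V assume "V \<in> ?C"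
    then obtain l c' where V: "V = hfr l c'" "c' \<in> Ip l" by auto
    show "U \<otimes>\<^bsub>ms.L\<^esub> V \<in> ?C" using hfr_mult[OF U(2) V(2)] Ip_mult[OF U(2) V(2)] U(1) V(1) by blast
    have p: "c \<otimes> d [^] l \<in> Ip (k + l)" "c' \<otimes> d [^] k \<in> Ip (k + l)"
      using Ip_mult[OF U(2) Ip_pow[OF d, of l]] Ip_mult[OF V(2) Ip_pow[OF d, of k]] by (simp_all add: add.commute)
    have "U \<oplus>\<^bsub>ms.L\<^esub> V = hfr (k + l) (c \<otimes> d [^] l \<oplus> c' \<otimes> d [^] k)"
      unfolding U(1) V(1) hfr_shift[OF U(2), of l] hfr_shift[OF V(2), of k] add.commute[of l k] by (rule hfr_add_same[OF p])
    then show "U \<oplus>\<^bsub>ms.L\<^esub> V \<in> ?C" using Ip_add[OF p] by blast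
  qed
  then have "subcring ?C ms.L" by (rule L.subcringI')
  then show ?thesis using L.subcring_iff[OF sub] unfolding RX_def by blast
qed

sublocale RX: cring RX by (rule RX_cring)

lemma RX_simps: "\<zero>\<^bsub>RX\<^esub> = \<zero>\<^bsub>ms.L\<^esub>" "\<one>\<^bsub>RX\<^esub> = \<one>\<^bsub>ms.L\<^esub>" "u \<otimes>\<^bsub>RX\<^esub> v = u \<otimes>\<^bsub>ms.L\<^esub> v" "u \<oplus>\<^bsub>RX\<^esub> v = u \<oplus>\<^bsub>ms.L\<^esub> v"
  by (simp_all add: RX_def)

lemma hfr_RX: "c \<in> Ip k \<Longrightarrow> hfr k c \<in> carrier RX" by (auto simp: RX_def)

lemma hfr0_hom: "hfr 0 \<in> ring_hom G RX"
  by (rule ring_hom_memI)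
    (use hfr_mult[of _ 0 _ 0] hfr_add_same[of _ 0] hfr_RX[of _ 0] in \<open>auto simp: RX_simps hfr_one\<close>)

text \<open>Written with the denominator \<open>D\<close> itself and not with its first power, the
  form that occurs in \<open>brk\<close>; \<open>q_hfr\<close> relates the two.\<close>

definition "q c = ms.fr (dg 1 c) D"

lemma q_hfr: "q c = hfr 1 c" unfolding q_def hfr_def D_def[symmetric] using D_closed by simp

lemma q_closed: "c \<in> I \<Longrightarrow> q c \<in> carrier RX"
  unfolding q_hfr by (rule hfr_RX[OF Ip_1])

lemma q_add: "c \<in> I \<Longrightarrow> c' \<in> I \<Longrightarrow> q (c \<oplus> c') = q c \<oplus>\<^bsub>RX\<^esub> q c'"
  unfolding q_hfr RX_simps by (rule hfr_add_same[OF Ip_1 Ip_1, symmetric])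

lemma q_zero: "q \<zero> = \<zero>\<^bsub>RX\<^esub>"
  unfolding q_hfr RX_simps by (rule hfr_zero)

lemma q_d: "q d = \<one>\<^bsub>RX\<^esub>"
proof -
  have "hfr 0 \<one> = hfr (0 + 1) (\<one> \<otimes> d [^] (1::nat))" by (rule hfr_shift) simp
  then show ?thesis using d ideal.Icarr[OF I] by (simp add: q_hfr RX_simps hfr_one)
qed

lemma q_scale: "g \<in> carrier G \<Longrightarrow> c \<in> I \<Longrightarrow> q (g \<otimes> c) = hfr 0 g \<otimes>\<^bsub>RX\<^esub> q c"
  unfolding q_hfr RX_simps using hfr_mult[of g 0 c 1] Ip_1 by simp

text \<open>All terms are put over d^2: the sum becomes (d e) / d^2, which is e / d in the
  localization.\<close>

lemma q_sum_products:
  assumes P: "finite P" "\<And>i. i \<in> P \<Longrightarrow> a i \<in> I \<and> b i \<in> I" and e: "e \<in> I" "(\<Oplus>i\<in>P. a i \<otimes> b i) = d \<otimes> e"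
  shows "(\<Oplus>\<^bsub>RX\<^esub>i\<in>P. q (a i) \<otimes>\<^bsub>RX\<^esub> q (b i)) = q e"
proof -
  have ab: "a i \<otimes> b i \<in> Ip 2" if "i \<in> P" for i
    using Ip_mult[OF Ip_1 Ip_1] P(2)[OF that] by (simp add: numeral_2_eq_2)
  have qq: "q (a i) \<otimes>\<^bsub>RX\<^esub> q (b i) = hfr 2 (a i \<otimes> b i)" if "i \<in> P" for i
    unfolding q_hfr RX_simps using hfr_mult[OF Ip_1 Ip_1] P(2)[OF that] by (simp add: numeral_2_eq_2)
  \<comment> \<open>Membership in I^2 is proved along with the sum, since
    \<open>hfr_add_same\<close> asks for it.\<close>
  have "(\<Oplus>i\<in>Q. a i \<otimes> b i) \<in> Ip 2 \<and> (\<Oplus>\<^bsub>RX\<^esub>i\<in>Q. hfr 2 (a i \<otimes> b i)) = hfr 2 (\<Oplus>i\<in>Q. a i \<otimes> b i)"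
    if "finite Q" "Q \<subseteq> P" for Q
    using that
  proof (induct Q rule: finite_induct)
    case empty
    then show ?case using Ip_zero[of 2] by (simp add: hfr_zero RX_simps)
  next
    case (insert i Q)
    then have c: "a i \<otimes> b i \<in> Ip 2" "(\<lambda>i. a i \<otimes> b i) \<in> Q \<rightarrow> carrier G" "(\<lambda>i. hfr 2 (a i \<otimes> b i)) \<in> Q \<rightarrow> carrier RX"
      using ab by (auto intro!: hfr_RX Ip_closed[OF ab])
    then show ?case using insert Ip_closed[OF c(1)]
      by (simp add: finsum_insert RX.finsum_insert hfr_RX Ip_add hfr_add_same[of _ 2, folded RX_simps])
  qed
  from this[OF P(1) order_refl] have "(\<Oplus>\<^bsub>RX\<^esub>i\<in>P. hfr 2 (a i \<otimes> b i)) = hfr 2 (d \<otimes> e)" using e by simp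
  also have "\<dots> = q d \<otimes>\<^bsub>RX\<^esub> q e"
    unfolding q_hfr RX_simps using hfr_mult[OF Ip_1[OF d] Ip_1[OF e(1)]] by (simp add: numeral_2_eq_2)
  also have "\<dots> = q e" using q_closed[OF e(1)] by (simp add: q_d)
  finally have "(\<Oplus>\<^bsub>RX\<^esub>i\<in>P. hfr 2 (a i \<otimes> b i)) = q e" .
  moreover have "(\<Oplus>\<^bsub>RX\<^esub>i\<in>P. q (a i) \<otimes>\<^bsub>RX\<^esub> q (b i)) = (\<Oplus>\<^bsub>RX\<^esub>i\<in>P. hfr 2 (a i \<otimes> b i))"
    by (rule RX.finsum_cong') (auto simp: qq intro!: hfr_RX ab)
  ultimately show ?thesis by simp
qed

end

section \<open>Algebras spanned by a finite sequence\<close>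

text \<open>The norms are forgotten here: C stands for R(x), and \<open>b y\<close> for the
  coordinates of [y]. The algebra structure follows from linearity of b and the two identities
  \<open>b_basis\<close> and \<open>b_product\<close>.\<close>

locale spanned = tens A F C
  for A :: "('a, 'x) ring_scheme" and F :: "('a, 'f, 'y) module_scheme" and C :: "('a, 'c, 'z) module_scheme" +
  fixes n :: nat and x :: "nat \<Rightarrow> 'f" and b :: "'f \<Rightarrow> nat \<Rightarrow> 'c"
  assumes x: "\<And>i. i \<in> {1..n} \<Longrightarrow> x i \<in> carrier F"
    and b_PiE: "\<And>y. y \<in> carrier F \<Longrightarrow> b y \<in> {1..n} \<rightarrow>\<^sub>E carrier C"
    and b_add: "\<And>y y' k. y \<in> carrier F \<Longrightarrow> y' \<in> carrier F \<Longrightarrow> k \<in> {1..n} \<Longrightarrow>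
      b (y \<oplus>\<^bsub>F\<^esub> y') k = b y k \<oplus>\<^bsub>C\<^esub> b y' k"
    and b_smult: "\<And>a y k. a \<in> carrier A \<Longrightarrow> y \<in> carrier F \<Longrightarrow> k \<in> {1..n} \<Longrightarrow>
      b (a \<odot>\<^bsub>F\<^esub> y) k = a \<odot>\<^bsub>C\<^esub> b y k"
    and b_basis: "\<And>i k. i \<in> {1..n} \<Longrightarrow> k \<in> {1..n} \<Longrightarrow> b (x i) k = (if k = i then \<one>\<^bsub>C\<^esub> else \<zero>\<^bsub>C\<^esub>)"
    and b_product: "\<And>y w k. y \<in> carrier F \<Longrightarrow> w \<in> carrier F \<Longrightarrow> k \<in> {1..n} \<Longrightarrow>
      (\<Oplus>\<^bsub>C\<^esub>i\<in>{1..n}. b y i \<otimes>\<^bsub>C\<^esub> b (x i \<otimes>\<^bsub>F\<^esub> w) k) = b (y \<otimes>\<^bsub>F\<^esub> w) k"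
begin

abbreviation "ix \<equiv> {1..n}"

definition E :: "('c, nat \<Rightarrow> 'c) module" where "E =
    \<lparr>carrier = ix \<rightarrow>\<^sub>E carrier C,
     monoid.mult = (\<lambda>u v. \<lambda>k\<in>ix. \<Oplus>\<^bsub>C\<^esub>i\<in>ix. \<Oplus>\<^bsub>C\<^esub>j\<in>ix. (u i \<otimes>\<^bsub>C\<^esub> v j) \<otimes>\<^bsub>C\<^esub> b (x i \<otimes>\<^bsub>F\<^esub> x j) k),
     one = b \<one>\<^bsub>F\<^esub>,
     ring.zero = (\<lambda>k\<in>ix. \<zero>\<^bsub>C\<^esub>),
     add = (\<lambda>u v. \<lambda>k\<in>ix. u k \<oplus>\<^bsub>C\<^esub> v k),
     smult = (\<lambda>c u. \<lambda>k\<in>ix. c \<otimes>\<^bsub>C\<^esub> u k)\<rparr>"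

lemma E_carrier: "carrier E = ix \<rightarrow>\<^sub>E carrier C" by (simp add: E_def)

lemma E_consts: "\<one>\<^bsub>E\<^esub> = b \<one>\<^bsub>F\<^esub>" "\<zero>\<^bsub>E\<^esub> = (\<lambda>k\<in>ix. \<zero>\<^bsub>C\<^esub>)"
  "u \<oplus>\<^bsub>E\<^esub> v = (\<lambda>k\<in>ix. u k \<oplus>\<^bsub>C\<^esub> v k)" "c \<odot>\<^bsub>E\<^esub> u = (\<lambda>k\<in>ix. c \<otimes>\<^bsub>C\<^esub> u k)"
  "u \<otimes>\<^bsub>E\<^esub> v = (\<lambda>k\<in>ix. \<Oplus>\<^bsub>C\<^esub>i\<in>ix. \<Oplus>\<^bsub>C\<^esub>j\<in>ix. (u i \<otimes>\<^bsub>C\<^esub> v j) \<otimes>\<^bsub>C\<^esub> b (x i \<otimes>\<^bsub>F\<^esub> x j) k)"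
  by (simp_all add: E_def)

lemma b_closed: "y \<in> carrier F \<Longrightarrow> k \<in> ix \<Longrightarrow> b y k \<in> carrier C"
  by (rule PiE_mem[OF b_PiE])

lemma b_E: "y \<in> carrier F \<Longrightarrow> b y \<in> carrier E" unfolding E_carrier by (rule b_PiE)

lemma E_mem: "u \<in> carrier E \<Longrightarrow> k \<in> ix \<Longrightarrow> u k \<in> carrier C"
  unfolding E_carrier by (rule PiE_mem)

lemma E_eqI: "u \<in> carrier E \<Longrightarrow> v \<in> carrier E \<Longrightarrow> (\<And>k. k \<in> ix \<Longrightarrow> u k = v k) \<Longrightarrow> u = v"
  unfolding E_carrier by (rule PiE_ext)

lemma E_restrict: "(\<And>k. k \<in> ix \<Longrightarrow> f k \<in> carrier C) \<Longrightarrow> (\<lambda>k\<in>ix. f k) \<in> carrier E"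
  unfolding E_carrier by simp

lemma E_add_closed: "u \<in> carrier E \<Longrightarrow> v \<in> carrier E \<Longrightarrow> u \<oplus>\<^bsub>E\<^esub> v \<in> carrier E"
  unfolding E_consts by (intro E_restrict C.a_closed E_mem)

lemma E_smult_closed: "c \<in> carrier C \<Longrightarrow> u \<in> carrier E \<Longrightarrow> c \<odot>\<^bsub>E\<^esub> u \<in> carrier E"
  unfolding E_consts by (rule E_restrict) (rule C.m_closed, simp, rule E_mem)

lemma E_mult_closed: "u \<in> carrier E \<Longrightarrow> v \<in> carrier E \<Longrightarrow> u \<otimes>\<^bsub>E\<^esub> v \<in> carrier E"
  unfolding E_consts by (intro E_restrict C.finsum_closed Pi_I C.m_closed E_mem b_closed F.m_closed x)

lemma E_abelian_group: "abelian_group E"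
proof (rule abelian_groupI)
  show "\<zero>\<^bsub>E\<^esub> \<in> carrier E" unfolding E_consts by (intro E_restrict) simp
  then show "\<zero>\<^bsub>E\<^esub> \<oplus>\<^bsub>E\<^esub> u = u" if "u \<in> carrier E" for u
    using that by (intro E_eqI E_add_closed) (auto simp: E_consts E_mem)
  fix u assume u: "u \<in> carrier E"
  have m: "(\<lambda>k\<in>ix. \<ominus>\<^bsub>C\<^esub> u k) \<in> carrier E" using u by (intro E_restrict C.a_inv_closed E_mem)
  show "\<exists>v\<in>carrier E. v \<oplus>\<^bsub>E\<^esub> u = \<zero>\<^bsub>E\<^esub>"
  proof (rule bexI[OF _ m], rule E_eqI)
    show "\<zero>\<^bsub>E\<^esub> \<in> carrier E" unfolding E_consts by (intro E_restrict) simp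
    show "(\<lambda>k\<in>ix. \<ominus>\<^bsub>C\<^esub> u k) \<oplus>\<^bsub>E\<^esub> u \<in> carrier E" using m u by (rule E_add_closed)
  qed (use u in \<open>simp add: E_consts E_mem C.l_neg\<close>)
  fix v assume v: "v \<in> carrier E"
  show "u \<oplus>\<^bsub>E\<^esub> v \<in> carrier E" using u v by (rule E_add_closed)
  show "u \<oplus>\<^bsub>E\<^esub> v = v \<oplus>\<^bsub>E\<^esub> u"
    using u v by (intro E_eqI E_add_closed) (auto simp: E_consts E_mem C.a_comm)
  fix w assume w: "w \<in> carrier E"
  show "u \<oplus>\<^bsub>E\<^esub> v \<oplus>\<^bsub>E\<^esub> w = u \<oplus>\<^bsub>E\<^esub> (v \<oplus>\<^bsub>E\<^esub> w)"
    using u v w by (intro E_eqI E_add_closed) (auto simp: E_consts E_mem C.a_assoc)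
qed

sublocale E: abelian_group E by (rule E_abelian_group)

lemma E_proj: "k \<in> ix \<Longrightarrow> (\<lambda>u. u k) \<in> add_hom E C"
  by (rule add_homI) (auto simp: E_mem, simp add: E_consts)

lemma E_smult_hom: "c \<in> carrier C \<Longrightarrow> (\<lambda>u. c \<odot>\<^bsub>E\<^esub> u) \<in> add_hom E E"
  by (rule add_homI, erule (1) E_smult_closed)
    (intro E_eqI E_add_closed E_smult_closed; simp add: E_consts E_mem C.r_distr)

lemma E_smult_laws:
  assumes "c \<in> carrier C" "c' \<in> carrier C" "u \<in> carrier E"
  shows "(c \<oplus>\<^bsub>C\<^esub> c') \<odot>\<^bsub>E\<^esub> u = c \<odot>\<^bsub>E\<^esub> u \<oplus>\<^bsub>E\<^esub> c' \<odot>\<^bsub>E\<^esub> u"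
    and "(c \<otimes>\<^bsub>C\<^esub> c') \<odot>\<^bsub>E\<^esub> u = c \<odot>\<^bsub>E\<^esub> (c' \<odot>\<^bsub>E\<^esub> u)"
  using assms by (intro E_eqI E_add_closed E_smult_closed C.one_closed C.a_closed C.m_closed;
      simp add: E_consts E_mem C.l_distr C.m_assoc)+

lemma E_smult_one: "u \<in> carrier E \<Longrightarrow> \<one>\<^bsub>C\<^esub> \<odot>\<^bsub>E\<^esub> u = u"
  by (intro E_eqI E_smult_closed C.one_closed; simp add: E_consts(4) E_mem)

lemma E_mult_hom_left: "v \<in> carrier E \<Longrightarrow> (\<lambda>u. u \<otimes>\<^bsub>E\<^esub> v) \<in> add_hom E E"
proof (rule add_homI)
  fix u u' assume v: "v \<in> carrier E" and u: "u \<in> carrier E" "u' \<in> carrier E"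
  show "(u \<oplus>\<^bsub>E\<^esub> u') \<otimes>\<^bsub>E\<^esub> v = u \<otimes>\<^bsub>E\<^esub> v \<oplus>\<^bsub>E\<^esub> u' \<otimes>\<^bsub>E\<^esub> v"
  proof (rule E_eqI)
    fix k assume k: "k \<in> ix"
    let ?t = "\<lambda>u i j. (u i \<otimes>\<^bsub>C\<^esub> v j) \<otimes>\<^bsub>C\<^esub> b (x i \<otimes>\<^bsub>F\<^esub> x j) k"
    have t: "?t w i j \<in> carrier C" if "w \<in> carrier E" "i \<in> ix" "j \<in> ix" for w i j
      using that v k by (intro C.m_closed E_mem b_closed F.m_closed x)
    have "((u \<oplus>\<^bsub>E\<^esub> u') \<otimes>\<^bsub>E\<^esub> v) k = (\<Oplus>\<^bsub>C\<^esub>i\<in>ix. \<Oplus>\<^bsub>C\<^esub>j\<in>ix. ?t (u \<oplus>\<^bsub>E\<^esub> u') i j)" using k by (simp add: E_consts(5))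
    also have "\<dots> = (\<Oplus>\<^bsub>C\<^esub>i\<in>ix. \<Oplus>\<^bsub>C\<^esub>j\<in>ix. ?t u i j \<oplus>\<^bsub>C\<^esub> ?t u' i j)"
    proof (intro C.finsum_cong' refl)
      fix i j assume ij: "i \<in> ix" "j \<in> ix"
      show "?t (u \<oplus>\<^bsub>E\<^esub> u') i j = ?t u i j \<oplus>\<^bsub>C\<^esub> ?t u' i j"
        using ij u v k b_closed[OF F.m_closed[OF x[OF ij(1)] x[OF ij(2)]] k] by (simp add: E_consts(3) E_mem C.l_distr)
    qed (use t u in auto)
    also have "\<dots> = (\<Oplus>\<^bsub>C\<^esub>i\<in>ix. (\<Oplus>\<^bsub>C\<^esub>j\<in>ix. ?t u i j) \<oplus>\<^bsub>C\<^esub> (\<Oplus>\<^bsub>C\<^esub>j\<in>ix. ?t u' i j))"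
      using t u by (intro C.finsum_cong' refl C.finsum_addf) auto
    also have "\<dots> = (\<Oplus>\<^bsub>C\<^esub>i\<in>ix. \<Oplus>\<^bsub>C\<^esub>j\<in>ix. ?t u i j) \<oplus>\<^bsub>C\<^esub> (\<Oplus>\<^bsub>C\<^esub>i\<in>ix. \<Oplus>\<^bsub>C\<^esub>j\<in>ix. ?t u' i j)"
      using t u by (intro C.finsum_addf) auto
    finally show "((u \<oplus>\<^bsub>E\<^esub> u') \<otimes>\<^bsub>E\<^esub> v) k = (u \<otimes>\<^bsub>E\<^esub> v \<oplus>\<^bsub>E\<^esub> u' \<otimes>\<^bsub>E\<^esub> v) k" using k by (simp add: E_consts)
  qed (use u v in \<open>auto intro: E_add_closed E_mult_closed\<close>)
qed (rule E_mult_closed)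

lemma E_mult_hom_right: "u \<in> carrier E \<Longrightarrow> (\<lambda>v. u \<otimes>\<^bsub>E\<^esub> v) \<in> add_hom E E"
proof (rule add_homI)
  fix v v' assume u: "u \<in> carrier E" and v: "v \<in> carrier E" "v' \<in> carrier E"
  show "u \<otimes>\<^bsub>E\<^esub> (v \<oplus>\<^bsub>E\<^esub> v') = u \<otimes>\<^bsub>E\<^esub> v \<oplus>\<^bsub>E\<^esub> u \<otimes>\<^bsub>E\<^esub> v'"
  proof (rule E_eqI)
    fix k assume k: "k \<in> ix"
    let ?t = "\<lambda>v i j. (u i \<otimes>\<^bsub>C\<^esub> v j) \<otimes>\<^bsub>C\<^esub> b (x i \<otimes>\<^bsub>F\<^esub> x j) k"
    have t: "?t w i j \<in> carrier C" if "w \<in> carrier E" "i \<in> ix" "j \<in> ix" for w i j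
      using that u k by (intro C.m_closed E_mem b_closed F.m_closed x)
    have "(u \<otimes>\<^bsub>E\<^esub> (v \<oplus>\<^bsub>E\<^esub> v')) k = (\<Oplus>\<^bsub>C\<^esub>i\<in>ix. \<Oplus>\<^bsub>C\<^esub>j\<in>ix. ?t (v \<oplus>\<^bsub>E\<^esub> v') i j)" using k by (simp add: E_consts(5))
    also have "\<dots> = (\<Oplus>\<^bsub>C\<^esub>i\<in>ix. \<Oplus>\<^bsub>C\<^esub>j\<in>ix. ?t v i j \<oplus>\<^bsub>C\<^esub> ?t v' i j)"
    proof (intro C.finsum_cong' refl)
      fix i j assume ij: "i \<in> ix" "j \<in> ix"
      show "?t (v \<oplus>\<^bsub>E\<^esub> v') i j = ?t v i j \<oplus>\<^bsub>C\<^esub> ?t v' i j"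
        using ij u v k b_closed[OF F.m_closed[OF x[OF ij(1)] x[OF ij(2)]] k]
        by (simp add: E_consts(3) E_mem C.l_distr C.r_distr)
    qed (use t v in auto)
    also have "\<dots> = (\<Oplus>\<^bsub>C\<^esub>i\<in>ix. (\<Oplus>\<^bsub>C\<^esub>j\<in>ix. ?t v i j) \<oplus>\<^bsub>C\<^esub> (\<Oplus>\<^bsub>C\<^esub>j\<in>ix. ?t v' i j))"
      using t v by (intro C.finsum_cong' refl C.finsum_addf) auto
    also have "\<dots> = (\<Oplus>\<^bsub>C\<^esub>i\<in>ix. \<Oplus>\<^bsub>C\<^esub>j\<in>ix. ?t v i j) \<oplus>\<^bsub>C\<^esub> (\<Oplus>\<^bsub>C\<^esub>i\<in>ix. \<Oplus>\<^bsub>C\<^esub>j\<in>ix. ?t v' i j)"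
      using t v by (intro C.finsum_addf) auto
    finally show "(u \<otimes>\<^bsub>E\<^esub> (v \<oplus>\<^bsub>E\<^esub> v')) k = (u \<otimes>\<^bsub>E\<^esub> v \<oplus>\<^bsub>E\<^esub> u \<otimes>\<^bsub>E\<^esub> v') k" using k by (simp add: E_consts)
  qed (use u v in \<open>auto intro: E_add_closed E_mult_closed\<close>)
qed (rule E_mult_closed)

text \<open>\<open>b_product\<close> is applied twice, over j to the coordinates of z and then over
  i to those of y; commutativity of F brings the products x_i x_j into the order it expects.\<close>

lemma smult_b_mult:
  assumes c: "c \<in> carrier C" "c' \<in> carrier C" and y: "y \<in> carrier F" "z \<in> carrier F"
  shows "(c \<odot>\<^bsub>E\<^esub> b y) \<otimes>\<^bsub>E\<^esub> (c' \<odot>\<^bsub>E\<^esub> b z) = (c \<otimes>\<^bsub>C\<^esub> c') \<odot>\<^bsub>E\<^esub> b (y \<otimes>\<^bsub>F\<^esub> z)"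
proof (rule E_eqI)
  fix k assume k: "k \<in> ix"
  have bx: "b (x i \<otimes>\<^bsub>F\<^esub> x j) k \<in> carrier C" if "i \<in> ix" "j \<in> ix" for i j
    using that k by (intro b_closed F.m_closed x)
  have bz: "b (x i \<otimes>\<^bsub>F\<^esub> z) k \<in> carrier C" if "i \<in> ix" for i
    using that k y by (intro b_closed F.m_closed x)
  have "((c \<odot>\<^bsub>E\<^esub> b y) \<otimes>\<^bsub>E\<^esub> (c' \<odot>\<^bsub>E\<^esub> b z)) k
      = (\<Oplus>\<^bsub>C\<^esub>i\<in>ix. \<Oplus>\<^bsub>C\<^esub>j\<in>ix. ((c \<odot>\<^bsub>E\<^esub> b y) i \<otimes>\<^bsub>C\<^esub> (c' \<odot>\<^bsub>E\<^esub> b z) j) \<otimes>\<^bsub>C\<^esub> b (x i \<otimes>\<^bsub>F\<^esub> x j) k)"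
    using k by (simp add: E_consts(5))
  also have "\<dots> = (\<Oplus>\<^bsub>C\<^esub>i\<in>ix. \<Oplus>\<^bsub>C\<^esub>j\<in>ix. (c \<otimes>\<^bsub>C\<^esub> c' \<otimes>\<^bsub>C\<^esub> b y i) \<otimes>\<^bsub>C\<^esub> (b z j \<otimes>\<^bsub>C\<^esub> b (x i \<otimes>\<^bsub>F\<^esub> x j) k))"
  proof (intro C.finsum_cong' refl)
    fix i j assume "i \<in> ix" "j \<in> ix"
    then show "((c \<odot>\<^bsub>E\<^esub> b y) i \<otimes>\<^bsub>C\<^esub> (c' \<odot>\<^bsub>E\<^esub> b z) j) \<otimes>\<^bsub>C\<^esub> b (x i \<otimes>\<^bsub>F\<^esub> x j) k
      = (c \<otimes>\<^bsub>C\<^esub> c' \<otimes>\<^bsub>C\<^esub> b y i) \<otimes>\<^bsub>C\<^esub> (b z j \<otimes>\<^bsub>C\<^esub> b (x i \<otimes>\<^bsub>F\<^esub> x j) k)"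
      using c y bx b_closed by (simp add: E_consts(4) C.m_ac)
  qed (use c y bx b_closed in auto)
  also have "\<dots> = (\<Oplus>\<^bsub>C\<^esub>i\<in>ix. (c \<otimes>\<^bsub>C\<^esub> c') \<otimes>\<^bsub>C\<^esub> (b y i \<otimes>\<^bsub>C\<^esub> b (x i \<otimes>\<^bsub>F\<^esub> z) k))"
  proof (intro C.finsum_cong' refl)
    fix i assume i: "i \<in> ix"
    have "(\<Oplus>\<^bsub>C\<^esub>j\<in>ix. (c \<otimes>\<^bsub>C\<^esub> c' \<otimes>\<^bsub>C\<^esub> b y i) \<otimes>\<^bsub>C\<^esub> (b z j \<otimes>\<^bsub>C\<^esub> b (x i \<otimes>\<^bsub>F\<^esub> x j) k))
        = (c \<otimes>\<^bsub>C\<^esub> c' \<otimes>\<^bsub>C\<^esub> b y i) \<otimes>\<^bsub>C\<^esub> (\<Oplus>\<^bsub>C\<^esub>j\<in>ix. b z j \<otimes>\<^bsub>C\<^esub> b (x i \<otimes>\<^bsub>F\<^esub> x j) k)"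
      using c y i bx b_closed by (intro C.finsum_rdistr[symmetric]) auto
    also have "(\<Oplus>\<^bsub>C\<^esub>j\<in>ix. b z j \<otimes>\<^bsub>C\<^esub> b (x i \<otimes>\<^bsub>F\<^esub> x j) k) = (\<Oplus>\<^bsub>C\<^esub>j\<in>ix. b z j \<otimes>\<^bsub>C\<^esub> b (x j \<otimes>\<^bsub>F\<^esub> x i) k)"
      using c y i bx b_closed by (intro C.finsum_cong') (auto simp: F.m_comm[OF x x])
    also have "\<dots> = b (x i \<otimes>\<^bsub>F\<^esub> z) k"
      unfolding b_product[OF y(2) x[OF i] k] F.m_comm[OF y(2) x[OF i]] ..
    finally show "(\<Oplus>\<^bsub>C\<^esub>j\<in>ix. (c \<otimes>\<^bsub>C\<^esub> c' \<otimes>\<^bsub>C\<^esub> b y i) \<otimes>\<^bsub>C\<^esub> (b z j \<otimes>\<^bsub>C\<^esub> b (x i \<otimes>\<^bsub>F\<^esub> x j) k))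
        = (c \<otimes>\<^bsub>C\<^esub> c') \<otimes>\<^bsub>C\<^esub> (b y i \<otimes>\<^bsub>C\<^esub> b (x i \<otimes>\<^bsub>F\<^esub> z) k)"
      using c i y bz b_closed by (simp add: C.m_assoc)
  qed (use c y bz b_closed in auto)
  also have "\<dots> = (c \<otimes>\<^bsub>C\<^esub> c') \<otimes>\<^bsub>C\<^esub> (\<Oplus>\<^bsub>C\<^esub>i\<in>ix. b y i \<otimes>\<^bsub>C\<^esub> b (x i \<otimes>\<^bsub>F\<^esub> z) k)"
    using c y bz b_closed by (intro C.finsum_rdistr[symmetric]) auto
  also have "\<dots> = ((c \<otimes>\<^bsub>C\<^esub> c') \<odot>\<^bsub>E\<^esub> b (y \<otimes>\<^bsub>F\<^esub> z)) k"
    unfolding b_product[OF y k] using k by (simp add: E_consts(4))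
  finally show "((c \<odot>\<^bsub>E\<^esub> b y) \<otimes>\<^bsub>E\<^esub> (c' \<odot>\<^bsub>E\<^esub> b z)) k = ((c \<otimes>\<^bsub>C\<^esub> c') \<odot>\<^bsub>E\<^esub> b (y \<otimes>\<^bsub>F\<^esub> z)) k" .
qed (use c y in \<open>auto intro!: E_mult_closed E_smult_closed b_E\<close>)

definition "induced h \<longleftrightarrow> h \<in> linear_maps C T E \<and> (\<forall>y\<in>carrier F. h (tn y \<one>\<^bsub>C\<^esub>) = b y)"

text \<open>Linearity forces y \<otimes> c to go to c \<cdot> b y, and this assignment is balanced
  because b is A-linear.\<close>

lemma induced_exists: "\<exists>h. induced h"
proof -
  let ?\<beta> = "\<lambda>y c. c \<odot>\<^bsub>E\<^esub> b y"
  have bF: "b (y \<oplus>\<^bsub>F\<^esub> y') = b y \<oplus>\<^bsub>E\<^esub> b y'" if "y \<in> carrier F" "y' \<in> carrier F" for y y'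
    using that by (intro E_eqI E_add_closed b_E) (auto simp: b_add E_consts(3))
  obtain h where h: "h \<in> add_hom T E" "\<And>y c. y \<in> carrier F \<Longrightarrow> c \<in> carrier C \<Longrightarrow> h (tn y c) = ?\<beta> y c"
  proof (rule t_lift[OF E_abelian_group, of ?\<beta>])
    fix a y c assume *: "a \<in> carrier A" "y \<in> carrier F" "c \<in> carrier C"
    then show "?\<beta> (a \<odot>\<^bsub>F\<^esub> y) c = ?\<beta> y (a \<odot>\<^bsub>C\<^esub> c)"
      using AC.smult_assoc2[OF *(1) b_closed[OF *(2)] *(3)] AC.smult_assoc2[OF *(1,3) b_closed[OF *(2)]]
      by (intro E_eqI E_smult_closed b_E AF.smult_closed AC.smult_closed)
        (auto simp: E_consts(4) b_smult b_closed C.m_comm)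
  qed (auto simp: E_smult_closed b_E bF E_smult_laws add_hom_add[OF E_smult_hom])
  have "h (c \<odot>\<^bsub>T\<^esub> u) = c \<odot>\<^bsub>E\<^esub> h u" if c: "c \<in> carrier C" and u: "u \<in> carrier T" for c u
    using u
  proof (rule T_add_hom_eq[rotated 2])
    show "(\<lambda>u. h (c \<odot>\<^bsub>T\<^esub> u)) \<in> add_hom T E"
      using c by (intro add_hom_comp[OF _ h(1)] add_homI) (auto simp: TA.smult_r_distr)
    show "(\<lambda>u. c \<odot>\<^bsub>E\<^esub> h u) \<in> add_hom T E" by (rule add_hom_comp[OF h(1) E_smult_hom[OF c]])
    fix y c' assume "y \<in> carrier F" "c' \<in> carrier C"
    then show "h (c \<odot>\<^bsub>T\<^esub> tn y c') = c \<odot>\<^bsub>E\<^esub> h (tn y c')"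
      using c by (simp add: t_smult h(2) E_smult_laws b_E)
  qed
  moreover have "h (tn y \<one>\<^bsub>C\<^esub>) = b y" if "y \<in> carrier F" for y
    using that by (simp add: h(2) E_smult_one b_E)
  ultimately show ?thesis
    unfolding induced_def linear_maps_def using add_hom_closed[OF h(1)] add_hom_add[OF h(1)]
    by (intro exI[of _ h]) auto
qed

context
  fixes h assumes h: "induced h"
begin

lemma induced_add_hom: "h \<in> add_hom T E"
  using h unfolding induced_def linear_maps_def by (auto intro!: add_homI)

lemma induced_smult: "c \<in> carrier C \<Longrightarrow> u \<in> carrier T \<Longrightarrow> h (c \<odot>\<^bsub>T\<^esub> u) = c \<odot>\<^bsub>E\<^esub> h u"
  using h unfolding induced_def linear_maps_def by auto

lemma induced_tensor: "y \<in> carrier F \<Longrightarrow> c \<in> carrier C \<Longrightarrow> h (tn y c) = c \<odot>\<^bsub>E\<^esub> b y"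
  using h induced_smult[of c "tn y \<one>\<^bsub>C\<^esub>"] by (simp add: t_smult induced_def)

text \<open>Both sides are additive in s and in t, which leaves pure tensors, and for these it is
  \<open>smult_b_mult\<close>.\<close>

lemma induced_mult:
  assumes s: "s \<in> carrier T" and t: "t \<in> carrier T" shows "h (s \<otimes>\<^bsub>T\<^esub> t) = h s \<otimes>\<^bsub>E\<^esub> h t"
  using s
proof (induct s rule: T_induct)
  case (tensor y c)
  show ?case using t
  proof (induct t rule: T_induct)
    case (tensor z c')
    then show ?case using \<open>y \<in> carrier F\<close> \<open>c \<in> carrier C\<close> by (simp add: t_mult induced_tensor smult_b_mult)
  next
    case (add u v)
    then show ?case using \<open>y \<in> carrier F\<close> \<open>c \<in> carrier C\<close>
      by (simp add: T.r_distr add_hom_add[OF induced_add_hom] add_hom_closed[OF induced_add_hom] add_hom_add[OF E_mult_hom_right])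
  qed
next
  case (add u v)
  then show ?case using t
    by (simp add: T.l_distr add_hom_add[OF induced_add_hom] add_hom_closed[OF induced_add_hom] add_hom_add[OF E_mult_hom_left])
qed

lemma induced_one: "h \<one>\<^bsub>T\<^esub> = \<one>\<^bsub>E\<^esub>"
  unfolding t_one[symmetric] using h by (simp add: induced_def E_consts)

lemma induced_ring_hom: "h \<in> ring_hom T E"
  by (rule ring_hom_memI)
    (auto simp: add_hom_closed[OF induced_add_hom] add_hom_add[OF induced_add_hom] induced_mult induced_one)

lemma induced_surj: "h ` carrier T = carrier E"
proof
  show "h ` carrier T \<subseteq> carrier E" using add_hom_closed[OF induced_add_hom] by auto
  show "carrier E \<subseteq> h ` carrier T"
  proof
    fix u assume u: "u \<in> carrier E"
    \<comment> \<open>A preimage is read off from the coordinates: x_i \<otimes> u_i goes to u_i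
      [x_i], because b sends x_i to the i-th unit vector.\<close>
    let ?t = "\<Oplus>\<^bsub>T\<^esub>i\<in>ix. tn (x i) (u i)"
    have tc: "(\<lambda>i. tn (x i) (u i)) \<in> ix \<rightarrow> carrier T" using u x E_mem by (intro Pi_I t_closed) auto
    then have t: "?t \<in> carrier T" by (rule T.finsum_closed)
    have ec: "(\<lambda>i. u i \<odot>\<^bsub>E\<^esub> b (x i)) \<in> ix \<rightarrow> carrier E" using u x E_mem b_E by (intro Pi_I E_smult_closed) auto
    have "h ?t = (\<Oplus>\<^bsub>E\<^esub>i\<in>ix. h (tn (x i) (u i)))"
      by (rule add_hom_finsum[OF T.abelian_group_axioms E_abelian_group induced_add_hom tc])
    also have "\<dots> = (\<Oplus>\<^bsub>E\<^esub>i\<in>ix. u i \<odot>\<^bsub>E\<^esub> b (x i))"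
      using ec by (rule E.finsum_cong'[OF refl]) (use u x E_mem in \<open>simp add: induced_tensor\<close>)
    also have "\<dots> = u"
    proof (rule E_eqI[OF E.finsum_closed[OF ec] u])
      fix k assume k: "k \<in> ix"
      have "(\<Oplus>\<^bsub>E\<^esub>i\<in>ix. u i \<odot>\<^bsub>E\<^esub> b (x i)) k = (\<Oplus>\<^bsub>C\<^esub>i\<in>ix. (u i \<odot>\<^bsub>E\<^esub> b (x i)) k)"
        by (rule add_hom_finsum[OF E_abelian_group C.abelian_group_axioms E_proj[OF k] ec])
      also have "\<dots> = (\<Oplus>\<^bsub>C\<^esub>i\<in>ix. if k = i then u i else \<zero>\<^bsub>C\<^esub>)"
        by (rule C.finsum_cong') (use k u in \<open>auto simp: E_consts(4) b_basis E_mem\<close>)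
      also have "\<dots> = u k" using k u E_mem by (intro C.finsum_singleton) auto
      finally show "(\<Oplus>\<^bsub>E\<^esub>i\<in>ix. u i \<odot>\<^bsub>E\<^esub> b (x i)) k = u k" .
    qed
    finally have "h ?t = u" .
    then show "u \<in> h ` carrier T" using imageI[OF t, of h] by (simp only:)
  qed
qed

end

text \<open>The ring axioms for \<open>E\<close> are inherited from \<open>F \<otimes>\<^sub>A C\<close> along the surjection.\<close>

lemma E_algebra: "algebra C E"
proof -
  obtain h where h: "induced h" using induced_exists by blast
  note hm = induced_mult[OF h, symmetric] and ho = induced_one[OF h, symmetric]
  have lift: "\<exists>s\<in>carrier T. u = h s" if "u \<in> carrier E" for u using induced_surj[OF h] that by blast
  have one: "\<one>\<^bsub>E\<^esub> \<in> carrier E" unfolding E_consts by (rule b_E) simp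
  have "comm_monoid E"
  proof (rule comm_monoidI[OF E_mult_closed one])
    fix u v w assume "u \<in> carrier E" "v \<in> carrier E" "w \<in> carrier E"
    then obtain r s t where "r \<in> carrier T" "s \<in> carrier T" "t \<in> carrier T" "u = h r" "v = h s" "w = h t" using lift by meson
    then show "u \<otimes>\<^bsub>E\<^esub> v \<otimes>\<^bsub>E\<^esub> w = u \<otimes>\<^bsub>E\<^esub> (v \<otimes>\<^bsub>E\<^esub> w)" by (simp add: hm T.m_assoc)
  next
    fix u assume "u \<in> carrier E"
    then obtain s where "s \<in> carrier T" "u = h s" using lift by meson
    then show "\<one>\<^bsub>E\<^esub> \<otimes>\<^bsub>E\<^esub> u = u" by (simp add: hm ho)
  next
    fix u v assume "u \<in> carrier E" "v \<in> carrier E"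
    then obtain s t where "s \<in> carrier T" "t \<in> carrier T" "u = h s" "v = h t" using lift by meson
    then show "u \<otimes>\<^bsub>E\<^esub> v = v \<otimes>\<^bsub>E\<^esub> u" by (simp add: hm T.m_comm)
  qed
  then have "cring E" by (rule cringI[OF E_abelian_group]) (rule add_hom_add[OF E_mult_hom_left])
  then show ?thesis
  proof (rule algebraI[OF C.is_cring])
    fix c u v assume c: "c \<in> carrier C" and "u \<in> carrier E" "v \<in> carrier E"
    then obtain s t where "s \<in> carrier T" "t \<in> carrier T" "u = h s" "v = h t" using lift by meson
    then show "c \<odot>\<^bsub>E\<^esub> u \<otimes>\<^bsub>E\<^esub> v = c \<odot>\<^bsub>E\<^esub> (u \<otimes>\<^bsub>E\<^esub> v)"
      using c by (simp add: hm induced_smult[OF h, symmetric] TA.smult_assoc2)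
  qed (simp_all add: E_smult_closed E_smult_laws E_smult_one add_hom_add[OF E_smult_hom])
qed

end

section \<open>The ring \<open>R(x)\<close>\<close>

locale norms_at = norms A F n
  for A :: "('a, 'x) ring_scheme" and F :: "('a, 'f, 'y) module_scheme" and n :: nat +
  fixes x :: "nat \<Rightarrow> 'f"
  assumes x: "x \<in> {1..n} \<rightarrow> carrier F"
begin

abbreviation "N \<equiv> dp_n A F n"
abbreviation "J \<equiv> norm_ideal A F n"

sublocale N: cring N by (rule algebra.M_cring[OF Gn_algebra])
sublocale NA: algebra A N by (rule Gn_algebra)

lemma deltas_part: "{\<delta> x y | x y. x \<in> ix \<rightarrow> carrier F \<and> y \<in> ix \<rightarrow> carrier F} \<subseteq> carrier N"
  using delta_part by (auto simp: Gn_simps)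

lemma J_ideal: "ideal J N"
  unfolding norm_ideal_def by (rule N.genideal_ideal[OF deltas_part])

lemma delta_J: "z \<in> ix \<rightarrow> carrier F \<Longrightarrow> y \<in> ix \<rightarrow> carrier F \<Longrightarrow> \<delta> z y \<in> J"
  unfolding norm_ideal_def by (rule subsetD[OF N.genideal_self[OF deltas_part]]) blast

sublocale rl: rees_loc N J "\<delta> x x"
proof -
  interpret rees N J using J_ideal N.is_cring by (simp add: rees_def rees_axioms_def)
  show "rees_loc N J (\<delta> x x)" by unfold_locales (rule delta_J[OF x x])
qed

definition "\<phi> a = rl.hfr 0 (a \<odot>\<^bsub>N\<^esub> \<one>\<^bsub>N\<^esub>)"

lemma rx_eq: "rx A F n x = algebra_via rl.RX \<phi>"
  by (simp add: rx_def rx_frac_def delta1_def delta_powers_def norm_rees_def Let_def rl.RX_def rl.hfr_def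
      rl.Sd_def rl.D_def fun_eq_iff \<phi>_def[abs_def])

lemma brk_eq: "brk A F n x y = (\<lambda>i\<in>ix. rl.q (\<delta> x (x(i := y))))"
  by (simp add: brk_def rx_frac_def delta1_def delta_powers_def norm_rees_def rl.q_def rl.Sd_def rl.D_def)

abbreviation "Rx \<equiv> rx A F n x"

lemma Rx_simps: "carrier Rx = carrier rl.RX" "\<zero>\<^bsub>Rx\<^esub> = \<zero>\<^bsub>rl.RX\<^esub>" "\<one>\<^bsub>Rx\<^esub> = \<one>\<^bsub>rl.RX\<^esub>"
  "u \<otimes>\<^bsub>Rx\<^esub> v = u \<otimes>\<^bsub>rl.RX\<^esub> v" "u \<oplus>\<^bsub>Rx\<^esub> v = u \<oplus>\<^bsub>rl.RX\<^esub> v" "a \<odot>\<^bsub>Rx\<^esub> u = \<phi> a \<otimes>\<^bsub>rl.RX\<^esub> u"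
  unfolding rx_eq by simp_all

lemma Rx_algebra: "algebra A Rx"
  unfolding rx_eq
proof (rule algebra_viaI[OF A.is_cring rl.RX_cring])
  have "(\<lambda>a. a \<odot>\<^bsub>N\<^esub> \<one>\<^bsub>N\<^esub>) \<in> ring_hom A N"
    by (rule ring_hom_memI) (auto simp: NA.smult_l_distr NA.smult_assoc1 NA.smult_assoc2)
  then show "\<phi> \<in> ring_hom A rl.RX"
    unfolding \<phi>_def[abs_def] by (rule ring_hom_comp[OF _ rl.hfr0_hom])
qed

lemma finsum_Rx: "finsum Rx f P = finsum rl.RX f P"
  unfolding finsum_def finprod_def by (simp add: rx_eq algebra_via_def)

text \<open>\<open>N\<close> and \<open>G\<close> have the same addition but different carriers, and
  \<open>finsum\<close> depends on the carrier; \<open>delta_cramer\<close> is stated with sums in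
  \<open>G\<close>, while R(x) is built from \<open>N\<close>.\<close>

lemma finsum_N: "f \<in> P \<rightarrow> part n \<Longrightarrow> finsum N f P = finsum G f P"
proof (induct P rule: infinite_finite_induct)
  case (insert i P)
  then have "f i \<in> part n" "f \<in> P \<rightarrow> part n" by auto
  then show ?case using insert part_closed[of _ n] by (simp add: Gn_simps Pi_def)
qed (simp_all add: Gn_simps)

lemma upd: "y \<in> carrier F \<Longrightarrow> x(i := y) \<in> ix \<rightarrow> carrier F" using x by auto

lemma q_delta_closed: "y \<in> carrier F \<Longrightarrow> rl.q (\<delta> x (x(i := y))) \<in> carrier rl.RX"
  by (rule rl.q_closed[OF delta_J[OF x upd]])

text \<open>Linearity comes from \<open>delta_linear\<close>, the basis condition from
  \<open>q_d\<close> and \<open>delta_repeated\<close>, and the product rule from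
  \<open>delta_cramer\<close> by way of \<open>q_sum_products\<close>.\<close>

sublocale sp: spanned A F Rx n x "brk A F n x"
proof -
  have xc: "x i \<in> carrier F" if "i \<in> ix" for i using x that by auto
  show "spanned A F Rx n x (brk A F n x)"
  proof (intro spanned.intro spanned_axioms.intro tens.intro AF Rx_algebra)
    fix y assume y: "y \<in> carrier F"
    show "brk A F n x y \<in> ix \<rightarrow>\<^sub>E carrier Rx"
      unfolding brk_eq Rx_simps using q_delta_closed[OF y] by auto
    fix k assume k: "k \<in> ix"
    show "brk A F n x (y \<oplus>\<^bsub>F\<^esub> y') k = brk A F n x y k \<oplus>\<^bsub>Rx\<^esub> brk A F n x y' k" if y': "y' \<in> carrier F" for y'
      using k rl.q_add[OF delta_J[OF x upd[OF y]] delta_J[OF x upd[OF y']]]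
      by (simp add: brk_eq Rx_simps add_hom_add[OF delta_linear(1)[OF x k] y y'] Gn_simps)
    show "brk A F n x (a \<odot>\<^bsub>F\<^esub> y) k = a \<odot>\<^bsub>Rx\<^esub> brk A F n x y k" if a: "a \<in> carrier A" for a
    proof -
      have d: "\<delta> x (x(k := y)) \<in> carrier N" using delta_part[OF x upd[OF y]] by (simp add: Gn_simps)
      \<comment> \<open>\<open>q_scale\<close> handles multiplication in \<Gamma>^n, so the scalar a
        is turned into the element a \<cdot> 1 of \<Gamma>^n.\<close>
      have "\<delta> x (x(k := a \<odot>\<^bsub>F\<^esub> y)) = (a \<odot>\<^bsub>N\<^esub> \<one>\<^bsub>N\<^esub>) \<otimes>\<^bsub>N\<^esub> \<delta> x (x(k := y))"
        using NA.smult_assoc2[OF a N.one_closed d] d by (simp add: delta_linear(2)[OF x k a y] Gn_simps(5))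
      then show ?thesis
        using k rl.q_scale[OF NA.smult_closed[OF a N.one_closed] delta_J[OF x upd[OF y]]]
        by (simp add: brk_eq Rx_simps \<phi>_def)
    qed
    fix w assume w: "w \<in> carrier F"
    have xw: "x i \<otimes>\<^bsub>F\<^esub> w \<in> carrier F" if "i \<in> ix" for i using xc[OF that] w by simp
    have "(\<Oplus>\<^bsub>rl.RX\<^esub>i\<in>ix. rl.q (\<delta> x (x(i := y))) \<otimes>\<^bsub>rl.RX\<^esub> rl.q (\<delta> x (x(k := x i \<otimes>\<^bsub>F\<^esub> w))))
        = rl.q (\<delta> x (x(k := y \<otimes>\<^bsub>F\<^esub> w)))"
    proof (rule rl.q_sum_products)
      fix i assume "i \<in> ix"
      then show "\<delta> x (x(i := y)) \<in> J \<and> \<delta> x (x(k := x i \<otimes>\<^bsub>F\<^esub> w)) \<in> J"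
        using delta_J[OF x upd[OF y]] delta_J[OF x upd[OF xw]] by blast
    next
      show "\<delta> x (x(k := y \<otimes>\<^bsub>F\<^esub> w)) \<in> J" by (rule delta_J[OF x upd[OF F.m_closed[OF y w]]])
      have "(\<lambda>i. \<delta> x (x(i := y)) \<otimes>\<^bsub>N\<^esub> \<delta> x (x(k := x i \<otimes>\<^bsub>F\<^esub> w))) \<in> ix \<rightarrow> part n"
        using N.m_closed[unfolded Gn_simps(1)] delta_part[OF x upd[OF y]] delta_part[OF x upd[OF xw]] by (intro Pi_I) blast
      then show "(\<Oplus>\<^bsub>N\<^esub>i\<in>ix. \<delta> x (x(i := y)) \<otimes>\<^bsub>N\<^esub> \<delta> x (x(k := x i \<otimes>\<^bsub>F\<^esub> w)))
          = \<delta> x x \<otimes>\<^bsub>N\<^esub> \<delta> x (x(k := y \<otimes>\<^bsub>F\<^esub> w))"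
        by (simp only: finsum_N delta_cramer[OF x y w k])
    qed simp
    moreover have "(\<Oplus>\<^bsub>rl.RX\<^esub>i\<in>ix. brk A F n x y i \<otimes>\<^bsub>rl.RX\<^esub> brk A F n x (x i \<otimes>\<^bsub>F\<^esub> w) k)
       = (\<Oplus>\<^bsub>rl.RX\<^esub>i\<in>ix. rl.q (\<delta> x (x(i := y))) \<otimes>\<^bsub>rl.RX\<^esub> rl.q (\<delta> x (x(k := x i \<otimes>\<^bsub>F\<^esub> w))))"
      using k q_delta_closed[OF y] q_delta_closed[OF xw] by (intro rl.RX.finsum_cong') (simp_all add: brk_eq)
    ultimately show "(\<Oplus>\<^bsub>Rx\<^esub>i\<in>ix. brk A F n x y i \<otimes>\<^bsub>Rx\<^esub> brk A F n x (x i \<otimes>\<^bsub>F\<^esub> w) k) = brk A F n x (y \<otimes>\<^bsub>F\<^esub> w) k"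
      using k by (simp add: finsum_Rx Rx_simps brk_eq)
  next
    fix i k assume ik: "i \<in> ix" "k \<in> ix"
    show "brk A F n x (x i) k = (if k = i then \<one>\<^bsub>Rx\<^esub> else \<zero>\<^bsub>Rx\<^esub>)"
    proof (cases "k = i")
      case True
      then show ?thesis using ik rl.q_d by (simp add: brk_eq Rx_simps)
    next
      case False
      then show ?thesis using ik rl.q_zero delta_repeated[OF x ik(1,2)] by (simp add: brk_eq Rx_simps Gn_simps)
    qed
  qed (rule xc)
qed

lemma mod_E_eq: "mod_E A F n x (brk A F n x \<one>\<^bsub>F\<^esub>) = sp.E"
  by (simp add: mod_E_def sp.E_def Let_def)

lemma is_induced_map_eq: "is_induced_map A F n x (brk A F n x \<one>\<^bsub>F\<^esub>) h \<longleftrightarrow> sp.induced h"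
  by (simp add: is_induced_map_def sp.induced_def mod_E_eq Let_def)

end

theorem proposition6p3:
  fixes A :: "('a, 'x) ring_scheme"
    and F :: "('a, 'f, 'y) module_scheme"
    and n :: nat
    and x :: "nat \<Rightarrow> 'f"
  assumes "algebra A F"
    and "n \<ge> 1"
    and "x \<in> {1..n} \<rightarrow> carrier F"
  shows "\<exists>e. algebra (rx A F n x) (mod_E A F n x e)
    \<and> (\<exists>h. is_induced_map A F n x e h)
    \<and> (\<forall>h. is_induced_map A F n x e h \<longrightarrow>
          h \<in> ring_hom (tensor_algebra A F (rx A F n x)) (mod_E A F n x e)
          \<and> h ` carrier (tensor_algebra A F (rx A F n x)) = carrier (mod_E A F n x e))"
proof -
  interpret norms_at A F n x
    using assms by (simp add: norms_at_def norms_at_axioms_def norms_def dpa_def)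
  \<comment> \<open>The unit is [1], the image of 1 \<otimes> 1; with this choice the structure is
    \<open>sp.E\<close>.\<close>
  show ?thesis
    using sp.E_algebra sp.induced_exists sp.induced_ring_hom sp.induced_surj
    by (intro exI[of _ "brk A F n x \<one>\<^bsub>F\<^esub>"]) (simp add: mod_E_eq is_induced_map_eq)
qed

end
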